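(* If there exists an EFI pair, then there exists a quantum polynomial-time algorithm $\mathcal{C}$ with mixed state outputs which is hard on average (to learn).
   Context: A polynomial is a function $p:\mathbb{N}\to\mathbb{N}$ for which there is a constant $c$ with $p(n)\le cn^c$ for all $n$. A function $f:\mathbb{N}\to\mathbb{R}$ is negligible if for every constant $c$ we have $f(n)<1/n^c$ for all sufficiently large $n$. QPT means quantum polynomial time; adversaries are uniform QPT algorithms. $\mathsf{TD}(\rho,\sigma)=\frac12\|\rho-\sigma\|_1$ is the trace distance. EFI pair: a uniform QPT algorithm that on input $1^\lambda$ and $b\in\{0,1\}$ outputs a (possibly mixed) quantum state $\rho_{\lambda,b}$ such that (statistical farness) $\mathsf{TD}(\rho_{\lambda,0},\rho_{\lambda,1})\ge 1/p(\lambda)$ for some positive polynomial $p$ and all sufficiently large $\lambda$, and (computational indistinguishability) for every uniform QPT algorithm $\mathcal{D}$, $\left|\Pr[1\leftarrow\mathcal{D}(1^\lambda,\rho_{\lambda,0})]-\Pr[1\leftarrow\mathcal{D}(1^\lambda,\rho_{\lambda,1})]\right|$ is negligible in $\lambda$. Hardness on average: let $\mathcal{C}$ be a quantum algorithm that takes $1^n$ with $n\in\mathbb{N}$ and $x\in\mathcal{X}_n=\{0,1\}^{\mathrm{poly}(n)}$ and outputs a $\mathrm{poly}(n)$-qubit quantum state $\psi_x$. $\mathcal{C}$ is hard on average if there exist an efficiently sampleable distribution $\mathcal{S}_n$ over $\mathcal{X}_n$ (that is, some uniform QPT algorithm $D$ is such that, for each $n$, the output of $D(1^n)$ is distributed exactly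 as $\mathcal{S}_n$) and polynomials $\epsilon$ and $\delta$ such that for all polynomials $t$ and all QPT algorithms $\mathcal{A}$ (learners, whose output is promised to lie in $\mathcal{X}_n$), $$\Pr\left[\mathsf{TD}(\psi_x,\psi_y)\le \frac{1}{\epsilon(n)}\;:\; x\leftarrow\mathcal{S}_n,\ \psi_x\leftarrow\mathcal{C}(1^n,x),\ y\leftarrow\mathcal{A}(\mathcal{C},\psi_x^{\otimes t(n)},1^n),\ \psi_y\leftarrow\mathcal{C}(1^n,y)\right]\le\frac{1}{\delta(n)}$$ for all sufficiently large $n\in\mathbb{N}$. *)

theory Defs
  imports
    "HOL-Probability.Probability_Mass_Function"
    "Jordan_Normal_Form.Char_Poly"
    "Jordan_Normal_Form.Schur_Decomposition"
begin

section \<open>Asymptotics\<close>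

text \<open>The bound is required for positive arguments only: at \<open>n = 0\<close> it would force
  \<open>p 0 = 0\<close>, and so exclude the nonzero constants.\<close>

definition polynomial :: "(nat \<Rightarrow> nat) \<Rightarrow> bool" where
  "polynomial p \<longleftrightarrow> (\<exists>c::nat. \<forall>n>0. p n \<le> c * n ^ c)"

definition negligible :: "(nat \<Rightarrow> real) \<Rightarrow> bool" where
  "negligible f \<longleftrightarrow> (\<forall>c::nat. \<forall>\<^sub>F n in sequentially. f n < 1 / real n ^ c)"

section \<open>Quantum states\<close>

text \<open>A state of \<open>N\<close> qubits is a density matrix of dimension \<open>2 ^ N\<close>. Basis indices are
  little-endian: qubit \<open>w\<close> of basis state \<open>i\<close> is \<open>bit i w\<close>.\<close>

definition kron :: "complex mat \<Rightarrow> complex mat \<Rightarrow> complex mat" where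
  "kron A B = mat (dim_row A * dim_row B) (dim_col A * dim_col B)
     (\<lambda>(i, j). A $$ (i div dim_row B, j div dim_col B) * B $$ (i mod dim_row B, j mod dim_col B))"

fun kron_power :: "complex mat \<Rightarrow> nat \<Rightarrow> complex mat" where
  "kron_power A 0 = 1\<^sub>m 1"
| "kron_power A (Suc t) = kron A (kron_power A t)"

definition index_of :: "bool list \<Rightarrow> nat" where
  "index_of xs = horner_sum of_bool 2 xs"

definition basis_state :: "bool list \<Rightarrow> complex mat" where
  "basis_state xs = mat (2 ^ length xs) (2 ^ length xs)
     (\<lambda>(i, j). of_bool (i = index_of xs \<and> j = index_of xs))"

text \<open>The sum of the singular values of \<open>A\<close>, with multiplicity.\<close>

definition trace_norm :: "complex mat \<Rightarrow> real" where
  "trace_norm A = (let P = mat_adjoint A * A in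
     \<Sum>e | eigenvalue P e. real (Polynomial.order e (char_poly P)) * sqrt (Re e))"

definition TD :: "complex mat \<Rightarrow> complex mat \<Rightarrow> real" where
  "TD \<rho> \<sigma> = trace_norm (\<rho> - \<sigma>) / 2"

section \<open>Quantum circuits\<close>

text \<open>The gate set is Clifford+T without the redundant phase gate \<open>S = T\<^sup>2\<close>; \<open>X\<close> and the
  Toffoli gate have exact Clifford+T implementations and are included for convenience.
  The last argument of \<open>CNot\<close> and \<open>Toffoli\<close> is the target.\<close>

datatype 'w gate = Had 'w | TPhase 'w | PauliX 'w | CNot 'w 'w | Toffoli 'w 'w 'w

fun gate_wires :: "'w gate \<Rightarrow> 'w list" where
  "gate_wires (Had a) = [a]"
| "gate_wires (TPhase a) = [a]"
| "gate_wires (PauliX a) = [a]"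
| "gate_wires (CNot a b) = [a, b]"
| "gate_wires (Toffoli a b c) = [a, b, c]"

fun gate_mat :: "'w gate \<Rightarrow> complex mat" where
  "gate_mat (Had _) = mat 2 2 (\<lambda>(i, j). (if i = 1 \<and> j = 1 then -1 else 1) / complex_of_real (sqrt 2))"
| "gate_mat (TPhase _) = mat 2 2 (\<lambda>(i, j). if i \<noteq> j then 0 else if i = 0 then 1 else cis (pi / 4))"
| "gate_mat (PauliX _) = mat 2 2 (\<lambda>(i, j). of_bool (i \<noteq> j))"
| "gate_mat (CNot _ _) =
     mat 4 4 (\<lambda>(i, j). of_bool (i = (if bit j 0 then flip_bit 1 j else j)))"
| "gate_mat (Toffoli _ _ _) =
     mat 8 8 (\<lambda>(i, j). of_bool (i = (if bit j 0 \<and> bit j 1 then flip_bit 2 j else j)))"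

text \<open>A circuit on \<open>k\<close> input qubits acts on wires \<open>0, 1, \<dots>\<close>; wires \<open>0, \<dots>, k - 1\<close> carry the input
  and every further wire starts in the zero state. The qubits on the wires \<open>outs\<close> are the output
  (in that order), all others are traced out.\<close>

datatype circuit = Circuit (gates: "nat gate list") (outs: "nat list")

definition wf_circuit :: "circuit \<Rightarrow> bool" where
  "wf_circuit c \<longleftrightarrow> distinct (outs c) \<and> (\<forall>g \<in> set (gates c). distinct (gate_wires g))"

definition width :: "nat \<Rightarrow> circuit \<Rightarrow> nat" where
  "width k c = Max (insert k (Suc ` (set (outs c) \<union> (\<Union>g \<in> set (gates c). set (gate_wires g)))))"

definition read_wires :: "nat list \<Rightarrow> nat \<Rightarrow> nat" where
  "read_wires ws i = index_of (map (bit i) ws)"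

definition agree_off :: "nat \<Rightarrow> nat list \<Rightarrow> nat \<Rightarrow> nat \<Rightarrow> bool" where
  "agree_off N ws i j \<longleftrightarrow> (\<forall>w < N. w \<notin> set ws \<longrightarrow> bit i w = bit j w)"

text \<open>\<open>U\<close> on the wires \<open>ws\<close>, tensored with the identity on all others.\<close>

definition on_wires :: "nat \<Rightarrow> nat list \<Rightarrow> complex mat \<Rightarrow> complex mat" where
  "on_wires N ws U = mat (2 ^ N) (2 ^ N)
     (\<lambda>(i, j). if agree_off N ws i j then U $$ (read_wires ws i, read_wires ws j) else 0)"

text \<open>The partial trace over all wires outside \<open>ws\<close>.\<close>

definition reduced_state :: "nat \<Rightarrow> nat list \<Rightarrow> complex mat \<Rightarrow> complex mat" where
  "reduced_state N ws \<rho> = mat (2 ^ length ws) (2 ^ length ws)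
     (\<lambda>(a, b). \<Sum>(i, j) | i < 2 ^ N \<and> j < 2 ^ N \<and> agree_off N ws i j \<and>
                         read_wires ws i = a \<and> read_wires ws j = b. \<rho> $$ (i, j))"

definition apply_gate :: "nat \<Rightarrow> complex mat \<Rightarrow> nat gate \<Rightarrow> complex mat" where
  "apply_gate N \<rho> g =
     (let U = on_wires N (gate_wires g) (gate_mat g) in U * \<rho> * mat_adjoint U)"

text \<open>The input is the second Kronecker factor because low-order bits belong to it.\<close>

definition run_circuit :: "nat \<Rightarrow> circuit \<Rightarrow> complex mat \<Rightarrow> complex mat" where
  "run_circuit k c \<rho> = (let N = width k c in
     reduced_state N (outs c)
       (foldl (apply_gate N) (kron (basis_state (replicate (N - k) False)) \<rho>) (gates c)))"

section \<open>Uniform quantum polynomial time\<close>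

text \<open>Circuits are generated by deterministic classical programs with finitely many stacks of bits,
  that is, by a structured form of multi-tape Turing machines (a tape is a pair of stacks), and the
  cost of a run is its number of steps. \<open>Apply\<close> and \<open>Output\<close> write a gate or an output wire to the
  circuit; wires are addressed in unary, by the height of a stack. Heights are at most the input
  length plus the number of steps, so charging one step for this is correct up to a polynomial.\<close>

datatype test = Nonempty nat | Top nat

datatype prog =
    Push nat bool
  | Pop nat
  | Apply "nat gate"
  | Output nat
  | Seq prog prog
  | IfElse test prog prog
  | While test prog

type_synonym config = "(nat \<Rightarrow> bool list) \<times> circuit"

fun holds :: "test \<Rightarrow> (nat \<Rightarrow> bool list) \<Rightarrow> bool" where
  "holds (Nonempty v) s \<longleftrightarrow> s v \<noteq> []"
| "holds (Top v) s \<longleftrightarrow> s v \<noteq> [] \<and> hd (s v)"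

inductive exec :: "prog \<Rightarrow> config \<Rightarrow> nat \<Rightarrow> config \<Rightarrow> bool" where
  exec_Push: "exec (Push v b) (s, c) 1 (s(v := b # s v), c)"
| exec_Pop: "exec (Pop v) (s, c) 1 (s(v := tl (s v)), c)"
| exec_Apply: "exec (Apply g) (s, Circuit gs os) 1
                 (s, Circuit (gs @ [map_gate (\<lambda>v. length (s v)) g]) os)"
| exec_Output: "exec (Output v) (s, Circuit gs os) 1 (s, Circuit gs (os @ [length (s v)]))"
| exec_Seq: "exec P a m b \<Longrightarrow> exec Q b n d \<Longrightarrow> exec (Seq P Q) a (m + n) d"
| exec_If_true: "holds t (fst a) \<Longrightarrow> exec P a m b \<Longrightarrow> exec (IfElse t P Q) a (Suc m) b"
| exec_If_false: "\<not> holds t (fst a) \<Longrightarrow> exec Q a m b \<Longrightarrow> exec (IfElse t P Q) a (Suc m) b"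
| exec_While_false: "\<not> holds t (fst a) \<Longrightarrow> exec (While t P) a 1 a"
| exec_While_true: "holds t (fst a) \<Longrightarrow> exec P a m b \<Longrightarrow> exec (While t P) b n d
                      \<Longrightarrow> exec (While t P) a (Suc (m + n)) d"

definition generates :: "prog \<Rightarrow> nat \<Rightarrow> nat \<Rightarrow> nat \<Rightarrow> circuit \<Rightarrow> bool" where
  "generates P n k T c \<longleftrightarrow>
     (\<exists>s. exec P ((\<lambda>_. [])(0 := replicate n True, 1 := replicate k True), Circuit [] []) T (s, c))"

text \<open>A quantum algorithm is a family of circuits: \<open>F n k\<close> is the circuit that it runs on the
  unary parameter \<open>n\<close> together with an input of \<open>k\<close> qubits (or \<open>k\<close> classical bits, given as a basis
  state). It is uniform QPT if this circuit can be generated from \<open>n\<close> and \<open>k\<close> in unary in time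
  polynomial in \<open>n + k\<close>.\<close>

type_synonym qalg = "nat \<Rightarrow> nat \<Rightarrow> circuit"

definition QPT :: "qalg \<Rightarrow> bool" where
  "QPT F \<longleftrightarrow> (\<forall>n k. wf_circuit (F n k)) \<and>
     (\<exists>P p. polynomial p \<and> (\<forall>n k. \<exists>T \<le> p (n + k). generates P n k T (F n k)))"

definition out_len :: "qalg \<Rightarrow> nat \<Rightarrow> nat \<Rightarrow> nat" where
  "out_len F n k = length (outs (F n k))"

definition run :: "qalg \<Rightarrow> nat \<Rightarrow> nat \<Rightarrow> complex mat \<Rightarrow> complex mat" where
  "run F n k \<rho> = run_circuit k (F n k) \<rho>"

text \<open>The probability that measuring the output in the computational basis yields exactly \<open>y\<close>.\<close>

definition prob_output :: "qalg \<Rightarrow> nat \<Rightarrow> nat \<Rightarrow> complex mat \<Rightarrow> bool list \<Rightarrow> real" where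
  "prob_output F n k \<rho> y =
     (if length y = out_len F n k then Re (run F n k \<rho> $$ (index_of y, index_of y)) else 0)"

section \<open>EFI pairs\<close>

definition efi_state :: "qalg \<Rightarrow> nat \<Rightarrow> bool \<Rightarrow> complex mat" where
  "efi_state G n b = run G n 1 (basis_state [b])"

definition statistically_far :: "qalg \<Rightarrow> bool" where
  "statistically_far G \<longleftrightarrow> (\<exists>p. polynomial p \<and> (\<forall>n. p n > 0) \<and>
     (\<forall>\<^sub>F n in sequentially. TD (efi_state G n False) (efi_state G n True) \<ge> 1 / real (p n)))"

definition comp_indistinguishable :: "qalg \<Rightarrow> bool" where
  "comp_indistinguishable G \<longleftrightarrow> (\<forall>D. QPT D \<longrightarrow>
     negligible (\<lambda>n. \<bar>prob_output D n (out_len G n 1) (efi_state G n False) [True]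
                    - prob_output D n (out_len G n 1) (efi_state G n True) [True]\<bar>))"

definition EFI_pair :: "qalg \<Rightarrow> bool" where
  "EFI_pair G \<longleftrightarrow> QPT G \<and> statistically_far G \<and> comp_indistinguishable G"

section \<open>Hardness on average\<close>

definition efficiently_sampleable :: "(nat \<Rightarrow> bool list pmf) \<Rightarrow> bool" where
  "efficiently_sampleable S \<longleftrightarrow>
     (\<exists>D. QPT D \<and> (\<forall>n x. pmf (S n) x = prob_output D n 0 (basis_state []) x))"

definition output_state :: "qalg \<Rightarrow> nat \<Rightarrow> bool list \<Rightarrow> complex mat" where
  "output_state C n x = run C n (length x) (basis_state x)"

text \<open>Here \<open>len n\<close> is the length of the strings in the domain of \<open>C\<close>, \<open>t n\<close> is the number of copies
  given to the learner \<open>A\<close>, and \<open>\<epsilon> n\<close> is the inverse accuracy.\<close>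

definition learning_prob ::
  "qalg \<Rightarrow> (nat \<Rightarrow> nat) \<Rightarrow> (nat \<Rightarrow> bool list pmf) \<Rightarrow> (nat \<Rightarrow> nat) \<Rightarrow> (nat \<Rightarrow> nat) \<Rightarrow> qalg \<Rightarrow> nat \<Rightarrow> real"
where
  "learning_prob C len S \<epsilon> t A n = measure_pmf.expectation (S n) (\<lambda>x.
     \<Sum>y | length y = len n \<and> TD (output_state C n x) (output_state C n y) \<le> 1 / real (\<epsilon> n).
       prob_output A n (t n * out_len C n (len n)) (kron_power (output_state C n x) (t n)) y)"

text \<open>\<open>C\<close> is fixed before the learner, so its (constant size) description need not be an
  explicit input of the learner. The condition \<open>\<delta> n \<ge> 2\<close> makes the bound \<open>1 / \<delta> n\<close> a
  restriction: with \<open>\<delta> n = 1\<close> it holds for every probability.\<close>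

definition hard_on_average :: "qalg \<Rightarrow> (nat \<Rightarrow> nat) \<Rightarrow> bool" where
  "hard_on_average C len \<longleftrightarrow>
     (\<exists>S \<epsilon> \<delta>. efficiently_sampleable S \<and> (\<forall>n. set_pmf (S n) \<subseteq> {x. length x = len n}) \<and>
        polynomial \<epsilon> \<and> (\<forall>n. \<epsilon> n > 0) \<and> polynomial \<delta> \<and> (\<forall>n. \<delta> n \<ge> 2) \<and>
        (\<forall>t A. polynomial t \<longrightarrow> QPT A \<longrightarrow>
           (\<forall>n. out_len A n (t n * out_len C n (len n)) = len n) \<longrightarrow>
           (\<forall>\<^sub>F n in sequentially. learning_prob C len S \<epsilon> t A n \<le> 1 / real (\<delta> n))))"

end

theory Submission imports Defs "HOL-Combinatorics.Transposition" begin

text \<open>For an EFI pair \<open>\<rho>\<close>, let \<open>C\<close> map two bits to \<open>\<rho> x1\<close> tensor \<open>\<rho> x2\<close>. Distinct inputs give far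
  states, so a learner with success above one half must, for uniform inputs, output the input itself. By Fourier
  expansion some parity of its output bits then has an expectation that changes noticeably when one input bit
  flips, and a hybrid argument locates one copy of \<open>\<rho>\<close> at which it changes. The number of copies is not assumed to be
  computable, so the distinguisher cannot pick the right hybrid. Instead it goes through all slots
  \<open>(a, z)\<close> below a computable polynomial bound, acts in each with a small probability, and there
  multiplies the parity value on the challenge by the difference of the values on fresh samples. Each slot thus contributes
  a nonnegative multiple of a squared difference, so that slots of the wrong size cannot cancel the right one.\<close>


text \<open>Two input bits leave slack. With one bit, guessing succeeds with probability 1/2, the
  largest bound that \<open>\<delta> n \<ge> 2\<close> allows, and a negligible advantage would
  already break it. With two bits, six parity differences of at most 1/2 force success at most 7/16,
  so only a constant jump has to be excluded.

  An active slot also swaps the challenge for a fresh sample of \<open>\<rho>\<close> for bit 0.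
  What follows then no longer depends on the challenge, and the gap between the two challenges obeys
  a recursion whose new term is a square times a positive factor.

  The distinguisher must embed circuits that arbitrary generating programs emit. It simulates these
  programs with shifted wire addresses and knows only upper bounds on the wires that they use. The
  copies of \<open>\<rho>\<close> therefore work on even wires, the learner and its input register
  on odd wires, each side with its own moving frontier: the register can stay contiguous while
  workspaces of unknown size are allocated. Since a generator may declare outputs before its last
  gate, it is replayed a second time for the gates that act on its outputs.\<close>

type_synonym asg = "nat => bool"
text \<open>Amplitudes are indexed by assignments to infinitely many wires, so that gate lists of
  different widths compose without resizing. Only finitely many wires ever leave the zero
  state.\<close>

type_synonym wave = "asg => complex"

section \<open>Gates acting on amplitudes over infinitely many wires\<close>

fun gap :: "nat gate => wave => wave" where
 "gap (Had a) \<psi> = (%s. (\<psi> (s(a := False)) + (if s a then -1 else 1) * \<psi> (s(a := True))) / complex_of_real (sqrt 2))"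
| "gap (TPhase a) \<psi> = (%s. (if s a then cis (pi / 4) else 1) * \<psi> s)"
| "gap (PauliX a) \<psi> = (%s. \<psi> (s(a := (\<not> s a))))"
| "gap (CNot a b) \<psi> = (%s. \<psi> (s(b := (s b ~= s a))))"
| "gap (Toffoli a b c) \<psi> = (%s. \<psi> (s(c := (s c ~= (s a \<and> s b)))))"

abbreviation waves :: "nat gate list => wave => wave" where "waves gs \<equiv> fold gap gs"

definition ground :: wave where "ground s = of_bool (s = (%_. False))"

definition st :: "nat gate list => wave" where "st gs = waves gs ground"

definition WL :: "nat gate list => nat set" where "WL gs = (\<Union>g\<in>set gs. set_gate g)"

definition wfg :: "nat gate => bool" where "wfg g \<longleftrightarrow> distinct (gate_wires g)"

definition indep :: "nat set => (asg => 'a) => bool" where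
 "indep W E \<longleftrightarrow> (\<forall>s s'. (\<forall>w. w \<notin> W --> s w = s' w) --> E s = E s')"

definition AsgOn :: "nat set => asg set" where "AsgOn W = {s. \<forall>w. w \<notin> W --> \<not> s w}"

definition join :: "asg => asg => asg" where "join s t = (%w. s w \<or> t w)"

definition mask :: "nat set => asg => asg" where "mask V s = (%w. w \<notin> V \<and> s w)"

text \<open>The expectation of a classical observable when every wire is measured at the end. The
  amplitude vanishes off \<open>AsgOn (WL gs)\<close>, so any larger finite set of wires gives the
  same sum (\<open>ex_eq\<close>).\<close>

definition ex :: "nat gate list => (asg => real) => real" where
 "ex gs E = (\<Sum>s\<in>AsgOn (WL gs). E s * (cmod (st gs s))\<^sup>2)"

lemma set_gate_wires: "set (gate_wires g) = set_gate g"
 by (cases g) auto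

lemma finite_set_gate [simp]: "finite (set_gate g)"
 by (cases g) auto

lemma WL_simps [simp]: "WL [] = {}" "WL (g # gs) = set_gate g \<union> WL gs" "WL (gs @ hs) = WL gs \<union> WL hs"
 by (auto simp: WL_def)

lemma WL_map_gate: "WL (map (map_gate f) gs) = f ` WL gs"
 by (auto simp: WL_def gate.set_map)

lemma finite_WL [simp]: "finite (WL gs)"
 by (auto simp: WL_def)

lemma indepD: "indep W E ==> (\<And>w. w \<notin> W ==> s w = s' w) ==> E s = E s'"
 unfolding indep_def by blast

lemma indep_upd: "indep W E ==> w \<in> W ==> E (s(w := v)) = E s"
 by (erule indepD) auto

lemma indep_subset: "indep W E ==> V \<subseteq> W ==> indep V E"
 unfolding indep_def by blast

text \<open>A coefficient that ignores the wires of the gate has the same value on all assignments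
  that the gate mixes, so it factors out.\<close>

lemma gap_mult:
 assumes "indep (set_gate g) a"
 shows "gap g (%s. a s * \<psi> s) = (%s. a s * gap g \<psi> s)"
 using indep_upd[OF assms]
 by (cases g) (auto simp: fun_eq_iff algebra_simps add_divide_distrib diff_divide_distrib)

lemma waves_mult:
 assumes "indep (WL gs) a"
 shows "waves gs (%s. a s * \<psi> s) = (%s. a s * waves gs \<psi> s)"
 using assms
proof (induction gs arbitrary: \<psi>)
 case (Cons g gs)
 then have "indep (set_gate g) a" "indep (WL gs) a" by (auto elim: indep_subset)
 then show ?case using Cons.IH by (simp add: gap_mult)
qed simp

lemma gap_commute:
 assumes "set_gate g \<inter> set_gate h = {}"
 shows "gap g (gap h \<psi>) = gap h (gap g \<psi>)"
 using assms
 by (cases g; cases h)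
   (auto simp: fun_eq_iff fun_upd_twist algebra_simps add_divide_distrib diff_divide_distrib)

lemma mask_upd: "a \<notin> V ==> mask V (s(a := v)) = (mask V s)(a := v)"
 by (auto simp: mask_def fun_eq_iff)

lemma mask_apply: "a \<notin> V ==> mask V s a = s a"
 by (simp add: mask_def)

lemma gap_mask:
 "set_gate g \<inter> V = {} ==> gap g (%s. \<psi> (mask V s)) = (%s. gap g \<psi> (mask V s))"
 by (cases g) (simp_all add: mask_upd mask_apply)

lemma waves_mask:
 "WL gs \<inter> V = {} ==> waves gs (%s. \<psi> (mask V s)) = (%s. waves gs \<psi> (mask V s))"
 by (induction gs arbitrary: \<psi>) (simp_all add: gap_mask Int_Un_distrib2)

lemma gap_add: "gap g (%s. \<phi> s + \<psi> s) = (%s. gap g \<phi> s + gap g \<psi> s)"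
 by (cases g) (auto simp: fun_eq_iff algebra_simps add_divide_distrib)

lemma waves_add: "waves gs (%s. \<phi> s + \<psi> s) = (%s. waves gs \<phi> s + waves gs \<psi> s)"
 by (induction gs arbitrary: \<phi> \<psi>) (simp_all add: gap_add)

lemma gap_waves_commute:
 assumes "set_gate g \<inter> WL hs = {}"
 shows "gap g (waves hs \<psi>) = waves hs (gap g \<psi>)"
 using assms by (induction hs arbitrary: \<psi>) (auto simp: gap_commute Int_Un_distrib)

lemma waves_commute:
 assumes "WL gs \<inter> WL hs = {}"
 shows "waves gs (waves hs \<psi>) = waves hs (waves gs \<psi>)"
 using assms by (induction gs arbitrary: \<psi>) (auto simp: gap_waves_commute Int_Un_distrib2)

lemma st_append: "st (gs @ hs) = waves hs (st gs)"
 by (simp add: st_def)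

lemma st_commute:
 assumes "WL gs \<inter> WL hs = {}"
 shows "st (as @ gs @ hs @ bs) = st (as @ hs @ gs @ bs)"
 using waves_commute[OF assms] by (simp add: st_def)

lemma AsgOn_mono: "U \<subseteq> V ==> AsgOn U \<subseteq> AsgOn V"
 by (auto simp: AsgOn_def)

lemma join_AsgOn: "s \<in> AsgOn U ==> t \<in> AsgOn V ==> join s t \<in> AsgOn (U \<union> V)"
 by (auto simp: AsgOn_def join_def)

lemma bij_betw_join:
 assumes "U \<inter> V = {}"
 shows "bij_betw (%(s, t). join s t) (AsgOn U \<times> AsgOn V) (AsgOn (U \<union> V))"
proof (rule bij_betwI[where g = "%s. (%w. w \<in> U \<and> s w, %w. w \<in> V \<and> s w)"])
 fix x assume "x \<in> AsgOn U \<times> AsgOn V"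
 then show "(%s. (%w. w \<in> U \<and> s w, %w. w \<in> V \<and> s w)) (case x of (s, t) => join s t) = x"
  using assms by (cases x) (auto simp: AsgOn_def join_def fun_eq_iff)
qed (auto simp: AsgOn_def join_def fun_eq_iff)

lemma finite_AsgOn [simp]: "finite W ==> finite (AsgOn W)"
proof (rule finite_imageD)
 assume "finite W"
 have "(%s. {w. s w}) ` AsgOn W \<subseteq> Pow W" by (auto simp: AsgOn_def)
 then show "finite ((%s. {w. s w}) ` AsgOn W)" using \<open>finite W\<close> by (metis finite_Pow_iff finite_subset)
 show "inj_on (%s. {w. s w}) (AsgOn W)" by (auto simp: inj_on_def)
qed

lemma sum_AsgOn_join:
 assumes "U \<inter> V = {}"
 shows "(\<Sum>s\<in>AsgOn (U \<union> V). f s) = (\<Sum>s\<in>AsgOn U. \<Sum>t\<in>AsgOn V. f (join s t))"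
proof -
 have "(\<Sum>s\<in>AsgOn (U \<union> V). f s) = (\<Sum>x\<in>AsgOn U \<times> AsgOn V. f (case x of (s, t) => join s t))"
  using sum.reindex_bij_betw[OF bij_betw_join[OF assms], of f] by simp
 then show ?thesis by (simp add: sum.cartesian_product case_prod_unfold)
qed

lemma AsgOn_empty [simp]: "AsgOn {} = {%_. False}"
 by (auto simp: AsgOn_def)

lemma AsgOn_single: "AsgOn {a} = {%_. False, (%_. False)(a := True)}"
 by (auto simp: AsgOn_def fun_eq_iff)

lemma sum_AsgOn_insert:
 assumes "a \<in> U"
 shows "(\<Sum>s\<in>AsgOn U. f s) = (\<Sum>s\<in>AsgOn (U - {a}). f s + f (s(a := True)))"
proof -
 have U: "U = (U - {a}) \<union> {a}" using assms by auto
 have ne: "(%_. False) ~= ((%_. False)(a := True) :: asg)" by (auto simp: fun_eq_iff)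
 have j: "join s ((%_. False)(a := True)) = s(a := True)" "join s (%_. False) = s" for s
  by (auto simp: join_def)
 show ?thesis
  by (subst U, subst sum_AsgOn_join) (auto simp: AsgOn_single ne j)
qed

lemma gap_support:
 assumes "\<And>s. \<psi> s ~= 0 ==> s \<in> AsgOn U"
 shows "gap g \<psi> s ~= 0 ==> s \<in> AsgOn (U \<union> set_gate g)"
proof (cases g)
 case (Had a)
 assume "gap g \<psi> s ~= 0"
 with Had have "\<psi> (s(a := False)) ~= 0 \<or> \<psi> (s(a := True)) ~= 0" by auto
 then have "s(a := False) \<in> AsgOn U \<or> s(a := True) \<in> AsgOn U" using assms by blast
 then show ?thesis using Had by (auto simp: AsgOn_def split: if_splits)
qed (auto dest!: assms simp: AsgOn_def split: if_splits)

lemma waves_support: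
 assumes "\<And>s. \<psi> s ~= 0 ==> s \<in> AsgOn U"
 shows "waves gs \<psi> s ~= 0 ==> s \<in> AsgOn (U \<union> WL gs)"
 using assms
proof (induction gs arbitrary: \<psi> U)
 case (Cons g gs)
 have "s \<in> AsgOn ((U \<union> set_gate g) \<union> WL gs)"
  by (rule Cons.IH[of "gap g \<psi>"]) (use Cons.prems gap_support[of \<psi> U g] in auto)
 then show ?case by (simp add: Un_assoc)
qed simp

lemma st_support: "st gs s ~= 0 ==> s \<in> AsgOn (WL gs)"
 using waves_support[of ground "{}" gs s] by (auto simp: st_def ground_def)

lemma ex_eq:
 assumes "finite U" "WL gs \<subseteq> U"
 shows "ex gs E = (\<Sum>s\<in>AsgOn U. E s * (cmod (st gs s))\<^sup>2)"
 unfolding ex_def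
 by (rule sum.mono_neutral_left) (use assms AsgOn_mono in \<open>auto dest: st_support\<close>)

lemma norm_sqrt2: "(cmod (z / complex_of_real (sqrt 2)))\<^sup>2 = (cmod z)\<^sup>2 / 2"
 by (simp add: norm_divide power_divide)

text \<open>The parallelogram law, which is the unitarity of the Hadamard gate.\<close>

lemma norm_had: "(cmod ((x + y) / complex_of_real (sqrt 2)))\<^sup>2 + (cmod ((x - y) / complex_of_real (sqrt 2)))\<^sup>2 = (cmod x)\<^sup>2 + (cmod y)\<^sup>2"
proof -
 have "(cmod ((x + y) / complex_of_real (sqrt 2)))\<^sup>2 + (cmod ((x - y) / complex_of_real (sqrt 2)))\<^sup>2
   = ((cmod (x + y))\<^sup>2 + (cmod (x - y))\<^sup>2) / 2"
  unfolding norm_sqrt2 by (simp add: add_divide_distrib)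
 also have "\<dots> = (cmod x)\<^sup>2 + (cmod y)\<^sup>2"
  unfolding cmod_power2 by (simp add: power2_eq_square field_simps)
 finally show ?thesis .
qed

text \<open>Unitarity in each fibre: \<open>E\<close> is constant on every set of assignments that
  differ only on the wires of the gate, and the gate preserves the norm there. The permutation gates
  are involutions; for \<open>CNot\<close> and \<open>Toffoli\<close> this needs \<open>wfg\<close>,
  a target that is not a control.\<close>

lemma sum_gap:
 assumes U: "set_gate g \<subseteq> U" and g: "wfg g" and E: "indep (set_gate g) E"
 shows "(\<Sum>s\<in>AsgOn U. E s * (cmod (gap g \<psi> s))\<^sup>2) = (\<Sum>s\<in>AsgOn U. E s * (cmod (\<psi> s))\<^sup>2)"
proof (cases g)
 case (Had a)
 then have a: "a \<in> U" using U by auto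
 have Ea: "E (s(a := v)) = E s" for s v using indep_upd[OF E, of a] Had by auto
 show ?thesis unfolding sum_AsgOn_insert[OF a]
 proof (rule sum.cong[OF refl])
  fix s assume "s \<in> AsgOn (U - {a})"
  then have s: "\<not> s a" "s(a := False) = s" by (auto simp: AsgOn_def fun_eq_iff)
  have "E s * (cmod (gap g \<psi> s))\<^sup>2 + E (s(a := True)) * (cmod (gap g \<psi> (s(a := True))))\<^sup>2
   = E s * ((cmod ((\<psi> s + \<psi> (s(a := True))) / complex_of_real (sqrt 2)))\<^sup>2
     + (cmod ((\<psi> s - \<psi> (s(a := True))) / complex_of_real (sqrt 2)))\<^sup>2)"
   using s by (simp add: Had Ea algebra_simps)
  also have "\<dots> = E s * (cmod (\<psi> s))\<^sup>2 + E (s(a := True)) * (cmod (\<psi> (s(a := True))))\<^sup>2"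
   by (simp only: norm_had) (simp add: Ea algebra_simps)
  finally show "E s * (cmod (gap g \<psi> s))\<^sup>2 + E (s(a := True)) * (cmod (gap g \<psi> (s(a := True))))\<^sup>2
   = E s * (cmod (\<psi> s))\<^sup>2 + E (s(a := True)) * (cmod (\<psi> (s(a := True))))\<^sup>2" .
 qed
next
 case (TPhase a)
 then show ?thesis by (auto simp: norm_mult intro!: sum.cong)
next
 case (PauliX a)
 show ?thesis
  by (rule sum.reindex_bij_witness[of _ "%s. s(a := (\<not> s a))" "%s. s(a := (\<not> s a))"])
    (use PauliX U indep_upd[OF E, of a] in \<open>auto simp: AsgOn_def\<close>)
next
 case (CNot a b)
 show ?thesis
  by (rule sum.reindex_bij_witness[of _ "%s. s(b := (s b ~= s a))" "%s. s(b := (s b ~= s a))"])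
    (use CNot U g indep_upd[OF E, of b] in \<open>auto simp: AsgOn_def wfg_def fun_eq_iff\<close>)
next
 case (Toffoli a b c)
 show ?thesis
  by (rule sum.reindex_bij_witness[of _ "%s. s(c := (s c ~= (s a \<and> s b)))" "%s. s(c := (s c ~= (s a \<and> s b)))"])
    (use Toffoli U g indep_upd[OF E, of c] in \<open>auto simp: AsgOn_def wfg_def fun_eq_iff\<close>)
qed

text \<open>The gates are unitary on wires that \<open>E\<close> ignores, so \<open>sum_gap\<close>
  removes them one by one from the end. This is the no-signalling principle by which the garbage of
  a computation disappears.\<close>

lemma ex_drop:
 assumes "\<forall>g\<in>set hs. wfg g" "indep (WL hs) E"
 shows "ex (gs @ hs) E = ex gs E"
 using assms
proof (induction hs rule: rev_induct)
 case (snoc h hs)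
 let ?U = "WL (gs @ hs @ [h])"
 have "ex (gs @ hs @ [h]) E = (\<Sum>s\<in>AsgOn ?U. E s * (cmod (gap h (st (gs @ hs)) s))\<^sup>2)"
  by (simp add: ex_def st_def)
 also have "\<dots> = (\<Sum>s\<in>AsgOn ?U. E s * (cmod (st (gs @ hs) s))\<^sup>2)"
  using snoc.prems by (intro sum_gap) (auto elim: indep_subset)
 also have "\<dots> = ex (gs @ hs) E" by (rule ex_eq[symmetric]) auto
 finally have "ex (gs @ hs @ [h]) E = ex (gs @ hs) E" .
 moreover have "ex (gs @ hs) E = ex gs E"
  by (rule snoc.IH) (use snoc.prems in \<open>auto elim: indep_subset\<close>)
 ultimately show ?case by simp
qed simp

lemma ex_cong: "st gs = st hs ==> ex gs E = ex hs E"
 using ex_eq[of "WL gs \<union> WL hs" gs E] ex_eq[of "WL gs \<union> WL hs" hs E] by simp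

lemma ex_const: "\<forall>g\<in>set gs. wfg g ==> ex gs (%_. c) = c"
proof -
 assume w: "\<forall>g\<in>set gs. wfg g"
 have "ex ([] @ gs) (%_. c) = ex [] (%_. c)" by (rule ex_drop[OF w]) (auto simp: indep_def)
 then show ?thesis by (simp add: ex_def st_def ground_def)
qed

text \<open>The amplitude after \<open>gs\<close> is a coefficient that depends only on the wires of
  \<open>gs\<close>, times the indicator \<open>\<eta>\<close> that all other wires are zero. The
  gates \<open>hs\<close> pass through the coefficient and act on \<open>\<eta>\<close> alone. The
  same splitting of \<open>ground\<close> expresses \<open>st hs\<close> by
  \<open>waves hs \<eta>\<close>.\<close>

lemma st_product:
 assumes "WL gs \<inter> WL hs = {}" "s \<in> AsgOn (WL gs)" "t \<in> AsgOn (WL hs)"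
 shows "st (gs @ hs) (join s t) = st gs s * st hs t"
proof -
 let ?V = "WL gs"
 let ?r = "%s w. w \<in> ?V \<and> s w" and ?o = "mask ?V"
 define \<eta> :: wave where "\<eta> s = of_bool (\<forall>w. w \<notin> ?V --> \<not> s w)" for s
 have r: "?r s \<in> AsgOn ?V ==> \<eta> s = 1 ==> ?r s = s" for s unfolding \<eta>_def by (auto simp: fun_eq_iff)
 have e: "st gs = (%s. st gs (?r s) * \<eta> s)"
 proof
  fix s show "st gs s = st gs (?r s) * \<eta> s"
  proof (cases "s \<in> AsgOn ?V")
   case True then have "?r s = s" "\<eta> s = 1" by (auto simp: AsgOn_def \<eta>_def fun_eq_iff)
   then show ?thesis by simp
  next
   case False then have "\<eta> s = 0" "st gs s = 0" using st_support by (auto simp: AsgOn_def \<eta>_def)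
   then show ?thesis by simp
  qed
 qed
 have 1: "indep (WL hs) (%s. st gs (?r s))"
  unfolding indep_def
 proof (intro allI impI)
  fix s s' :: asg assume "\<forall>w. w \<notin> WL hs --> s w = s' w"
  then have "?r s = ?r s'" using assms(1) by (auto simp: fun_eq_iff)
  then show "st gs (?r s) = st gs (?r s')" by simp
 qed
 have a: "st (gs @ hs) = (%s. st gs (?r s) * waves hs \<eta> s)"
  unfolding st_append by (subst e) (rule waves_mult[OF 1])
 let ?z = "%s::asg. of_bool (\<forall>w\<in>?V. \<not> s w) :: complex"
 have g: "ground = (%s. ?z s * \<eta> s)" by (auto simp: ground_def \<eta>_def fun_eq_iff)
 have 2: "indep (WL hs) ?z"
  unfolding indep_def using assms(1) by (auto simp: disjoint_iff)
 have b: "st hs = (%s. ?z s * waves hs \<eta> s)"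
  unfolding st_def by (subst g) (rule waves_mult[OF 2])
 have inv: "waves hs (%s. \<eta> (?o s)) = (%s. waves hs \<eta> (?o s))"
  using waves_mask[of hs ?V \<eta>] assms(1) by (simp add: Int_commute)
 have c: "(%s. \<eta> (?o s)) = \<eta>" by (auto simp: \<eta>_def mask_def fun_eq_iff)
 have rj: "?r (join s t) = s" "?o (join s t) = t" 
  using assms by (auto simp: join_def AsgOn_def mask_def fun_eq_iff)
 have "st (gs @ hs) (join s t) = st gs s * waves hs \<eta> t"
  unfolding a using rj fun_cong[OF inv, of "join s t"] c by simp
 moreover have "st hs t = waves hs \<eta> t" unfolding b using assms by (auto simp: AsgOn_def)
 ultimately show ?thesis by simp
qed

text \<open>Amplitudes of a product state factor, and each observable ignores the wires of the other
  list, so the double sum splits.\<close>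

lemma ex_prod:
 assumes "WL gs \<inter> WL hs = {}" "indep (WL hs) E" "indep (WL gs) F"
 shows "ex (gs @ hs) (%s. E s * F s) = ex gs E * ex hs F"
proof -
 have E: "E (join s t) = E s" if "t \<in> AsgOn (WL hs)" for s t
  by (rule indepD[OF assms(2)]) (use that in \<open>auto simp: AsgOn_def join_def\<close>)
 have F: "F (join s t) = F t" if "s \<in> AsgOn (WL gs)" for s t
  by (rule indepD[OF assms(3)]) (use that in \<open>auto simp: AsgOn_def join_def\<close>)
 have "ex (gs @ hs) (%s. E s * F s) = (\<Sum>s\<in>AsgOn (WL gs). \<Sum>t\<in>AsgOn (WL hs). 
   (E s * (cmod (st gs s))\<^sup>2) * (F t * (cmod (st hs t))\<^sup>2))"
  unfolding ex_def WL_simps sum_AsgOn_join[OF assms(1)]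
  by (intro sum.cong refl) (simp add: E F st_product[OF assms(1)] norm_mult power_mult_distrib)
 then show ?thesis by (simp add: ex_def sum_product)
qed


section \<open>Classical controls, coins and the activation bit\<close>

fun nontarget :: "nat => nat gate => bool" where
 "nontarget a (Had b) \<longleftrightarrow> b ~= a"
| "nontarget a (TPhase b) \<longleftrightarrow> True"
| "nontarget a (PauliX b) \<longleftrightarrow> b ~= a"
| "nontarget a (CNot b c) \<longleftrightarrow> c ~= a"
| "nontarget a (Toffoli b c d) \<longleftrightarrow> d ~= a"

lemma nontargetI: "a \<notin> set_gate g ==> nontarget a g"
 by (cases g) auto

lemma nontarget_WL: "a \<notin> WL gs ==> \<forall>g\<in>set gs. nontarget a g"
 by (auto simp: WL_def nontargetI)

lemma waves_control:
 assumes "\<forall>g\<in>set gs. nontarget a g"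
 shows "waves gs (%s. f (s a) * \<psi> s) = (%s. f (s a) * waves gs \<psi> s)"
 using assms
proof (induction gs arbitrary: \<psi>)
 case (Cons g gs)
 have "gap g (%s. f (s a) * \<psi> s) = (%s. f (s a) * gap g \<psi> s)"
  using Cons.prems by (cases g) (auto simp: fun_eq_iff algebra_simps add_divide_distrib diff_divide_distrib)
 then show ?case using Cons by simp
qed simp

lemma ground_zero: "s w ==> ground s = 0"
 by (auto simp: ground_def)

lemma waves_zero:
 assumes "\<forall>g\<in>set gs. nontarget k g" "\<And>s. s k ~= v ==> \<psi> s = 0" "s k ~= v"
 shows "waves gs \<psi> s = 0"
proof -
 have "(%s. of_bool (s k = v) * \<psi> s) = \<psi>" using assms(2) by (auto simp: fun_eq_iff)
 from waves_control[OF assms(1), of "%b. of_bool (b = v)" \<psi>, unfolded this]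
 have "waves gs \<psi> s = of_bool (s k = v) * waves gs \<psi> s" by (rule fun_cong)
 also have "\<dots> = 0" using assms(3) by simp
 finally show ?thesis .
qed

text \<open>The later gates never change wire \<open>a\<close>, so the branches
  \<open>?\<phi>0\<close> and \<open>?\<phi>1\<close> keep disjoint supports. The cross terms in the
  squared modulus vanish, and the superposition behaves like a fair classical coin.\<close>

lemma ex_coin:
 assumes "\<forall>g\<in>set gs. nontarget a g"
 shows "ex (Had a # gs) E = (ex gs E + ex (PauliX a # gs) E) / 2"
proof -
 let ?c = "1 / complex_of_real (sqrt 2)"
 let ?\<phi>0 = "waves gs ground" and ?\<phi>1 = "waves gs (gap (PauliX a) ground)"
 have had: "gap (Had a) ground = (%s. ?c * (ground s + gap (PauliX a) ground s))"
 proof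
  fix s show "gap (Had a) ground s = ?c * (ground s + gap (PauliX a) ground s)"
  proof (cases "s a")
   case True
   then show ?thesis by (simp add: ground_zero[of s a] ground_zero[of "s(a := True)" a])
  next
   case False
   then have "s(a := False) = s" by (simp add: fun_upd_idem)
   then show ?thesis using False by (simp add: ground_zero[of "s(a := True)" a])
  qed
 qed
 have "indep (WL gs) (%_. ?c)" by (simp add: indep_def)
 then have w: "waves gs (gap (Had a) ground) = (%s. ?c * (?\<phi>0 s + ?\<phi>1 s))"
  unfolding had by (subst waves_mult) (simp_all add: waves_add)
 have z0: "?\<phi>0 s = 0" if "s a" for s
  by (rule waves_zero[OF assms, of False]) (use that in \<open>auto simp: ground_zero\<close>)
 have z1: "?\<phi>1 s = 0" if "\<not> s a" for s
  by (rule waves_zero[OF assms, of True]) (use that ground_zero[of _ a] in auto)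
 have n: "(cmod (?c * (?\<phi>0 s + ?\<phi>1 s)))\<^sup>2 = ((cmod (?\<phi>0 s))\<^sup>2 + (cmod (?\<phi>1 s))\<^sup>2) / 2" for s
  using z0 z1 by (cases "s a") (auto simp: norm_mult norm_divide power_mult_distrib power_divide)
 let ?U = "insert a (WL gs)"
 have "ex (Had a # gs) E = (\<Sum>s\<in>AsgOn ?U. E s * (((cmod (?\<phi>0 s))\<^sup>2 + (cmod (?\<phi>1 s))\<^sup>2) / 2))"
  unfolding n[symmetric] by (subst ex_eq[of ?U]) (auto simp: st_def w simp del: gap.simps)
 also have "\<dots> = ((\<Sum>s\<in>AsgOn ?U. E s * (cmod (?\<phi>0 s))\<^sup>2) + (\<Sum>s\<in>AsgOn ?U. E s * (cmod (?\<phi>1 s))\<^sup>2)) / 2"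
  by (subst sum.distrib[symmetric], subst sum_divide_distrib) (rule sum.cong[OF refl], simp add: field_simps)
 also have "\<dots> = (ex gs E + ex (PauliX a # gs) E) / 2"
  by (simp add: ex_eq[of ?U gs] ex_eq[of ?U "PauliX a # gs"] subset_insertI st_def)
 finally show ?thesis .
qed

text \<open>Partial evaluation of a gate whose first control is \<open>k\<close>, given that wire
  \<open>k\<close> has the value \<open>v\<close>. A Toffoli gate with \<open>k\<close> as second
  control stays as it is, which is also correct.\<close>

fun ctl :: "nat => bool => nat gate => nat gate list" where
 "ctl k v (CNot a b) = (if a = k then (if v then [PauliX b] else []) else [CNot a b])"
| "ctl k v (Toffoli a b c) = (if a = k then (if v then [CNot b c] else []) else [Toffoli a b c])"
| "ctl k v g = [g]"

definition ctls :: "nat => bool => nat gate list => nat gate list" where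
 "ctls k v gs = concat (map (ctl k v) gs)"

lemma ctls_simps [simp]: "ctls k v [] = []" "ctls k v (g # gs) = ctl k v g @ ctls k v gs"
 "ctls k v (gs @ hs) = ctls k v gs @ ctls k v hs"
 by (auto simp: ctls_def)

lemma ctl_id: "k \<notin> set_gate g ==> ctl k v g = [g]"
 by (cases g) auto

lemma ctls_id: "k \<notin> WL gs ==> ctls k v gs = gs"
 by (induction gs) (auto simp: ctl_id)

lemma waves_ctls:
 assumes "\<forall>g\<in>set gs. nontarget k g" "\<And>s. s k ~= v ==> \<psi> s = 0"
 shows "waves gs \<psi> = waves (ctls k v gs) \<psi>"
 using assms
proof (induction gs arbitrary: \<psi>)
 case (Cons g gs)
 have "gap g \<psi> s = waves (ctl k v g) \<psi> s" for s
 proof (cases "s k = v")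
  case True
  then show ?thesis by (cases g) auto
 next
  case False
  then have "\<psi> (s(b := u)) = 0" if "b ~= k" for b u using Cons.prems(2)[of "s(b := u)"] that by (metis fun_upd_other)
  then show ?thesis using Cons.prems(1) Cons.prems(2)[of s] False by (cases g) auto
 qed
 then have "gap g \<psi> = waves (ctl k v g) \<psi>" by blast
 moreover have "waves gs (gap g \<psi>) = waves (ctls k v gs) (gap g \<psi>)"
  using Cons.prems waves_zero[of "[g]" k v \<psi>] by (intro Cons.IH) auto
 ultimately show ?case by simp
qed simp

lemma ex_ctl_False:
 assumes "\<forall>g\<in>set gs. nontarget k g"
 shows "ex gs E = ex (ctls k False gs) E"
 by (rule ex_cong) (use waves_ctls[OF assms, of False ground] ground_zero in \<open>auto simp: st_def\<close>)

text \<open>After the partial evaluation no gate touches \<open>k\<close>, so the initial flip moves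
  to the end, where the observable does not see it.\<close>

lemma ex_ctl_True:
 assumes "\<forall>g\<in>set gs. nontarget k g" "k \<notin> WL (ctls k True gs)" "indep {k} E"
 shows "ex (PauliX k # gs) E = ex (ctls k True gs) E"
proof -
 have "st (PauliX k # gs) = waves (ctls k True gs) (gap (PauliX k) ground)"
  using waves_ctls[OF assms(1), of True "gap (PauliX k) ground"] ground_zero[of _ k] by (auto simp: st_def)
 also have "\<dots> = st (ctls k True gs @ [PauliX k])"
  using gap_waves_commute[of "PauliX k" "ctls k True gs" ground] assms(2) by (simp add: st_def)
 finally have "ex (PauliX k # gs) E = ex (ctls k True gs @ [PauliX k]) E" by (rule ex_cong)
 also have "\<dots> = ex (ctls k True gs) E" by (rule ex_drop) (use assms in \<open>auto simp: wfg_def\<close>)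
 finally show ?thesis .
qed

text \<open>A chain of conjunctions: each round tosses a coin on \<open>e + 2\<close> and writes its
  conjunction with wire \<open>e\<close> to \<open>e + 4\<close>. If wire \<open>e\<close> starts as
  one, wire \<open>e + 4 * r\<close> ends as one with probability \<open>1 / 2 ^ r\<close>. The
  chain produces this probability exactly.\<close>

fun gad :: "nat => nat => nat gate list" where
 "gad e 0 = []"
| "gad e (Suc r) = Had (e + 2) # Toffoli e (e + 2) (e + 4) # gad (e + 4) r"

lemma WL_gad: "w \<in> WL (gad e r) ==> e \<le> w \<and> w \<le> e + 4 * r \<and> (even e --> even w)"
proof (induction r arbitrary: e)
 case (Suc r)
 then consider "w \<in> {e, e + 2, e + 4}" | "w \<in> WL (gad (e + 4) r)" by auto
 then show ?case using Suc.IH[of "e + 4"] by cases auto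
qed simp

lemma gad_wfg: "g \<in> set (gad e r) ==> wfg g"
 by (induction r arbitrary: e) (auto simp: wfg_def)

definition offgad :: "nat => nat => nat set" where
 "offgad e r = {w. even w --> w < e \<or> e + 4 * r < w}"

text \<open>With wire \<open>e\<close> at zero every Toffoli gate of the chain is idle, and the
  coins are invisible to \<open>E\<close>.\<close>

lemma ex_gad_False:
 assumes "even e" "WL gs \<subseteq> insert (e + 4 * r) (offgad e r)"
  "\<forall>g\<in>set gs. nontarget (e + 4 * r) g" "indep (- offgad e r) E"
 shows "ex (gad e r @ gs) E = ex (ctls (e + 4 * r) False gs) E"
 using assms
proof (induction r arbitrary: e)
 case 0
 then show ?case using ex_ctl_False by simp
next
 case (Suc r)
 let ?R = "gad (e + 4) r @ gs"
 have "e \<notin> WL gs" "e + 2 \<notin> WL gs" using Suc.prems(1,2) by (auto simp: offgad_def)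
 moreover have "e \<notin> WL (gad (e + 4) r)" "e + 2 \<notin> WL (gad (e + 4) r)"
  using WL_gad[of e "e + 4" r] WL_gad[of "e + 2" "e + 4" r] by auto
 ultimately have nt: "e \<notin> WL ?R" "e + 2 \<notin> WL ?R" by auto
 have "ex (gad e (Suc r) @ gs) E = ex (ctls e False (gad e (Suc r) @ gs)) E"
  using nontarget_WL[OF nt(1)] by (intro ex_ctl_False) auto
 also have "ctls e False (gad e (Suc r) @ gs) = Had (e + 2) # ?R"
  using ctls_id[of e ?R False] nt by simp
 also have "ex (Had (e + 2) # ?R) E = ex (?R @ [Had (e + 2)]) E"
  by (rule ex_cong) (use st_commute[of "[Had (e + 2)]" ?R "[]" "[]"] nt(2) in simp)
 also have "\<dots> = ex ?R E"
  using Suc.prems(1) indep_subset[OF Suc.prems(4), of "{e + 2}"] by (intro ex_drop) (auto simp: wfg_def offgad_def)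
 also have "\<dots> = ex (ctls (e + 4 + 4 * r) False gs) E"
 proof (rule Suc.IH)
  show "WL gs \<subseteq> insert (e + 4 + 4 * r) (offgad (e + 4) r)" using Suc.prems(2) by (auto simp: offgad_def)
  show "indep (- offgad (e + 4) r) E" using Suc.prems(4) by (rule indep_subset) (auto simp: offgad_def)
 qed (use Suc.prems in \<open>auto simp: algebra_simps\<close>)
 finally show ?case by (simp add: algebra_simps)
qed

text \<open>Evaluating wire \<open>e\<close> turns the first Toffoli gate into a \<open>CNot\<close>
  from the coin. Conditioned on the coin, the rest of the chain starts either from zero, where
  \<open>ex_gad_False\<close> applies, or from one, where the induction hypothesis does.\<close>

lemma ex_gad:
 assumes "even e" "WL gs \<subseteq> insert (e + 4 * r) (offgad e r)"
  "\<forall>g\<in>set gs. nontarget (e + 4 * r) g" "indep (- offgad e r) E" 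
  "e + 4 * r \<notin> WL (ctls (e + 4 * r) True gs)"
 shows "ex (PauliX e # gad e r @ gs) E = 
  (1 / 2 ^ r) * ex (ctls (e + 4 * r) True gs) E + (1 - 1 / 2 ^ r) * ex (ctls (e + 4 * r) False gs) E"
 using assms
proof (induction r arbitrary: e)
 case 0
 then have "ex (PauliX e # gs) E = ex (ctls e True gs) E"
  by (intro ex_ctl_True) (auto simp: offgad_def elim: indep_subset)
 then show ?case by simp
next
 case (Suc r)
 let ?R = "gad (e + 4) r @ gs" and ?k = "e + 4 * Suc r"
 have "e \<notin> WL gs" "e + 2 \<notin> WL gs" using Suc.prems(1,2) by (auto simp: offgad_def)
 moreover have "e \<notin> WL (gad (e + 4) r)" "e + 2 \<notin> WL (gad (e + 4) r)"
  using WL_gad[of e "e + 4" r] WL_gad[of "e + 2" "e + 4" r] by auto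
 ultimately have nt: "e \<notin> WL ?R" "e + 2 \<notin> WL ?R" by auto
 have nt2: "\<forall>g\<in>set ?R. nontarget e g \<and> nontarget (e + 2) g" 
  using nontarget_WL[OF nt(1)] nontarget_WL[OF nt(2)] by blast
 have Ei: "indep {e} E" "indep {e + 2} E"
  by (rule indep_subset[OF Suc.prems(4)]; use Suc.prems(1) in \<open>simp add: offgad_def\<close>)+
 have k: "?k = e + 4 + 4 * r" by simp
 have IHp: "even (e + 4)" "WL gs \<subseteq> insert (e + 4 + 4 * r) (offgad (e + 4) r)"
  "\<forall>g\<in>set gs. nontarget (e + 4 + 4 * r) g" "indep (- offgad (e + 4) r) E"
  "e + 4 + 4 * r \<notin> WL (ctls (e + 4 + 4 * r) True gs)"
  using Suc.prems(1-3,5) unfolding k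
  by (auto simp: offgad_def intro!: indep_subset[OF Suc.prems(4)])
 have cR: "ctls e v ?R = ?R" "ctls (e + 2) v ?R = ?R" for v by (simp_all only: ctls_id[OF nt(1)] ctls_id[OF nt(2)])
 have "ex (PauliX e # gad e (Suc r) @ gs) E = ex (ctls e True (gad e (Suc r) @ gs)) E"
 proof (rule ex_ctl_True)
  have "ctls e True (gad e (Suc r) @ gs) = Had (e + 2) # CNot (e + 2) (e + 4) # ?R" using cR by simp
  then show "e \<notin> WL (ctls e True (gad e (Suc r) @ gs))" using nt by simp
 qed (use nt2 Ei in auto)
 also have "ctls e True (gad e (Suc r) @ gs) = Had (e + 2) # CNot (e + 2) (e + 4) # ?R"
  using cR by simp
 also have "ex \<dots> E = (ex (CNot (e + 2) (e + 4) # ?R) E + ex (PauliX (e + 2) # CNot (e + 2) (e + 4) # ?R) E) / 2"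
  using nt2 by (intro ex_coin) auto
 also have "ex (CNot (e + 2) (e + 4) # ?R) E = ex ?R E"
  using ex_ctl_False[of "CNot (e + 2) (e + 4) # ?R" "e + 2" E] nt2 cR by simp
 also have "ex (PauliX (e + 2) # CNot (e + 2) (e + 4) # ?R) E = ex (PauliX (e + 4) # ?R) E"
 proof -
  have c: "ctls (e + 2) True (CNot (e + 2) (e + 4) # ?R) = PauliX (e + 4) # ?R" using cR by simp
  show ?thesis unfolding c[symmetric]
   by (rule ex_ctl_True) (use nt nt2 Ei c in \<open>simp_all del: ctls_simps\<close>)
 qed
 also have "ex ?R E = ex (ctls ?k False gs) E"
  unfolding k by (rule ex_gad_False[OF IHp(1-4)])
 also have "ex (PauliX (e + 4) # ?R) E = 
   (1 / 2 ^ r) * ex (ctls ?k True gs) E + (1 - 1 / 2 ^ r) * ex (ctls ?k False gs) E"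
  unfolding k by (rule Suc.IH[OF IHp])
 finally show ?case by (simp add: field_simps)
qed

subsection \<open>Swaps\<close>

definition swapg :: "nat => nat => nat gate list" where
 "swapg a b = [CNot a b, CNot b a, CNot a b]"

definition swaps :: "(nat \<times> nat) list => nat gate list" where
 "swaps ps = concat (map (%(a, b). swapg a b) ps)"

fun swt :: "(nat \<times> nat) list => nat => nat" where
 "swt [] = id"
| "swt ((a, b) # ps) = swt ps \<circ> Transposition.transpose a b"

lemma waves_swapg: "a ~= b ==> waves (swapg a b) \<psi> = (%s. \<psi> (s \<circ> Transposition.transpose a b))"
 by (auto simp: swapg_def fun_eq_iff Transposition.transpose_def intro!: arg_cong[of _ _ \<psi>])

lemma waves_swaps:
 "\<forall>(a, b)\<in>set ps. a ~= b ==> waves (swaps ps) \<psi> = (%s. \<psi> (s \<circ> swt ps))"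
 by (induction ps arbitrary: \<psi>) (auto simp: swaps_def waves_swapg comp_assoc)

lemma bij_swt: "bij (swt ps)"
proof (induction ps rule: swt.induct)
 case (2 a b ps)
 then show ?case unfolding swt.simps by (intro bij_comp) auto
qed (simp add: bij_id[unfolded id_def])

lemma gap_perm:
 assumes "inj f"
 shows "gap (map_gate f g) (%s. \<psi> (s \<circ> f)) = (%s. gap g \<psi> (s \<circ> f))"
proof -
 have "(s(f a := v)) \<circ> f = (s \<circ> f)(a := v)" for s :: asg and a v
  using assms by (auto simp: fun_eq_iff inj_eq)
 then show ?thesis by (cases g) (simp_all add: comp_def)
qed

lemma waves_perm:
 "inj f ==> waves (map (map_gate f) gs) (%s. \<psi> (s \<circ> f)) = (%s. waves gs \<psi> (s \<circ> f))"
 by (induction gs arbitrary: \<psi>) (simp_all add: gap_perm)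

lemma st_perm:
 assumes "bij f"
 shows "st (map (map_gate f) gs) = (%s. st gs (s \<circ> f))"
proof -
 have "ground = (%s. ground (s \<circ> f))"
 proof
  fix s :: asg
  have "s = (%_. False) \<longleftrightarrow> s \<circ> f = (%_. False)"
   using bij_is_surj[OF assms] by (metis comp_apply surj_def)
  then show "ground s = ground (s \<circ> f)" by (simp add: ground_def)
 qed
 then show ?thesis unfolding st_def using waves_perm[OF bij_is_inj[OF assms], of gs ground] by simp
qed

text \<open>The all-zero state is invariant under permutations of the wires, so swaps at the end
  amount to having used renamed wires from the start. In the analysis swaps thereby turn into
  renamings.\<close>

lemma st_swaps:
 assumes "\<forall>(a, b)\<in>set ps. a ~= b"
 shows "st (gs @ swaps ps) = st (map (map_gate (swt ps)) gs)"
 by (simp add: st_append waves_swaps[OF assms] st_perm[OF bij_swt])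

lemma swt_off: "w \<notin> fst ` set ps ==> w \<notin> snd ` set ps ==> swt ps w = w"
 by (induction ps rule: swt.induct) auto

lemma swt_zip:
 assumes "length as = length bs" "distinct (as @ bs)" "i < length as"
 shows "swt (zip as bs) (as ! i) = bs ! i \<and> swt (zip as bs) (bs ! i) = as ! i"
 using assms
proof (induction as bs arbitrary: i rule: list_induct2)
 case (Cons a as b bs)
 show ?case
 proof (cases i)
  case 0
  have "swt (zip as bs) w = w" if "w \<in> {a, b}" for w
   using Cons.prems that by (intro swt_off) (auto dest: set_zip_leftD set_zip_rightD)
  then show ?thesis using 0 by simp
 next
  case (Suc j)
  then have j: "j < length as" using Cons by auto
  then have m: "as ! j \<in> set as" "bs ! j \<in> set bs" using Cons by auto
  then have "Transposition.transpose a b (as ! j) = as ! j" "Transposition.transpose a b (bs ! j) = bs ! j"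
   using Cons.prems by (auto simp: Transposition.transpose_def)
  moreover have "swt (zip as bs) (as ! j) = bs ! j \<and> swt (zip as bs) (bs ! j) = as ! j"
   by (rule Cons.IH) (use Cons.prems j in auto)
  ultimately show ?thesis using Suc by simp
 qed
qed simp

lemma swt_map: "length as = length bs ==> distinct (as @ bs) ==> map (swt (zip as bs)) as = bs"
 by (rule nth_equalityI) (simp_all add: swt_zip)

lemma swt_map': "length as = length bs ==> distinct (as @ bs) ==> map (swt (zip as bs)) bs = as"
 by (rule nth_equalityI) (simp_all add: swt_zip)

lemma WL_swaps: "WL (swaps ps) = fst ` set ps \<union> snd ` set ps"
 by (induction ps) (auto simp: swaps_def swapg_def)


section \<open>Reduced states\<close>

definition wr :: "nat list => nat => asg" where
 "wr ws a = (%w. \<exists>i<length ws. ws ! i = w \<and> bit a i)"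

definition rd :: "nat list => asg => nat" where "rd ws s = index_of (map s ws)"

text \<open>The partial trace over all wires outside \<open>ws\<close>. Wires that \<open>gs\<close>
  does not use are zero, so environments on \<open>WL gs - set ws\<close> suffice.\<close>

definition red :: "nat gate list => nat list => complex mat" where
 "red gs ws = mat (2 ^ length ws) (2 ^ length ws) (%(a, b).
   \<Sum>s\<in>AsgOn (WL gs - set ws). st gs (join s (wr ws a)) * cnj (st gs (join s (wr ws b))))"

lemma red_carrier [simp]: "red gs ws \<in> carrier_mat (2 ^ length ws) (2 ^ length ws)"
 "dim_row (red gs ws) = 2 ^ length ws" "dim_col (red gs ws) = 2 ^ length ws"
 by (auto simp: red_def)

lemma bit_index_of: "bit (index_of xs) i \<longleftrightarrow> i < length xs \<and> xs ! i"
 by (simp add: index_of_def bit_horner_sum_bit_iff)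

lemma index_of_less: "index_of xs < 2 ^ length xs"
proof -
 have "take_bit (length xs) (index_of xs) = index_of xs"
  by (rule bit_eqI) (auto simp: bit_take_bit_iff bit_index_of)
 then show ?thesis by (simp add: take_bit_nat_eq_self_iff)
qed

lemma bit_ge_length: "a < 2 ^ k ==> bit a i ==> i < k" for a :: nat
 by (metis bit_take_bit_iff take_bit_nat_eq_self)

lemma nat_eq_bits:
 assumes "a < 2 ^ k" "b < 2 ^ k" "\<And>i. i < k ==> bit a i = bit b i"
 shows "a = (b :: nat)"
 by (rule bit_eqI) (use assms bit_ge_length in blast)

lemma wr_AsgOn: "wr ws a \<in> AsgOn (set ws)"
 by (auto simp: wr_def AsgOn_def)

lemma rd_less: "rd ws s < 2 ^ length ws"
 using index_of_less[of "map s ws"] by (simp add: rd_def)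

lemma wr_nth: "distinct ws ==> i < length ws ==> wr ws a (ws ! i) = bit a i"
 by (auto simp: wr_def nth_eq_iff_index_eq)

lemma rd_wr:
 assumes "distinct ws" "a < 2 ^ length ws"
 shows "rd ws (wr ws a) = a"
 by (rule nat_eq_bits[OF rd_less assms(2)]) (use assms in \<open>auto simp: rd_def bit_index_of wr_nth\<close>)

lemma wr_rd:
 assumes "s \<in> AsgOn (set ws)"
 shows "wr ws (rd ws s) = s"
proof
 fix w show "wr ws (rd ws s) w = s w"
  using assms by (auto simp: wr_def rd_def bit_index_of AsgOn_def in_set_conv_nth) (metis nth_map)
qed

lemma rd_cong: "(\<And>w. w \<in> set ws ==> s w = t w) ==> rd ws s = rd ws t"
 by (simp add: rd_def cong: map_cong)

lemma rd_join_wr: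
 assumes "distinct ws" "a < 2 ^ length ws" "s \<in> AsgOn (U - set ws)"
 shows "rd ws (join s (wr ws a)) = a"
proof -
 have "rd ws (join s (wr ws a)) = rd ws (wr ws a)"
  by (rule rd_cong) (use assms(3) in \<open>auto simp: join_def AsgOn_def\<close>)
 then show ?thesis using rd_wr assms by simp
qed

lemma bij_wr:
 assumes "distinct ws"
 shows "bij_betw (wr ws) {..<2 ^ length ws} (AsgOn (set ws))"
 by (rule bij_betwI[where g = "rd ws"]) (auto simp: wr_AsgOn rd_less rd_wr assms wr_rd)

lemma sum_wr:
 assumes "distinct ws"
 shows "(\<Sum>t\<in>AsgOn (set ws). f t) = (\<Sum>a<2 ^ length ws. f (wr ws a))"
 using sum.reindex_bij_betw[OF bij_wr[OF assms], of f] by simp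

lemma wr_upt: "a < 2 ^ N ==> wr [0..<N] a = bit a"
proof
 fix x assume a: "a < 2 ^ N"
 show "wr [0..<N] a x = bit a x"
  using bit_ge_length[OF a, of x] by (auto simp: wr_def intro!: exI[of _ x])
qed

lemma red_eq:
 assumes "finite U" "WL gs \<subseteq> U" "a < 2 ^ length ws" "b < 2 ^ length ws"
 shows "red gs ws $$ (a, b) =
  (\<Sum>s\<in>AsgOn (U - set ws). st gs (join s (wr ws a)) * cnj (st gs (join s (wr ws b))))"
proof -
 have "st gs (join s t) = 0" if "s \<in> AsgOn (U - set ws) - AsgOn (WL gs - set ws)" for s t
 proof (rule ccontr)
  assume "st gs (join s t) ~= 0"
  then have "join s t \<in> AsgOn (WL gs)" by (rule st_support)
  then show False using that by (auto simp: AsgOn_def join_def)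
 qed
 then have "(\<Sum>s\<in>AsgOn (WL gs - set ws). st gs (join s (wr ws a)) * cnj (st gs (join s (wr ws b)))) =
   (\<Sum>s\<in>AsgOn (U - set ws). st gs (join s (wr ws a)) * cnj (st gs (join s (wr ws b))))"
  using assms(1,2) by (intro sum.mono_neutral_left AsgOn_mono) auto
 then show ?thesis unfolding red_def using assms(3,4) by simp
qed

lemma red_cong: "st gs = st hs ==> red gs ws = red hs ws"
 by (rule eq_matI) (simp_all add: red_eq[of "WL gs \<union> WL hs"])

text \<open>The final assignments are grouped by their restriction to \<open>ws\<close>. This is the
  link between expectations of gate lists and the output probabilities read off a density
  matrix.\<close>

lemma ex_red:
 assumes "distinct ws"
 shows "ex gs (%s. F (rd ws s)) = (\<Sum>a<2 ^ length ws. F a * Re (red gs ws $$ (a, a)))"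
proof -
 let ?U = "(WL gs - set ws) \<union> set ws"
 have "ex gs (%s. F (rd ws s)) = (\<Sum>s\<in>AsgOn ?U. F (rd ws s) * (cmod (st gs s))\<^sup>2)"
  by (rule ex_eq) auto
 also have "\<dots> = (\<Sum>s\<in>AsgOn (WL gs - set ws). \<Sum>a<2 ^ length ws. F a * (cmod (st gs (join s (wr ws a))))\<^sup>2)"
  by (subst sum_AsgOn_join) (auto simp: sum_wr[OF assms] rd_join_wr[OF assms] intro!: sum.cong)
 also have "\<dots> = (\<Sum>a<2 ^ length ws. \<Sum>s\<in>AsgOn (WL gs - set ws). F a * (cmod (st gs (join s (wr ws a))))\<^sup>2)"
  by (rule sum.swap)
 also have "\<dots> = (\<Sum>a<2 ^ length ws. F a * Re (red gs ws $$ (a, a)))"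
 proof (rule sum.cong[OF refl])
  fix a :: nat assume a: "a \<in> {..<2 ^ length ws}"
  have n: "Re (z * cnj z) = (cmod z)\<^sup>2" for z
   by (subst cmod_power2) (simp add: power2_eq_square)
  have "Re (red gs ws $$ (a, a)) = (\<Sum>s\<in>AsgOn (WL gs - set ws). (cmod (st gs (join s (wr ws a))))\<^sup>2)"
   using a n unfolding red_def by simp
  then show "(\<Sum>s\<in>AsgOn (WL gs - set ws). F a * (cmod (st gs (join s (wr ws a))))\<^sup>2) = F a * Re (red gs ws $$ (a, a))"
   by (simp add: sum_distrib_left)
 qed
 finally show ?thesis .
qed

lemma red_perm:
 assumes f: "bij f" and ws: "distinct ws"
 shows "red (map (map_gate f) gs) (map f ws) = red gs ws"
proof (rule eq_matI)
 fix a b assume "a < dim_row (red gs ws)" "b < dim_col (red gs ws)"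
 then have ab: "a < 2 ^ length ws" "b < 2 ^ length ws" by auto
 have inj: "inj f" using f bij_is_inj by auto
 have W: "WL (map (map_gate f) gs) - set (map f ws) = f ` (WL gs - set ws)"
  using inj by (simp add: WL_map_gate image_set_diff)
 have wr: "wr (map f ws) c \<circ> f = wr ws c" for c
  using inj by (auto simp: wr_def fun_eq_iff inj_eq)
 have jo: "join s t \<circ> f = join (s \<circ> f) (t \<circ> f)" for s t by (auto simp: join_def)
 have "red (map (map_gate f) gs) (map f ws) $$ (a, b) = (\<Sum>s\<in>AsgOn (f ` (WL gs - set ws)).
   st gs (join (s \<circ> f) (wr ws a)) * cnj (st gs (join (s \<circ> f) (wr ws b))))"
  using ab unfolding red_def W by (simp add: st_perm[OF f] jo wr)
 also have "\<dots> = red gs ws $$ (a, b)"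
 proof -
  have "bij_betw (%s. s \<circ> f) (AsgOn (f ` (WL gs - set ws))) (AsgOn (WL gs - set ws))"
  proof (rule bij_betwI[where g = "%s. s \<circ> Hilbert_Choice.inv f"])
   show "(%s. s \<circ> f) \<in> AsgOn (f ` (WL gs - set ws)) \<rightarrow> AsgOn (WL gs - set ws)"
    using inj by (auto simp: AsgOn_def inj_image_mem_iff)
   show "(%s. s \<circ> Hilbert_Choice.inv f) \<in> AsgOn (WL gs - set ws) \<rightarrow> AsgOn (f ` (WL gs - set ws))"
   proof
    fix s assume s: "s \<in> AsgOn (WL gs - set ws)"
    have "Hilbert_Choice.inv f w \<notin> WL gs - set ws" if "w \<notin> f ` (WL gs - set ws)" for w
     using that surj_f_inv_f[OF bij_is_surj[OF f], of w] by (metis imageI)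
    then show "s \<circ> Hilbert_Choice.inv f \<in> AsgOn (f ` (WL gs - set ws))" using s by (auto simp: AsgOn_def)
   qed
  qed (use f inj in \<open>auto simp: comp_assoc bij_is_surj surj_iff[THEN iffD1]\<close>)
  from sum.reindex_bij_betw[OF this, of "%s. st gs (join s (wr ws a)) * cnj (st gs (join s (wr ws b)))"]
  show ?thesis using ab by (simp add: red_def)
 qed
 finally show "red (map (map_gate f) gs) (map f ws) $$ (a, b) = red gs ws $$ (a, b)" .
qed auto

lemma st_product':
 assumes "finite U" "finite V" "WL gs \<subseteq> U" "WL hs \<subseteq> V" "U \<inter> V = {}" "s \<in> AsgOn U" "t \<in> AsgOn V"
 shows "st (gs @ hs) (join s t) = st gs s * st hs t"
proof (cases "s \<in> AsgOn (WL gs) \<and> t \<in> AsgOn (WL hs)")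
 case True
 then show ?thesis using assms by (intro st_product) auto
next
 case False
 then have "join s t \<notin> AsgOn (WL (gs @ hs))"
  using assms by (auto simp: AsgOn_def join_def) blast+
 then have "st (gs @ hs) (join s t) = 0" "st gs s = 0 \<or> st hs t = 0" using st_support False by blast+
 then show ?thesis by auto
qed

lemma kron_dims [simp]: "dim_row (kron A B) = dim_row A * dim_row B" "dim_col (kron A B) = dim_col A * dim_col B"
 by (auto simp: kron_def)

lemma ex_less_add: "(\<exists>i<m + n. P i) \<longleftrightarrow> (\<exists>i<m. P i) \<or> (\<exists>i<n. P (m + i))" for m n :: nat
proof
 assume "\<exists>i<m + n. P i"
 then obtain i where i: "i < m + n" "P i" by blast
 show "(\<exists>i<m. P i) \<or> (\<exists>i<n. P (m + i))"
 proof (cases "i < m")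
  case False
  then have "i - m < n" "P (m + (i - m))" using i by auto
  then show ?thesis by blast
 qed (use i in blast)
qed (meson add_less_cancel_left trans_less_add1)

text \<open>The wires \<open>ws\<close> come first in the list and carry the low-order bits, which
  belong to the second Kronecker factor; hence the reversed order.\<close>

lemma red_par:
 assumes "(WL gs \<union> set ws) \<inter> (WL hs \<union> set vs) = {}"
 shows "red (gs @ hs) (ws @ vs) = kron (red hs vs) (red gs ws)"
proof (rule eq_matI)
 fix a b assume "a < dim_row (kron (red hs vs) (red gs ws))" "b < dim_col (kron (red hs vs) (red gs ws))"
 then have ab: "a < 2 ^ length vs * 2 ^ length ws" "b < 2 ^ length vs * 2 ^ length ws" by auto
 let ?m = "2 ^ length ws :: nat"
 let ?U = "WL gs \<union> set ws" and ?V = "WL hs \<union> set vs"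
 have d: "c div ?m < 2 ^ length vs" "c mod ?m < ?m" if "c < 2 ^ length vs * 2 ^ length ws" for c
  using that by (auto simp: less_mult_imp_div_less)
 have w: "wr (ws @ vs) c = join (wr ws (c mod ?m)) (wr vs (c div ?m))" for c
 proof
  fix x
  have b1: "bit (c mod ?m) i = (i < length ws \<and> bit c i)" for i
   by (simp add: bit_take_bit_iff flip: take_bit_eq_mod)
  have b2: "bit (c div ?m) i = bit c (length ws + i)" for i
   by (simp add: bit_drop_bit_eq flip: drop_bit_eq_div)
  show "wr (ws @ vs) c x = join (wr ws (c mod ?m)) (wr vs (c div ?m)) x"
   unfolding wr_def join_def b1 b2 length_append ex_less_add by (auto simp: nth_append)
 qed
 have j: "join (join s t) (join s' t') = join (join s s') (join t t')" for s t s' t'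
  by (auto simp: join_def)
 have sp: "st (gs @ hs) (join (join s t) (wr (ws @ vs) c)) = st gs (join s (wr ws (c mod ?m))) * st hs (join t (wr vs (c div ?m)))"
  if "s \<in> AsgOn (?U - set ws)" "t \<in> AsgOn (?V - set vs)" for s t c
  unfolding w
 proof (subst j, rule st_product'[of ?U ?V])
  show "join s (wr ws (c mod ?m)) \<in> AsgOn ?U"
   using join_AsgOn[OF that(1) wr_AsgOn[of ws]] by (simp add: Un_absorb2 insert_absorb Un_commute) 
  show "join t (wr vs (c div ?m)) \<in> AsgOn ?V"
   using join_AsgOn[OF that(2) wr_AsgOn[of vs]] by (simp add: Un_absorb2 insert_absorb Un_commute) 
 qed (use assms in auto)
 have U: "(?U \<union> ?V) - set (ws @ vs) = (?U - set ws) \<union> (?V - set vs)" using assms by auto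
 have "red (gs @ hs) (ws @ vs) $$ (a, b) = (\<Sum>s\<in>AsgOn ((?U - set ws) \<union> (?V - set vs)).
   st (gs @ hs) (join s (wr (ws @ vs) a)) * cnj (st (gs @ hs) (join s (wr (ws @ vs) b))))"
  using ab unfolding U[symmetric] by (intro red_eq) (auto simp: power_add mult.commute)
 also have "\<dots> = (\<Sum>s\<in>AsgOn (?U - set ws). \<Sum>t\<in>AsgOn (?V - set vs).
   (st gs (join s (wr ws (a mod ?m))) * cnj (st gs (join s (wr ws (b mod ?m))))) *
   (st hs (join t (wr vs (a div ?m))) * cnj (st hs (join t (wr vs (b div ?m))))))"
  using assms by (subst sum_AsgOn_join) (auto simp: sp intro!: sum.cong)
 also have "\<dots> = red gs ws $$ (a mod ?m, b mod ?m) * red hs vs $$ (a div ?m, b div ?m)"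
 proof -
  have "red gs ws $$ (a mod ?m, b mod ?m) = (\<Sum>s\<in>AsgOn (?U - set ws). st gs (join s (wr ws (a mod ?m))) * cnj (st gs (join s (wr ws (b mod ?m)))))"
   by (rule red_eq) (use d ab in auto)
  moreover have "red hs vs $$ (a div ?m, b div ?m) = (\<Sum>s\<in>AsgOn (?V - set vs). st hs (join s (wr vs (a div ?m))) * cnj (st hs (join s (wr vs (b div ?m)))))"
   by (rule red_eq) (use d ab in auto)
  ultimately show ?thesis by (simp add: sum_product)
 qed
 also have "\<dots> = kron (red hs vs) (red gs ws) $$ (a, b)"
  using ab d by (simp add: kron_def)
 finally show "red (gs @ hs) (ws @ vs) $$ (a, b) = kron (red hs vs) (red gs ws) $$ (a, b)" .
qed (auto simp: power_add)


section \<open>Agreement of gate matrices and matrix circuits with the action on amplitudes\<close>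

lemma sum_AsgOn1: "(\<Sum>t\<in>AsgOn {a}. f t) = f (%_. False) + f ((%_. False)(a := True))"
 by (subst sum_AsgOn_insert[of a]) (auto simp: fun_upd_def)

lemma sum_AsgOn2:
 assumes "a ~= b"
 shows "(\<Sum>t\<in>AsgOn {a, b}. f t) = f (%_. False) + f ((%_. False)(a := True)) +
  (f ((%_. False)(b := True)) + f ((%_. False)(b := True, a := True)))"
proof -
 have "{a, b} - {a} = {b}" using assms by auto
 then show ?thesis by (subst sum_AsgOn_insert[of a]) (auto simp: sum_AsgOn1)
qed

lemma sum_AsgOn3:
 assumes "a ~= b" "a ~= c" "b ~= c"
 shows "(\<Sum>t\<in>AsgOn {a, b, c}. f t) = f (%_. False) + f ((%_. False)(a := True)) +
  (f ((%_. False)(b := True)) + f ((%_. False)(b := True, a := True))) +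
  (f ((%_. False)(c := True)) + f ((%_. False)(c := True, a := True)) +
  (f ((%_. False)(c := True, b := True)) + f ((%_. False)(c := True, b := True, a := True))))"
proof -
 have "{a, b, c} - {a} = {b, c}" using assms by auto
 then show ?thesis using assms by (subst sum_AsgOn_insert[of a]) (auto simp: sum_AsgOn2)
qed

lemma flip_bit_values: "flip_bit 1 0 = (2 :: nat)" "flip_bit 1 1 = (3 :: nat)" "flip_bit 1 2 = (0 :: nat)"
 "flip_bit 1 3 = (1 :: nat)" "flip_bit 2 3 = (7 :: nat)" "flip_bit 2 7 = (3 :: nat)"
 by code_simp+

lemma bit_values: "\<not> bit (0 :: nat) n" "bit (1 :: nat) 0" "\<not> bit (2 :: nat) 0" "bit (3 :: nat) 0"
 "\<not> bit (4 :: nat) 0" "bit (5 :: nat) 0" "\<not> bit (6 :: nat) 0" "bit (7 :: nat) 0"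
 "\<not> bit (1 :: nat) 1" "bit (2 :: nat) 1" "bit (3 :: nat) 1"
 "\<not> bit (4 :: nat) 1" "\<not> bit (5 :: nat) 1" "bit (6 :: nat) 1" "bit (7 :: nat) 1"
 "\<not> bit (Suc (Suc 0)) 0"
 by (simp, code_simp+)

lemma CNot_entry:
 "gate_mat (CNot a b) $$ (index_of [x, y], index_of [x', y']) = of_bool (x = x' \<and> y = (y' ~= x'))"
 unfolding index_of_def
 by (cases x; cases y; cases x'; cases y') (simp_all add: flip_bit_values bit_values del: One_nat_def)

lemma Toffoli_entry:
 "gate_mat (Toffoli a b c) $$ (index_of [x, y, z], index_of [x', y', z']) =
  of_bool (x = x' \<and> y = y' \<and> z = (z' ~= (x' \<and> y')))"
 unfolding index_of_def
 by (cases x; cases y; cases z; cases x'; cases y'; cases z')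
  (simp_all add: flip_bit_values bit_values del: One_nat_def)

text \<open>The two descriptions of a gate are compared by evaluating all matrix entries, for each
  gate and each value of its wires in \<open>s\<close>.\<close>

lemma gap_sum:
 assumes "wfg g"
 shows "gap g \<phi> s = (\<Sum>t\<in>AsgOn (set_gate g).
   gate_mat g $$ (rd (gate_wires g) s, rd (gate_wires g) t) * \<phi> (join (mask (set_gate g) s) t))"
proof -
 have j1: "join (mask {a} s) (%_. False) = s(a := False)" 
  "join (mask {a} s) ((%_. False)(a := True)) = s(a := True)" for a
  by (auto simp: join_def mask_def fun_eq_iff)
 have j2: "join (mask {a, b} s) (%_. False) = s(a := False, b := False)" 
  "join (mask {a, b} s) ((%_. False)(a := True)) = s(a := True, b := False)"
  "join (mask {a, b} s) ((%_. False)(b := True)) = s(a := False, b := True)"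
  "join (mask {a, b} s) ((%_. False)(b := True, a := True)) = s(a := True, b := True)"
  if "a ~= b" for a b
  using that by (auto simp: join_def mask_def fun_eq_iff)
 have j3: "join (mask {a, b, c} s) (%_. False) = s(a := False, b := False, c := False)" 
  "join (mask {a, b, c} s) ((%_. False)(a := True)) = s(a := True, b := False, c := False)"
  "join (mask {a, b, c} s) ((%_. False)(b := True)) = s(a := False, b := True, c := False)"
  "join (mask {a, b, c} s) ((%_. False)(b := True, a := True)) = s(a := True, b := True, c := False)"
  "join (mask {a, b, c} s) ((%_. False)(c := True)) = s(a := False, b := False, c := True)"
  "join (mask {a, b, c} s) ((%_. False)(c := True, a := True)) = s(a := True, b := False, c := True)"
  "join (mask {a, b, c} s) ((%_. False)(c := True, b := True)) = s(a := False, b := True, c := True)"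
  "join (mask {a, b, c} s) ((%_. False)(c := True, b := True, a := True)) = s(a := True, b := True, c := True)"
  if "a ~= b" "a ~= c" "b ~= c" for a b c
  using that by (auto simp: join_def mask_def fun_eq_iff)
 have u: "s(a := v) = s" if "s a = v" for a v using that by (simp add: fun_upd_idem)
 show ?thesis
 proof (cases g)
  case (Had a)
  then show ?thesis
   by (cases "s a") (simp_all add: sum_AsgOn1 j1 rd_def index_of_def field_simps)
 next
  case (TPhase a)
  then show ?thesis
   by (cases "s a") (simp_all add: sum_AsgOn1 j1 rd_def index_of_def u)
 next
  case (PauliX a)
  then show ?thesis
   by (cases "s a") (simp_all add: sum_AsgOn1 j1 rd_def index_of_def)
 next
  case (CNot a b)
  then have ne: "a ~= b" using assms by (simp add: wfg_def)
  then have ne': "b ~= a" by simp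
  show ?thesis
   unfolding CNot by (cases "s a"; cases "s b") 
    (simp_all add: sum_AsgOn2[OF ne] j2[OF ne] rd_def CNot_entry u ne ne' del: gate_mat.simps)
 next
  case (Toffoli a b c)
  then have ne: "a ~= b" "a ~= c" "b ~= c" using assms by (auto simp: wfg_def)
  then have ne': "b ~= a" "c ~= a" "c ~= b" by auto
  show ?thesis
   unfolding Toffoli by (cases "s a"; cases "s b"; cases "s c") 
    (simp_all add: sum_AsgOn3[OF ne] j3[OF ne] rd_def Toffoli_entry u ne ne' del: gate_mat.simps)
 qed
qed


lemma sum_bits: "(\<Sum>u\<in>{..<2 ^ N :: nat}. f (bit u)) = (\<Sum>s\<in>AsgOn {..<N}. f s)"
proof -
 have "(\<Sum>s\<in>AsgOn (set [0..<N]). f s) = (\<Sum>u\<in>{..<2 ^ N :: nat}. f (wr [0..<N] u))"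
  by (subst sum_wr) auto
 also have "\<dots> = (\<Sum>u\<in>{..<2 ^ N :: nat}. f (bit u))"
  by (intro sum.cong refl) (auto simp: wr_upt)
 finally show ?thesis by (simp add: atLeast0LessThan)
qed

text \<open>The condition \<open>agree_off\<close> leaves a single assignment outside the wires of
  the gate, that of \<open>i\<close>. The sum over \<open>2 ^ N\<close> indices therefore collapses
  to the one in \<open>gap_sum\<close>.\<close>

lemma on_wires_gap:
 assumes g: "wfg g" "set_gate g \<subseteq> {..<N}" and i: "i < 2 ^ N"
 shows "gap g \<phi> (bit i) = (\<Sum>u<2 ^ N. on_wires N (gate_wires g) (gate_mat g) $$ (i, u) * \<phi> (bit u))"
proof -
 let ?W = "set_gate g" and ?ws = "gate_wires g"
 let ?c = "%s. if \<forall>w<N. w \<notin> ?W --> bit i w = s w then gate_mat g $$ (rd ?ws (bit i), rd ?ws s) else 0"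
 let ?s0 = "mask ?W (bit i)"
 have s0: "?s0 \<in> AsgOn ({..<N} - ?W)"
  using bit_ge_length[OF i] by (auto simp: AsgOn_def mask_def)
 have U: "{..<N} = ({..<N} - ?W) \<union> ?W" using g by auto
 have c: "?c (join s t) = (if s = ?s0 then gate_mat g $$ (rd ?ws (bit i), rd ?ws t) else 0)"
  if st: "s \<in> AsgOn ({..<N} - ?W)" "t \<in> AsgOn ?W" for s t
 proof -
  have "(\<forall>w<N. w \<notin> ?W --> bit i w = join s t w) \<longleftrightarrow> s = ?s0"
   using st bit_ge_length[OF i] by (auto simp: AsgOn_def join_def mask_def fun_eq_iff)
  moreover have "rd ?ws (join s t) = rd ?ws t"
   by (rule rd_cong) (use st in \<open>auto simp: AsgOn_def join_def set_gate_wires\<close>)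
  ultimately show ?thesis by (simp only:)
 qed
 have "(\<Sum>u<2 ^ N. on_wires N ?ws (gate_mat g) $$ (i, u) * \<phi> (bit u)) = (\<Sum>u\<in>{..<2 ^ N :: nat}. ?c (bit u) * \<phi> (bit u))"
  using i by (intro sum.cong) (auto simp: on_wires_def agree_off_def read_wires_def rd_def set_gate_wires)
 also have "\<dots> = (\<Sum>s\<in>AsgOn {..<N}. ?c s * \<phi> s)"
  by (rule sum_bits)
 also have "\<dots> = (\<Sum>s\<in>AsgOn ({..<N} - ?W). \<Sum>t\<in>AsgOn ?W. ?c (join s t) * \<phi> (join s t))"
  by (subst U, subst sum_AsgOn_join) auto
 also have "\<dots> = (\<Sum>s\<in>AsgOn ({..<N} - ?W). if s = ?s0 then
   (\<Sum>t\<in>AsgOn ?W. gate_mat g $$ (rd ?ws (bit i), rd ?ws t) * \<phi> (join s t)) else 0)"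
  by (intro sum.cong refl) (simp add: c cong: sum.cong)
 also have "\<dots> = gap g \<phi> (bit i)"
  using s0 by (simp add: sum.delta' gap_sum[OF g(1)])
 finally show ?thesis by simp
qed

text \<open>Splits a global assignment into the wires of a circuit embedded by \<open>f\<close> and
  an environment \<open>e\<close>, which will index the pure components of a mixed input.\<close>

definition pl :: "(nat => nat) => asg => asg => asg" where
 "pl f e u = (%w. if w \<in> range f then u (the_inv f w) else e w)"

lemma pl_app: "inj f ==> pl f e u (f a) = u a"
 by (simp add: pl_def the_inv_f_f)

lemma pl_upd: "inj f ==> (pl f e u)(f a := v) = pl f e (u(a := v))"
 by (auto simp: pl_def the_inv_f_f fun_eq_iff inj_eq)

lemma gap_pl: "inj f ==> gap (map_gate f g) \<psi> (pl f e u) = gap g (%u. \<psi> (pl f e u)) u"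
 by (cases g) (simp_all add: pl_app pl_upd)

lemma waves_pl: "inj f ==> waves (map (map_gate f) gs) \<psi> (pl f e u) = waves gs (%u. \<psi> (pl f e u)) u"
 by (induction gs arbitrary: \<psi>) (simp_all add: gap_pl)

lemma mat_adjoint_index:
 "i < dim_col A ==> j < dim_row A ==> mat_adjoint A $$ (i, j) = cnj (A $$ (j, i))" for A :: "complex mat"
 by (simp add: mat_adjoint_def mat_of_rows_def)

lemma mat_adjoint_dims [simp]: "dim_row (mat_adjoint A) = dim_col A" "dim_col (mat_adjoint A) = dim_row A"
 by (simp_all add: mat_adjoint_def)

text \<open>A mixed state is carried along as a sum of outer products, one for each environment.
  Conjugation with the gate matrix then acts on each vector separately.\<close>

lemma apply_gate_outer:
 assumes g: "wfg g" "set_gate g \<subseteq> {..<N}" and M: "M \<in> carrier_mat (2 ^ N) (2 ^ N)"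
  and o: "\<And>i j. i < 2 ^ N ==> j < 2 ^ N ==> M $$ (i, j) = (\<Sum>e\<in>X. \<phi> e (bit i) * cnj (\<phi> e (bit j)))"
 shows "apply_gate N M g \<in> carrier_mat (2 ^ N) (2 ^ N)"
  "i < 2 ^ N ==> j < 2 ^ N ==> apply_gate N M g $$ (i, j) = (\<Sum>e\<in>X. gap g (\<phi> e) (bit i) * cnj (gap g (\<phi> e) (bit j)))"
proof -
 let ?U = "on_wires N (gate_wires g) (gate_mat g)"
 have U: "?U \<in> carrier_mat (2 ^ N) (2 ^ N)" by (simp add: on_wires_def)
 then have A: "mat_adjoint ?U \<in> carrier_mat (2 ^ N) (2 ^ N)" by (intro carrier_matI) auto
 show "apply_gate N M g \<in> carrier_mat (2 ^ N) (2 ^ N)"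
  unfolding apply_gate_def Let_def by (rule mult_carrier_mat[OF mult_carrier_mat[OF U M] A])
 assume ij: "i < 2 ^ N" "j < 2 ^ N"
 let ?I = "{..<2 ^ N} :: nat set"
 have "apply_gate N M g $$ (i, j) = (\<Sum>v\<in>?I. (\<Sum>u\<in>?I. ?U $$ (i, u) * M $$ (u, v)) * cnj (?U $$ (j, v)))"
 proof -
  have 1: "(?U * M) $$ (i, v) = (\<Sum>u\<in>?I. ?U $$ (i, u) * M $$ (u, v))" if "v < 2 ^ N" for v
   using carrier_matD[OF U] carrier_matD[OF M] ij that by (simp add: scalar_prod_def atLeast0LessThan)
  have "apply_gate N M g $$ (i, j) = (\<Sum>v\<in>?I. (?U * M) $$ (i, v) * mat_adjoint ?U $$ (v, j))"
   using carrier_matD[OF U] carrier_matD[OF M] carrier_matD[OF A] ij unfolding apply_gate_def Let_def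
   by (subst index_mult_mat) (auto simp: scalar_prod_def atLeast0LessThan intro!: sum.cong)
  also have "\<dots> = (\<Sum>v\<in>?I. (\<Sum>u\<in>?I. ?U $$ (i, u) * M $$ (u, v)) * cnj (?U $$ (j, v)))"
   by (rule sum.cong[OF refl]) (use 1 ij carrier_matD[OF U] in \<open>simp add: mat_adjoint_index\<close>)
  finally show ?thesis .
 qed
 also have "\<dots> = (\<Sum>v\<in>?I. \<Sum>u\<in>?I. \<Sum>e\<in>X. (?U $$ (i, u) * \<phi> e (bit u)) * cnj (?U $$ (j, v) * \<phi> e (bit v)))"
  by (intro sum.cong refl) (auto simp: o sum_distrib_left sum_distrib_right mult_ac intro!: sum.cong)
 also have "\<dots> = (\<Sum>v\<in>?I. \<Sum>e\<in>X. \<Sum>u\<in>?I. (?U $$ (i, u) * \<phi> e (bit u)) * cnj (?U $$ (j, v) * \<phi> e (bit v)))"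
  by (rule sum.cong[OF refl], rule sum.swap)
 also have "\<dots> = (\<Sum>e\<in>X. \<Sum>v\<in>?I. \<Sum>u\<in>?I. (?U $$ (i, u) * \<phi> e (bit u)) * cnj (?U $$ (j, v) * \<phi> e (bit v)))"
  by (rule sum.swap)
 also have "\<dots> = (\<Sum>e\<in>X. gap g (\<phi> e) (bit i) * cnj (gap g (\<phi> e) (bit j)))"
  unfolding on_wires_gap[OF g ij(1)] on_wires_gap[OF g ij(2)] cnj_sum sum_product
  by (rule sum.cong[OF refl], rule sum.swap)
 finally show "apply_gate N M g $$ (i, j) = (\<Sum>e\<in>X. gap g (\<phi> e) (bit i) * cnj (gap g (\<phi> e) (bit j)))" .
qed

lemma foldl_apply_gate_outer:
 assumes "\<forall>g\<in>set gs. wfg g \<and> set_gate g \<subseteq> {..<N}" "M \<in> carrier_mat (2 ^ N) (2 ^ N)"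
  "\<And>i j. i < 2 ^ N ==> j < 2 ^ N ==> M $$ (i, j) = (\<Sum>e\<in>X. \<phi> e (bit i) * cnj (\<phi> e (bit j)))"
  "i < 2 ^ N" "j < 2 ^ N"
 shows "foldl (apply_gate N) M gs $$ (i, j) = (\<Sum>e\<in>X. waves gs (\<phi> e) (bit i) * cnj (waves gs (\<phi> e) (bit j)))"
 using assms
proof (induction gs arbitrary: M \<phi>)
 case (Cons g gs)
 have "wfg g" "set_gate g \<subseteq> {..<N}" using Cons.prems(1) by auto
 note a = apply_gate_outer[OF this Cons.prems(2,3)]
 have "foldl (apply_gate N) (apply_gate N M g) gs $$ (i, j) =
  (\<Sum>e\<in>X. waves gs (gap g (\<phi> e)) (bit i) * cnj (waves gs (gap g (\<phi> e)) (bit j)))"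
  by (rule Cons.IH) (use Cons.prems a in auto)
 then show ?case by simp
qed simp

lemma width_bounds:
 "k \<le> width k c" "WL (gates c) \<subseteq> {..<width k c}" "set (outs c) \<subseteq> {..<width k c}"
proof -
 let ?S = "insert k (Suc ` (set (outs c) \<union> (\<Union>g \<in> set (gates c). set (gate_wires g))))"
 have *: "x \<le> width k c" if "x \<in> ?S" for x
  unfolding width_def by (rule Max_ge) (use that in auto)
 show "k \<le> width k c" by (rule *) simp
 show "WL (gates c) \<subseteq> {..<width k c}"
  using * by (fastforce simp: WL_def set_gate_wires less_eq_Suc_le)
 show "set (outs c) \<subseteq> {..<width k c}"
  using * by (fastforce simp: less_eq_Suc_le)
qed


lemma index_of_replicate: "index_of (replicate n False) = 0"
 by (rule bit_eqI) (simp add: bit_index_of)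

lemma bit_ge: "\<not> i < 2 ^ k ==> \<exists>b\<ge>k. bit i b" for i :: nat
proof (rule ccontr)
 assume a: "\<not> i < 2 ^ k" "\<not> (\<exists>b\<ge>k. bit i b)"
 then have "take_bit k i = i" by (intro bit_eqI) (auto simp: bit_take_bit_iff not_le)
 then show False using a by (simp add: take_bit_nat_eq_self_iff)
qed

theorem red_run:
 assumes wf: "wf_circuit c" and f: "inj f" and anc: "WL gs0 \<inter> f ` {k..} = {}"
 shows "red (gs0 @ map (map_gate f) (gates c)) (map f (outs c)) = run_circuit k c (red gs0 (map f [0..<k]))"
proof (rule eq_matI)
 define N where "N = width k c"
 have kN: "k \<le> N" and WN: "WL (gates c) \<subseteq> {..<N}" and oN: "set (outs c) \<subseteq> {..<N}"
  using width_bounds[where k = k and c = c] by (auto simp: N_def)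
 define E where "E = WL gs0 - f ` {..<k}"
 define X where "X = AsgOn E"
 define \<phi> where "\<phi> e u = st gs0 (pl f e u)" for e u
 define R where "R = red gs0 (map f [0..<k])"
 define M0 where "M0 = kron (basis_state (replicate (N - k) False)) R"
 define z :: asg where "z = (%_. False)"
 have Er: "E \<inter> range f = {}"
 proof -
  have "f x \<notin> E" for x using anc by (cases "x < k") (auto simp: E_def)
  then show ?thesis by auto
 qed
 have finE: "finite E" by (simp add: E_def)
 have zX: "e (f x) = False" if "e \<in> X" for e x using that Er by (auto simp: X_def AsgOn_def)
 have kk: "2 ^ (N - k) * 2 ^ k = (2 ^ N :: nat)" using kN by (simp flip: power_add)
 have M0c: "M0 \<in> carrier_mat (2 ^ N) (2 ^ N)"
  by (intro carrier_matI) (auto simp: M0_def R_def basis_state_def kk)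
 have pl_wr: "pl f e (bit i) = join e (wr (map f [0..<k]) i)" if "e \<in> X" "i < 2 ^ k" for e i
 proof
  fix w
  show "pl f e (bit i) w = join e (wr (map f [0..<k]) i) w"
  proof (cases "w \<in> range f")
   case True
   then obtain x where x: "w = f x" by auto
   have "wr (map f [0..<k]) i (f x) = bit i x"
    using bit_ge_length[OF that(2), of x] f by (auto simp: wr_def inj_eq)
   then show ?thesis using x zX[OF that(1), of x] by (simp add: pl_app[OF f] join_def)
  next
   case False
   then show ?thesis by (auto simp: pl_def join_def wr_def)
  qed
 qed
 have base: "M0 $$ (i, j) = (\<Sum>e\<in>X. \<phi> e (bit i) * cnj (\<phi> e (bit j)))" if ij: "i < 2 ^ N" "j < 2 ^ N" for i j
 proof -
  have div: "i div 2 ^ k < 2 ^ (N - k)" "j div 2 ^ k < 2 ^ (N - k)"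
   using ij kk by (auto simp: less_mult_imp_div_less)
  have M: "M0 $$ (i, j) = of_bool (i div 2 ^ k = 0 \<and> j div 2 ^ k = 0) * R $$ (i mod 2 ^ k, j mod 2 ^ k)"
   using ij kk div by (simp add: M0_def kron_def R_def basis_state_def index_of_replicate)
  \<comment> \<open>A bit of the index at a position from \<open>k\<close> on would put an ancilla
    into state one, where the amplitude after \<open>gs0\<close> vanishes.\<close>
  have zero: "\<phi> e (bit i) = 0" if "\<not> i < 2 ^ k" for e and i :: nat
  proof (rule ccontr)
   obtain b where b: "b \<ge> k" "bit i b" using bit_ge \<open>\<not> i < 2 ^ k\<close> by blast
   assume "\<phi> e (bit i) ~= 0"
   then have "pl f e (bit i) \<in> AsgOn (WL gs0)" unfolding \<phi>_def by (rule st_support)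
   moreover have "pl f e (bit i) (f b)" using b by (simp add: pl_app[OF f])
   ultimately show False using anc b by (auto simp: AsgOn_def)
  qed
  show ?thesis
  proof (cases "i < 2 ^ k \<and> j < 2 ^ k")
   case True
   have "R $$ (i, j) = (\<Sum>e\<in>AsgOn (WL gs0 - set (map f [0..<k])).
     st gs0 (join e (wr (map f [0..<k]) i)) * cnj (st gs0 (join e (wr (map f [0..<k]) j))))"
    unfolding R_def by (rule red_eq) (use True in auto)
   also have "WL gs0 - set (map f [0..<k]) = E" by (auto simp: E_def atLeast0LessThan)
   finally show ?thesis using True pl_wr by (simp add: M \<phi>_def X_def)
  next
   case False
   then have "i div 2 ^ k ~= 0 \<or> j div 2 ^ k ~= 0" by (metis div_eq_0_iff power_not_zero zero_neq_numeral)
   then show ?thesis using False zero by (auto simp: M)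
  qed
 qed
 define M where "M = foldl (apply_gate N) M0 (gates c)"
 have Mij: "M $$ (i, j) = (\<Sum>e\<in>X. waves (gates c) (\<phi> e) (bit i) * cnj (waves (gates c) (\<phi> e) (bit j)))"
  if "i < 2 ^ N" "j < 2 ^ N" for i j
  unfolding M_def
  by (rule foldl_apply_gate_outer[OF _ M0c base]) (use that wf WN in \<open>auto simp: wf_circuit_def wfg_def WL_def\<close>)
 have run: "run_circuit k c R = reduced_state N (outs c) M"
  by (simp add: run_circuit_def Let_def N_def M_def M0_def)
 have dist: "distinct (outs c)" using wf by (simp add: wf_circuit_def)
 define gs where "gs = gs0 @ map (map_gate f) (gates c)"
 define \<Phi> where "\<Phi> e = waves (gates c) (\<phi> e)" for e
 have stpl: "st gs (pl f e u) = \<Phi> e u" for e u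
  by (simp add: gs_def st_append waves_pl[OF f] \<Phi>_def \<phi>_def[abs_def])
 let ?L = "2 ^ length (outs c) :: nat" and ?O = "set (outs c)"
 fix a b assume "a < dim_row (run_circuit k c R)" "b < dim_col (run_circuit k c R)"
 then have ab: "a < ?L" "b < ?L" by (simp_all add: run reduced_state_def)
 let ?V = "{..<N} - ?O"
 let ?n = "%s. rd [0..<N] s"
 let ?P = "{(i, j). i < 2 ^ N \<and> j < 2 ^ N \<and> agree_off N (outs c) i j \<and>
    read_wires (outs c) i = a \<and> read_wires (outs c) j = b}"
 have nlt: "?n s < 2 ^ N" for s using rd_less[of "[0..<N]" s] by simp
 have bitn: "bit (?n s) = s" if "s \<in> AsgOn {..<N}" for s
 proof -
  have "wr [0..<N] (?n s) = s" by (rule wr_rd) (use that in \<open>auto simp: AsgOn_def\<close>)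
  then show ?thesis using wr_upt[OF nlt[of s]] by simp
 qed
 have nbit: "?n (bit i) = i" if "i < 2 ^ N" for i
  using rd_wr[of "[0..<N]" i] that by (simp add: wr_upt)
 have jA: "join s (wr (outs c) x) \<in> AsgOn {..<N}" if "s \<in> AsgOn ?V" for s x
  using that wr_AsgOn[of "outs c" x] oN by (auto simp: AsgOn_def join_def)
 have rdo: "read_wires (outs c) i = rd (outs c) (bit i)" for i by (simp add: read_wires_def rd_def)
 have "reduced_state N (outs c) M $$ (a, b) = (\<Sum>p\<in>?P. M $$ p)"
  using ab by (simp add: reduced_state_def case_prod_unfold)
 \<comment> \<open>With the output values \<open>a\<close> and \<open>b\<close> fixed, an index pair
   that agrees off the outputs is determined by its common assignment to the traced-out
   wires.\<close>
 also have "\<dots> = (\<Sum>s\<in>AsgOn ?V. M $$ (?n (join s (wr (outs c) a)), ?n (join s (wr (outs c) b))))"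
 proof (rule sum.reindex_bij_witness[of _ "%s. (?n (join s (wr (outs c) a)), ?n (join s (wr (outs c) b)))" 
    "%(i, j). mask ?O (bit i)"])
  fix p assume p: "p \<in> ?P"
  obtain i j where ij: "p = (i, j)" "i < 2 ^ N" "j < 2 ^ N" "\<forall>w<N. w \<notin> ?O --> bit i w = bit j w"
   "rd (outs c) (bit i) = a" "rd (outs c) (bit j) = b"
   using p by (auto simp: agree_off_def rdo)
  have sp: "join (mask ?O s) (wr (outs c) (rd (outs c) s)) = s" for s :: asg
  proof -
   have "wr (outs c) (rd (outs c) s) = wr (outs c) (rd (outs c) (%w. w \<in> ?O \<and> s w))"
    by (rule arg_cong[of _ _ "wr (outs c)"], rule rd_cong) auto
   also have "\<dots> = (%w. w \<in> ?O \<and> s w)" by (rule wr_rd) (auto simp: AsgOn_def)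
   finally show ?thesis by (auto simp: join_def mask_def fun_eq_iff)
  qed
  have m: "mask ?O (bit i) = mask ?O (bit j)"
  proof
   fix w show "mask ?O (bit i) w = mask ?O (bit j) w"
    using ij bit_ge_length[of i N w] bit_ge_length[of j N w] by (cases "w < N") (auto simp: mask_def)
  qed
  have "join (mask ?O (bit i)) (wr (outs c) a) = bit i" "join (mask ?O (bit i)) (wr (outs c) b) = bit j"
   using sp[of "bit i"] sp[of "bit j"] ij m by simp_all
  then show eq: "(?n (join ((%(i, j). mask ?O (bit i)) p) (wr (outs c) a)), ?n (join ((%(i, j). mask ?O (bit i)) p) (wr (outs c) b))) = p"
   using ij nbit by simp
  show "(%(i, j). mask ?O (bit i)) p \<in> AsgOn ?V"
   using ij bit_ge_length[of i N] by (auto simp: AsgOn_def mask_def)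
  show "M $$ (?n (join ((%(i, j). mask ?O (bit i)) p) (wr (outs c) a)), ?n (join ((%(i, j). mask ?O (bit i)) p) (wr (outs c) b))) = M $$ p"
   using eq by simp
 next
  fix s assume s: "s \<in> AsgOn ?V"
  then have s': "s w ==> w \<notin> ?O" for w by (auto simp: AsgOn_def)
  have r: "rd (outs c) (join s (wr (outs c) x)) = x" if "x < ?L" for x
   by (rule rd_join_wr[OF dist that s])
  have "mask ?O (join s (wr (outs c) a)) = s"
   using s' wr_AsgOn[of "outs c" a] by (fastforce simp: mask_def join_def fun_eq_iff AsgOn_def)
  then show "(%(i, j). mask ?O (bit i)) (?n (join s (wr (outs c) a)), ?n (join s (wr (outs c) b))) = s"
   by (simp add: bitn[OF jA[OF s]])
  have "agree_off N (outs c) (?n (join s (wr (outs c) a))) (?n (join s (wr (outs c) b)))"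
   unfolding agree_off_def bitn[OF jA[OF s]] using wr_AsgOn[of "outs c"] by (auto simp: join_def AsgOn_def)
  then show "(?n (join s (wr (outs c) a)), ?n (join s (wr (outs c) b))) \<in> ?P"
   using nlt r ab by (simp add: rdo bitn[OF jA[OF s]])
 qed
 also have "\<dots> = (\<Sum>s\<in>AsgOn ?V. \<Sum>e\<in>X. \<Phi> e (join s (wr (outs c) a)) * cnj (\<Phi> e (join s (wr (outs c) b))))"
  by (rule sum.cong[OF refl]) (simp add: Mij nlt bitn jA \<Phi>_def)
 also have "\<dots> = (\<Sum>e\<in>X. \<Sum>s\<in>AsgOn ?V. \<Phi> e (join s (wr (outs c) a)) * cnj (\<Phi> e (join s (wr (outs c) b))))"
  by (rule sum.swap)
 also have "\<dots> = (\<Sum>e\<in>X. \<Sum>t\<in>AsgOn (f ` ?V). st gs (join (join e t) (wr (map f (outs c)) a)) *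
   cnj (st gs (join (join e t) (wr (map f (outs c)) b))))"
 proof (rule sum.cong[OF refl])
  fix e assume e: "e \<in> X"
  have pj: "join (join e (pl f z s)) (wr (map f (outs c)) x) = pl f e (join s (wr (outs c) x))" for s x
  proof
   fix w
   show "join (join e (pl f z s)) (wr (map f (outs c)) x) w = pl f e (join s (wr (outs c) x)) w"
   proof (cases "w \<in> range f")
    case True
    then obtain y where y: "w = f y" by auto
    have "wr (map f (outs c)) x (f y) = wr (outs c) x y"
     using f by (auto simp: wr_def inj_eq)
    then show ?thesis using y zX[OF e, of y] by (simp add: pl_app[OF f] join_def)
   next
    case False
    then show ?thesis by (auto simp: pl_def join_def wr_def z_def)
   qed
  qed
  have bij: "bij_betw (pl f z) (AsgOn ?V) (AsgOn (f ` ?V))"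
  proof (rule bij_betwI[where g = "%t. t \<circ> f"])
   show "pl f z \<in> AsgOn ?V \<rightarrow> AsgOn (f ` ?V)"
   proof
    fix s assume s: "s \<in> AsgOn ?V"
    have "\<not> pl f z s w" if "w \<notin> f ` ?V" for w
    proof (cases "w \<in> range f")
     case True
     then obtain y where "w = f y" by auto
     then show ?thesis using s that by (auto simp: pl_app[OF f] AsgOn_def)
    qed (auto simp: pl_def z_def)
    then show "pl f z s \<in> AsgOn (f ` ?V)" by (simp add: AsgOn_def)
   qed
   show "(%t. t \<circ> f) \<in> AsgOn (f ` ?V) \<rightarrow> AsgOn ?V"
    using f by (auto simp: AsgOn_def inj_image_mem_iff)
   show "pl f z s \<circ> f = s" for s using f by (auto simp: pl_app fun_eq_iff)
   show "pl f z (t \<circ> f) = t" if "t \<in> AsgOn (f ` ?V)" for t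
   proof
    fix w show "pl f z (t \<circ> f) w = t w"
    proof (cases "w \<in> range f")
     case True
     then obtain y where "w = f y" by auto
     then show ?thesis by (simp add: pl_app[OF f])
    next
     case False
     then have "w \<notin> f ` ?V" by auto
     then show ?thesis using that False by (simp add: pl_def z_def AsgOn_def)
    qed
   qed
  qed
  show "(\<Sum>s\<in>AsgOn ?V. \<Phi> e (join s (wr (outs c) a)) * cnj (\<Phi> e (join s (wr (outs c) b)))) =
   (\<Sum>t\<in>AsgOn (f ` ?V). st gs (join (join e t) (wr (map f (outs c)) a)) *
   cnj (st gs (join (join e t) (wr (map f (outs c)) b))))"
   using sum.reindex_bij_betw[OF bij, of "%t. st gs (join (join e t) (wr (map f (outs c)) a)) *
   cnj (st gs (join (join e t) (wr (map f (outs c)) b)))"] by (simp only: pj stpl)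
 qed
 also have "\<dots> = (\<Sum>s\<in>AsgOn (E \<union> f ` ?V). st gs (join s (wr (map f (outs c)) a)) *
   cnj (st gs (join s (wr (map f (outs c)) b))))"
  unfolding X_def using Er by (subst sum_AsgOn_join) auto
 also have "E \<union> f ` ?V = (E \<union> f ` {..<N}) - set (map f (outs c))"
  using f Er by (auto simp: inj_eq)
 also have "(\<Sum>s\<in>AsgOn \<dots>. st gs (join s (wr (map f (outs c)) a)) *
   cnj (st gs (join s (wr (map f (outs c)) b)))) = red gs (map f (outs c)) $$ (a, b)"
  by (rule red_eq[symmetric]) (use finE ab WN kN in \<open>auto simp: gs_def E_def WL_map_gate\<close>)
 finally show "red (gs0 @ map (map_gate f) (gates c)) (map f (outs c)) $$ (a, b) = run_circuit k c R $$ (a, b)"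
  by (simp add: run gs_def)
qed (simp_all add: run_circuit_def Let_def reduced_state_def)


section \<open>Lists of states, and gate lists that prepare a state\<close>

lemma kron_assoc: "kron (kron A B) C = kron A (kron B C)"
proof (rule eq_matI)
 fix i j assume ij: "i < dim_row (kron A (kron B C))" "j < dim_col (kron A (kron B C))"
 have *: "x div c div b < a" "x div c mod b < b" "x mod (b * c) div c = x div c mod b"
  "x mod (b * c) mod c = x mod c" "x div (b * c) = x div c div b" "x mod (b * c) < b * c" "x mod c < c" "x div c < a * b"
  if "x < a * (b * c)" for x a b c :: nat
 proof -
  have c: "0 < c" "0 < b" using that by (auto intro!: Nat.gr0I)
  have "x < a * b * c" using that by (simp only: mult.assoc)
  then show "x div c < a * b" by (rule less_mult_imp_div_less)
  then show "x div c div b < a" by (rule less_mult_imp_div_less)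
  show "x div c mod b < b" "x mod (b * c) < b * c" "x mod c < c" using c by auto
  show "x mod (b * c) mod c = x mod c" by (simp add: mod_mod_cancel)
  show "x div (b * c) = x div c div b" using div_mult2_eq[of x c b] by (simp only: mult.commute)
  have "x mod (b * c) = c * (x div c mod b) + x mod c" using mod_mult2_eq[of x c b] by (simp only: mult.commute)
  then show "x mod (b * c) div c = x div c mod b" using c by simp
 qed
 show "kron (kron A B) C $$ (i, j) = kron A (kron B C) $$ (i, j)"
  using ij *[of i "dim_row A" "dim_row B" "dim_row C"] *[of j "dim_col A" "dim_col B" "dim_col C"]
  by (simp add: kron_def mult.assoc)
qed auto

lemma kron_one: "kron A (1\<^sub>m 1) = A" "kron (1\<^sub>m 1) A = A"
 "kron A (1\<^sub>m (Suc 0)) = A" "kron (1\<^sub>m (Suc 0)) A = A"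
 by (rule eq_matI; simp add: kron_def)+

text \<open>The head of the list is the low-order factor, as in \<^const>\<open>read_wires\<close>.\<close>

fun klist :: "complex mat list => complex mat" where
 "klist [] = 1\<^sub>m 1"
| "klist (\<rho> # \<rho>s) = kron (klist \<rho>s) \<rho>"

lemma klist_append: "klist (xs @ ys) = kron (klist ys) (klist xs)"
 by (induction xs) (simp_all add: kron_one kron_assoc)

lemma kron_power_comm: "kron (kron_power A t) A = kron A (kron_power A t)"
 by (induction t) (simp_all add: kron_one kron_assoc)

lemma klist_power: "klist (concat (replicate t xs)) = kron_power (klist xs) t"
 by (induction t) (simp_all add: klist_append kron_power_comm)

lemma red_nil:
 assumes "\<forall>g\<in>set gs. wfg g"
 shows "red gs [] = 1\<^sub>m 1"
proof (rule eq_matI)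
 have "Re (red gs [] $$ (0, 0)) = 1"
  using ex_red[of "[]" gs "%_. 1"] ex_const[OF assms, of 1] by simp
 moreover have "Im (red gs [] $$ (0, 0)) = 0"
  by (simp add: red_def Im_sum)
 ultimately show "red gs [] $$ (i, j) = 1\<^sub>m 1 $$ (i, j)" if "i < dim_row (1\<^sub>m 1 :: complex mat)" "j < dim_col (1\<^sub>m 1 :: complex mat)" for i j
  using that by (simp add: complex_eq_iff)
qed auto

text \<open>A gate list on foreign wires contributes only its trace,
  \<open>red hs [] = 1\<^sub>m 1\<close>.\<close>

lemma red_extra:
 assumes "\<forall>g\<in>set hs. wfg g" "WL hs \<inter> (WL gs \<union> set ws) = {}"
 shows "red (hs @ gs) ws = red gs ws"
 using red_par[of hs "[]" gs ws] assms by (simp add: red_nil kron_one)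

definition xp :: "bool => nat => nat gate list" where "xp b w = (if b then [PauliX w] else [])"

lemma xp_simps [simp]: "WL (xp b w) = (if b then {w} else {})" "g \<in> set (xp b w) ==> wfg g"
 by (auto simp: xp_def wfg_def split: if_splits)

lemma red_xp: "red (xp b w) [w] = basis_state [b]"
proof (rule eq_matI)
 fix i j assume "i < dim_row (basis_state [b])" "j < dim_col (basis_state [b])"
 then have ij: "i < 2" "j < 2" by (auto simp: basis_state_def)
 have W: "AsgOn (WL (xp b w) - {w}) = {%_. False}" by auto
 have s: "st (xp b w) (join (%_. False) (wr [w] a)) = of_bool (a = index_of [b])" if "a < 2" for a
 proof -
  have a: "a = 0 \<or> a = 1" using that by auto
  then have "bit a 0 = (a = 1)" by (auto simp: bit_0)
  then have b: "wr [w] a = (%x. x = w \<and> a = 1)" by (intro ext) (auto simp: wr_def)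
  have "join (%_. False) (wr [w] a) = (%x. x = w \<and> a = 1)" unfolding b by (auto simp: join_def)
  moreover have "st (xp b w) (%x. x = w \<and> a = 1) = of_bool (b = (a = 1))"
  proof -
   have "(%x. x = w) ~= (%_. False)" by (metis (mono_tags))
   moreover have "(%x. x = w)(w := False) = (%_. False)" by (rule ext) simp
   moreover have "(%_. False)(w := True) ~= (%_. False)" by (metis fun_upd_same)
   ultimately show ?thesis by (cases b; cases "a = 1") (simp_all add: st_def xp_def ground_def del: fun_upd_apply)
  qed
  moreover have "(b = (a = 1)) = (a = index_of [b])" using a by (cases b) (auto simp: index_of_def)
  ultimately show ?thesis by (simp only:)
 qed
 show "red (xp b w) [w] $$ (i, j) = basis_state [b] $$ (i, j)"
 proof -
  have "red (xp b w) [w] $$ (i, j) = st (xp b w) (join (%_. False) (wr [w] i)) * cnj (st (xp b w) (join (%_. False) (wr [w] j)))"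
   using ij unfolding red_def W by simp
  also have "\<dots> = of_bool (i = index_of [b]) * cnj (of_bool (j = index_of [b]))"
   unfolding s[OF ij(1)] s[OF ij(2)] ..
  also have "\<dots> = basis_state [b] $$ (i, j)" using ij by (auto simp: basis_state_def)
  finally show ?thesis .
 qed
qed (auto simp: basis_state_def)

text \<open>The inclusion \<open>set ws \<subseteq> WL gs\<close> makes the registers of two sources
  disjoint as soon as their gate lists are.\<close>

definition source :: "nat gate list => nat list => complex mat => bool" where
 "source gs ws \<rho> \<longleftrightarrow> (\<forall>g\<in>set gs. wfg g) \<and> distinct ws \<and> set ws \<subseteq> WL gs \<and> red gs ws = \<rho>"

text \<open>The outputs of \<open>g\<close> sit at arbitrary wires. The swaps carry them to the
  register \<open>ds\<close>, where the next circuit expects its input.\<close>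

definition copyg :: "circuit => nat gate list => (nat => nat) => nat list => nat gate list" where
 "copyg g prep f ds = prep @ map (map_gate f) (gates g) @ swaps (zip (map f (outs g)) ds)"

lemma wfg_map: "inj f ==> wfg g ==> wfg (map_gate f g)"
 by (cases g) (auto simp: wfg_def inj_eq)

lemma wfg_gates: "wf_circuit c ==> g \<in> set (gates c) ==> wfg g"
 by (auto simp: wf_circuit_def wfg_def)

lemma wfg_swaps: "\<forall>(a, b)\<in>set ps. a ~= b ==> g \<in> set (swaps ps) ==> wfg g"
 by (auto simp: swaps_def swapg_def wfg_def)

lemma WL_copyg:
 "WL (copyg g prep f ds) \<subseteq> WL prep \<union> f ` (WL (gates g) \<union> set (outs g)) \<union> set ds"
proof -
 have "WL (swaps (zip (map f (outs g)) ds)) \<subseteq> set (map f (outs g)) \<union> set ds"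
  unfolding WL_swaps by (auto elim!: in_set_zipE)
 then show ?thesis by (auto simp: copyg_def WL_map_gate)
qed

lemma zip_ne: "set ds \<inter> range f = {} ==> \<forall>(a, b)\<in>set (zip (map f xs) ds). a ~= b"
proof clarify
 fix b assume "set ds \<inter> range f = {}" and b: "(b, b) \<in> set (zip (map f xs) ds)"
 moreover have "b \<in> set (map f xs)" "b \<in> set ds" using b by (auto elim: in_set_zipE)
 ultimately show False by auto
qed

lemma wfg_copyg:
 assumes "wf_circuit g" "inj f" "\<forall>h\<in>set prep. wfg h" "set ds \<inter> range f = {}"
 shows "h \<in> set (copyg g prep f ds) ==> wfg h"
proof -
 assume "h \<in> set (copyg g prep f ds)"
 moreover note zip_ne[OF assms(4), of "outs g"]
 ultimately show ?thesis using assms wfg_swaps wfg_map wfg_gates unfolding copyg_def by fastforce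
qed

text \<open>By \<open>st_swaps\<close> the swaps rename the output wires to \<open>ds\<close>, so
  the register has the state that \<open>red_run\<close> yields at the outputs.\<close>

lemma source_copyg:
 assumes g: "wf_circuit g" and f: "inj f" and ds: "distinct ds" "length ds = length (outs g)" "set ds \<inter> range f = {}"
 shows "source (copyg g (xp b (f 0)) f ds) ds (run_circuit 1 g (basis_state [b]))"
proof -
 let ?gs = "xp b (f 0) @ map (map_gate f) (gates g)" and ?ps = "zip (map f (outs g)) ds"
 have d: "distinct (map f (outs g) @ ds)"
  using g ds inj_on_subset[OF f subset_UNIV] by (auto simp: wf_circuit_def distinct_map)
 note ne = zip_ne[OF ds(3), of "outs g"]
 have e: "map (swt ?ps) (map f (outs g)) = ds" by (rule swt_map) (use d ds(2) in auto)
 have "red ?gs (map f (outs g)) = run_circuit 1 g (red (xp b (f 0)) (map f [0..<1]))"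
  by (rule red_run[OF g f]) (use f in \<open>auto simp: inj_eq\<close>)
 then have r: "red ?gs (map f (outs g)) = run_circuit 1 g (basis_state [b])"
  by (simp add: red_xp)
 have "red (?gs @ swaps ?ps) ds = red (map (map_gate (swt ?ps)) ?gs) ds"
  by (rule red_cong[OF st_swaps[OF ne]])
 also have "red (map (map_gate (swt ?ps)) ?gs) ds = red ?gs (map f (outs g))"
  using red_perm[OF bij_swt, of "map f (outs g)" ?ps ?gs] d unfolding e by simp
 finally have "red (copyg g (xp b (f 0)) f ds) ds = run_circuit 1 g (basis_state [b])"
  using r by (simp add: copyg_def)
 moreover have "set ds \<subseteq> WL (swaps ?ps)"
  using ds(2) by (auto simp: WL_swaps set_zip in_set_conv_nth image_iff)
 ultimately show ?thesis
  using wfg_copyg[OF g f _ ds(3), of "xp b (f 0)"] ds(1) by (auto simp: source_def copyg_def)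
qed

lemma source_perm:
 assumes "source gs ws \<rho>" "bij f"
 shows "source (map (map_gate f) gs) (map f ws) \<rho>"
proof -
 have i: "inj f" using assms(2) by (rule bij_is_inj)
 have s: "\<forall>g\<in>set gs. wfg g" "distinct ws" "set ws \<subseteq> WL gs" "red gs ws = \<rho>"
  using assms(1) unfolding source_def by blast+
 have "\<forall>g\<in>set (map (map_gate f) gs). wfg g" using s(1) wfg_map[OF i] by auto
 moreover have "distinct (map f ws)" using s(2) inj_on_subset[OF i subset_UNIV] by (simp add: distinct_map)
 moreover have "set (map f ws) \<subseteq> WL (map (map_gate f) gs)" using s(3) by (auto simp: WL_map_gate)
 moreover have "red (map (map_gate f) gs) (map f ws) = \<rho>" using red_perm[OF assms(2) s(2)] s(4) by simp
 ultimately show ?thesis unfolding source_def by blast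
qed

section \<open>Parities of output bits and sign observables\<close>

definition sg :: "bool => real" where "sg b = (if b then -1 else 1)"

text \<open>The Fourier character with mask \<open>S\<close>, that is, the sign of the parity of the
  selected bits.\<close>

definition chi :: "bool list => bool list => real" where
 "chi S xs = (\<Prod>(q, x)\<leftarrow>zip S xs. if q then sg x else 1)"

text \<open>The Fourier coefficient at \<open>S\<close> of the output distribution of the
  circuit.\<close>

definition uval :: "circuit => nat => bool list => complex mat => real" where
 "uval c k S \<rho> = (\<Sum>a<2 ^ length (outs c). chi S (map (bit a) [0..<length (outs c)]) * Re (run_circuit k c \<rho> $$ (a, a)))"

lemma map_bit_rd: "map (bit (rd ws s)) [0..<length ws] = map s ws"
 by (rule nth_equalityI) (auto simp: rd_def bit_index_of)

lemma ex_trial: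
 assumes src: "source gs (map f [0..<k]) \<rho>" and c: "wf_circuit c" and f: "inj f" and anc: "WL gs \<inter> f ` {k..} = {}"
 shows "ex (gs @ map (map_gate f) (gates c)) (%s. chi S (map s (map f (outs c)))) = uval c k S \<rho>"
proof -
 let ?ws = "map f (outs c)"
 have d: "distinct ?ws" using c inj_on_subset[OF f subset_UNIV] by (simp add: wf_circuit_def distinct_map)
 have "ex (gs @ map (map_gate f) (gates c)) (%s. chi S (map s ?ws)) =
  ex (gs @ map (map_gate f) (gates c)) (%s. chi S (map (bit (rd ?ws s)) [0..<length ?ws]))"
  by (simp only: map_bit_rd)
 also have "\<dots> = (\<Sum>a<2 ^ length ?ws. chi S (map (bit a) [0..<length ?ws]) * Re (red (gs @ map (map_gate f) (gates c)) ?ws $$ (a, a)))"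
  by (rule ex_red[OF d])
 also have "\<dots> = uval c k S \<rho>"
  using red_run[OF c f anc] src by (simp add: uval_def source_def)
 finally show ?thesis .
qed

lemma sg_simps [simp]: "sg True = -1" "sg False = 1" "sg (x ~= y) = sg x * sg y"
 by (auto simp: sg_def)

lemma sg_neq: "sg (x = (\<not> y)) = sg x * sg y"
 by (auto simp: sg_def)

text \<open>Sufficient for commuting with \<open>CNot w t\<close>: the gate avoids both wires, or it
  adds to \<open>t\<close> a value that does not depend on \<open>t\<close>.\<close>

definition targets :: "nat => nat => nat gate => bool" where
 "targets w t g \<longleftrightarrow> set_gate g \<inter> {w, t} = {} \<or> (\<exists>a. g = CNot a t \<and> a ~= t) \<or> (\<exists>a b. g = Toffoli a b t \<and> a ~= t \<and> b ~= t)"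

lemma ex_cnot_end:
 assumes "w ~= t"
 shows "ex (gs @ [CNot w t]) E = ex gs (%s. E (s(t := (s t ~= s w))))"
proof -
 let ?U = "WL gs \<union> {w, t}"
 define h :: "asg => asg" where "h s = s(t := (s t ~= s w))" for s
 have hh: "h (h s) = s" for s using assms by (auto simp: h_def fun_eq_iff)
 have hA: "h s \<in> AsgOn ?U" if "s \<in> AsgOn ?U" for s using that by (auto simp: h_def AsgOn_def)
 have g: "gap (CNot w t) (st gs) = (%s. st gs (h s))" by (simp add: h_def)
 have "ex (gs @ [CNot w t]) E = (\<Sum>s\<in>AsgOn ?U. E s * (cmod (st gs (h s)))\<^sup>2)"
  by (subst ex_eq[of ?U]) (auto simp: st_append g simp del: gap.simps)
 also have "\<dots> = (\<Sum>s\<in>AsgOn ?U. E (h s) * (cmod (st gs s))\<^sup>2)"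
  by (rule sum.reindex_bij_witness[of _ h h]) (simp_all only: hh hA)
 also have "\<dots> = ex gs (%s. E (h s))"
  by (subst ex_eq[of ?U]) auto
 finally show ?thesis by (simp add: h_def)
qed

lemma gap_cnot_targets:
 assumes "targets w t g" "w ~= t"
 shows "gap g (gap (CNot w t) \<psi>) = gap (CNot w t) (gap g \<psi>)"
 using assms(1) unfolding targets_def
proof (elim disjE exE conjE)
 assume "set_gate g \<inter> {w, t} = {}"
 then show ?thesis by (intro gap_commute) auto
qed (use assms(2) in \<open>auto intro!: arg_cong[of _ _ \<psi>] simp: fun_eq_iff\<close>)

lemma waves_cnot_targets:
 "\<forall>g\<in>set gs. targets w t g ==> w ~= t ==> waves gs (gap (CNot w t) \<psi>) = gap (CNot w t) (waves gs \<psi>)"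
 by (induction gs arbitrary: \<psi>) (simp_all add: gap_cnot_targets del: gap.simps)

text \<open>Every \<open>CNot w t\<close> commutes with all later gates and moves to the end. There,
  adding \<open>w\<close> to \<open>t\<close> multiplies the sign of \<open>t\<close> by the sign of
  \<open>w\<close>. Parity gates thus become factors of the observable.\<close>

lemma ex_cnots:
 assumes "t \<notin> set ws" "\<forall>w\<in>set ws. \<forall>g\<in>set gs2. targets w t g" "indep {t} E"
 shows "ex (gs1 @ map (%w. CNot w t) ws @ gs2) (%s. sg (s t) * E s) =
  ex (gs1 @ gs2) (%s. sg (s t) * ((\<Prod>w\<leftarrow>ws. sg (s w)) * E s))"
 using assms
proof (induction ws arbitrary: E)
 case (Cons w ws)
 let ?hs = "map (%w. CNot w t) ws @ gs2"
 have w: "w ~= t" using Cons.prems by auto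
 have "st (gs1 @ CNot w t # ?hs) = st ((gs1 @ ?hs) @ [CNot w t])"
  using waves_cnot_targets[of ?hs w t "st gs1"] Cons.prems
  by (auto simp: st_def targets_def)
 then have "ex (gs1 @ CNot w t # ?hs) (%s. sg (s t) * E s) = ex ((gs1 @ ?hs) @ [CNot w t]) (%s. sg (s t) * E s)"
  by (rule ex_cong)
 also have "\<dots> = ex (gs1 @ ?hs) (%s. sg (s t) * (sg (s w) * E s))"
  unfolding ex_cnot_end[OF w]
 proof (rule arg_cong[of _ _ "ex _"], rule ext)
  fix s
  have "E (s(t := v)) = E s" for v by (rule indep_upd[OF Cons.prems(3)]) simp
  then show "sg ((s(t := (s t ~= s w))) t) * E (s(t := (s t ~= s w))) = sg (s t) * (sg (s w) * E s)"
   by (simp add: sg_neq)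
 qed
 also have "\<dots> = ex (gs1 @ gs2) (%s. sg (s t) * ((\<Prod>w\<leftarrow>ws. sg (s w)) * (sg (s w) * E s)))"
 proof (rule Cons.IH)
  show "indep {t} (%s. sg (s w) * E s)"
   using Cons.prems(3) w unfolding indep_def by auto
 qed (use Cons.prems in auto)
 finally show ?case by (simp add: mult_ac)
qed simp

lemma indep_empty: "indep {} F"
 unfolding indep_def by (intro allI impI arg_cong[of _ _ F] ext) auto

text \<open>Each branch of the coin contributes with its own sign, so the result is half the
  difference of the two branches where \<open>ex_coin\<close> gives their average. A sign observable
  can thereby estimate a difference of two values.\<close>

lemma ex_coin_sign:
 assumes "\<forall>g\<in>set gs. nontarget a g" "\<And>v. a \<notin> WL (ctls a v gs)" "indep {a} E"
 shows "ex (Had a # gs) (%s. sg (s a) * E s) = (ex (ctls a False gs) E - ex (ctls a True gs) E) / 2"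
proof -
 have i: "indep (WL (ctls a v gs)) (%s. sg (s a))" for v
  using assms(2) by (auto simp: indep_def)
 have F: "ex gs (%s. sg (s a) * E s) = ex (ctls a False gs) E"
 proof -
  have "ex gs (%s. sg (s a) * E s) = ex (ctls a False gs @ []) (%s. E s * sg (s a))"
   using ex_ctl_False[OF assms(1)] by (simp add: mult.commute)
  also have "\<dots> = ex (ctls a False gs) E * ex [] (%s. sg (s a))"
   by (rule ex_prod) (use i indep_empty in auto)
  also have "ex [] (%s. sg (s a)) = 1" by (simp add: ex_def st_def ground_def)
  finally show ?thesis by simp
 qed
 have T: "ex (PauliX a # gs) (%s. sg (s a) * E s) = - ex (ctls a True gs) E"
 proof -
  have "st (PauliX a # gs) = waves (ctls a True gs) (gap (PauliX a) ground)"
   using waves_ctls[OF assms(1), of True "gap (PauliX a) ground"] ground_zero[of _ a] by (auto simp: st_def)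
  also have "\<dots> = st (ctls a True gs @ [PauliX a])"
   using gap_waves_commute[of "PauliX a" "ctls a True gs" ground] assms(2) by (simp add: st_def)
  finally have "ex (PauliX a # gs) (%s. sg (s a) * E s) = ex (ctls a True gs @ [PauliX a]) (%s. E s * sg (s a))"
   by (subst ex_cong[of "PauliX a # gs"]) (auto simp: mult.commute)
  also have "\<dots> = ex (ctls a True gs) E * ex [PauliX a] (%s. sg (s a))"
   by (rule ex_prod) (use i assms in auto)
  also have "ex [PauliX a] (%s. sg (s a)) = -1"
  proof -
   have "(%_. False)(a := True) ~= (%_. False)" "(%_. False)(a := False) = (%_. False)"
    by (auto simp: fun_eq_iff)
   then show ?thesis by (simp add: ex_def sum_AsgOn1 st_def ground_def)
  qed
  finally show ?thesis by simp
 qed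
 show ?thesis using ex_coin[OF assms(1)] F T by simp
qed


section \<open>Layout of the wires and independent copies of a state\<close>

definition pf :: "nat => nat => nat" where "pf B w = B + 2 * w"

definition dsts :: "nat => nat => nat list" where "dsts d m = map (%j. d + 2 * j) [0..<m]"

text \<open>The even interval holds the workspaces of the copies, the activation bits and the coins.
  The odd interval holds the input registers and workspaces of the learner. The two intervals grow
  independently.\<close>

definition zone :: "nat => nat => nat => nat => nat set" where
 "zone a b c d = {w. even w \<and> a \<le> w \<and> w < b} \<union> {w. odd w \<and> c \<le> w \<and> w < d}"

text \<open>The end \<open>e'\<close> is any wire of the parity of \<open>e\<close> beyond the
  displaced circuit, since a generating program knows no exact width. The condition
  \<open>e < e'\<close> reserves wire \<open>e\<close> for the input bit.\<close>

definition fits :: "circuit => nat => nat => bool" where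
 "fits c e e' \<longleftrightarrow> even (e + e') \<and> e < e' \<and> (\<forall>w\<in>WL (gates c) \<union> set (outs c). e + 2 * w < e')"

definition qstate :: "circuit => bool => complex mat" where
 "qstate g b = run_circuit 1 g (basis_state [b])"

fun copies :: "circuit => bool list => nat => nat => nat gate list => nat => bool" where
 "copies g [] e d gs e' \<longleftrightarrow> gs = [] \<and> e' = e"
| "copies g (b # bs) e d gs e' \<longleftrightarrow> (\<exists>e1 hs. fits g e e1 \<and> copies g bs e1 (d + 2 * length (outs g)) hs e' \<and>
   gs = copyg g (xp b e) (pf e) (dsts d (length (outs g))) @ hs)"

lemma inj_pf: "inj (pf B)"
 by (rule injI) (simp add: pf_def)

lemma pf_zero: "pf B 0 = B" by (simp add: pf_def)

lemma dsts_add: "dsts d (a + b) = dsts d a @ dsts (d + 2 * a) b"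
proof -
 have "[a..<a + b] = map (%j. a + j) [0..<b]" by (simp add: map_add_upt add.commute)
 then have "map (%j. d + 2 * j) [a..<a + b] = dsts (d + 2 * a) b" by (simp add: dsts_def algebra_simps)
 then show ?thesis by (simp add: dsts_def upt_add_eq_append[of 0 a b, simplified])
qed

lemma dsts_pf: "dsts o' n = map (pf o') [0..<n]"
 by (simp add: dsts_def pf_def)

lemma length_dsts [simp]: "length (dsts d m) = m"
 by (simp add: dsts_def)

lemma distinct_dsts [simp]: "distinct (dsts d m)"
 by (simp add: dsts_def distinct_map inj_on_def)

lemma set_dsts: "w \<in> set (dsts d m) \<longleftrightarrow> (\<exists>j<m. w = d + 2 * j)"
 by (auto simp: dsts_def)

lemma set_dsts_zone: "odd d ==> set (dsts d m) \<subseteq> zone 0 0 d (d + 2 * m)"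
 by (auto simp: set_dsts zone_def)

lemma dsts_range: "odd d ==> even e ==> set (dsts d m) \<inter> range (pf e) = {}"
proof (intro equals0I)
 fix x assume a: "odd d" "even e" "x \<in> set (dsts d m) \<inter> range (pf e)"
 from a(1,3) have "odd x" by (auto simp: set_dsts)
 moreover from a(2,3) have "even x" unfolding pf_def by auto
 ultimately show False by simp
qed

lemma zone_disj: "b \<le> a' \<or> b' \<le> a ==> d \<le> c' \<or> d' \<le> c ==> zone a b c d \<inter> zone a' b' c' d' = {}"
 by (auto simp: zone_def)

lemma zone_mono: "a' \<le> a ==> b \<le> b' ==> c' \<le> c ==> d \<le> d' ==> zone a b c d \<subseteq> zone a' b' c' d'"
 by (auto simp: zone_def)

lemma fits_WL: "fits c e e' ==> even e ==> pf e ` (WL (gates c) \<union> set (outs c)) \<subseteq> zone e e' 0 0"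
 by (auto simp: fits_def zone_def pf_def)

lemma fits_WL_odd: "fits c e e' ==> odd e ==> pf e ` (WL (gates c) \<union> set (outs c)) \<subseteq> zone 0 0 e e'"
 by (auto simp: fits_def zone_def pf_def)

lemma source_append:
 assumes "source gs ws \<rho>" "source hs vs \<sigma>" "WL gs \<inter> WL hs = {}"
 shows "source (gs @ hs) (ws @ vs) (kron \<sigma> \<rho>)"
proof -
 have s: "\<forall>g\<in>set gs. wfg g" "distinct ws" "set ws \<subseteq> WL gs" "red gs ws = \<rho>"
  "\<forall>g\<in>set hs. wfg g" "distinct vs" "set vs \<subseteq> WL hs" "red hs vs = \<sigma>"
  using assms unfolding source_def by blast+
 have "red (gs @ hs) (ws @ vs) = kron \<sigma> \<rho>"
  using red_par[of gs ws hs vs] s assms(3) by (simp add: Un_absorb2)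
 moreover have "set ws \<inter> set vs = {}" using s assms(3) by blast
 ultimately show ?thesis using s unfolding source_def by auto
qed

lemma source_nil: "source [] [] (1\<^sub>m 1)"
 by (simp add: source_def red_nil[of "[]", simplified])

lemma source_copyg':
 assumes "wf_circuit g" "even e" "odd d"
 shows "source (copyg g (xp b e) (pf e) (dsts d (length (outs g)))) (dsts d (length (outs g))) (qstate g b)"
 using source_copyg[OF assms(1) inj_pf[of e] distinct_dsts length_dsts dsts_range[OF assms(3,2)], of b]
 by (simp add: qstate_def pf_zero)

lemma WL_copyg':
 assumes "fits g e e'" "even e" "odd d" "WL prep \<subseteq> zone e0 e' 0 0" "e0 \<le> e"
 shows "WL (copyg g prep (pf e) (dsts d m)) \<subseteq> zone e0 e' d (d + 2 * m)"
proof -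
 have "pf e ` (WL (gates g) \<union> set (outs g)) \<subseteq> zone e0 e' d (d + 2 * m)"
  using fits_WL[OF assms(1,2)] zone_mono[of e0 e e' e' d 0 0 "d + 2 * m"] assms(5) 
  by (auto simp: zone_def)
 moreover have "set (dsts d m) \<subseteq> zone e0 e' d (d + 2 * m)"
  using set_dsts_zone[OF assms(3), of m] by (auto simp: zone_def)
 moreover have "WL prep \<subseteq> zone e0 e' d (d + 2 * m)" using assms(4) by (auto simp: zone_def)
 ultimately show ?thesis using WL_copyg[of g prep "pf e" "dsts d m"] by blast
qed

lemma WL_xp_zone: "fits g e e' ==> even e ==> WL (xp b e) \<subseteq> zone e e' 0 0"
 by (auto simp: fits_def zone_def)

lemma copies_source:
 assumes "wf_circuit g" "even e" "odd d" "copies g bs e d gs e'"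
 shows "even e' \<and> e \<le> e' \<and> WL gs \<subseteq> zone e e' d (d + 2 * (length (outs g) * length bs)) \<and>
  source gs (dsts d (length (outs g) * length bs)) (klist (map (qstate g) bs))"
 using assms(2-)
proof (induction bs arbitrary: e d gs)
 case Nil
 then show ?case using source_nil by (simp add: dsts_def)
next
 case (Cons b bs)
 let ?m = "length (outs g)"
 obtain e1 hs where 1: "fits g e e1" "copies g bs e1 (d + 2 * ?m) hs e'"
  "gs = copyg g (xp b e) (pf e) (dsts d ?m) @ hs" using Cons.prems by auto
 have e1: "even e1" "e < e1" using 1(1) Cons.prems(1) by (auto simp: fits_def)
 have IH: "even e'" "e1 \<le> e'" "WL hs \<subseteq> zone e1 e' (d + 2 * ?m) (d + 2 * ?m + 2 * (?m * length bs))"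
  "source hs (dsts (d + 2 * ?m) (?m * length bs)) (klist (map (qstate g) bs))"
  using Cons.IH[OF e1(1) _ 1(2)] Cons.prems(2) by auto
 let ?h = "copyg g (xp b e) (pf e) (dsts d ?m)"
 have W: "WL ?h \<subseteq> zone e e1 d (d + 2 * ?m)"
  by (rule WL_copyg'[OF 1(1) Cons.prems(1,2) WL_xp_zone[OF 1(1) Cons.prems(1)]]) simp
 have "WL ?h \<inter> WL hs = {}"
  using W IH(3) zone_disj[of e1 e1 e' e "d + 2 * ?m" "d + 2 * ?m" _ d] by blast
 then have "source gs (dsts d ?m @ dsts (d + 2 * ?m) (?m * length bs)) (kron (klist (map (qstate g) bs)) (qstate g b))"
  unfolding 1(3) by (intro source_append source_copyg' IH(4) assms(1) Cons.prems(1,2))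
 moreover have "WL gs \<subseteq> zone e e' d (d + 2 * (?m * length (b # bs)))"
 proof -
  have "zone e e1 d (d + 2 * ?m) \<subseteq> zone e e' d (d + 2 * (?m * length (b # bs)))"
   "zone e1 e' (d + 2 * ?m) (d + 2 * ?m + 2 * (?m * length bs)) \<subseteq> zone e e' d (d + 2 * (?m * length (b # bs)))"
   using e1(2) IH(2) by (rule_tac zone_mono; simp)+
  then show ?thesis using W IH(3) unfolding 1(3) WL_simps by blast
 qed
 ultimately show ?case using IH e1 by (simp add: dsts_add[of d ?m, symmetric])
qed

subsection \<open>A single trial\<close>

lemma trial_value:
 assumes c: "wf_circuit c" and anc: "(WL P \<union> WL H \<union> WL Q) \<inter> pf o' ` {p + m + q..} = {}"
  and s: "source P (dsts o' p) Rp" "source H (dsts (o' + 2 * p) m) R" "source Q (dsts (o' + 2 * (p + m)) q) Rq"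
  and d: "WL P \<inter> WL H = {}" "WL P \<inter> WL Q = {}" "WL H \<inter> WL Q = {}"
 shows "ex (P @ H @ Q @ map (map_gate (pf o')) (gates c)) (%s. chi S (map s (map (pf o') (outs c)))) =
  uval c (p + m + q) S (kron (kron Rq R) Rp)"
proof -
 have "source (P @ (H @ Q)) (dsts o' p @ (dsts (o' + 2 * p) m @ dsts (o' + 2 * (p + m)) q)) (kron (kron Rq R) Rp)"
  by (intro source_append s d) (use d in auto)
 also have "dsts o' p @ (dsts (o' + 2 * p) m @ dsts (o' + 2 * (p + m)) q) = map (pf o') [0..<p + m + q]"
  by (simp add: dsts_add flip: dsts_pf)
 finally show ?thesis
  using ex_trial[OF _ c inj_pf, of "P @ H @ Q" o' "p + m + q"] anc by (simp add: Un_assoc)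
qed

lemma chi_indep: "indep V (%s. chi S (map s ws))" if "V \<inter> set ws = {}"
proof -
 have "chi S (map s ws) = chi S (map s' ws)" if "\<forall>w. w \<notin> V --> s w = s' w" for s s' :: asg
 proof -
  have "map s ws = map s' ws" using that \<open>V \<inter> set ws = {}\<close> by auto
  then show ?thesis by (rule arg_cong)
 qed
 then show ?thesis by (simp add: indep_def)
qed

text \<open>The input bit of the tested copy is the coin \<open>h\<close>, and the observable
  includes the sign of \<open>h\<close>. By \<open>ex_coin_sign\<close> the value is half the
  difference between the two bits.\<close>

lemma trial_had:
 assumes c: "wf_circuit c" and g: "wf_circuit g" and m: "m = length (outs g)"
  and anc: "(WL P \<union> WL Q) \<inter> pf o' ` {p + m + q..} = {}"
  and s: "source P (dsts o' p) Rp" "source Q (dsts (o' + 2 * (p + m)) q) Rq"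
  and W: "WL P \<subseteq> zone e3 h o' (o' + 2 * p)" "WL Q \<subseteq> zone e5 e6 (o' + 2 * (p + m)) (o' + 2 * (p + m + q))"
  and f: "fits g (h + 2) e5" and par: "even h" "odd o'" 
 shows "ex (P @ (Had h # copyg g [CNot h (h + 2)] (pf (h + 2)) (dsts (o' + 2 * p) m)) @ Q @ map (map_gate (pf o')) (gates c))
   (%s. sg (s h) * chi S (map s (map (pf o') (outs c)))) =
  (uval c (p + m + q) S (kron (kron Rq (qstate g False)) Rp) - uval c (p + m + q) S (kron (kron Rq (qstate g True)) Rp)) / 2"
proof -
 let ?d = "o' + 2 * p" and ?B = "h + 2" and ?A = "map (map_gate (pf o')) (gates c)"
 let ?H = "%b. copyg g (xp b ?B) (pf ?B) (dsts ?d m)"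
 let ?C = "copyg g [CNot h ?B] (pf ?B) (dsts ?d m)"
 let ?E = "%s. chi S (map s (map (pf o') (outs c)))"
 have e5: "h + 2 < e5" using f by (simp add: fits_def)
 have odd: "odd ?d" "even ?B" using par by auto
 have pfo: "pf o' x ~= h" for x using par by (auto simp: pf_def)
 have hP: "h \<notin> WL P" using W(1) par by (auto simp: zone_def)
 have hQ: "h \<notin> WL Q" using W(2) e5 par(1) by (auto simp: zone_def)
 have hA: "h \<notin> WL ?A" using pfo by (auto simp: WL_map_gate)
 have WH: "WL (?H b) \<subseteq> zone ?B e5 ?d (?d + 2 * m)" for b
  by (rule WL_copyg'[OF f odd(2,1) WL_xp_zone[OF f odd(2)]]) simp
 then have hH: "h \<notin> WL (?H b)" for b using par by (fastforce simp: zone_def)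
 have Hx: "?H b = xp b ?B @ ?H False" for b by (simp add: copyg_def xp_def)
 have Cx: "?C = CNot h ?B # ?H False" by (simp add: copyg_def xp_def)
 let ?R = "P @ ?C @ Q @ ?A"
 \<comment> \<open>At the value \<open>b\<close> of the coin, the \<open>CNot\<close> from
   \<open>h\<close> becomes the preparation of the input bit \<open>b\<close>.\<close>
 have ctl: "ctls h b ?R = P @ ?H b @ Q @ ?A" for b
 proof -
  have "ctls h b ?C = ctl h b (CNot h ?B) @ ?H False"
   unfolding Cx ctls_simps ctls_id[OF hH[of False]] ..
  also have "ctl h b (CNot h ?B) = xp b ?B" by (simp add: xp_def)
  finally have "ctls h b ?C = ?H b" unfolding Hx[symmetric] .
  then show ?thesis unfolding ctls_simps ctls_id[OF hP] ctls_id[OF hQ] ctls_id[OF hA] by (rule arg_cong)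
 qed
 have nt: "\<forall>x\<in>set ?R. nontarget h x"
  using nontarget_WL[OF hP] nontarget_WL[OF hQ] nontarget_WL[OF hA] nontarget_WL[OF hH[of False]] unfolding Cx by auto
 have val: "ex (P @ ?H b @ Q @ ?A) ?E = uval c (p + m + q) S (kron (kron Rq (qstate g b)) Rp)" for b
 proof (rule trial_value[OF c _ s(1) _ s(2)])
  show "source (?H b) (dsts ?d m) (qstate g b)" using source_copyg'[OF g odd(2,1), of b] m by simp
  have "zone ?B e5 ?d (?d + 2 * m) \<inter> pf o' ` {p + m + q..} = {}" 
   using par by (auto simp: zone_def pf_def)
  then show "(WL P \<union> WL (?H b) \<union> WL Q) \<inter> pf o' ` {p + m + q..} = {}" using anc WH[of b] by blast
  show "WL P \<inter> WL (?H b) = {}" "WL P \<inter> WL Q = {}" "WL (?H b) \<inter> WL Q = {}"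
   using W WH[of b] zone_disj[of h ?B e5 e3 ?d ?d "?d + 2 * m" o']
    zone_disj[of h e5 e6 e3 ?d "o' + 2 * (p + m)" "o' + 2 * (p + m + q)" o']
    zone_disj[of e5 e5 e6 ?B "?d + 2 * m" "o' + 2 * (p + m)" "o' + 2 * (p + m + q)" ?d] e5 by auto
 qed
 have "st (P @ (Had h # ?C) @ Q @ ?A) = st (Had h # ?R)"
  using st_commute[of "P" "[Had h]" "[]" "?C @ Q @ ?A"] hP by simp
 then have "ex (P @ (Had h # ?C) @ Q @ ?A) (%s. sg (s h) * ?E s) = ex (Had h # ?R) (%s. sg (s h) * ?E s)"
  by (rule ex_cong)
 also have "\<dots> = (ex (ctls h False ?R) ?E - ex (ctls h True ?R) ?E) / 2"
 proof (rule ex_coin_sign[OF nt])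
  show "h \<notin> WL (ctls h v ?R)" for v using ctl[of v] hP hQ hA hH[of v] by simp
  show "indep {h} ?E" using pfo by (intro chi_indep) auto
 qed
 finally show ?thesis unfolding ctl val .
qed

section \<open>A single slot of the distinguisher\<close>

definition tofs :: "nat => nat => bool list => nat list => nat gate list" where
 "tofs \<kappa> t S ws = concat (map (%(q, w). if q then [Toffoli \<kappa> w t] else []) (zip S ws))"

definition sel :: "bool list => nat list => nat list" where "sel S ws = map snd (filter fst (zip S ws))"

lemma ctls_tofs_False: "ctls \<kappa> False (tofs \<kappa> t S ws) = []"
 by (induction S ws rule: list_induct2') (auto simp: tofs_def)

lemma ctls_tofs_True: "ctls \<kappa> True (tofs \<kappa> t S ws) = map (%w. CNot w t) (sel S ws)"
 by (induction S ws rule: list_induct2') (auto simp: tofs_def sel_def)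

lemma chi_sel: "chi S (map s ws) = (\<Prod>w\<leftarrow>sel S ws. sg (s w))"
 by (induction S ws rule: list_induct2') (auto simp: chi_def sel_def)

lemma set_sel: "set (sel S ws) \<subseteq> set ws"
 by (auto simp: sel_def dest: set_zip_rightD)

lemma set_tofs: "g \<in> set (tofs \<kappa> t S ws) ==> \<exists>w\<in>set ws. g = Toffoli \<kappa> w t"
 by (auto simp: tofs_def split: if_splits dest: set_zip_rightD)

text \<open>One Fredkin gate per pair. At control zero the two outer \<open>CNot\<close> gates
  cancel, so only the middle gate of the swap needs the control.\<close>

definition cswaps :: "nat => (nat \<times> nat) list => nat gate list" where
 "cswaps \<kappa> ps = concat (map (%(a, b). [CNot b a, Toffoli \<kappa> a b, CNot b a]) ps)"

lemma ctls_cswaps_True: "\<forall>(a, b)\<in>set ps. b ~= \<kappa> ==> ctls \<kappa> True (cswaps \<kappa> ps) = swaps (map (%(a, b). (b, a)) ps)"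
 by (induction ps) (auto simp: cswaps_def swaps_def swapg_def)

lemma waves_cswaps_False:
 "\<forall>(a, b)\<in>set ps. b ~= \<kappa> \<and> a ~= b ==> waves (ctls \<kappa> False (cswaps \<kappa> ps)) \<psi> = \<psi>"
proof (induction ps arbitrary: \<psi>)
 case (Cons x ps)
 obtain a b where x: "x = (a, b)" by force
 have "gap (CNot b a) (gap (CNot b a) \<psi>) = \<psi>"
  using Cons.prems x by (auto simp: fun_eq_iff intro!: arg_cong[of _ _ \<psi>])
 then show ?case using Cons x by (simp add: cswaps_def del: gap.simps)
qed (simp add: cswaps_def)

lemma set_cswaps: "g \<in> set (cswaps \<kappa> ps) ==> \<exists>(a, b)\<in>set ps. g = CNot b a \<or> g = Toffoli \<kappa> a b"
 by (auto simp: cswaps_def)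


text \<open>Wires \<open>0, ..., k - 1\<close> carry the challenge, wire \<open>k\<close> collects
  the answer, and \<open>\<kappa>\<close> is the activation bit. The first half swaps the challenge
  into the learner's register and a fresh sample for bit 0 into the challenge register; the second
  half tests a sample for a random bit and adds this bit to wire \<open>k\<close>. Both halves add
  the parity of the learner's output to wire \<open>k\<close>. The learner runs in any case;
  \<open>\<kappa>\<close> controls only the swap and the additions.\<close>

definition slot :: "circuit => circuit => nat => nat => bool list => bool list => bool list =>
  nat => nat => nat gate list => nat => nat => bool" where
 "slot g c k r S pre post e o1 gs e' o3 \<longleftrightarrow> (\<exists>P1 e1 e2 Q1 e3 o2 P2 e4 e5 Q2.
   let m = length (outs g); p = m * length pre; q = m * length post; \<kappa> = e + 4 * r in
   copies g pre (\<kappa> + 2) o1 P1 e1 \<and> fits g e1 e2 \<and> copies g post e2 (o1 + 2 * (p + m)) Q1 e3 \<and>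
   fits c o1 o2 \<and> o1 + 2 * (p + m + q) \<le> o2 \<and>
   copies g pre e3 o2 P2 e4 \<and> fits g (e4 + 2) e5 \<and> copies g post e5 (o2 + 2 * (p + m)) Q2 e' \<and>
   fits c o2 o3 \<and> o2 + 2 * (p + m + q) \<le> o3 \<and>
   gs = PauliX e # gad e r @
    P1 @ copyg g [] (pf e1) (dsts (o1 + 2 * p) m) @ cswaps \<kappa> (zip [0..<k] (dsts (o1 + 2 * p) k)) @
    Q1 @ map (map_gate (pf o1)) (gates c) @ tofs \<kappa> k S (map (pf o1) (outs c)) @
    P2 @ (Had e4 # copyg g [CNot e4 (e4 + 2)] (pf (e4 + 2)) (dsts (o2 + 2 * p) m)) @ [Toffoli \<kappa> e4 k] @
    Q2 @ map (map_gate (pf o2)) (gates c) @ tofs \<kappa> k S (map (pf o2) (outs c)))"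

fun slots :: "circuit => (nat => circuit) => nat => nat => bool list => (bool list \<times> bool list) list =>
  nat => nat => nat gate list => nat => nat => bool" where
 "slots g C k r S [] e o1 gs e' o' \<longleftrightarrow> gs = [] \<and> e' = e \<and> o' = o1"
| "slots g C k r S ((pre, post) # xs) e o1 gs e' o' \<longleftrightarrow> (\<exists>gs1 e1 o2 gs2.
   slot g (C (length (outs g) * (length pre + 1 + length post))) k r S pre post e o1 gs1 e1 o2 \<and>
   slots g C k r S xs e1 o2 gs2 e' o' \<and> gs = gs1 @ gs2)"

text \<open>Later slots touch the answer wire only as the target of a Toffoli gate, so the additions
  of an earlier slot commute past them.\<close>

definition onlytgt :: "nat => nat gate => bool" where
 "onlytgt k g \<longleftrightarrow> k \<notin> set_gate g \<or> (\<exists>a b. g = Toffoli a b k \<and> a ~= k \<and> b ~= k)"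

lemma swt_image:
 assumes "length as = length bs" "distinct (as @ bs)" "W \<inter> set bs = {}"
 shows "swt (zip as bs) ` W \<subseteq> (W - set as) \<union> set bs"
proof clarify
 fix w assume w: "w \<in> W" "swt (zip as bs) w \<notin> set bs"
 show "swt (zip as bs) w \<in> W - set as"
 proof (cases "w \<in> set as")
  case True
  then obtain i where i: "i < length as" "w = as ! i" by (auto simp: in_set_conv_nth)
  then have "swt (zip as bs) w = bs ! i" using swt_zip assms(1,2) by blast
  then show ?thesis using w i assms(1) by auto
 next
  case False
  then have "swt (zip as bs) w = w"
   using w(1) assms(3) by (intro swt_off) (auto elim!: in_set_zipE)
  then show ?thesis using w False by auto
 qed
qed

text \<open>Swapping the registers of two independent sources is a renaming of wires, so it produces two
 independent sources again.\<close>

lemma swap_sources: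
 assumes s: "source gs Z \<rho>" "source hs ds \<sigma>" and W: "WL gs \<inter> WL hs = {}" and l: "length ds = length Z"
 obtains gs' hs' where "source gs' ds \<rho>" "source hs' Z \<sigma>" "WL gs' \<subseteq> (WL gs - set Z) \<union> set ds"
  "WL hs' \<subseteq> (WL hs - set ds) \<union> set Z" "st (gs @ hs @ swaps (zip ds Z)) = st (gs' @ hs')"
proof -
 have d: "distinct Z" "distinct ds" "set Z \<subseteq> WL gs" "set ds \<subseteq> WL hs"
  using s unfolding source_def by blast+
 then have dd: "distinct (ds @ Z)" "distinct (Z @ ds)" using W by auto
 define \<tau> where "\<tau> = swt (zip ds Z)"
 have ne: "\<forall>(a, b)\<in>set (zip ds Z). a ~= b" using dd(1) by (auto elim!: in_set_zipE)
 have m: "map \<tau> ds = Z" "map \<tau> Z = ds" unfolding \<tau>_def using swt_map swt_map' dd(1) l by blast+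
 have "st ((gs @ hs) @ swaps (zip ds Z)) = st (map (map_gate \<tau>) (gs @ hs))"
  unfolding \<tau>_def by (rule st_swaps[OF ne])
 moreover have "source (map (map_gate \<tau>) gs) ds \<rho>" "source (map (map_gate \<tau>) hs) Z \<sigma>"
  using source_perm[OF s(1) bij_swt] source_perm[OF s(2) bij_swt] m unfolding \<tau>_def by metis+
 moreover have "\<tau> ` WL hs \<subseteq> (WL hs - set ds) \<union> set Z"
  unfolding \<tau>_def by (rule swt_image) (use l dd d W in auto)
 moreover have "\<tau> ` WL gs \<subseteq> (WL gs - set Z) \<union> set ds"
 proof clarify
  fix w assume w: "w \<in> WL gs" "\<tau> w \<notin> set ds"
  have "w \<notin> set Z" using w(2) m(2) by (metis imageI list.set_map)
  moreover have "\<tau> w = w" unfolding \<tau>_def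
   using w(1) \<open>w \<notin> set Z\<close> d W by (intro swt_off) (auto elim!: in_set_zipE)
  ultimately show "\<tau> w \<in> WL gs - set Z" using w by simp
 qed
 ultimately show thesis using that[of "map (map_gate \<tau>) gs" "map (map_gate \<tau>) hs"] by (simp add: WL_map_gate)
qed

definition slotval :: "circuit => circuit => bool list => bool list => bool list => bool => real" where
 "slotval g c S pre post b = uval c (length (outs g) * (length pre + 1 + length post)) S
   (klist (map (qstate g) (pre @ b # post)))"

lemma klist_middle: "kron (kron (klist ys) R) (klist xs) = klist (xs @ R # ys)"
 by (simp add: klist_append)

lemma prod_indep:
 assumes "V \<inter> set ws = {}"
 shows "indep V (%s. \<Prod>w\<leftarrow>ws. sg (s w))"
proof -
 have "map (%w. sg (s w)) ws = map (%w. sg (s' w)) ws" if "\<forall>w. w \<notin> V --> s w = s' w" for s s' :: asg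
  using that assms by auto
 then show ?thesis unfolding indep_def by metis
qed

lemma indep_mult: "indep V E ==> indep V F ==> indep V (%s. E s * F s :: real)"
 unfolding indep_def by metis

lemma indep_sg: "w \<notin> V ==> indep V (%s. sg (s w))"
 by (auto simp: indep_def)

text \<open>Condition on the activation bit. An inactive slot is garbage and is dropped. An active
  slot separates into three independent parts: the trial on the challenge, the trial on the random
  bit, and the remaining slots. The remaining slots now start from a sample for
  \<open>False\<close>, whatever \<open>b\<close> is.\<close>

lemma slot_step:
 assumes g: "wf_circuit g" "length (outs g) = k" and c: "wf_circuit c"
  and sl: "slot g c k r S pre post e o1 gs e' o3"
  and par: "even e" "odd o1" "k < e" "k < o1"
  and src: "source gs0 [0..<k] (qstate g b)" "WL gs0 \<inter> zone e eN o1 oN = {}" "k \<notin> WL gs0"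
   "WL gs0 \<subseteq> {..<k} \<union> {w. even w}"
  and rest: "WL rest \<subseteq> {..k} \<union> zone e' eN o3 oN" "\<forall>h\<in>set rest. onlytgt k h" "e' \<le> eN" "o3 \<le> oN"
  and rest_wf: "\<forall>h\<in>set rest. wfg h"
 shows "even e' \<and> odd o3 \<and> e < e' \<and> o1 < o3 \<and> (\<exists>gs1. source gs1 [0..<k] (qstate g False) \<and> WL gs1 \<inter> zone e' eN o3 oN = {} \<and> k \<notin> WL gs1 \<and>
  WL gs1 \<subseteq> {..<k} \<union> {w. even w} \<and>
  ex (gs0 @ gs @ rest) (%s. sg (s k)) = (1 - 1 / 2 ^ r) * ex (gs0 @ rest) (%s. sg (s k)) +
   (1 / 2 ^ r) * (slotval g c S pre post b * ((slotval g c S pre post False - slotval g c S pre post True) / 2)) *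
   ex (gs1 @ rest) (%s. sg (s k)))"
proof -
 define p q \<kappa> where "p = k * length pre" and "q = k * length post" and "\<kappa> = e + 4 * r"
 obtain P1 e1 e2 Q1 e3 o2 P2 e4 e5 Q2 where sl1:
   "copies g pre (\<kappa> + 2) o1 P1 e1" "fits g e1 e2" "copies g post e2 (o1 + 2 * (p + k)) Q1 e3"
   "fits c o1 o2" "o1 + 2 * (p + k + q) \<le> o2"
   "copies g pre e3 o2 P2 e4" "fits g (e4 + 2) e5" "copies g post e5 (o2 + 2 * (p + k)) Q2 e'"
   "fits c o2 o3" "o2 + 2 * (p + k + q) \<le> o3"
   and gs: "gs = PauliX e # gad e r @
    P1 @ copyg g [] (pf e1) (dsts (o1 + 2 * p) k) @ cswaps \<kappa> (zip [0..<k] (dsts (o1 + 2 * p) k)) @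
    Q1 @ map (map_gate (pf o1)) (gates c) @ tofs \<kappa> k S (map (pf o1) (outs c)) @
    P2 @ (Had e4 # copyg g [CNot e4 (e4 + 2)] (pf (e4 + 2)) (dsts (o2 + 2 * p) k)) @ [Toffoli \<kappa> e4 k] @
    Q2 @ map (map_gate (pf o2)) (gates c) @ tofs \<kappa> k S (map (pf o2) (outs c))"
  using sl unfolding slot_def Let_def g(2) p_def[symmetric] q_def[symmetric] \<kappa>_def[symmetric] by blast
 define d1 d2 where "d1 = o1 + 2 * p" and "d2 = o2 + 2 * p"
 define H where "H = copyg g [] (pf e1) (dsts d1 k)"
 define A1 where "A1 = map (map_gate (pf o1)) (gates c)"
 define A2 where "A2 = map (map_gate (pf o2)) (gates c)"
 define C2 where "C2 = Had e4 # copyg g [CNot e4 (e4 + 2)] (pf (e4 + 2)) (dsts d2 k)"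
 define ws1 where "ws1 = map (pf o1) (outs c)"
 define ws2 where "ws2 = map (pf o2) (outs c)"
 define SW where "SW = cswaps \<kappa> (zip [0..<k] (dsts d1 k))"
 define T1 where "T1 = tofs \<kappa> k S ws1"
 define T2 where "T2 = tofs \<kappa> k S ws2"
 have gs': "gs = PauliX e # gad e r @ P1 @ H @ SW @ Q1 @ A1 @ T1 @ P2 @ C2 @ [Toffoli \<kappa> e4 k] @ Q2 @ A2 @ T2"
  by (simp add: gs H_def SW_def A1_def T1_def C2_def A2_def T2_def ws1_def ws2_def d1_def d2_def)
 have ev\<kappa>: "even \<kappa>" "e \<le> \<kappa>" using par by (auto simp: \<kappa>_def)
 have k2: "even (\<kappa> + 2)" using ev\<kappa> by simp
 note P1 = copies_source[OF g(1) k2 par(2) sl1(1), unfolded g(2), folded p_def, folded d1_def]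
 then have e1: "even e1" "\<kappa> + 2 \<le> e1" by auto
 have e2: "even e2" "e1 < e2" using sl1(2) e1 by (auto simp: fits_def)
 have od1: "odd (o1 + 2 * (p + k))" "odd d1" using par by (auto simp: d1_def)
 note Q1 = copies_source[OF g(1) e2(1) od1(1) sl1(3), unfolded g(2), folded q_def]
 then have e3: "even e3" "e2 \<le> e3" by auto
 have o2: "odd o2" "o1 < o2" using sl1(4) par by (auto simp: fits_def)
 note P2 = copies_source[OF g(1) e3(1) o2(1) sl1(6), unfolded g(2), folded p_def, folded d2_def]
 then have e4: "even e4" "e3 \<le> e4" by auto
 have e5: "even e5" "e4 + 2 < e5" using sl1(7) e4 by (auto simp: fits_def)
 have od2: "odd (o2 + 2 * (p + k))" "odd d2" using o2 by (auto simp: d2_def)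
 note Q2 = copies_source[OF g(1) e5(1) od2(1) sl1(8), unfolded g(2), folded q_def]
 then have e': "even e'" "e5 \<le> e'" by auto
 have o3: "odd o3" "o2 < o3" using sl1(9) o2 by (auto simp: fits_def)
 have sH: "source H (dsts d1 k) (qstate g False)"
  using source_copyg'[OF g(1) e1(1) od1(2), of False] g(2) by (simp add: H_def xp_def)
 have WP1: "WL P1 \<subseteq> zone (\<kappa> + 2) e1 o1 d1" and sP1: "source P1 (dsts o1 p) (klist (map (qstate g) pre))" using P1 by auto
 have WQ1: "WL Q1 \<subseteq> zone e2 e3 (d1 + 2 * k) (d1 + 2 * k + 2 * q)"
  and sQ1: "source Q1 (dsts (o1 + 2 * (p + k)) q) (klist (map (qstate g) post))" 
  using Q1 by (auto simp: d1_def algebra_simps)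
 have WP2: "WL P2 \<subseteq> zone e3 e4 o2 d2" and sP2: "source P2 (dsts o2 p) (klist (map (qstate g) pre))" using P2 by auto
 have WQ2: "WL Q2 \<subseteq> zone e5 e' (o2 + 2 * (p + k)) (o2 + 2 * (p + k + q))"
  and sQ2: "source Q2 (dsts (o2 + 2 * (p + k)) q) (klist (map (qstate g) post))" 
  using Q2 by (auto simp: algebra_simps)
 have WH: "WL H \<subseteq> zone e1 e2 d1 (d1 + 2 * k)"
  unfolding H_def by (rule WL_copyg'[OF sl1(2) e1(1) od1(2)]) auto
 have WC2: "WL C2 \<subseteq> zone e4 e5 d2 (d2 + 2 * k)"
 proof -
  have "WL (copyg g [CNot e4 (e4 + 2)] (pf (e4 + 2)) (dsts d2 k)) \<subseteq> zone e4 e5 d2 (d2 + 2 * k)"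
   by (rule WL_copyg'[OF sl1(7) _ od2(2)]) (use e4 e5 in \<open>auto simp: zone_def\<close>)
  then show ?thesis using e4 e5 by (auto simp: C2_def zone_def)
 qed
 have WA1: "WL A1 \<union> set ws1 \<subseteq> zone 0 0 o1 o2"
  using fits_WL_odd[OF sl1(4) par(2)] by (auto simp: A1_def ws1_def WL_map_gate)
 have WA2: "WL A2 \<union> set ws2 \<subseteq> zone 0 0 o2 o3"
  using fits_WL_odd[OF sl1(9) o2(1)] by (auto simp: A2_def ws2_def WL_map_gate)
 have d12: "d1 + 2 * k + 2 * q \<le> o2" "o1 \<le> d1" "o2 \<le> d2" "d2 + 2 * k \<le> o3" "o2 + 2 * (p + k + q) \<le> o3"
  using sl1(5,10) by (auto simp: d1_def d2_def algebra_simps)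
 have ZA: "zone (\<kappa> + 2) e1 o1 d1 \<union> zone e1 e2 d1 (d1 + 2 * k) \<union> zone e2 e3 (d1 + 2 * k) (d1 + 2 * k + 2 * q) \<union> zone 0 0 o1 o2
   \<subseteq> zone (\<kappa> + 2) e3 o1 o2"
  using e1 e2 e3 d12 by (auto simp: zone_def)
 have ZB: "zone e3 e4 o2 d2 \<union> zone e4 e5 d2 (d2 + 2 * k) \<union> zone e5 e' (o2 + 2 * (p + k)) (o2 + 2 * (p + k + q)) \<union> zone 0 0 o2 o3
   \<subseteq> zone e3 e' o2 o3"
  using e4 e5 e' d12 by (auto simp: zone_def)
 let ?ZA = "zone (\<kappa> + 2) e3 o1 o2" and ?ZB = "zone e3 e' o2 o3"
 have WA: "WL P1 \<subseteq> ?ZA" "WL H \<subseteq> ?ZA" "WL Q1 \<subseteq> ?ZA" "WL A1 \<subseteq> ?ZA" "set ws1 \<subseteq> ?ZA"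
  using ZA WP1 WH WQ1 WA1 by blast+
 have WB: "WL P2 \<subseteq> ?ZB" "WL C2 \<subseteq> ?ZB" "WL Q2 \<subseteq> ?ZB" "WL A2 \<subseteq> ?ZB" "set ws2 \<subseteq> ?ZB"
  using ZB WP2 WC2 WQ2 WA2 by blast+
 have dAB: "?ZA \<inter> ?ZB = {}" by (rule zone_disj) auto
 have eo: "e < e'" "o1 < o3" "e3 \<le> e'" "\<kappa> + 2 \<le> e3" "k < \<kappa>" using ev\<kappa> e1 e2 e3 e4 e5 e' o2 o3 par by linarith+
 have ZR: "?ZA \<inter> zone e' eN o3 oN = {}" "?ZB \<inter> zone e' eN o3 oN = {}"
  by (rule zone_disj; use eo o3 in simp)+
 have Zlow: "?ZA \<inter> {..k} = {}" "?ZB \<inter> {..k} = {}"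
  using eo par o2 by (auto simp: zone_def)
 have Zbig: "?ZA \<subseteq> zone e eN o1 oN" "?ZB \<subseteq> zone e eN o1 oN" "zone e' eN o3 oN \<subseteq> zone e eN o1 oN"
  by (rule zone_mono; use eo ev\<kappa> o2 o3 rest(3,4) in linarith)+
 have d0: "WL gs0 \<inter> ?ZA = {}" "WL gs0 \<inter> ?ZB = {}" "WL gs0 \<inter> zone e' eN o3 oN = {}"
  using src(2) Zbig by blast+
 have dR: "WL rest \<inter> ?ZA = {}" "WL rest \<inter> ?ZB = {}"
  using rest(1) ZR Zlow by blast+
 have \<kappa>Z: "\<kappa> \<notin> ?ZA" "\<kappa> \<notin> ?ZB" "\<kappa> \<notin> zone e' eN o3 oN" "\<kappa> \<notin> {..k}"
  using ev\<kappa> eo by (auto simp: zone_def)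
 have \<kappa>Zb: "\<kappa> \<in> zone e eN o1 oN" using ev\<kappa> eo rest(3) by (auto simp: zone_def)
 have \<kappa>W: "\<kappa> \<notin> WL gs0" "\<kappa> \<notin> WL P1" "\<kappa> \<notin> WL H" "\<kappa> \<notin> WL Q1" "\<kappa> \<notin> WL A1" "\<kappa> \<notin> WL P2" "\<kappa> \<notin> WL C2" "\<kappa> \<notin> WL Q2" "\<kappa> \<notin> WL A2" "\<kappa> \<notin> WL rest"
  using \<kappa>Z \<kappa>Zb WA WB src(2) rest(1) by blast+
 have e4\<kappa>: "e4 ~= \<kappa>" "e4 ~= k" "\<kappa> ~= k" using e1 e2 e3 e4 eo by linarith+
 have e4Z: "e4 \<in> ?ZB" using e4 e5 e' by (auto simp: zone_def)
 have dz: "set (dsts d1 k) \<subseteq> zone 0 0 d1 (d1 + 2 * k)" by (rule set_dsts_zone[OF od1(2)])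
 have dsZ: "set (dsts d1 k) \<subseteq> ?ZA"
  using sH WA(2) unfolding source_def by blast
 have zipk: "a < k \<and> b \<in> ?ZA" if "(a, b) \<in> set (zip [0..<k] (dsts d1 k))" for a b
  using that dsZ by (auto elim!: in_set_zipE)
 have zne: "\<forall>(a, b)\<in>set (zip [0..<k] (dsts d1 k)). b ~= \<kappa> \<and> a ~= b"
  using zipk \<kappa>Z(1) Zlow(1) by fastforce
 let ?E = "%s. sg (s k)"
 let ?T = "P1 @ H @ SW @ Q1 @ A1 @ T1 @ P2 @ C2 @ [Toffoli \<kappa> e4 k] @ Q2 @ A2 @ T2"
 let ?gs = "gs0 @ ?T @ rest"
 have ctlg: "ctls \<kappa> v ?gs = gs0 @ P1 @ H @ ctls \<kappa> v SW @ Q1 @ A1 @ ctls \<kappa> v T1 @ P2 @ C2 @ (if v then [CNot e4 k] else []) @ Q2 @ A2 @ ctls \<kappa> v T2 @ rest" for v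
  by (simp add: ctls_id[OF \<kappa>W(1)] ctls_id[OF \<kappa>W(2)] ctls_id[OF \<kappa>W(3)] ctls_id[OF \<kappa>W(4)] ctls_id[OF \<kappa>W(5)]
    ctls_id[OF \<kappa>W(6)] ctls_id[OF \<kappa>W(7)] ctls_id[OF \<kappa>W(8)] ctls_id[OF \<kappa>W(9)] ctls_id[OF \<kappa>W(10)])
 define SW' where "SW' = ctls \<kappa> True SW"
 have SW': "SW' = swaps (zip (dsts d1 k) [0..<k])"
  unfolding SW'_def SW_def using zne 
  by (subst ctls_cswaps_True) (auto simp: zip_commute[of "dsts d1 k"])
 define cn1 where "cn1 = map (%w. CNot w k) (sel S ws1)"
 define cn2 where "cn2 = map (%w. CNot w k) (sel S ws2)"
 define LT where "LT = ctls \<kappa> True ?gs"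
 define LF where "LF = ctls \<kappa> False ?gs"
 have ctlT: "LT = gs0 @ P1 @ H @ SW' @ Q1 @ A1 @ cn1 @ P2 @ C2 @ [CNot e4 k] @ Q2 @ A2 @ cn2 @ rest"
  unfolding LT_def ctlg unfolding SW'_def T1_def T2_def ctls_tofs_True cn1_def cn2_def by simp
 have ctlF: "LF = gs0 @ P1 @ H @ ctls \<kappa> False SW @ Q1 @ A1 @ P2 @ C2 @ Q2 @ A2 @ rest"
  unfolding LF_def ctlg unfolding T1_def T2_def ctls_tofs_False by simp
 have WSW': "WL SW' \<subseteq> ?ZA \<union> {..<k}"
  unfolding SW' WL_swaps using dsZ by (auto elim!: in_set_zipE)
 have WSW: "WL SW \<subseteq> ?ZA \<union> {..<k} \<union> {\<kappa>}"
  using zipk unfolding SW_def WL_def by (auto dest!: set_cswaps)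
 have WT: "WL T1 \<subseteq> ?ZA \<union> {\<kappa>, k}" "WL T2 \<subseteq> ?ZB \<union> {\<kappa>, k}"
  using WA(5) WB(5) unfolding T1_def T2_def WL_def by (auto dest!: set_tofs)
 have Wcn: "WL cn1 \<subseteq> ?ZA \<union> {k}" "WL cn2 \<subseteq> ?ZB \<union> {k}"
  using WA(5) WB(5) set_sel[of S ws1] set_sel[of S ws2] unfolding cn1_def cn2_def WL_def by auto
 have off: "x \<in> offgad e r" if "odd x \<or> x < e \<or> \<kappa> < x" for x
  using that par(1) by (auto simp: offgad_def \<kappa>_def)
 have offZ: "?ZA \<subseteq> offgad e r" "?ZB \<subseteq> offgad e r" "zone e' eN o3 oN \<subseteq> offgad e r" "{..k} \<subseteq> offgad e r"
  using eo ev\<kappa> par by (auto intro!: off simp: zone_def)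
 have off0: "WL gs0 \<subseteq> offgad e r"
 proof
  fix x assume x: "x \<in> WL gs0"
  then have "x \<notin> zone e eN o1 oN" using src(2) by auto
  then have "odd x \<or> x < e \<or> eN \<le> x" by (auto simp: zone_def)
  then show "x \<in> offgad e r" using off eo rest(3) by force
 qed
 have "indep (- offgad e r) ?E"
  using offZ(4) by (auto simp: indep_def)
 moreover have "WL ?gs \<subseteq> insert \<kappa> (offgad e r)"
 proof -
  have "WL ?T \<subseteq> ?ZA \<union> ?ZB \<union> {..k} \<union> {\<kappa>}"
  proof -
   have "WL [Toffoli \<kappa> e4 k] \<subseteq> ?ZB \<union> {..k} \<union> {\<kappa>}" using e4Z by auto
   moreover have "WL SW \<subseteq> ?ZA \<union> {..k} \<union> {\<kappa>}" "WL T1 \<subseteq> ?ZA \<union> {..k} \<union> {\<kappa>}" "WL T2 \<subseteq> ?ZB \<union> {..k} \<union> {\<kappa>}"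
    using WSW WT by auto
   ultimately show ?thesis using WA WB unfolding WL_simps(3) by blast
  qed
  then show ?thesis using off0 offZ rest(1) by (simp only: WL_simps) blast
 qed
 moreover have "\<forall>h\<in>set ?gs. nontarget \<kappa> h"
 proof -
  have "nontarget \<kappa> h" if "h \<in> set SW" for h
  proof -
   obtain a b where ab: "(a, b) \<in> set (zip [0..<k] (dsts d1 k))" "h = CNot b a \<or> h = Toffoli \<kappa> a b"
    using \<open>h \<in> set SW\<close> unfolding SW_def by (auto dest!: set_cswaps)
   then have "a < k" "b ~= \<kappa>" using zne zipk by auto
   then show ?thesis using ab(2) eo by auto
  qed
  moreover have "nontarget \<kappa> h" if "h \<in> set T1 \<union> set T2" for h
   using that e4\<kappa> unfolding T1_def T2_def by (auto dest!: set_tofs)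
  ultimately show ?thesis
   using nontarget_WL[OF \<kappa>W(1)] nontarget_WL[OF \<kappa>W(2)] nontarget_WL[OF \<kappa>W(3)] nontarget_WL[OF \<kappa>W(4)] nontarget_WL[OF \<kappa>W(5)]
    nontarget_WL[OF \<kappa>W(6)] nontarget_WL[OF \<kappa>W(7)] nontarget_WL[OF \<kappa>W(8)] nontarget_WL[OF \<kappa>W(9)] nontarget_WL[OF \<kappa>W(10)] e4\<kappa>
   by auto
 qed
 moreover have "\<kappa> \<notin> WL (LT)"
 proof -
  have "\<kappa> \<notin> WL SW'" "\<kappa> \<notin> WL cn1" "\<kappa> \<notin> WL cn2" using WSW' Wcn \<kappa>Z e4\<kappa> by auto
  then show ?thesis unfolding ctlT using \<kappa>W e4\<kappa> by auto
 qed
 ultimately have gadv: "ex (PauliX e # gad e r @ ?gs) ?E =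
   (1 / 2 ^ r) * ex (LT) ?E + (1 - 1 / 2 ^ r) * ex (LF) ?E"
  using ex_gad[OF par(1), of ?gs r ?E] unfolding LT_def LF_def \<kappa>_def by blast
 have "WL gs0 \<inter> WL (PauliX e # gad e r) = {}"
 proof -
  have "WL (PauliX e # gad e r) \<subseteq> zone e eN o1 oN"
  proof
   fix x assume "x \<in> WL (PauliX e # gad e r)"
   then have "e \<le> x \<and> x \<le> \<kappa> \<and> even x" using WL_gad[of x e r] par(1) by (auto simp: \<kappa>_def)
   then show "x \<in> zone e eN o1 oN" using eo rest(3) by (auto simp: zone_def)
  qed
  then show ?thesis using src(2) by blast
 qed
 then have "st (gs0 @ gs @ rest) = st (PauliX e # gad e r @ ?gs)"
  using st_commute[of gs0 "PauliX e # gad e r" "[]" "?T @ rest"] by (simp add: gs')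
 then have "ex (gs0 @ gs @ rest) ?E = ex (PauliX e # gad e r @ ?gs) ?E" by (rule ex_cong)
 also note gadv
 finally have main: "ex (gs0 @ gs @ rest) ?E = (1 / 2 ^ r) * ex LT ?E + (1 - 1 / 2 ^ r) * ex LF ?E" .
 have wfs: "\<forall>h\<in>set P1. wfg h" "\<forall>h\<in>set H. wfg h" "\<forall>h\<in>set Q1. wfg h" "\<forall>h\<in>set P2. wfg h" "\<forall>h\<in>set Q2. wfg h"
  using sP1 sH sQ1 sP2 sQ2 unfolding source_def by blast+
 have wfA: "\<forall>h\<in>set A1. wfg h" "\<forall>h\<in>set A2. wfg h"
  unfolding A1_def A2_def using wfg_map[OF inj_pf] wfg_gates[OF c] by auto
 have wfC2: "\<forall>h\<in>set C2. wfg h"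
 proof -
  have "wfg h" if "h \<in> set (copyg g [CNot e4 (e4 + 2)] (pf (e4 + 2)) (dsts d2 k))" for h
   by (rule wfg_copyg[OF g(1) inj_pf _ dsts_range that]) (use od2 e4 in \<open>auto simp: wfg_def\<close>)
  then show ?thesis by (auto simp: C2_def wfg_def)
 qed
 \<comment> \<open>The inactive case: the controlled swaps act as the identity, and the other gates
   of the slot avoid both wire \<open>k\<close> and the later slots, so they move to the end and are
   dropped.\<close>
 have F: "ex (LF) ?E = ex (gs0 @ rest) ?E"
 proof -
  let ?X = "P1 @ H @ Q1 @ A1 @ P2 @ C2 @ Q2 @ A2"
  have X: "WL ?X \<subseteq> ?ZA \<union> ?ZB" using WA WB by (simp only: WL_simps) blast
  then have "WL ?X \<inter> WL rest = {}" "k \<notin> WL ?X" using dR Zlow by blast+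
  have "st (LF) = st (gs0 @ ?X @ rest)"
   unfolding ctlF SW_def by (simp only: st_def fold_append comp_apply waves_cswaps_False[OF zne])
  also have "\<dots> = st ((gs0 @ rest) @ ?X)"
   using st_commute[of ?X rest gs0 "[]"] \<open>WL ?X \<inter> WL rest = {}\<close> by simp
  finally have "ex (LF) ?E = ex ((gs0 @ rest) @ ?X) ?E" by (rule ex_cong)
  also have "\<dots> = ex (gs0 @ rest) ?E"
  proof (rule ex_drop)
   show "\<forall>g\<in>set ?X. wfg g" using wfs wfA wfC2 by auto
   show "indep (WL ?X) ?E" using \<open>k \<notin> WL ?X\<close> by (auto simp: indep_def)
  qed
  finally show ?thesis .
 qed
 \<comment> \<open>After the swap, \<open>gs0'\<close> prepares the challenge in the learner's
   register, and \<open>H'\<close> prepares the fresh sample in the challenge register.\<close>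
 obtain gs0' H' where sw: "source gs0' (dsts d1 k) (qstate g b)" "source H' [0..<k] (qstate g False)"
  "WL gs0' \<subseteq> (WL gs0 - set [0..<k]) \<union> set (dsts d1 k)" "WL H' \<subseteq> (WL H - set (dsts d1 k)) \<union> set [0..<k]"
  "st (gs0 @ H @ SW') = st (gs0' @ H')"
  unfolding SW' by (rule swap_sources[OF src(1) sH]) (use d0 WA in auto)
 have WH': "WL H' \<subseteq> zone e1 e2 0 0 \<union> {..<k}"
 proof
  fix x assume x: "x \<in> WL H'"
  have "zone e1 e2 d1 (d1 + 2 * k) - set (dsts d1 k) \<subseteq> zone e1 e2 0 0"
  proof
   fix x assume x: "x \<in> zone e1 e2 d1 (d1 + 2 * k) - set (dsts d1 k)"
   show "x \<in> zone e1 e2 0 0"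
   proof (cases "even x")
    case False
    then have "d1 \<le> x" "x < d1 + 2 * k" "odd x" using x by (auto simp: zone_def)
    then have "x = d1 + 2 * ((x - d1) div 2)" "(x - d1) div 2 < k" using od1(2) by auto
    then have "x \<in> set (dsts d1 k)" unfolding set_dsts by blast
    then show ?thesis using x by simp
   qed (use x in \<open>auto simp: zone_def\<close>)
  qed
  moreover have "x \<in> (WL H - set (dsts d1 k)) \<union> set [0..<k]" using x sw(4) by blast
  moreover have "set [0..<k] = {..<k}" by auto
  ultimately show "x \<in> zone e1 e2 0 0 \<union> {..<k}" using WH by blast
 qed
 have H'd: "WL H' \<inter> WL P1 = {}" "WL H' \<inter> WL Q1 = {}" "WL H' \<inter> WL A1 = {}" "WL H' \<inter> ?ZB = {}" "k \<notin> WL H'" "WL H' \<inter> zone e' eN o3 oN = {}"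
  "WL H' \<inter> WL gs0' = {}"
 proof -
  have z: "zone e1 e2 0 0 \<inter> zone (\<kappa> + 2) e1 o1 d1 = {}" "zone e1 e2 0 0 \<inter> zone e2 e3 (d1 + 2 * k) (d1 + 2 * k + 2 * q) = {}"
   "zone e1 e2 0 0 \<inter> zone 0 0 o1 o2 = {}" "zone e1 e2 0 0 \<inter> ?ZB = {}" "zone e1 e2 0 0 \<inter> zone e' eN o3 oN = {}"
   using e3 eo by (auto intro!: zone_disj)
  have "{..<k} \<subseteq> {..k}" by auto
  then have l: "{..<k} \<inter> ?ZA = {}" "{..<k} \<inter> ?ZB = {}" using Zlow by blast+
  have l3: "{..<k} \<inter> zone e' eN o3 oN = {}" using eo(1,2) par(3,4) by (auto simp: zone_def)
  show "WL H' \<inter> WL P1 = {}" using WH' WP1 WA z l by blast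
  show "WL H' \<inter> WL Q1 = {}" using WH' WQ1 WA z l by blast
  show "WL H' \<inter> WL A1 = {}" using WH' WA1 WA z l by blast
  show "WL H' \<inter> ?ZB = {}" using WH' z l by blast
  show "WL H' \<inter> zone e' eN o3 oN = {}" using WH' z l3 by blast
  have "k \<notin> zone e1 e2 0 0" using e1 eo by (auto simp: zone_def)
  then show "k \<notin> WL H'" using WH' by auto
  show "WL H' \<inter> WL gs0' = {}"
  proof -
   have "WL gs0 \<inter> WL H = {}" using d0 WA by blast
   moreover have "set [0..<k] \<inter> set (dsts d1 k) = {}" using dsZ l by auto
   moreover have "set [0..<k] \<subseteq> WL gs0" using src(1) unfolding source_def by blast
   ultimately show ?thesis using sw(3,4) by blast
  qed
 qed
 have W0': "WL gs0' \<inter> WL P1 = {}" "WL gs0' \<inter> WL Q1 = {}" "WL gs0' \<inter> ?ZB = {}" "WL gs0' \<inter> zone e' eN o3 oN = {}" 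
   "WL gs0' \<inter> {..k} = {}" "WL gs0' \<inter> pf o1 ` {p + k + q..} = {}"
 proof -
  have z: "zone 0 0 d1 (d1 + 2 * k) \<inter> zone (\<kappa> + 2) e1 o1 d1 = {}" "zone 0 0 d1 (d1 + 2 * k) \<inter> zone e2 e3 (d1 + 2 * k) (d1 + 2 * k + 2 * q) = {}"
   using par by (auto intro!: zone_disj)
  show "WL gs0' \<inter> WL P1 = {}" using sw(3) d0 WA WP1 z dz by blast
  show "WL gs0' \<inter> WL Q1 = {}" using sw(3) d0 WA WQ1 z dz by blast
  show "WL gs0' \<inter> ?ZB = {}" using sw(3) d0 dsZ dAB by blast
  show "WL gs0' \<inter> zone e' eN o3 oN = {}" using sw(3) d0 dsZ ZR by blast
  have "set (dsts d1 k) \<inter> {..k} = {}" using dsZ Zlow(1) by blast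
  moreover have "(WL gs0 - set [0..<k]) \<inter> {..k} = {}"
  proof (rule equals0I)
   fix x assume "x \<in> (WL gs0 - set [0..<k]) \<inter> {..k}"
   then have "x \<in> WL gs0" "x = k" by auto
   then show False using src(3) by simp
  qed
  ultimately show "WL gs0' \<inter> {..k} = {}" using sw(3) by blast
  have "set (dsts d1 k) \<inter> pf o1 ` {p + k + q..} = {}" using dz by (auto simp: zone_def pf_def d1_def)
  moreover have "WL gs0 \<inter> pf o1 ` {p + k + q..} = {}"
   using src(4) par by (auto simp: pf_def)
  ultimately show "WL gs0' \<inter> pf o1 ` {p + k + q..} = {}" using sw(3) by blast
 qed
 define B where "B = P2 @ C2 @ Q2 @ A2"
 have WBB: "WL B \<subseteq> ?ZB" unfolding B_def using WB by (simp only: WL_simps) blast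
 define F1 where "F1 s = (\<Prod>w\<leftarrow>sel S ws1. sg (s w))" for s :: asg
 define F2 where "F2 s = (\<Prod>w\<leftarrow>sel S ws2. sg (s w))" for s :: asg
 have selk: "sel S ws1 = sel S ws1" "set (sel S ws1) \<subseteq> ?ZA" "set (sel S ws2) \<subseteq> ?ZB"
  using set_sel[of S] WA(5) WB(5) by blast+
 have tgt: "targets w k h" if "h \<in> set hs" "w \<notin> WL hs" "\<forall>h\<in>set hs. onlytgt k h" for w h hs
  using that unfolding targets_def onlytgt_def WL_def by blast
 have kB: "k \<notin> WL P2" "k \<notin> WL C2" "k \<notin> WL Q2" "k \<notin> WL A2" using WB Zlow by blast+
 have onl: "\<forall>h\<in>set hs. onlytgt k h" if "k \<notin> WL hs" for hs
  using that by (auto simp: onlytgt_def WL_def)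
 have cnt: "targets w k (CNot x k)" if "x ~= k" for w x using that by (auto simp: targets_def)
 \<comment> \<open>\<open>ex_cnots\<close> is applied three times: to the parity of the first trial,
   to the coin \<open>e4\<close>, and to the parity of the second trial. Each leaves a factor in the
   observable.\<close>
 have T: "ex (LT) ?E = ex (gs0 @ P1 @ H @ SW' @ Q1 @ A1 @ B @ rest) (%s. sg (s k) * (F2 s * (sg (s e4) * F1 s)))"
 proof -
  let ?pre = "gs0 @ P1 @ H @ SW' @ Q1 @ A1"
  have "ex (LT) ?E = ex (?pre @ map (%w. CNot w k) (sel S ws1) @
    (P2 @ C2 @ [CNot e4 k] @ Q2 @ A2 @ cn2 @ rest)) (%s. sg (s k) * 1)"
   by (simp add: ctlT cn1_def)
  also have "\<dots> = ex (?pre @ (P2 @ C2 @ [CNot e4 k] @ Q2 @ A2 @ cn2 @ rest)) (%s. sg (s k) * ((\<Prod>w\<leftarrow>sel S ws1. sg (s w)) * 1))"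
  proof (rule ex_cnots)
   show "k \<notin> set (sel S ws1)" using selk Zlow by auto
   show "\<forall>w\<in>set (sel S ws1). \<forall>g\<in>set (P2 @ C2 @ [CNot e4 k] @ Q2 @ A2 @ cn2 @ rest). targets w k g"
   proof (intro ballI)
    fix w h assume w: "w \<in> set (sel S ws1)" and h: "h \<in> set (P2 @ C2 @ [CNot e4 k] @ Q2 @ A2 @ cn2 @ rest)"
    have wn: "w \<notin> WL P2" "w \<notin> WL C2" "w \<notin> WL Q2" "w \<notin> WL A2" "w \<notin> WL rest"
     using w selk WB dAB dR by blast+
    have "targets w k h" if "h \<in> set cn2"
     using that selk Zlow unfolding cn2_def by (auto intro!: cnt)
    moreover have "targets w k (CNot e4 k)" using cnt e4\<kappa> by blast
    ultimately show "targets w k h"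
     using h tgt[OF _ wn(1) onl[OF kB(1)]] tgt[OF _ wn(2) onl[OF kB(2)]] tgt[OF _ wn(3) onl[OF kB(3)]]
      tgt[OF _ wn(4) onl[OF kB(4)]] tgt[OF _ wn(5) rest(2)] by auto
   qed
  qed (simp add: indep_def)
  also have "\<dots> = ex ((?pre @ P2 @ C2) @ map (%w. CNot w k) [e4] @ (Q2 @ A2 @ cn2 @ rest)) (%s. sg (s k) * F1 s)"
   by (simp add: F1_def)
  also have "\<dots> = ex ((?pre @ P2 @ C2) @ (Q2 @ A2 @ cn2 @ rest)) (%s. sg (s k) * ((\<Prod>w\<leftarrow>[e4]. sg (s w)) * F1 s))"
  proof (rule ex_cnots)
   show "\<forall>w\<in>set [e4]. \<forall>g\<in>set (Q2 @ A2 @ cn2 @ rest). targets w k g"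
   proof (intro ballI)
    fix w h assume w: "w \<in> set [e4]" and h: "h \<in> set (Q2 @ A2 @ cn2 @ rest)"
    have wn: "w \<notin> WL Q2" "w \<notin> WL A2" "w \<notin> WL rest"
     using w WQ2 WA2 e5 e4 e4Z dR by (auto simp: zone_def)
    have "targets w k h" if "h \<in> set cn2"
     using that selk Zlow unfolding cn2_def by (auto intro!: cnt)
    then show "targets w k h"
     using h tgt[OF _ wn(1) onl[OF kB(3)]] tgt[OF _ wn(2) onl[OF kB(4)]] tgt[OF _ wn(3) rest(2)] by auto
   qed
   show "indep {k} F1" unfolding F1_def by (rule prod_indep) (use selk Zlow in auto)
  qed (use e4\<kappa> in simp)
  also have "\<dots> = ex ((gs0 @ P1 @ H @ SW' @ Q1 @ A1 @ B) @ map (%w. CNot w k) (sel S ws2) @ rest) (%s. sg (s k) * (sg (s e4) * F1 s))"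
   by (simp add: B_def cn2_def)
  also have "\<dots> = ex ((gs0 @ P1 @ H @ SW' @ Q1 @ A1 @ B) @ rest) (%s. sg (s k) * ((\<Prod>w\<leftarrow>sel S ws2. sg (s w)) * (sg (s e4) * F1 s)))"
  proof (rule ex_cnots)
   show "k \<notin> set (sel S ws2)" using selk Zlow by auto
   show "\<forall>w\<in>set (sel S ws2). \<forall>g\<in>set rest. targets w k g"
    using tgt[OF _ _ rest(2)] selk dR by blast
   have "indep {k} F1" unfolding F1_def by (rule prod_indep) (use selk Zlow in auto)
   then show "indep {k} (%s. sg (s e4) * F1 s)" using e4\<kappa> by (intro indep_mult indep_sg) auto
  qed
  finally show ?thesis by (simp add: F2_def)
 qed
 \<comment> \<open>The gates are reordered into three blocks on disjoint wires: the trial on the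
   challenge, the trial \<open>B\<close>, and the new challenge register together with the later
   slots.\<close>
 have st1: "st (gs0 @ P1 @ H @ SW' @ Q1 @ A1 @ B @ rest) = st ((P1 @ gs0' @ Q1 @ A1) @ B @ (H' @ rest))"
 proof -
  have "WL P1 \<inter> WL (H @ SW') = {}"
  proof -
   have "WL SW' \<subseteq> set (dsts d1 k) \<union> {..<k}" unfolding SW' WL_swaps by (auto elim!: in_set_zipE)
   moreover have "set (dsts d1 k) \<subseteq> WL H" using sH unfolding source_def by blast
   moreover have "WL P1 \<inter> WL H = {}"
    using WP1 WH zone_disj[of e1 e1 e2 "\<kappa> + 2" d1 d1 "d1 + 2 * k" o1] by auto
   moreover have "WL P1 \<inter> {..<k} = {}" using WA Zlow by auto
   ultimately show ?thesis by (simp only: WL_simps) blast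
  qed
  then have "st (gs0 @ P1 @ H @ SW' @ Q1 @ A1 @ B @ rest) = st ((gs0 @ H @ SW') @ P1 @ Q1 @ A1 @ B @ rest)"
   using st_commute[of P1 "H @ SW'" gs0 "Q1 @ A1 @ B @ rest"] by simp
  also have "\<dots> = st ((gs0' @ H') @ P1 @ Q1 @ A1 @ B @ rest)"
   unfolding st_append[of _ "P1 @ Q1 @ A1 @ B @ rest"] sw(5) ..
  also have "\<dots> = st (gs0' @ (P1 @ Q1 @ A1 @ B) @ H' @ rest)"
  proof -
   have "WL H' \<inter> WL (P1 @ Q1 @ A1 @ B) = {}" using H'd(1-4) WBB unfolding WL_simps by blast
   from st_commute[OF this, of gs0' rest] show ?thesis by simp
  qed
  also have "\<dots> = st ((P1 @ gs0' @ Q1 @ A1) @ B @ (H' @ rest))"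
   using st_commute[of gs0' P1 "[]" "Q1 @ A1 @ B @ H' @ rest"] W0'(1) by simp
  finally show ?thesis .
 qed
 let ?X = "P1 @ gs0' @ Q1 @ A1"
 have ws1H: "set ws1 \<inter> WL H' = {}"
 proof -
  have "zone e1 e2 0 0 \<inter> zone 0 0 o1 o2 = {}" by (rule zone_disj) auto
  moreover have "{..<k} \<subseteq> {..k}" by auto
  ultimately show ?thesis using WH' WA1 WA(5) Zlow(1) by blast
 qed
 have WX: "WL ?X \<subseteq> ?ZA \<union> WL gs0'" using WA by (simp only: WL_simps) blast
 have XB: "WL ?X \<inter> (WL B \<union> WL (H' @ rest)) = {}"
 proof -
  have "WL gs0' \<inter> WL rest = {}" using rest(1) W0' by blast
  moreover have "WL H' \<inter> WL ?X = {}" using H'd by (simp only: WL_simps) blast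
  ultimately show ?thesis using WX WBB W0'(3) dAB dR unfolding WL_simps by blast
 qed
 have BR: "WL B \<inter> WL (H' @ rest) = {}" using WBB H'd(4) dR by (simp only: WL_simps) blast
 have e4n: "e4 \<notin> WL (H' @ rest)" "e4 \<notin> WL ?X" 
  using e4Z H'd(4) dR(2) WX dAB W0'(3) unfolding WL_simps by blast+
 have "ex (gs0 @ P1 @ H @ SW' @ Q1 @ A1 @ B @ rest) (%s. sg (s k) * (F2 s * (sg (s e4) * F1 s))) =
  ex (?X @ B @ (H' @ rest)) (%s. F1 s * ((sg (s e4) * F2 s) * sg (s k)))"
  by (subst ex_cong[OF st1]) (simp add: mult_ac)
 also have "\<dots> = ex ?X F1 * ex (B @ (H' @ rest)) (%s. (sg (s e4) * F2 s) * sg (s k))"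
 proof (rule ex_prod)
  show "WL ?X \<inter> WL (B @ H' @ rest) = {}" using XB by auto
  show "indep (WL (B @ H' @ rest)) F1" unfolding F1_def
  proof (rule prod_indep)
   have "set (sel S ws1) \<inter> WL H' = {}" using ws1H set_sel by blast
   then show "WL (B @ H' @ rest) \<inter> set (sel S ws1) = {}"
    using selk(2) WBB dAB dR by (simp only: WL_simps) blast
  qed
  have i: "indep (WL ?X) F2" unfolding F2_def
   by (rule prod_indep) (use selk(3) WX dAB W0'(3) in blast)
  have "k \<notin> WL ?X" using WX Zlow W0'(5) by auto
  then show "indep (WL ?X) (%s. sg (s e4) * F2 s * sg (s k))"
   by (intro indep_mult indep_sg i e4n(2))
 qed
 also have "ex (B @ (H' @ rest)) (%s. (sg (s e4) * F2 s) * sg (s k)) = ex B (%s. sg (s e4) * F2 s) * ex (H' @ rest) ?E"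
 proof (rule ex_prod[OF BR])
  have i: "indep (WL (H' @ rest)) F2" unfolding F2_def
   by (rule prod_indep) (use selk(3) H'd(4) dR in \<open>simp only: WL_simps, blast\<close>)
  then show "indep (WL (H' @ rest)) (%s. sg (s e4) * F2 s)"
   by (intro indep_mult indep_sg e4n(1))
  have "k \<notin> WL B" using WBB Zlow by blast
  then show "indep (WL B) ?E" by (auto simp: indep_def)
 qed
 also have "ex ?X F1 = slotval g c S pre post b"
 proof -
  have "ex ?X (%s. chi S (map s (map (pf o1) (outs c)))) = 
   uval c (p + k + q) S (kron (kron (klist (map (qstate g) post)) (qstate g b)) (klist (map (qstate g) pre)))"
   unfolding A1_def
  proof (rule trial_value[OF c _ sP1 _ sQ1])
   have "zone (\<kappa> + 2) e1 o1 d1 \<inter> pf o1 ` {p + k + q..} = {}" "zone e2 e3 (d1 + 2 * k) (d1 + 2 * k + 2 * q) \<inter> pf o1 ` {p + k + q..} = {}"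
    using par(2) by (auto simp: zone_def pf_def d1_def)
   then show "(WL P1 \<union> WL gs0' \<union> WL Q1) \<inter> pf o1 ` {p + k + q..} = {}"
    using WP1 WQ1 W0'(6) by blast
   show "source gs0' (dsts (o1 + 2 * p) k) (qstate g b)" using sw(1) by (simp add: d1_def)
   show "WL P1 \<inter> WL gs0' = {}" "WL gs0' \<inter> WL Q1 = {}" using W0' by blast+
   show "WL P1 \<inter> WL Q1 = {}" 
    using WP1 WQ1 zone_disj[of e1 e2 e3 "\<kappa> + 2" d1 "d1 + 2 * k" "d1 + 2 * k + 2 * q" o1] e2 by auto
  qed
  then show ?thesis unfolding F1_def chi_sel ws1_def[symmetric]
   by (simp add: slotval_def g(2) p_def q_def klist_middle algebra_simps)
 qed
 also have "ex B (%s. sg (s e4) * F2 s) = (slotval g c S pre post False - slotval g c S pre post True) / 2"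
 proof -
  have "ex B (%s. sg (s e4) * chi S (map s (map (pf o2) (outs c)))) =
   (uval c (p + k + q) S (kron (kron (klist (map (qstate g) post)) (qstate g False)) (klist (map (qstate g) pre))) -
   uval c (p + k + q) S (kron (kron (klist (map (qstate g) post)) (qstate g True)) (klist (map (qstate g) pre)))) / 2"
   unfolding B_def C2_def A2_def d2_def
  proof (rule trial_had[OF c g(1) g(2)[symmetric] _ sP2 sQ2 _ WQ2 sl1(7) e4(1) o2(1)])
   have "zone e3 e4 o2 d2 \<inter> pf o2 ` {p + k + q..} = {}" "zone e5 e' (o2 + 2 * (p + k)) (o2 + 2 * (p + k + q)) \<inter> pf o2 ` {p + k + q..} = {}"
    using o2(1) by (auto simp: zone_def pf_def d2_def)
   then show "(WL P2 \<union> WL Q2) \<inter> pf o2 ` {p + k + q..} = {}" using WP2 WQ2 by blast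
   show "WL P2 \<subseteq> zone e3 e4 o2 (o2 + 2 * p)" using WP2 by (simp add: d2_def)
  qed
  then show ?thesis unfolding F2_def chi_sel ws2_def[symmetric]
   by (simp add: slotval_def g(2) p_def q_def klist_middle algebra_simps)
 qed
 finally have "ex (LT) ?E = slotval g c S pre post b *
   ((slotval g c S pre post False - slotval g c S pre post True) / 2 * ex (H' @ rest) ?E)" unfolding T .
 then have "ex (gs0 @ gs @ rest) ?E = (1 - 1 / 2 ^ r) * ex (gs0 @ rest) ?E +
   (1 / 2 ^ r) * (slotval g c S pre post b * ((slotval g c S pre post False - slotval g c S pre post True) / 2)) *
   ex (H' @ rest) ?E"
  unfolding main F by (subst add.commute) (simp only: mult.assoc)
 moreover have "WL H' \<subseteq> {..<k} \<union> {w. even w}" using WH' by (auto simp: zone_def)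
 ultimately show ?thesis using e'(1) o3(1) eo sw(2) H'd by blast
qed


text \<open>The circuit has to be well formed for every \<open>k\<close>, whereas the layout makes
  sense only if \<open>k\<close> is the output length of \<open>g\<close>. The claims about wires
  are therefore conditional.\<close>

lemma slot_wf:
 assumes g: "wf_circuit g" and c: "wf_circuit c" and sl: "slot g c k r S pre post e o1 gs e' o3"
  and par: "even e" "odd o1" "k < e" "k < o1"
 shows "even e' \<and> odd o3 \<and> e < e' \<and> o1 < o3 \<and> (\<forall>h\<in>set gs. wfg h) \<and>
  (length (outs g) = k --> WL gs \<subseteq> {..k} \<union> zone e e' o1 o3 \<and> (\<forall>h\<in>set gs. onlytgt k h))"
proof -
 define m p q \<kappa> where "m = length (outs g)" and "p = m * length pre" and "q = m * length post" and "\<kappa> = e + 4 * r"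
 obtain P1 e1 e2 Q1 e3 o2 P2 e4 e5 Q2 where sl1:
   "copies g pre (\<kappa> + 2) o1 P1 e1" "fits g e1 e2" "copies g post e2 (o1 + 2 * (p + m)) Q1 e3"
   "fits c o1 o2" "o1 + 2 * (p + m + q) \<le> o2"
   "copies g pre e3 o2 P2 e4" "fits g (e4 + 2) e5" "copies g post e5 (o2 + 2 * (p + m)) Q2 e'"
   "fits c o2 o3" "o2 + 2 * (p + m + q) \<le> o3"
   and gs: "gs = PauliX e # gad e r @
    P1 @ copyg g [] (pf e1) (dsts (o1 + 2 * p) m) @ cswaps \<kappa> (zip [0..<k] (dsts (o1 + 2 * p) k)) @
    Q1 @ map (map_gate (pf o1)) (gates c) @ tofs \<kappa> k S (map (pf o1) (outs c)) @
    P2 @ (Had e4 # copyg g [CNot e4 (e4 + 2)] (pf (e4 + 2)) (dsts (o2 + 2 * p) m)) @ [Toffoli \<kappa> e4 k] @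
    Q2 @ map (map_gate (pf o2)) (gates c) @ tofs \<kappa> k S (map (pf o2) (outs c))"
  using sl unfolding slot_def Let_def m_def[symmetric] p_def[symmetric] q_def[symmetric] \<kappa>_def[symmetric] by blast
 have ev\<kappa>: "even \<kappa>" "e \<le> \<kappa>" using par by (auto simp: \<kappa>_def)
 have k2: "even (\<kappa> + 2)" using ev\<kappa> by simp
 note P1 = copies_source[OF g k2 par(2) sl1(1), folded m_def, folded p_def]
 then have e1: "even e1" "\<kappa> + 2 \<le> e1" by auto
 have e2: "even e2" "e1 < e2" using sl1(2) e1 by (auto simp: fits_def)
 have od1: "odd (o1 + 2 * (p + m))" "odd (o1 + 2 * p)" using par by auto
 note Q1 = copies_source[OF g e2(1) od1(1) sl1(3), folded m_def, folded q_def]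
 then have e3: "even e3" "e2 \<le> e3" by auto
 have o2: "odd o2" "o1 < o2" using sl1(4) par by (auto simp: fits_def)
 note P2 = copies_source[OF g e3(1) o2(1) sl1(6), folded m_def, folded p_def]
 then have e4: "even e4" "e3 \<le> e4" by auto
 have e5: "even e5" "e4 + 2 < e5" using sl1(7) e4 by (auto simp: fits_def)
 have od2: "odd (o2 + 2 * (p + m))" "odd (o2 + 2 * p)" using o2 by auto
 note Q2 = copies_source[OF g e5(1) od2(1) sl1(8), folded m_def, folded q_def]
 then have e': "even e'" "e5 \<le> e'" by auto
 have o3: "odd o3" "o2 < o3" using sl1(9) o2 by (auto simp: fits_def)
 have eo: "e < e'" "o1 < o3" using ev\<kappa> e1 e2 e3 e4 e5 e' o2 o3 by linarith+
 have \<kappa>k: "k < \<kappa>" "\<kappa> < e4" using par ev\<kappa> e1 e2 e3 e4 by linarith+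
 have zk: "a < k \<and> odd b \<and> k < b \<and> (k = m --> b < o2 \<and> o1 \<le> b)" if "(a, b) \<in> set (zip [0..<k] (dsts (o1 + 2 * p) k))" for a b
 proof -
  have "a < k" "b \<in> set (dsts (o1 + 2 * p) k)" using that by (auto elim!: in_set_zipE)
  then obtain j where "b = o1 + 2 * p + 2 * j" "j < k" by (auto simp: set_dsts)
  then show ?thesis using \<open>a < k\<close> par sl1(5) by auto
 qed
 have wf0: "\<forall>h\<in>set P1. wfg h" "\<forall>h\<in>set Q1. wfg h" "\<forall>h\<in>set P2. wfg h" "\<forall>h\<in>set Q2. wfg h"
  using P1 Q1 P2 Q2 unfolding source_def by blast+
 have wf1: "wfg h" if "h \<in> set (copyg g [] (pf e1) (dsts (o1 + 2 * p) m))" for h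
  by (rule wfg_copyg[OF g inj_pf _ dsts_range that]) (use od1 e1 in auto)
 have wf2: "wfg h" if "h \<in> set (copyg g [CNot e4 (e4 + 2)] (pf (e4 + 2)) (dsts (o2 + 2 * p) m))" for h
  by (rule wfg_copyg[OF g inj_pf _ dsts_range that]) (use od2 e4 in \<open>auto simp: wfg_def\<close>)
 have wf3: "wfg h" if "h \<in> set (map (map_gate (pf e)) (gates c))" for h e
  using that wfg_map[OF inj_pf] wfg_gates[OF c] by auto
 have wf4: "wfg h \<and> onlytgt k h" if hx: "h \<in> set (tofs \<kappa> k S (map (pf x) (outs c)))" "odd x" "k < x" for h x
 proof -
  obtain w where w: "w \<in> set (outs c)" "h = Toffoli \<kappa> (pf x w) k" using set_tofs[OF hx(1)] by auto
  have "odd (pf x w)" "k < pf x w" using hx by (auto simp: pf_def)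
  then have "pf x w ~= \<kappa>" "pf x w ~= k" using ev\<kappa> by auto
  then show ?thesis using w \<kappa>k by (auto simp: wfg_def onlytgt_def)
 qed
 have wf5: "wfg h" if hx: "h \<in> set (cswaps \<kappa> (zip [0..<k] (dsts (o1 + 2 * p) k)))" for h
 proof -
  obtain a b where ab: "(a, b) \<in> set (zip [0..<k] (dsts (o1 + 2 * p) k))" "h = CNot b a \<or> h = Toffoli \<kappa> a b"
   using set_cswaps[OF hx] by auto
  have "a ~= b" "\<kappa> ~= a" "\<kappa> ~= b" using zk[OF ab(1)] ev\<kappa> \<kappa>k by auto
  then show ?thesis using ab(2) by (auto simp: wfg_def)
 qed
 have ko2: "k < o2" using par o2 by simp
 let ?A = "%x. map (map_gate (pf x)) (gates c)" and ?T = "%x. tofs \<kappa> k S (map (pf x) (outs c))"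
 let ?C1 = "copyg g [] (pf e1) (dsts (o1 + 2 * p) m)"
 let ?C2 = "copyg g [CNot e4 (e4 + 2)] (pf (e4 + 2)) (dsts (o2 + 2 * p) m)"
 let ?SW = "cswaps \<kappa> (zip [0..<k] (dsts (o1 + 2 * p) k))"
 have split: "h \<in> set gs ==> h \<in> {PauliX e, Had e4, Toffoli \<kappa> e4 k} \<or> h \<in> set P1 \<or> h \<in> set Q1 \<or> h \<in> set P2 \<or> h \<in> set Q2 \<or>
  h \<in> set (gad e r) \<or> h \<in> set ?C1 \<or> h \<in> set ?C2 \<or> h \<in> set (?A o1) \<or> h \<in> set (?A o2) \<or> h \<in> set (?T o1) \<or> h \<in> set (?T o2) \<or> h \<in> set ?SW" for h
  unfolding gs by (auto simp only: set_append list.set Un_iff insert_iff empty_iff)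
 have w3: "wfg h" if "h \<in> {PauliX e, Had e4, Toffoli \<kappa> e4 k}" for h
  using that \<kappa>k by (auto simp: wfg_def)
 have wf: "\<forall>h\<in>set gs. wfg h"
  using split w3 wf0 wf1 wf2 wf3 wf4[OF _ par(2,4)] wf4[OF _ o2(1) ko2] wf5 gad_wfg[of _ e r] by metis
 have "WL gs \<subseteq> {..k} \<union> zone e e' o1 o3 \<and> (\<forall>h\<in>set gs. onlytgt k h)" if km: "m = k"
 proof -
  let ?Z = "zone e e' o1 o3"
  have Zs: "zone a b c d \<subseteq> ?Z" if "e \<le> a \<or> b = 0" "b \<le> e'" "o1 \<le> c" "d \<le> o3" for a b c d
   using that by (auto simp: zone_def)
  have V: "WL P1 \<subseteq> zone (\<kappa> + 2) e1 o1 (o1 + 2 * p)"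
   "WL Q1 \<subseteq> zone e2 e3 (o1 + 2 * (p + m)) (o1 + 2 * (p + m) + 2 * q)"
   "WL P2 \<subseteq> zone e3 e4 o2 (o2 + 2 * p)"
   "WL Q2 \<subseteq> zone e5 e' (o2 + 2 * (p + m)) (o2 + 2 * (p + m) + 2 * q)"
   using P1 Q1 P2 Q2 by blast+
  note le = ev\<kappa> e1 e2 e3 e4 e5 e' o2 o3 sl1(5,10)
  have W1: "WL P1 \<subseteq> ?Z" by (rule order_trans[OF V(1) Zs]) (use le in \<open>simp_all\<close>)
  have W1': "WL Q1 \<subseteq> ?Z" by (rule order_trans[OF V(2) Zs]) (use le in \<open>simp_all\<close>)
  have W2: "WL P2 \<subseteq> ?Z" by (rule order_trans[OF V(3) Zs]) (use le in \<open>simp_all\<close>)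
  have W2': "WL Q2 \<subseteq> ?Z" by (rule order_trans[OF V(4) Zs]) (use le in \<open>simp_all\<close>)
  have W3: "WL (copyg g [] (pf e1) (dsts (o1 + 2 * p) m)) \<subseteq> ?Z"
   by (rule order_trans[OF WL_copyg'[OF sl1(2) e1(1) od1(2), of "[]" e1] Zs])
     (use ev\<kappa> e1 e2 e3 e4 e5 e' o2 o3 sl1(5,10) in \<open>simp; linarith\<close>)+
  have W4: "WL (copyg g [CNot e4 (e4 + 2)] (pf (e4 + 2)) (dsts (o2 + 2 * p) m)) \<subseteq> ?Z"
  proof (rule order_trans[OF WL_copyg'[OF sl1(7) _ od2(2), of "[CNot e4 (e4 + 2)]" e4] Zs])
   show "WL [CNot e4 (e4 + 2)] \<subseteq> zone e4 e5 0 0" using e4 e5 by (auto simp: zone_def)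
  qed (use ev\<kappa> e1 e2 e3 e4 e5 e' o2 o3 sl1(5,10) in \<open>simp; linarith\<close>)+
  have W5: "pf o1 ` (WL (gates c) \<union> set (outs c)) \<subseteq> ?Z"
   by (rule order_trans[OF fits_WL_odd[OF sl1(4) par(2)] Zs]) (use o2 o3 in auto)
  have W6: "pf o2 ` (WL (gates c) \<union> set (outs c)) \<subseteq> ?Z"
   by (rule order_trans[OF fits_WL_odd[OF sl1(9) o2(1)] Zs]) (use o2 o3 in auto)
  have \<kappa>Z: "\<kappa> \<in> ?Z" "e \<in> ?Z" "e4 \<in> ?Z" 
   using ev\<kappa> e1 e2 e3 e4 e5 e' par by (auto simp: zone_def)
  have W7: "WL (tofs \<kappa> k S (map (pf x) (outs c))) \<subseteq> {..k} \<union> ?Z"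
   if x: "pf x ` (WL (gates c) \<union> set (outs c)) \<subseteq> ?Z" for x
  proof
   fix y assume "y \<in> WL (tofs \<kappa> k S (map (pf x) (outs c)))"
   then obtain w where w: "w \<in> set (outs c)" "y \<in> {\<kappa>, pf x w, k}"
    unfolding WL_def by (auto dest!: set_tofs)
   then show "y \<in> {..k} \<union> ?Z" using x \<kappa>Z by auto
  qed
  have zz: "a \<in> {..k} \<and> b \<in> ?Z" if "(a, b) \<in> set (zip [0..<k] (dsts (o1 + 2 * p) k))" for a b
   using zk[OF that] km o3 by (auto simp: zone_def)
  have W8: "WL (cswaps \<kappa> (zip [0..<k] (dsts (o1 + 2 * p) k))) \<subseteq> {..k} \<union> ?Z"
   using zz \<kappa>Z unfolding WL_def by (auto dest!: set_cswaps)
  have W9: "WL (gad e r) \<subseteq> ?Z"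
  proof
   fix x assume "x \<in> WL (gad e r)"
   then show "x \<in> ?Z" using WL_gad[of x e r] par(1) ev\<kappa> e1 e2 e3 e4 e5 e' by (auto simp: zone_def \<kappa>_def)
  qed
  have "WL gs \<subseteq> {..k} \<union> ?Z"
   unfolding gs WL_simps WL_map_gate using W1 W1' W2 W2' W3 W4 W5 W6 W7[OF W5] W7[OF W6] W8 W9 \<kappa>Z by auto
  moreover have "\<forall>h\<in>set gs. onlytgt k h"
  proof -
   have kZ: "k \<notin> ?Z" using par by (auto simp: zone_def)
   have on: "onlytgt k h" if "h \<in> set hs" "WL hs \<subseteq> ?Z" for h hs
    using that kZ by (auto simp: onlytgt_def WL_def)
   have "WL (map (map_gate (pf o1)) (gates c)) \<subseteq> ?Z" "WL (map (map_gate (pf o2)) (gates c)) \<subseteq> ?Z"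
    using W5 W6 by (auto simp: WL_map_gate)
   note o = on[OF _ W1] on[OF _ W1'] on[OF _ W2] on[OF _ W2'] on[OF _ W3] on[OF _ W4] on[OF _ this(1)] on[OF _ this(2)] on[OF _ W9]
   have "onlytgt k h" if hx: "h \<in> set (cswaps \<kappa> (zip [0..<k] (dsts (o1 + 2 * p) k)))" for h
   proof -
    obtain a b where ab: "(a, b) \<in> set (zip [0..<k] (dsts (o1 + 2 * p) k))" "h = CNot b a \<or> h = Toffoli \<kappa> a b"
     using set_cswaps[OF hx] by auto
    then show ?thesis using zk[OF ab(1)] \<kappa>k by (auto simp: onlytgt_def)
   qed
   moreover have "onlytgt k (PauliX e)" "onlytgt k (Had e4)" "onlytgt k (Toffoli \<kappa> e4 k)"
    using \<kappa>k par by (auto simp: onlytgt_def)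
   then have "onlytgt k h" if "h \<in> {PauliX e, Had e4, Toffoli \<kappa> e4 k}" for h using that by blast
   ultimately show ?thesis
    using split o wf4[OF _ par(2,4)] wf4[OF _ o2(1) ko2] by metis
  qed
  ultimately show ?thesis by blast
 qed
 then show ?thesis using e'(1) o3(1) eo wf by (auto simp: m_def)
qed

lemma slots_wf:
 assumes g: "wf_circuit g" and C: "\<And>j. wf_circuit (C j)" and sl: "slots g C k r S xs e o1 gs e' o3"
  and par: "even e" "odd o1" "k < e" "k < o1"
 shows "even e' \<and> odd o3 \<and> e \<le> e' \<and> o1 \<le> o3 \<and> (\<forall>h\<in>set gs. wfg h) \<and>
  (length (outs g) = k --> WL gs \<subseteq> {..k} \<union> zone e e' o1 o3 \<and> (\<forall>h\<in>set gs. onlytgt k h))"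
 using sl par
proof (induction xs arbitrary: e o1 gs)
 case (Cons x xs)
 obtain pre post where x: "x = (pre, post)" by force
 obtain gs1 e1 o2 gs2 where 1: "slot g (C (length (outs g) * (length pre + 1 + length post))) k r S pre post e o1 gs1 e1 o2"
  "slots g C k r S xs e1 o2 gs2 e' o3" "gs = gs1 @ gs2" using Cons.prems(1) x by auto
 note w = slot_wf[OF g C 1(1) Cons.prems(2-)]
 have w2: "even e' \<and> odd o3 \<and> e1 \<le> e' \<and> o2 \<le> o3 \<and> (\<forall>h\<in>set gs2. wfg h) \<and>
  (length (outs g) = k --> WL gs2 \<subseteq> {..k} \<union> zone e1 e' o2 o3 \<and> (\<forall>h\<in>set gs2. onlytgt k h))"
  by (rule Cons.IH[OF 1(2)]) (use w Cons.prems in auto)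
 have "zone e e1 o1 o2 \<subseteq> zone e e' o1 o3" "zone e1 e' o2 o3 \<subseteq> zone e e' o1 o3"
  by (rule zone_mono; use w w2 in simp)+
 then have "length (outs g) = k --> WL (gs1 @ gs2) \<subseteq> {..k} \<union> zone e e' o1 o3 \<and> (\<forall>h\<in>set (gs1 @ gs2). onlytgt k h)"
  using w w2 unfolding WL_simps set_append by blast
 moreover have "\<forall>h\<in>set (gs1 @ gs2). wfg h" using w w2 unfolding set_append by blast
 ultimately show ?case using w w2 unfolding 1(3) by linarith
qed auto

section \<open>The value of all slots together\<close>

fun Fv :: "real => (real \<times> real) list => bool => real" where
 "Fv p [] b = 1"
| "Fv p ((u, v) # xs) b = (1 - p) * Fv p xs b + p * ((if b then v else u) * ((u - v) / 2)) * Fv p xs False"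

definition slotvals :: "circuit => (nat => circuit) => bool list => (bool list \<times> bool list) list => (real \<times> real) list" where
 "slotvals g C S xs = map (%(pre, post). let c = C (length (outs g) * (length pre + 1 + length post)) in
   (slotval g c S pre post False, slotval g c S pre post True)) xs"

text \<open>An inactive slot passes the challenge on, an active slot consumes it and leaves a sample
  for \<open>False\<close>. This is the recursion of \<open>Fv\<close>, with \<open>gs0\<close>
  generalised to any source on the challenge register.\<close>

lemma slots_value:
 assumes g: "wf_circuit g" "length (outs g) = k" and C: "\<And>j. wf_circuit (C j)" and sl: "slots g C k r S xs e o1 gs e' o3"
  and par: "even e" "odd o1" "k < e" "k < o1"
  and src: "source gs0 [0..<k] (qstate g b)" "WL gs0 \<inter> zone e e' o1 o3 = {}" "k \<notin> WL gs0" "WL gs0 \<subseteq> {..<k} \<union> {w. even w}"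
 shows "ex (gs0 @ gs) (%s. sg (s k)) = Fv (1 / 2 ^ r) (slotvals g C S xs) b"
 using sl par src
proof (induction xs arbitrary: e o1 gs gs0 b)
 case Nil
 have "ex (gs0 @ []) (%s. 1 * sg (s k)) = ex gs0 (%_. 1) * ex [] (%s. sg (s k))"
  by (rule ex_prod) (use Nil in \<open>auto simp: indep_def\<close>)
 also have "ex gs0 (%_. 1) = 1" using Nil by (intro ex_const) (auto simp: source_def)
 also have "ex [] (%s. sg (s k)) = 1" by (simp add: ex_def st_def ground_def)
 finally show ?case using Nil by (simp add: slotvals_def)
next
 case (Cons x xs)
 obtain pre post where x: "x = (pre, post)" by force
 define c where "c = C (length (outs g) * (length pre + 1 + length post))"
 obtain gs1 e1 o2 gs2 where 1: "slot g c k r S pre post e o1 gs1 e1 o2"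
  "slots g C k r S xs e1 o2 gs2 e' o3" "gs = gs1 @ gs2" using Cons.prems(1) x by (auto simp: c_def)
 have c: "wf_circuit c" by (simp add: c_def C)
 note w = slot_wf[OF g(1) c 1(1) Cons.prems(2-5)]
 have w2: "e1 \<le> e'" "o2 \<le> o3" "\<forall>h\<in>set gs2. wfg h" "WL gs2 \<subseteq> {..k} \<union> zone e1 e' o2 o3" "\<forall>h\<in>set gs2. onlytgt k h"
  using slots_wf[OF g(1) C 1(2)] w Cons.prems(2-5) g(2) by auto
 obtain hs where hs: "source hs [0..<k] (qstate g False)" "WL hs \<inter> zone e1 e' o2 o3 = {}" "k \<notin> WL hs" "WL hs \<subseteq> {..<k} \<union> {w. even w}"
  and v: "ex (gs0 @ gs1 @ gs2) (%s. sg (s k)) = (1 - 1 / 2 ^ r) * ex (gs0 @ gs2) (%s. sg (s k)) +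
   (1 / 2 ^ r) * (slotval g c S pre post b * ((slotval g c S pre post False - slotval g c S pre post True) / 2)) *
   ex (hs @ gs2) (%s. sg (s k))"
  using slot_step[OF g c 1(1) Cons.prems(2-9) w2(4,5,1,2,3)] by blast
 have p: "even e1" "odd o2" "k < e1" "k < o2" using w Cons.prems(4,5) by auto
 have "zone e1 e' o2 o3 \<subseteq> zone e e' o1 o3" using w by (intro zone_mono) auto
 then have "WL gs0 \<inter> zone e1 e' o2 o3 = {}" using Cons.prems(7) by blast
 from Cons.IH[OF 1(2) p Cons.prems(6) this Cons.prems(8,9)] Cons.IH[OF 1(2) p hs]
 show ?case unfolding 1(3) v by (auto simp: slotvals_def x Let_def c_def)
qed

lemma ex_abs_le:
 assumes "\<forall>g\<in>set gs. wfg g" "\<And>s. \<bar>E s\<bar> \<le> 1"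
 shows "\<bar>ex gs E\<bar> \<le> 1"
proof -
 have "\<bar>ex gs E\<bar> \<le> (\<Sum>s\<in>AsgOn (WL gs). \<bar>E s * (cmod (st gs s))\<^sup>2\<bar>)" unfolding ex_def by (rule sum_abs)
 also have "\<dots> \<le> (\<Sum>s\<in>AsgOn (WL gs). 1 * (cmod (st gs s))\<^sup>2)"
  by (intro sum_mono) (use assms(2) in \<open>simp add: abs_mult mult_left_le_one_le\<close>)
 also have "\<dots> = 1" using ex_const[OF assms(1), of 1] by (simp add: ex_def)
 finally show ?thesis .
qed

lemma prob_slots:
 assumes g: "wf_circuit g" "length (outs g) = k" and C: "\<And>j. wf_circuit (C j)" and sl: "slots g C k r S xs e o1 gs e' o3"
  and par: "even e" "odd o1" "k < e" "k < o1"
 shows "Re (run_circuit k (Circuit gs [k]) (qstate g b) $$ (1, 1)) = (1 - Fv (1 / 2 ^ r) (slotvals g C S xs) b) / 2"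
proof -
 let ?c = "Circuit gs [k]"
 define B where "B = 2 * (e' + o3 + k + 1)"
 define gs0 where "gs0 = copyg g (xp b (pf B 0)) (pf B) [0..<k]"
 have d: "set [0..<k] \<inter> range (pf B) = {}" by (auto simp: pf_def B_def)
 have src: "source gs0 [0..<k] (qstate g b)"
  unfolding gs0_def qstate_def by (rule source_copyg[OF g(1) inj_pf _ _ d]) (use g(2) in auto)
 have W0: "WL gs0 \<subseteq> {..<k} \<union> {w. even w \<and> B \<le> w}"
  using WL_copyg[of g "xp b (pf B 0)" "pf B" "[0..<k]"] unfolding gs0_def by (auto simp: pf_def B_def split: if_splits)
 have w: "WL gs \<subseteq> {..k} \<union> zone e e' o1 o3" "\<forall>h\<in>set gs. wfg h" "e \<le> e'" "o1 \<le> o3" using slots_wf[OF g(1) C sl par] g(2) by auto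
 have v: "ex (gs0 @ gs) (%s. sg (s k)) = Fv (1 / 2 ^ r) (slotvals g C S xs) b"
 proof (rule slots_value[OF g C sl par src])
  have "({..<k} \<union> {w. even w \<and> B \<le> w}) \<inter> zone e e' o1 o3 = {}"
   using par by (auto simp: B_def zone_def)
  then show "WL gs0 \<inter> zone e e' o1 o3 = {}" using W0 by blast
  have "k \<notin> {..<k} \<union> {w. even w \<and> B \<le> w}" by (simp add: B_def)
  then show "k \<notin> WL gs0" using W0 by blast
 qed (use W0 in blast)
 define f where "f w = (if w < B then w else 2 * w + 1)" for w
 have f: "inj f" by (rule injI) (auto simp: f_def split: if_splits)
 have ws: "x < B" if "x \<in> WL gs" for x
  using that w by (auto simp: B_def zone_def)
 have fi: "map (map_gate f) gs = gs"
  by (rule map_idI, rule gate.map_ident_strong) (use ws in \<open>auto simp: f_def WL_def\<close>)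
 have wfc: "wf_circuit ?c" using w(2) by (auto simp: wf_circuit_def wfg_def)
 have anc: "WL gs0 \<inter> f ` {k..} = {}"
 proof (rule equals0I)
  fix x assume "x \<in> WL gs0 \<inter> f ` {k..}"
  then obtain y where y: "f y \<in> WL gs0" "k \<le> y" by auto
  have "f y < k \<or> (even (f y) \<and> B \<le> f y)" using W0 y(1) by auto
  then show False using y(2) by (auto simp: f_def split: if_splits)
 qed
 have fk: "map f [0..<k] = [0..<k]" "map f [k] = [k]" by (auto simp: f_def B_def intro!: map_idI)
 have "red (gs0 @ map (map_gate f) (gates ?c)) (map f (outs ?c)) = run_circuit k ?c (red gs0 (map f [0..<k]))"
  by (rule red_run[OF wfc f anc])
 then have R: "red (gs0 @ gs) [k] = run_circuit k ?c (qstate g b)"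
  using src fi fk by (simp add: source_def)
 have s2: "(\<Sum>a<2 ^ length [k]. h a) = h 0 + h 1" for h :: "nat => real"
  by (simp add: numeral_2_eq_2)
 have w0: "\<forall>h\<in>set (gs0 @ gs). wfg h" using src w(2) by (auto simp: source_def)
 have tr: "Re (red (gs0 @ gs) [k] $$ (0, 0)) + Re (red (gs0 @ gs) [k] $$ (1, 1)) = 1"
  using ex_red[of "[k]" "gs0 @ gs" "%_. 1"] ex_const[OF w0, of 1] s2 by simp
 have "(rd [k] s = 1) = s k" for s by (simp add: rd_def index_of_def)
 then have "ex (gs0 @ gs) (%s. sg (s k)) = ex (gs0 @ gs) (%s. sg (rd [k] s = 1))" by (simp only:)
 also have "\<dots> = Re (red (gs0 @ gs) [k] $$ (0, 0)) - Re (red (gs0 @ gs) [k] $$ (1, 1))"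
  using ex_red[of "[k]" "gs0 @ gs" "%a. sg (a = 1)"] s2 by simp
 finally show ?thesis using tr v R by simp
qed


lemma copies_exist: "\<exists>gs e'. copies g bs e d gs e'"
proof (induction bs arbitrary: e d)
 case (Cons b bs)
 have "finite (WL (gates g) \<union> set (outs g))" by simp
 then obtain M where M: "\<And>w. w \<in> WL (gates g) \<union> set (outs g) ==> w \<le> M"
  unfolding finite_nat_set_iff_bounded_le by blast
 define e1 where "e1 = e + 2 * Suc M"
 have "fits g e e1" unfolding fits_def
 proof (intro conjI ballI)
  fix w assume "w \<in> WL (gates g) \<union> set (outs g)"
  from M[OF this] show "e + 2 * w < e1" by (simp add: e1_def)
 qed (simp_all add: e1_def)
 obtain hs e' where "copies g bs e1 (d + 2 * length (outs g)) hs e'" using Cons by blast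
 then have "copies g (b # bs) e d (copyg g (xp b e) (pf e) (dsts d (length (outs g))) @ hs) e'"
  using \<open>fits g e e1\<close> by auto
 then show ?case by blast
next
 case Nil
 show ?case by (rule exI[of _ "[]"], rule exI[of _ e]) simp
qed

text \<open>The output on copies of the states is realised as the measurement of one gate list, so
  normalisation and bounds follow from those for \<open>ex\<close>.\<close>

lemma output_distribution:
 assumes g: "wf_circuit g" and c: "wf_circuit c" and k: "k = length (outs g) * length bs"
 shows "\<exists>gs ws. (\<forall>h\<in>set gs. wfg h) \<and> distinct ws \<and> length ws = length (outs c) \<and>
  (\<forall>F. (\<Sum>a<2 ^ length (outs c). F a * Re (run_circuit k c (klist (map (qstate g) bs)) $$ (a, a))) = ex gs (%s. F (rd ws s)))"
proof -
 obtain hs e' where h: "copies g bs 0 1 hs e'" using copies_exist by blast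
 have s: "WL hs \<subseteq> zone 0 e' 1 (1 + 2 * k)" "source hs (dsts 1 k) (klist (map (qstate g) bs))"
  using copies_source[OF g _ _ h] by (auto simp: k)
 let ?gs = "hs @ map (map_gate (pf 1)) (gates c)" and ?ws = "map (pf 1) (outs c)"
 have "zone 0 e' 1 (1 + 2 * k) \<inter> pf 1 ` {k..} = {}" by (auto simp: zone_def pf_def)
 then have "WL hs \<inter> pf 1 ` {k..} = {}" using s(1) by blast
 from red_run[OF c inj_pf this] have R: "red ?gs ?ws = run_circuit k c (klist (map (qstate g) bs))"
  using s(2) unfolding dsts_pf source_def by simp
 have d: "distinct ?ws" using c inj_on_subset[OF inj_pf subset_UNIV] by (simp add: wf_circuit_def distinct_map)
 have "\<forall>h\<in>set ?gs. wfg h" using s(2) wfg_map[OF inj_pf] wfg_gates[OF c] by (auto simp: source_def)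
 moreover have "(\<Sum>a<2 ^ length (outs c). F a * Re (run_circuit k c (klist (map (qstate g) bs)) $$ (a, a))) = ex ?gs (%s. F (rd ?ws s))" for F
  using ex_red[OF d, of ?gs F] R by simp
 ultimately show ?thesis using d by (intro exI[of _ ?gs] exI[of _ ?ws]) simp
qed

lemma uval_abs_le:
 assumes "wf_circuit g" "wf_circuit c" "k = length (outs g) * length bs"
 shows "\<bar>uval c k S (klist (map (qstate g) bs))\<bar> \<le> 1"
proof -
 obtain gs ws where 1: "\<forall>h\<in>set gs. wfg h" 
  "\<forall>F. (\<Sum>a<2 ^ length (outs c). F a * Re (run_circuit k c (klist (map (qstate g) bs)) $$ (a, a))) = ex gs (%s. F (rd ws s))"
  using output_distribution[OF assms] by blast
 have "\<bar>chi S xs\<bar> \<le> 1" for xs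
 proof (induction S xs rule: list_induct2')
  case (4 q S x xs)
  then show ?case by (cases q; cases x) (auto simp: chi_def)
 qed (auto simp: chi_def)
 then have "\<bar>ex gs (%s. chi S (map (bit (rd ws s)) [0..<length (outs c)]))\<bar> \<le> 1"
  by (intro ex_abs_le[OF 1(1)])
 then show ?thesis unfolding uval_def using 1(2)[rule_format, of "%a. chi S (map (bit a) [0..<length (outs c)])"] by simp
qed

lemma slotval_abs_le: "wf_circuit g ==> wf_circuit c ==> \<bar>slotval g c S pre post b\<bar> \<le> 1"
 unfolding slotval_def by (rule uval_abs_le) auto

text \<open>At \<open>b = False\<close> a slot multiplies the value by
  \<open>(1 - p) + p * x\<close> with \<open>\<bar>x\<bar> \<le> 1\<close>, which is at least
  \<open>1 - 2 * p\<close>.\<close>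

lemma Fv_False_ge:
 assumes "0 \<le> p" "p \<le> 1 / 2" "\<forall>(u, v)\<in>set xs. \<bar>u\<bar> \<le> 1 \<and> \<bar>v\<bar> \<le> 1"
 shows "(1 - 2 * p) ^ length xs \<le> Fv p xs False"
 using assms(3)
proof (induction xs)
 case (Cons x xs)
 obtain u v where x: "x = (u, v)" by force
 have uv: "\<bar>u\<bar> \<le> 1" "\<bar>v\<bar> \<le> 1" using Cons.prems x by auto
 have IH: "(1 - 2 * p) ^ length xs \<le> Fv p xs False" using Cons by auto
 have "0 \<le> (1 - 2 * p) ^ length xs" using assms(2) by simp
 then have F: "0 \<le> Fv p xs False" using IH by linarith
 have "\<bar>u * ((u - v) / 2)\<bar> \<le> 1 * 1" unfolding abs_mult by (intro mult_mono) (use uv in auto)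
 then have "- 1 \<le> u * ((u - v) / 2)" by linarith
 then have "p * - 1 \<le> p * (u * ((u - v) / 2))" using assms(1) by (intro mult_left_mono)
 then have "(1 - 2 * p) * Fv p xs False \<le> ((1 - p) + p * (u * ((u - v) / 2))) * Fv p xs False"
  using F by (intro mult_right_mono) auto
 also have "\<dots> = Fv p (x # xs) False" by (simp add: x distrib_right)
 finally show ?case using mult_left_mono[OF IH, of "1 - 2 * p"] assms(2) by simp
qed simp

text \<open>For the difference \<open>D\<close> the recursion is
  \<open>(1 - p) * D + p * (u - v)\<^sup>2 / 2 * Fv p xs False\<close>, because the value after an
  active slot is the same for both challenges. All terms are nonnegative, so any one slot bounds the
  total from below; the other slots cost at most factors \<open>1 - 2 * p\<close>.\<close>

lemma Fv_diff:
 assumes "0 \<le> p" "p \<le> 1 / 2" "\<forall>(u, v)\<in>set xs. \<bar>u\<bar> \<le> 1 \<and> \<bar>v\<bar> \<le> 1"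
 shows "0 \<le> Fv p xs False - Fv p xs True \<and>
  (\<forall>(u, v)\<in>set xs. p * (u - v)\<^sup>2 / 2 * (1 - 2 * p) ^ length xs \<le> Fv p xs False - Fv p xs True)"
 using assms(3)
proof (induction xs)
 case (Cons x xs)
 obtain u v where x: "x = (u, v)" by force
 have xs: "\<forall>(u, v)\<in>set xs. \<bar>u\<bar> \<le> 1 \<and> \<bar>v\<bar> \<le> 1" using Cons.prems by auto
 let ?D = "Fv p xs False - Fv p xs True"
 have IH: "0 \<le> ?D" "\<forall>(u, v)\<in>set xs. p * (u - v)\<^sup>2 / 2 * (1 - 2 * p) ^ length xs \<le> ?D"
  using Cons.IH[OF xs] by auto
 have e: "Fv p (x # xs) False - Fv p (x # xs) True = (1 - p) * ?D + p * (u - v)\<^sup>2 / 2 * Fv p xs False"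
  by (simp add: x power2_eq_square field_simps)
 have F: "(1 - 2 * p) ^ length xs \<le> Fv p xs False" by (rule Fv_False_ge[OF assms(1,2) xs])
 have q: "0 \<le> (1 - 2 * p) ^ length xs" using assms(2) by simp
 have n: "0 \<le> (1 - p) * ?D" "0 \<le> p * (u - v)\<^sup>2 / 2 * Fv p xs False"
  using IH(1) assms(1,2) order_trans[OF q F] by (auto intro!: mult_nonneg_nonneg)
 have h: "p * (u - v)\<^sup>2 / 2 * (1 - 2 * p) ^ length (x # xs) \<le> p * (u - v)\<^sup>2 / 2 * Fv p xs False"
 proof (rule mult_left_mono)
  have "(1 - 2 * p) * (1 - 2 * p) ^ length xs \<le> 1 * (1 - 2 * p) ^ length xs"
   using q assms by (intro mult_right_mono) auto
  then show "(1 - 2 * p) ^ length (x # xs) \<le> Fv p xs False" using F by simp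
 qed (use assms(1) in simp)
 have t: "p * (u' - v')\<^sup>2 / 2 * (1 - 2 * p) ^ length (x # xs) \<le> (1 - p) * ?D" if "(u', v') \<in> set xs" for u' v'
 proof -
  have "p * (u' - v')\<^sup>2 / 2 * (1 - 2 * p) ^ length (x # xs) = (1 - 2 * p) * (p * (u' - v')\<^sup>2 / 2 * (1 - 2 * p) ^ length xs)"
   by simp
  also have "\<dots> \<le> (1 - p) * ?D"
   by (rule mult_mono) (use IH that assms q in auto)
  finally show ?thesis .
 qed
 show ?case unfolding e
 proof (intro conjI ballI)
  fix y assume "y \<in> set (x # xs)"
  moreover obtain u' v' where "y = (u', v')" by force
  ultimately consider "y = (u', v')" "u' = u" "v' = v" | "y = (u', v')" "(u', v') \<in> set xs" using x by auto
  then show "case y of (u', v') => p * (u' - v')\<^sup>2 / 2 * (1 - 2 * p) ^ length (x # xs) \<le> (1 - p) * ?D + p * (u - v)\<^sup>2 / 2 * Fv p xs False"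
  proof cases
   case 1
   then show ?thesis using h n(1) by simp
  next
   case 2
   then show ?thesis using t[OF 2(2)] n(2) by simp
  qed
 qed (use n in linarith)
qed simp


section \<open>The pair algorithm and the sampler as circuits\<close>

lemma index_of_append: "index_of (xs @ ys) = index_of xs + 2 ^ length xs * index_of ys"
 by (induction xs) (simp_all add: index_of_def algebra_simps)

lemma basis_state_append: "basis_state (xs @ ys) = kron (basis_state ys) (basis_state xs)"
proof (rule eq_matI)
 fix i j assume "i < dim_row (kron (basis_state ys) (basis_state xs))" "j < dim_col (kron (basis_state ys) (basis_state xs))"
 then have ij: "i < 2 ^ length ys * 2 ^ length xs" "j < 2 ^ length ys * 2 ^ length xs" by (auto simp: basis_state_def)
 have e: "(x = index_of (xs @ ys)) = (x div 2 ^ length xs = index_of ys \<and> x mod 2 ^ length xs = index_of xs)" for x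
 proof
  assume "x = index_of (xs @ ys)"
  then show "x div 2 ^ length xs = index_of ys \<and> x mod 2 ^ length xs = index_of xs"
   using index_of_less[of xs] by (simp add: index_of_append)
 next
  assume a: "x div 2 ^ length xs = index_of ys \<and> x mod 2 ^ length xs = index_of xs"
  have "x = 2 ^ length xs * (x div 2 ^ length xs) + x mod 2 ^ length xs" by simp
  then show "x = index_of (xs @ ys)" using a by (simp add: index_of_append)
 qed
 have d: "x div 2 ^ length xs < 2 ^ length ys" "x mod 2 ^ length xs < 2 ^ length xs" if "x < 2 ^ length ys * 2 ^ length xs" for x :: nat
  using that by (auto simp: less_mult_imp_div_less)
 show "basis_state (xs @ ys) $$ (i, j) = kron (basis_state ys) (basis_state xs) $$ (i, j)"
  using ij d[OF ij(1)] d[OF ij(2)] e[of i] e[of j]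
  by (auto simp: kron_def basis_state_def power_add mult.commute)
qed (auto simp: basis_state_def power_add)

text \<open>Wire \<open>a\<close> carries the classical value \<open>b\<close> and is not touched by
  \<open>X\<close>, so the control can be evaluated in place.\<close>

lemma st_known_control:
 assumes "a \<notin> WL X" "a ~= t"
 shows "st (xp b a @ X @ CNot a t # Y) = st (xp b a @ X @ xp b t @ Y)"
proof -
 let ?\<psi> = "waves X (waves (xp b a) ground)"
 have z: "?\<psi> s = 0" if "s a ~= b" for s
 proof (rule waves_zero[where k = a and v = b])
  show "\<forall>g\<in>set X. nontarget a g" by (rule nontarget_WL[OF assms(1)])
  show "s a ~= b" by (rule that)
  show "waves (xp b a) ground s = 0" if "s a ~= b" for s
   using that by (cases b) (auto simp: xp_def intro!: ground_zero[of _ a])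
 qed
 have "gap (CNot a t) ?\<psi> s = waves (xp b t) ?\<psi> s" for s
 proof (cases "s a = b")
  case True
  then show ?thesis by (cases b) (simp_all add: xp_def)
 next
  case False
  then have "(s(t := u)) a ~= b" for u using assms(2) by simp
  then show ?thesis using z z[of s] False by (cases b) (simp_all add: xp_def del: fun_upd_apply)
 qed
 then have "gap (CNot a t) ?\<psi> = waves (xp b t) ?\<psi>" by blast
 then show ?thesis by (simp add: st_def del: gap.simps)
qed

lemma red_copy:
 assumes "wf_circuit g" "inj f"
 shows "red (xp b (f 0) @ map (map_gate f) (gates g)) (map f (outs g)) = qstate g b"
proof -
 have "red (xp b (f 0) @ map (map_gate f) (gates g)) (map f (outs g)) = run_circuit 1 g (red (xp b (f 0)) (map f [0..<1]))"
  by (rule red_run[OF assms]) (use assms(2) in \<open>auto simp: inj_eq\<close>)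
 then show ?thesis by (simp add: red_xp qstate_def)
qed

text \<open>The inputs arrive on wires \<open>0\<close> and \<open>1\<close>. The
  \<open>CNot\<close> gates copy them to the input wires of two displaced runs of \<open>g\<close>,
  which leave the original wires alone.\<close>

definition pairc :: "circuit => nat => nat => circuit" where
 "pairc g B B' = Circuit (CNot 0 B # map (map_gate (pf B)) (gates g) @ CNot 1 B' # map (map_gate (pf B')) (gates g))
   (map (pf B) (outs g) @ map (pf B') (outs g))"

lemma pairc_facts:
 assumes g: "wf_circuit g" and f: "fits g B B'" and B: "even B" "2 \<le> B"
 shows "wf_circuit (pairc g B B')" "run_circuit 2 (pairc g B B') (basis_state [x1, x2]) = kron (qstate g x2) (qstate g x1)"
proof -
 have B': "even B'" "B < B'" using f B by (auto simp: fits_def)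
 have lt: "w \<in> WL (gates g) \<union> set (outs g) ==> B \<le> pf B w \<and> pf B w < B'" "B' \<le> pf B' w" for w
  using f by (auto simp: fits_def pf_def)
 let ?A = "%B. map (map_gate (pf B)) (gates g)" and ?o = "%B. map (pf B) (outs g)"
 have d: "distinct (?o B)" for B using g inj_on_subset[OF inj_pf subset_UNIV] by (simp add: wf_circuit_def distinct_map)
 have oB: "B \<le> x \<and> x < B'" if "x \<in> set (?o B)" for x using that lt(1) by auto
 have oB': "B' \<le> x" if "x \<in> set (?o B')" for x using that lt(2) by auto
 have dj: "set (?o B) \<inter> set (?o B') = {}" using oB oB' by (meson disjoint_iff not_le)
 have wA: "\<forall>h\<in>set (?A B). wfg h" for B using wfg_map[OF inj_pf] wfg_gates[OF g] by auto
 have "distinct (outs (pairc g B B'))" using d dj by (simp add: pairc_def)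
 moreover have "\<forall>h\<in>set (gates (pairc g B B')). distinct (gate_wires h)"
  using wA B B' unfolding pairc_def wfg_def by auto
 ultimately show wf: "wf_circuit (pairc g B B')" by (simp add: wf_circuit_def)
 have WA: "WL (?A B) \<subseteq> {B..<B'}" "WL (?A B') \<subseteq> {B'..}"
  unfolding WL_map_gate using lt by auto
 have nb: "0 \<notin> WL (?A B)" "1 \<notin> WL (?A B)" "0 ~= B" "1 ~= B'" "0 ~= B'" "1 ~= B"
  using WA(1) B B' by auto
 let ?c = "pairc g B B'"
 let ?h = "xp x1 0 @ xp x2 1"
 have "red (?h @ map (map_gate id) (gates ?c)) (map id (outs ?c)) = run_circuit 2 ?c (red ?h (map id [0..<2]))"
  by (rule red_run[OF wf inj_on_id]) auto
 moreover have "red ?h (map id [0..<2]) = basis_state [x1, x2]"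
 proof -
  have "red ?h ([0] @ [1]) = kron (red (xp x2 1) [1]) (red (xp x1 0) [0])"
   by (rule red_par) auto
  then show ?thesis using basis_state_append[of "[x1]" "[x2]"] by (simp add: red_xp numeral_2_eq_2)
 qed
 ultimately have R: "run_circuit 2 ?c (basis_state [x1, x2]) = red (?h @ gates ?c) (outs ?c)"
  by (simp add: gate.map_id0 gate.map_id)
 have "st (?h @ gates ?c) = st (xp x1 0 @ xp x2 1 @ xp x1 B @ ?A B @ CNot 1 B' # ?A B')"
  using st_known_control[of 0 "xp x2 1" B x1 "?A B @ CNot 1 B' # ?A B'"] nb by (simp add: pairc_def)
 also have "\<dots> = st (xp x2 1 @ (xp x1 0 @ xp x1 B @ ?A B) @ CNot 1 B' # ?A B')"
  using st_commute[of "xp x1 0" "xp x2 1" "[]" "xp x1 B @ ?A B @ CNot 1 B' # ?A B'"] by simp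
 also have "\<dots> = st (xp x2 1 @ (xp x1 0 @ xp x1 B @ ?A B) @ xp x2 B' @ ?A B')"
  by (rule st_known_control) (use nb in auto)
 also have "\<dots> = st ((xp x2 1 @ xp x1 0) @ (xp x1 B @ ?A B) @ (xp x2 B' @ ?A B'))" by simp
 finally have "red (?h @ gates ?c) (outs ?c) = red ((xp x2 1 @ xp x1 0) @ (xp x1 B @ ?A B) @ (xp x2 B' @ ?A B')) (?o B @ ?o B')"
  by (subst red_cong) (auto simp: pairc_def)
 also have "\<dots> = red ((xp x1 B @ ?A B) @ (xp x2 B' @ ?A B')) (?o B @ ?o B')"
 proof (rule red_extra)
  have "set (?o B) \<union> set (?o B') \<subseteq> {B..}" using oB order_trans[OF less_imp_le[OF B'(2)] oB'] by auto
  then show "WL (xp x2 1 @ xp x1 0) \<inter> (WL ((xp x1 B @ ?A B) @ xp x2 B' @ ?A B') \<union> set (?o B @ ?o B')) = {}"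
   using WA B B' by (auto split: if_splits)
 qed auto
 also have "\<dots> = kron (red (xp x2 B' @ ?A B') (?o B')) (red (xp x1 B @ ?A B) (?o B))"
 proof (rule red_par)
  have "WL (xp x1 B @ ?A B) \<union> set (?o B) \<subseteq> {B..<B'}" "WL (xp x2 B' @ ?A B') \<union> set (?o B') \<subseteq> {B'..}"
   using oB oB' WA B' by (auto split: if_splits)
  moreover have "{B..<B'} \<inter> {B'..} = {}" by auto
  ultimately show "(WL (xp x1 B @ ?A B) \<union> set (?o B)) \<inter> (WL (xp x2 B' @ ?A B') \<union> set (?o B')) = {}" by blast
 qed
 also have "\<dots> = kron (qstate g x2) (qstate g x1)"
  using red_copy[OF g inj_pf] by (simp add: pf_zero)
 finally show "run_circuit 2 ?c (basis_state [x1, x2]) = kron (qstate g x2) (qstate g x1)" using R by simp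
qed

lemma run_circuit_dims: "run_circuit k c \<rho> \<in> carrier_mat (2 ^ length (outs c)) (2 ^ length (outs c))"
 by (simp add: run_circuit_def Let_def reduced_state_def)

lemma red_Had: "a < 2 ==> red [Had w] [w] $$ (a, a) = 1 / 2"
proof -
 assume a: "a < 2"
 have 1: "AsgOn (WL [Had w] - set [w]) = {%_. False}" by simp
 let ?s = "join (%_. False) (wr [w] a)"
 have s: "?s(w := False) = (%_. False)" by (rule ext) (simp add: join_def wr_def)
 have "st [Had w] ?s = 1 / complex_of_real (sqrt 2)"
  unfolding st_def by (simp add: s ground_zero[of "?s(w := True)" w]) (simp add: ground_def)
 then have "red [Had w] [w] $$ (a, a) = (1 / complex_of_real (sqrt 2)) * cnj (1 / complex_of_real (sqrt 2))"
  using a unfolding red_def 1 by simp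
 also have "\<dots> = 1 / (complex_of_real (sqrt 2) * complex_of_real (sqrt 2))"
  by (simp only: complex_cnj_divide complex_cnj_one complex_cnj_complex_of_real times_divide_times_eq mult_1_left)
 also have "complex_of_real (sqrt 2) * complex_of_real (sqrt 2) = 2"
  by (metis abs_numeral of_real_mult of_real_numeral real_sqrt_mult_self)
 finally show ?thesis .
qed

lemma coin_distribution:
 assumes "length x = 2"
 shows "Re (run_circuit 0 (Circuit [Had 0, Had 1] [0, 1]) (basis_state []) $$ (index_of x, index_of x)) = 1 / 4"
proof -
 let ?c = "Circuit [Had 0, Had 1] [0, 1]"
 have b: "basis_state [] = 1\<^sub>m 1" by (rule eq_matI) (auto simp: basis_state_def index_of_def)
 have "red ([] @ map (map_gate id) (gates ?c)) (map id (outs ?c)) = run_circuit 0 ?c (red [] (map id [0..<0]))"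
  by (rule red_run) (auto simp: wf_circuit_def)
 then have "run_circuit 0 ?c (basis_state []) = red ([Had 0] @ [Had 1]) ([0] @ [1])"
  by (simp add: b red_nil)
 also have "\<dots> = kron (red [Had 1] [1]) (red [Had 0] [0])" by (rule red_par) auto
 finally have R: "run_circuit 0 ?c (basis_state []) = kron (red [Had 1] [1]) (red [Had 0] [0])" .
 have i: "index_of x < 4" using index_of_less[of x] assms by simp
 then have "index_of x div 2 < 2" "index_of x mod 2 < 2" by auto
 then show ?thesis using i unfolding R kron_def by (simp add: red_Had del: One_nat_def)
qed


section \<open>Stack programs and their running time\<close>

definition reach :: "prog => config => config => nat => bool" where
 "reach P a b T \<longleftrightarrow> (\<exists>T'\<le>T. exec P a T' b)"

lemma reach_mono: "reach P a b T ==> T \<le> T' ==> reach P a b T'"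
 unfolding reach_def by (meson le_trans)

lemma reach_Seq: "reach P a b m ==> reach Q b d n ==> reach (Seq P Q) a d (m + n)"
 unfolding reach_def by (meson add_mono exec_Seq)

lemma reach_Push: "reach (Push v b) (s, c) (s(v := b # s v), c) 1"
 unfolding reach_def using exec_Push by blast

lemma reach_Push': "s' = s(v := b # s v) ==> reach (Push v b) (s, c) (s', c) 1"
 by (simp only: reach_Push)

lemma reach_Pop: "reach (Pop v) (s, c) (s(v := tl (s v)), c) 1"
 unfolding reach_def using exec_Pop by blast

lemma reach_Pop': "s' = s(v := tl (s v)) ==> reach (Pop v) (s, c) (s', c) 1"
 by (simp only: reach_Pop)

lemma reach_Apply: "reach (Apply g) (s, Circuit gs os) (s, Circuit (gs @ [map_gate (%v. length (s v)) g]) os) 1"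
 unfolding reach_def using exec_Apply by blast

lemma reach_Output: "reach (Output v) (s, Circuit gs os) (s, Circuit gs (os @ [length (s v)])) 1"
 unfolding reach_def using exec_Output by blast

lemma reach_If_true: "holds t (fst a) ==> reach P a b m ==> reach (IfElse t P Q) a b (m + 1)"
 unfolding reach_def using exec_If_true by fastforce

lemma reach_If_false: "\<not> holds t (fst a) ==> reach Q a b m ==> reach (IfElse t P Q) a b (m + 1)"
 unfolding reach_def using exec_If_false by fastforce

lemma reach_While_false: "\<not> holds t (fst a) ==> reach (While t P) a a 1"
 unfolding reach_def using exec_While_false by blast

lemma reach_While_true: "holds t (fst a) ==> reach P a b m ==> reach (While t P) b d n ==> reach (While t P) a d (m + n + 1)"
 unfolding reach_def using exec_While_true by (metis Suc_eq_plus1 Suc_le_mono add_mono)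

definition skip :: prog where "skip = Seq (Push 2 True) (Pop 2)"

lemma reach_skip: "reach skip (s, c) (s, c) 2"
 unfolding skip_def using reach_mono[OF reach_Seq[OF reach_Push[of 2 True s c] reach_Pop[of 2]], of 2] by (simp add: fun_upd_idem)

definition for_loop :: "nat => prog => prog" where
 "for_loop v P = While (Nonempty v) (Seq (Pop v) P)"

text \<open>The index of the invariant counts completed iterations. An iteration costs
  \<open>B + 2\<close>, for the body, the test and the pop; the final test costs 1.\<close>

lemma reach_for:
 assumes "I 0 (s, c)" "length (s v) = n"
  and "\<And>i s c. i < n ==> I i (s, c) ==> length (s v) = n - i ==>
   \<exists>s' c'. reach P (s(v := tl (s v)), c) (s', c') B \<and> length (s' v) = n - Suc i \<and> I (Suc i) (s', c')"
 shows "\<exists>s' c'. reach (for_loop v P) (s, c) (s', c') (n * (B + 2) + 1) \<and> s' v = [] \<and> I n (s', c')"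
proof -
 have "\<exists>s' c'. reach (for_loop v P) (s, c) (s', c') (j * (B + 2) + 1) \<and> s' v = [] \<and> I n (s', c')"
  if "I (n - j) (s, c)" "length (s v) = j" "j \<le> n" for j s c
  using that
 proof (induction j arbitrary: s c)
  case 0
  have "exec (for_loop v P) (s, c) 1 (s, c)"
   unfolding for_loop_def by (rule exec_While_false) (use 0 in simp)
  then show ?case using 0 by (force simp: reach_def)
 next
  case (Suc j)
  have ne: "s v ~= []" using Suc.prems by auto
  obtain s' c' where 1: "reach P (s(v := tl (s v)), c) (s', c') B" "length (s' v) = n - Suc (n - Suc j)" "I (Suc (n - Suc j)) (s', c')"
   using assms(3)[of "n - Suc j" s c] Suc.prems by auto
  have e: "Suc (n - Suc j) = n - j" "n - Suc (n - Suc j) = j" using Suc.prems by auto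
  obtain s'' c'' where 2: "reach (for_loop v P) (s', c') (s'', c'') (j * (B + 2) + 1)" "s'' v = []" "I n (s'', c'')"
   using Suc.IH[of s' c'] 1 Suc.prems e by auto
  obtain T1 where T1: "T1 \<le> 1 + B" "exec (Seq (Pop v) P) (s, c) T1 (s', c')"
   using reach_Seq[OF reach_Pop 1(1)] unfolding reach_def by blast
  obtain T2 where T2: "T2 \<le> j * (B + 2) + 1" "exec (for_loop v P) (s', c') T2 (s'', c'')"
   using 2(1) unfolding reach_def by blast
  have "exec (for_loop v P) (s, c) (Suc (T1 + T2)) (s'', c'')"
   unfolding for_loop_def by (rule exec_While_true[OF _ T1(2)]) (use ne T2(2) in \<open>simp_all add: for_loop_def\<close>)
  moreover have "Suc (T1 + T2) \<le> Suc j * (B + 2) + 1" using T1(1) T2(1) by simp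
  ultimately have "reach (for_loop v P) (s, c) (s'', c'') (Suc j * (B + 2) + 1)" unfolding reach_def by blast
  then show ?case using 2 by blast
 qed
 from this[of n s c] show ?thesis using assms(1,2) by simp
qed

abbreviation un :: "nat => bool list" where "un n \<equiv> replicate n True"

text \<open>Reading a stack in unary destroys it, so its height passes through the scratch stack
  \<open>2\<close> and back. The height is added to that of \<open>b\<close>, not assigned.\<close>

definition copy :: "nat => nat => prog" where
 "copy a b = Seq (for_loop a (Seq (Push 2 True) (Push b True))) (for_loop 2 (Push a True))"

lemma un_tl: "tl (un n) = un (n - 1)"
 by simp

lemma reach_copy:
 assumes "s a = un x" "s b = un y" "s 2 = []" "a ~= b" "a ~= 2" "b ~= 2"
 shows "reach (copy a b) (s, c) (s(b := un (x + y)), c) (8 * x + 2)"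
proof -
 let ?I = "%i p. p = (s(a := un (x - i), 2 := un i, b := un (i + y)), c)"
 have "\<exists>s' c'. reach (for_loop a (Seq (Push 2 True) (Push b True))) (s, c) (s', c') (x * (2 + 2) + 1) \<and> s' a = [] \<and> ?I x (s', c')"
 proof (rule reach_for[where I = ?I])
  show "?I 0 (s, c)" using assms by (auto simp: fun_eq_iff)
  fix i s1 c1 assume i: "i < x" "?I i (s1, c1)"
  then have s1: "s1 = s(a := un (x - i), 2 := un i, b := un (i + y))" "c1 = c" by blast+
  have "reach (Seq (Push 2 True) (Push b True)) (s1(a := tl (s1 a)), c1) (s(a := un (x - Suc i), 2 := un (Suc i), b := un (Suc i + y)), c) (1 + 1)"
   unfolding s1 by (rule reach_Seq[OF reach_Push], rule reach_Push') (use i(1) assms in \<open>auto simp: fun_eq_iff un_tl\<close>)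
  moreover have "length ((s(a := un (x - Suc i), 2 := un (Suc i), b := un (Suc i + y))) a) = x - Suc i" using assms by simp
  ultimately show "\<exists>s' c'. reach (Seq (Push 2 True) (Push b True)) (s1(a := tl (s1 a)), c1) (s', c') 2 \<and> length (s' a) = x - Suc i \<and> ?I (Suc i) (s', c')"
   unfolding one_add_one by blast
 qed (use assms in simp)
 then have 1: "reach (for_loop a (Seq (Push 2 True) (Push b True))) (s, c) (s(a := [], 2 := un x, b := un (x + y)), c) (x * (2 + 2) + 1)"
  by auto
 let ?t = "s(a := [], 2 := un x, b := un (x + y))"
 let ?J = "%i p. p = (s(a := un i, 2 := un (x - i), b := un (x + y)), c)"
 have "\<exists>s' c'. reach (for_loop 2 (Push a True)) (?t, c) (s', c') (x * (1 + 2) + 1) \<and> s' 2 = [] \<and> ?J x (s', c')"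
 proof (rule reach_for[where I = ?J])
  show "?J 0 (?t, c)" by simp
  fix i s1 c1 assume i: "i < x" "?J i (s1, c1)"
  then have s1: "s1 = s(a := un i, 2 := un (x - i), b := un (x + y))" "c1 = c" by blast+
  have "reach (Push a True) (s1(2 := tl (s1 2)), c1) (s(a := un (Suc i), 2 := un (x - Suc i), b := un (x + y)), c) 1"
   unfolding s1 by (rule reach_Push') (use i(1) assms in \<open>auto simp: fun_eq_iff un_tl\<close>)
  moreover have "length ((s(a := un (Suc i), 2 := un (x - Suc i), b := un (x + y))) 2) = x - Suc i" using assms by simp
  ultimately show "\<exists>s' c'. reach (Push a True) (s1(2 := tl (s1 2)), c1) (s', c') 1 \<and> length (s' 2) = x - Suc i \<and> ?J (Suc i) (s', c')"
   by blast
 qed (use assms in simp)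
 moreover have "s(a := un x, 2 := [], b := un (x + y)) = s(b := un (x + y))" using assms by (auto simp: fun_eq_iff)
 ultimately have 2: "reach (for_loop 2 (Push a True)) (?t, c) (s(b := un (x + y)), c) (x * (1 + 2) + 1)"
  by auto
 show ?thesis unfolding copy_def using reach_mono[OF reach_Seq[OF 1 2]] by simp
qed

definition clear :: "nat => prog" where "clear v = for_loop v skip"

lemma reach_clear: "reach (clear v) (s, c) (s(v := []), c) (4 * length (s v) + 1)"
proof -
 let ?I = "%i p. p = (s(v := drop i (s v)), c)"
 have "\<exists>s' c'. reach (clear v) (s, c) (s', c') (length (s v) * (2 + 2) + 1) \<and> s' v = [] \<and> ?I (length (s v)) (s', c')"
  unfolding clear_def
 proof (rule reach_for[where I = ?I])
  fix i s1 c1 assume i: "i < length (s v)" "?I i (s1, c1)"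
  have "s1(v := tl (s1 v)) = s(v := drop (Suc i) (s v))" using i by (simp add: drop_Suc tl_drop)
  then show "\<exists>s' c'. reach skip (s1(v := tl (s1 v)), c1) (s', c') 2 \<and> length (s' v) = length (s v) - Suc i \<and> ?I (Suc i) (s', c')"
   using reach_skip[of "s1(v := tl (s1 v))" c1] i by (intro exI conjI) auto
 qed simp_all
 then have "reach (clear v) (s, c) (s(v := []), c) (length (s v) * (2 + 2) + 1)" by auto
 then show ?thesis by (rule reach_mono) simp
qed

section \<open>Simulation with displaced wires\<close>

definition cs :: "nat => nat" where "cs v = 40 + 2 * v"
definition hs :: "nat => nat" where "hs v = 41 + 2 * v"

text \<open>Stack \<open>v\<close> of the simulated program is kept on stack \<open>cs v\<close>, while \<open>hs v\<close> has the height of the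
 wire that replaces the wire addressed by \<open>v\<close>; stack \<open>FR\<close> stays above all of these heights.\<close>

fun sim :: "nat => (nat gate => prog) => (nat => prog) => prog => prog" where
 "sim FR ap ou (Push v b) = Seq (Push (cs v) b) (Seq (Seq (Push (hs v) True) (Push (hs v) True)) (Seq (Push FR True) (Push FR True)))"
| "sim FR ap ou (Pop v) = IfElse (Nonempty (cs v)) (Seq (Pop (cs v)) (Seq (Pop (hs v)) (Pop (hs v)))) skip"
| "sim FR ap ou (Apply g) = ap g"
| "sim FR ap ou (Output v) = ou v"
| "sim FR ap ou (Seq P Q) = Seq (sim FR ap ou P) (sim FR ap ou Q)"
| "sim FR ap ou (IfElse (Nonempty v) P Q) = IfElse (Nonempty (cs v)) (sim FR ap ou P) (sim FR ap ou Q)"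
| "sim FR ap ou (IfElse (Top v) P Q) = IfElse (Top (cs v)) (sim FR ap ou P) (sim FR ap ou Q)"
| "sim FR ap ou (While (Nonempty v) P) = While (Nonempty (cs v)) (sim FR ap ou P)"
| "sim FR ap ou (While (Top v) P) = While (Top (cs v)) (sim FR ap ou P)"

fun uses :: "prog => nat set" where
 "uses (Push v b) = {v}"
| "uses (Pop v) = {v}"
| "uses (Apply g) = set_gate g"
| "uses (Output v) = {v}"
| "uses (Seq P Q) = uses P \<union> uses Q"
| "uses (IfElse t P Q) = (case t of Nonempty v => {v} | Top v => {v}) \<union> uses P \<union> uses Q"
| "uses (While t P) = (case t of Nonempty v => {v} | Top v => {v}) \<union> uses P"

lemma finite_uses: "finite (uses P)"
 by (induction P) (auto split: test.split)

text \<open>Stacks below 40 other than \<open>FR\<close> belong to the simulating program and form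
  the frame \<open>q\<close>. Stack \<open>hs v\<close> has height
  \<open>pf B (length (s v))\<close>, so a gate addressed through the \<open>hs\<close> stacks lands
  on the displaced wires.\<close>

definition mk :: "nat => nat => nat => (nat => bool list) => nat => (nat => bool list) => nat => bool list" where
 "mk V FR B s fr q = (%v. if v < 40 then (if v = FR then un fr else q v)
   else if (v - 40) div 2 < V then (if even v then s ((v - 40) div 2) else un (B + 2 * length (s ((v - 40) div 2))))
   else [])"

lemma cs_hs: "cs a = cs b \<longleftrightarrow> a = b" "hs a = hs b \<longleftrightarrow> a = b" "cs a ~= hs b" "hs a ~= cs b"
 unfolding cs_def hs_def by presburger+

lemma cs_hs_low: "f < 40 ==> cs a ~= f \<and> f ~= cs a \<and> hs a ~= f \<and> f ~= hs a"
 by (auto simp: cs_def hs_def)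

lemma mk_cs: "v < V ==> mk V FR B s fr q (cs v) = s v"
 by (simp add: mk_def cs_def)

lemma mk_hs: "v < V ==> mk V FR B s fr q (hs v) = un (B + 2 * length (s v))"
 by (simp add: mk_def hs_def)

lemma mk_low: "v < 40 ==> v ~= FR ==> mk V FR B s fr q v = q v"
 by (simp add: mk_def)

lemma mk_upd_low: "v < 40 ==> v ~= FR ==> (mk V FR B s fr q)(v := x) = mk V FR B s fr (q(v := x))"
 by (auto simp: mk_def fun_eq_iff)

lemma mk_upd:
 assumes "v < V" "FR < 40"
 shows "(mk V FR B s fr q)(cs v := x, hs v := un (B + 2 * length x), FR := un fr') = mk V FR B (s(v := x)) fr' q"
proof
 fix w
 have e: "w = cs ((w - 40) div 2)" if "40 \<le> w" "even w" using that by (auto simp: cs_def)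
 have o: "w = hs ((w - 40) div 2)" if ow: "40 \<le> w" "odd w"
 proof -
  obtain b where "w = 2 * b + 1" using ow(2) oddE by blast
  then show ?thesis using ow(1) by (auto simp: hs_def)
 qed
 show "((mk V FR B s fr q)(cs v := x, hs v := un (B + 2 * length x), FR := un fr')) w = mk V FR B (s(v := x)) fr' q w"
 proof (cases "w < 40")
  case True
  then show ?thesis using assms by (auto simp: mk_def cs_def hs_def)
 next
  case False
  have c: "cs a = cs b \<longleftrightarrow> a = b" "hs a = hs b \<longleftrightarrow> a = b" "cs a ~= hs b" "hs b ~= cs a" "cs a ~= FR" "hs a ~= FR" for a b
   using cs_hs cs_hs_low[OF assms(2)] by auto
  show ?thesis
  proof (cases "(w - 40) div 2 < V")
   case in_V: True
   show ?thesis
   proof (cases "even w")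
    case True
    then have w: "w = cs ((w - 40) div 2)" using e False by simp
    show ?thesis by (subst (1 2) w) (use c in_V in \<open>simp add: mk_cs\<close>)
   next
    case odd: False
    then have w: "w = hs ((w - 40) div 2)" using o False by simp
    show ?thesis by (subst (1 2) w) (use c in_V in \<open>simp add: mk_hs\<close>)
   qed
  next
   case nV: False
   then have "w ~= cs v" "w ~= hs v" using assms(1) by (auto simp: cs_def hs_def)
   then show ?thesis using nV False assms(2) by (auto simp: mk_def)
  qed
 qed
qed

type_synonym frame = "(nat => bool list) \<times> circuit"

text \<open>The events of a generator, gates and outputs, in the order of emission.
  \<open>fA\<close> and \<open>fO\<close> describe the response of the simulating program to an
  event on displaced wires.\<close>

definition evs :: "nat => (nat gate => frame => frame) => (nat => frame => frame) => (nat gate + nat) list => frame => frame" where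
 "evs B fA fO = fold (%e. case e of Inl g => fA (map_gate (pf B) g) | Inr w => fO (pf B w))"

definition lefts :: "(nat gate + nat) list => nat gate list" where "lefts es = [g. Inl g \<leftarrow> es]"
definition rights :: "(nat gate + nat) list => nat list" where "rights es = [w. Inr w \<leftarrow> es]"

lemma lefts_simps [simp]: "lefts [] = []" "lefts (Inl g # es) = g # lefts es" "lefts (Inr w # es) = lefts es" "lefts (xs @ ys) = lefts xs @ lefts ys"
 by (auto simp: lefts_def)

lemma rights_simps [simp]: "rights [] = []" "rights (Inl g # es) = rights es" "rights (Inr w # es) = w # rights es" "rights (xs @ ys) = rights xs @ rights ys"
 by (auto simp: rights_def)

text \<open>\<open>ap\<close> and \<open>ou\<close> replace \<open>Apply\<close> and
  \<open>Output\<close>, with effects \<open>fA\<close> and \<open>fO\<close> on frame and circuit.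
  \<open>H\<close> bounds the cost of simulating one step, including the five steps of a simulated
  push.\<close>

locale simulation =
 fixes V FR B H :: nat and ap :: "nat gate => prog" and ou :: "nat => prog"
  and fA :: "nat gate => frame => frame" and fO :: "nat => frame => frame"
 assumes FR: "FR < 40" "FR ~= 2" and H: "6 \<le> H"
  and ap: "\<And>g s fr q C. set_gate g \<subseteq> {..<V} ==> reach (ap g) (mk V FR B s fr q, C)
   (mk V FR B s fr (fst (fA (map_gate (%v. pf B (length (s v))) g) (q, C))), snd (fA (map_gate (%v. pf B (length (s v))) g) (q, C))) H"
  and ou: "\<And>v s fr q C. v < V ==> reach (ou v) (mk V FR B s fr q, C)
   (mk V FR B s fr (fst (fO (pf B (length (s v))) (q, C))), snd (fO (pf B (length (s v))) (q, C))) H"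
begin

lemma holds_mk: "(case t of Nonempty v => {v} | Top v => {v}) \<subseteq> {..<V} ==>
  holds (case t of Nonempty v => Nonempty (cs v) | Top v => Top (cs v)) (mk V FR B s fr q) = holds t s"
 by (cases t) (auto simp: mk_cs)

lemma sim_If: "sim FR ap ou (IfElse t P Q) = IfElse (case t of Nonempty v => Nonempty (cs v) | Top v => Top (cs v)) (sim FR ap ou P) (sim FR ap ou Q)"
 by (cases t) auto

lemma sim_While: "sim FR ap ou (While t P) = While (case t of Nonempty v => Nonempty (cs v) | Top v => Top (cs v)) (sim FR ap ou P)"
 by (cases t) auto

lemma evs_append: "evs B fA fO (xs @ ys) f = evs B fA fO ys (evs B fA fO xs f)"
 by (simp add: evs_def)

lemma sim_Push:
 assumes "v < V"
 shows "reach (sim FR ap ou (Push v b)) (mk V FR B s fr q, C) (mk V FR B (s(v := b # s v)) (fr + 2) q, C) 5"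
proof -
 let ?S = "mk V FR B s fr q"
 have ne: "cs v ~= hs v" "hs v ~= cs v" "cs v ~= FR" "hs v ~= FR" "FR ~= hs v" "FR ~= cs v" using cs_hs cs_hs_low[OF FR(1)] by auto
 have F: "?S FR = un fr" using FR by (simp add: mk_def)
 have "reach (sim FR ap ou (Push v b)) (?S, C)
  (?S(cs v := b # s v, hs v := un (B + 2 * length (b # s v)), FR := un (fr + 2)), C) (1 + ((1 + 1) + (1 + 1)))"
  unfolding sim.simps
 proof (rule reach_Seq, rule reach_Push, rule reach_Seq, rule reach_Seq, rule reach_Push, rule reach_Push, rule reach_Seq, rule reach_Push)
  let ?T = "?S(cs v := b # ?S (cs v))"
  let ?T1 = "?T(hs v := True # ?T (hs v))" 
  let ?T2 = "?T1(hs v := True # ?T1 (hs v))"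
  let ?T3 = "?T2(FR := True # ?T2 FR)"
  have "?T3(FR := True # ?T3 FR) = ?S(cs v := b # s v, hs v := un (B + 2 * length (b # s v)), FR := un (fr + 2))"
   using ne F assms by (auto simp: fun_eq_iff mk_cs mk_hs un_tl)
  then show "reach (Push FR True) (?T3, C) (?S(cs v := b # s v, hs v := un (B + 2 * length (b # s v)), FR := un (fr + 2)), C) 1"
   using reach_Push[of FR True ?T3 C] by simp
 qed
 then show ?thesis unfolding mk_upd[OF assms FR(1)] by (rule reach_mono) simp
qed

lemma sim_Pop:
 assumes "v < V"
 shows "reach (sim FR ap ou (Pop v)) (mk V FR B s fr q, C) (mk V FR B (s(v := tl (s v))) fr q, C) 4"
proof (cases "s v = []")
 case True
 have "reach (sim FR ap ou (Pop v)) (mk V FR B s fr q, C) (mk V FR B s fr q, C) (2 + 1)"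
  unfolding sim.simps by (rule reach_If_false[OF _ reach_skip]) (use True assms in \<open>simp add: mk_cs\<close>)
 then show ?thesis using True reach_mono by (simp add: fun_upd_idem)
next
 case False
 let ?S = "mk V FR B s fr q"
 have ne: "cs v ~= hs v" "hs v ~= cs v" "cs v ~= FR" "hs v ~= FR" "FR ~= hs v" "FR ~= cs v" using cs_hs cs_hs_low[OF FR(1)] by auto
 have F: "?S FR = un fr" using FR by (simp add: mk_def)
 have l: "length (s v) = Suc (length (tl (s v)))" using False by (cases "s v") auto
 have "reach (Seq (Pop (cs v)) (Seq (Pop (hs v)) (Pop (hs v)))) (?S, C)
  (?S(cs v := tl (s v), hs v := un (B + 2 * length (tl (s v))), FR := un fr), C) (1 + (1 + 1))"
 proof (rule reach_Seq, rule reach_Pop, rule reach_Seq, rule reach_Pop)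
  let ?T = "?S(cs v := tl (?S (cs v)))"
  let ?T1 = "?T(hs v := tl (?T (hs v)))" 
  have "?T1(hs v := tl (?T1 (hs v))) = ?S(cs v := tl (s v), hs v := un (B + 2 * length (tl (s v))), FR := un fr)"
   using ne F assms l by (auto simp: fun_eq_iff mk_cs mk_hs un_tl)
  then show "reach (Pop (hs v)) (?T1, C) (?S(cs v := tl (s v), hs v := un (B + 2 * length (tl (s v))), FR := un fr), C) 1"
   using reach_Pop[of "hs v" ?T1 C] by simp
 qed
 then have "reach (sim FR ap ou (Pop v)) (?S, C) (?S(cs v := tl (s v), hs v := un (B + 2 * length (tl (s v))), FR := un fr), C) (1 + (1 + 1) + 1)"
  unfolding sim.simps by (rule reach_If_true[rotated]) (use False assms in \<open>simp add: mk_cs\<close>)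
 then show ?thesis unfolding mk_upd[OF assms FR(1)] by (rule reach_mono) simp
qed

text \<open>The frontier lies above every displaced address that the simulated program can form from
  its current stacks.\<close>

definition room :: "(nat => bool list) => nat => bool" where
 "room s fr \<longleftrightarrow> (\<forall>v. B + 2 * length (s v) < fr)"

text \<open>A push raises one displaced address by 2 and the frontier by 2, and a pop lowers only
  the address. The frontier thus stays above all addresses without any comparison, keeps its parity,
  and grows by at most 2 per simulated step.\<close>

lemma sim_exec:
 assumes "exec P (s, Circuit gs os) T (s', C')" "uses P \<subseteq> {..<V}" "room s fr"
 shows "\<exists>es fr'. C' = Circuit (gs @ lefts es) (os @ rights es) \<and> room s' fr' \<and> fr \<le> fr' \<and> fr' \<le> fr + 2 * T \<and> even (fr + fr') \<and>
   (\<forall>w \<in> WL (lefts es) \<union> set (rights es). B + 2 * w < fr') \<and>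
   reach (sim FR ap ou P) (mk V FR B s fr q, C) (mk V FR B s' fr' (fst (evs B fA fO es (q, C))), snd (evs B fA fO es (q, C))) (H * T)"
 using assms
proof (induction P "(s, Circuit gs os)" T "(s', C')" arbitrary: s gs os s' C' fr q C rule: exec.induct)
 case (exec_Push v b s)
 have "reach (sim FR ap ou (Push v b)) (mk V FR B s fr q, C) (mk V FR B (s(v := b # s v)) (fr + 2) q, C) (H * 1)"
  by (rule reach_mono[OF sim_Push]) (use exec_Push H in auto)
 then show ?case using exec_Push(2) 
  by (intro exI[of _ "[]"] exI[of _ "fr + 2"]) (auto simp: evs_def room_def intro: less_le_trans)
next
 case (exec_Pop v s)
 have "reach (sim FR ap ou (Pop v)) (mk V FR B s fr q, C) (mk V FR B (s(v := tl (s v))) fr q, C) (H * 1)"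
  by (rule reach_mono[OF sim_Pop]) (use exec_Pop H in auto)
 moreover have "room (s(v := tl (s v))) fr" unfolding room_def
 proof
  fix w
  have "length ((s(v := tl (s v))) w) \<le> length (s w)" by simp
  moreover have "B + 2 * length (s w) < fr" using exec_Pop(2) by (simp add: room_def)
  ultimately show "B + 2 * length ((s(v := tl (s v))) w) < fr" by linarith
 qed
 ultimately show ?case by (intro exI[of _ "[]"] exI[of _ "fr"]) (auto simp: evs_def)
next
 case (exec_Apply g s gs os)
 let ?g = "map_gate (%v. length (s v)) g"
 have m: "map_gate (pf B) ?g = map_gate (%v. pf B (length (s v))) g" by (simp add: gate.map_comp comp_def)
 have "reach (ap g) (mk V FR B s fr q, C) (mk V FR B s fr (fst (evs B fA fO [Inl ?g] (q, C))), snd (evs B fA fO [Inl ?g] (q, C))) (H * 1)"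
  using ap[of g s fr q C] exec_Apply(1) by (simp add: evs_def m)
 then show ?case using exec_Apply(2) by (intro exI[of _ "[Inl ?g]"] exI[of _ "fr"]) (auto simp: room_def gate.set_map)
next
 case (exec_Output v s gs os)
 have "reach (ou v) (mk V FR B s fr q, C) (mk V FR B s fr (fst (evs B fA fO [Inr (length (s v))] (q, C))), snd (evs B fA fO [Inr (length (s v))] (q, C))) (H * 1)"
  using ou[of v s fr q C] exec_Output(1) by (simp add: evs_def)
 then show ?case using exec_Output(2) by (intro exI[of _ "[Inr (length (s v))]"] exI[of _ "fr"]) (auto simp: room_def)
next
 case (exec_Seq P m b Q n)
 obtain s1 C1 where b: "b = (s1, C1)" by force
 obtain es1 fr1 where 1: "C1 = Circuit (gs @ lefts es1) (os @ rights es1)" "room s1 fr1" "fr \<le> fr1" "fr1 \<le> fr + 2 * m" "even (fr + fr1)"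
   "\<forall>w \<in> WL (lefts es1) \<union> set (rights es1). B + 2 * w < fr1"
   "reach (sim FR ap ou P) (mk V FR B s fr q, C) (mk V FR B s1 fr1 (fst (evs B fA fO es1 (q, C))), snd (evs B fA fO es1 (q, C))) (H * m)"
  using exec_Seq(2)[OF b, of fr q C] exec_Seq(5,6) by auto
 obtain es2 fr2 where 2: "C' = Circuit ((gs @ lefts es1) @ lefts es2) ((os @ rights es1) @ rights es2)" "room s' fr2" "fr1 \<le> fr2" "fr2 \<le> fr1 + 2 * n" "even (fr1 + fr2)"
   "\<forall>w \<in> WL (lefts es2) \<union> set (rights es2). B + 2 * w < fr2"
   "reach (sim FR ap ou Q) (mk V FR B s1 fr1 (fst (evs B fA fO es1 (q, C))), snd (evs B fA fO es1 (q, C)))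
    (mk V FR B s' fr2 (fst (evs B fA fO es2 (evs B fA fO es1 (q, C)))), snd (evs B fA fO es2 (evs B fA fO es1 (q, C)))) (H * n)"
  using exec_Seq(4)[of s1 "gs @ lefts es1" "os @ rights es1" fr1 "fst (evs B fA fO es1 (q, C))" "snd (evs B fA fO es1 (q, C))"] exec_Seq(5) 1(2) b 1(1) by auto
 show ?case
  by (rule exI[of _ "es1 @ es2"], rule exI[of _ fr2], intro conjI)
    (use 1 2 reach_Seq[OF 1(7) 2(7)] in \<open>auto simp: evs_append distrib_left intro: less_le_trans\<close>)
next
 case (exec_If_true t P m Q)
 have u: "uses P \<subseteq> {..<V}" using exec_If_true(4) by simp
 obtain es fr' where 1: "C' = Circuit (gs @ lefts es) (os @ rights es)" "room s' fr'" "fr \<le> fr'" "fr' \<le> fr + 2 * m" "even (fr + fr')"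
   "\<forall>w \<in> WL (lefts es) \<union> set (rights es). B + 2 * w < fr'"
   "reach (sim FR ap ou P) (mk V FR B s fr q, C) (mk V FR B s' fr' (fst (evs B fA fO es (q, C))), snd (evs B fA fO es (q, C))) (H * m)"
  using exec_If_true(3)[OF u exec_If_true(5), of q C] by auto
 have h: "holds (case t of Nonempty v => Nonempty (cs v) | Top v => Top (cs v)) (fst (mk V FR B s fr q, C))"
  using exec_If_true(1,4) holds_mk[of t s fr q] by simp
 have "reach (sim FR ap ou (IfElse t P Q)) (mk V FR B s fr q, C) (mk V FR B s' fr' (fst (evs B fA fO es (q, C))), snd (evs B fA fO es (q, C))) (H * Suc m)"
  unfolding sim_If by (rule reach_mono[OF reach_If_true[OF h 1(7)]]) (use H in simp)
 then show ?case using 1 by (intro exI[of _ es] exI[of _ fr']) auto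
next
 case (exec_If_false t Q m P)
 have u: "uses Q \<subseteq> {..<V}" using exec_If_false(4) by simp
 obtain es fr' where 1: "C' = Circuit (gs @ lefts es) (os @ rights es)" "room s' fr'" "fr \<le> fr'" "fr' \<le> fr + 2 * m" "even (fr + fr')"
   "\<forall>w \<in> WL (lefts es) \<union> set (rights es). B + 2 * w < fr'"
   "reach (sim FR ap ou Q) (mk V FR B s fr q, C) (mk V FR B s' fr' (fst (evs B fA fO es (q, C))), snd (evs B fA fO es (q, C))) (H * m)"
  using exec_If_false(3)[OF u exec_If_false(5), of q C] by auto
 have h: "\<not> holds (case t of Nonempty v => Nonempty (cs v) | Top v => Top (cs v)) (fst (mk V FR B s fr q, C))"
  using exec_If_false(1,4) holds_mk[of t s fr q] by simp
 have "reach (sim FR ap ou (IfElse t P Q)) (mk V FR B s fr q, C) (mk V FR B s' fr' (fst (evs B fA fO es (q, C))), snd (evs B fA fO es (q, C))) (H * Suc m)"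
  unfolding sim_If by (rule reach_mono[OF reach_If_false[OF h 1(7)]]) (use H in simp)
 then show ?case using 1 by (intro exI[of _ es] exI[of _ fr']) auto
next
 case (exec_While_false t P)
 have h: "\<not> holds (case t of Nonempty v => Nonempty (cs v) | Top v => Top (cs v)) (fst (mk V FR B s fr q, C))"
  using exec_While_false holds_mk[of t s fr q] by auto
 have "reach (sim FR ap ou (While t P)) (mk V FR B s fr q, C) (mk V FR B s fr q, C) (H * 1)"
  unfolding sim_While by (rule reach_mono[OF reach_While_false[OF h]]) (use H in simp)
 then show ?case using exec_While_false by (intro exI[of _ "[]"] exI[of _ fr]) (auto simp: evs_def)
next
 case (exec_While_true t P m b n)
 obtain s1 C1 where b: "b = (s1, C1)" by force
 have u: "uses P \<subseteq> {..<V}" using exec_While_true(6) by simp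
 obtain es1 fr1 where 1: "C1 = Circuit (gs @ lefts es1) (os @ rights es1)" "room s1 fr1" "fr \<le> fr1" "fr1 \<le> fr + 2 * m" "even (fr + fr1)"
   "\<forall>w \<in> WL (lefts es1) \<union> set (rights es1). B + 2 * w < fr1"
   "reach (sim FR ap ou P) (mk V FR B s fr q, C) (mk V FR B s1 fr1 (fst (evs B fA fO es1 (q, C))), snd (evs B fA fO es1 (q, C))) (H * m)"
  using exec_While_true(3)[OF b u exec_While_true(7), of q C] by auto
 obtain es2 fr2 where 2: "C' = Circuit ((gs @ lefts es1) @ lefts es2) ((os @ rights es1) @ rights es2)" "room s' fr2" "fr1 \<le> fr2" "fr2 \<le> fr1 + 2 * n" "even (fr1 + fr2)"
   "\<forall>w \<in> WL (lefts es2) \<union> set (rights es2). B + 2 * w < fr2"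
   "reach (sim FR ap ou (While t P)) (mk V FR B s1 fr1 (fst (evs B fA fO es1 (q, C))), snd (evs B fA fO es1 (q, C)))
    (mk V FR B s' fr2 (fst (evs B fA fO es2 (evs B fA fO es1 (q, C)))), snd (evs B fA fO es2 (evs B fA fO es1 (q, C)))) (H * n)"
  using exec_While_true(5)[of s1 "gs @ lefts es1" "os @ rights es1" fr1 "fst (evs B fA fO es1 (q, C))" "snd (evs B fA fO es1 (q, C))"] exec_While_true(6) 1(2) b 1(1) by auto
 have h: "holds (case t of Nonempty v => Nonempty (cs v) | Top v => Top (cs v)) (fst (mk V FR B s fr q, C))"
  using exec_While_true(1,6) holds_mk[of t s fr q] by auto
 have "reach (sim FR ap ou (While t P)) (mk V FR B s fr q, C)
    (mk V FR B s' fr2 (fst (evs B fA fO (es1 @ es2) (q, C))), snd (evs B fA fO (es1 @ es2) (q, C))) (H * Suc (m + n))"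
  using reach_mono[OF reach_While_true[OF h 1(7) 2(7)[unfolded sim_While]], of "H * Suc (m + n)"] H
  unfolding sim_While evs_append by (simp add: distrib_left)
 moreover have "\<forall>w \<in> WL (lefts (es1 @ es2)) \<union> set (rights (es1 @ es2)). B + 2 * w < fr2"
  using 1(6) 2(3,6) by (auto intro: less_le_trans)
 ultimately show ?case using 1(3,4,5) 2(1-5)
  by (intro exI[of _ "es1 @ es2"] exI[of _ fr2] conjI) auto
qed

end


section \<open>Replaying a generated circuit on displaced wires\<close>

definition U :: "(nat => nat) => nat => bool list" where "U h = (%v. un (h v))"

lemma U_upd: "(U h)(v := un x) = U (h(v := x))"
 by (auto simp: U_def fun_eq_iff)

lemma U_app [simp]: "U h v = un (h v)"
 by (simp add: U_def)

lemma reach_copyU: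
 assumes "h 2 = 0" "a ~= b" "a ~= 2" "b ~= 2"
 shows "reach (copy a b) (U h, c) (U (h(b := h a + h b)), c) (8 * h a + 2)"
 using reach_copy[of "U h" a "h a" b "h b" c] assms by (simp add: U_upd)

lemma reach_PushU: "reach (Push v True) (U h, c) (U (h(v := Suc (h v))), c) 1"
 by (rule reach_Push') (auto simp: U_def fun_eq_iff)

lemma reach_clearU: "reach (clear v) (U h, c) (U (h(v := 0)), c) (4 * h v + 1)"
 using reach_clear[of v "U h" c] U_upd[of h v 0] by simp

lemma reach_ApplyU: "reach (Apply g) (U h, Circuit gs os) (U h, Circuit (gs @ [map_gate h g]) os) 1"
proof -
 have "map_gate (%v. length (U h v)) g = map_gate h g" by simp
 then show ?thesis using reach_Apply[of g "U h" gs os] by simp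
qed

fun heights :: "nat => prog" where
 "heights 0 = skip"
| "heights (Suc v) = Seq (heights v) (copy 15 (hs v))"

lemma reach_heights:
 assumes "h 2 = 0" "\<forall>w\<ge>40. h w = 0"
 shows "reach (heights V) (U h, c) (U (%w. if 40 \<le> w \<and> odd w \<and> (w - 40) div 2 < V then h 15 else h w), c) (V * (8 * h 15 + 2) + 2)"
proof (induction V)
 case 0
 show ?case using reach_skip[of "U h" c] by (simp del: U_app add: numeral_2_eq_2)
next
 case (Suc V)
 let ?h = "%w. if 40 \<le> w \<and> odd w \<and> (w - 40) div 2 < V then h 15 else h w"
 have e: "?h(hs V := ?h 15 + ?h (hs V)) = (%w. if 40 \<le> w \<and> odd w \<and> (w - 40) div 2 < Suc V then h 15 else h w)"
 proof
  fix w
  have "w = hs V \<longleftrightarrow> 40 \<le> w \<and> odd w \<and> (w - 40) div 2 = V" unfolding hs_def by presburger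
  moreover have "h (hs V) = 0" "hs V \<ge> 40" using assms by (simp_all add: hs_def)
  ultimately show "(?h(hs V := ?h 15 + ?h (hs V))) w = (if 40 \<le> w \<and> odd w \<and> (w - 40) div 2 < Suc V then h 15 else h w)"
   by (auto simp: less_Suc_eq)
 qed
 have "reach (copy 15 (hs V)) (U ?h, c) (U (?h(hs V := ?h 15 + ?h (hs V))), c) (8 * ?h 15 + 2)"
  by (rule reach_copyU) (use assms in \<open>auto simp: hs_def\<close>)
 then have "reach (copy 15 (hs V)) (U ?h, c) (U (%w. if 40 \<le> w \<and> odd w \<and> (w - 40) div 2 < Suc V then h 15 else h w), c) (8 * h 15 + 2)"
  unfolding e by simp
 from reach_Seq[OF Suc this] show ?case unfolding heights.simps by (rule reach_mono) simp
qed

text \<open>Stack \<open>0\<close> holds the parameter \<open>n\<close>, stack \<open>16\<close> the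
  input length and stack \<open>15\<close> the displacement. The frontier is lifted by
  \<open>2 * (n + k) + 2\<close>, beyond the addresses given by the initial stacks of the
  generator.\<close>

definition prepare :: "nat => nat => prog" where
 "prepare V FR = Seq (heights V) (Seq (copy 0 40) (Seq (copy 16 42) (Seq (copy 0 41) (Seq (copy 0 41) (Seq (copy 16 43) (Seq (copy 16 43)
   (Seq (copy 0 FR) (Seq (copy 0 FR) (Seq (copy 16 FR) (Seq (copy 16 FR) (Seq (Push FR True) (Push FR True))))))))))))"

definition inist :: "nat => nat => nat => bool list" where
 "inist n k = (%_. [])(0 := un n, 1 := un k)"

lemma reach_prepare:
 assumes h: "h 2 = 0" "\<forall>w\<ge>40. h w = 0" and FR: "FR = 3 \<or> FR = 4" and V: "2 \<le> V"
  and X: "h 0 \<le> X" "h 15 \<le> X" "h 16 \<le> X"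
 shows "reach (prepare V FR) (U h, c) (mk V FR (h 15) (inist (h 0) (h 16)) (h FR + 2 * (h 0 + h 16) + 2) (U h), c) ((V + 10) * (8 * X + 2) + 4)"
proof -
 define h1 where "h1 w = (if 40 \<le> w \<and> odd w \<and> (w - 40) div 2 < V then h 15 else h w)" for w
 let ?n = "h 0" and ?k = "h 16" and ?B = "h 15"
 have f: "h1 w = h w" if "w < 40" for w using that by (simp add: h1_def)
 have f4: "h1 40 = 0" "h1 42 = 0" "h1 41 = ?B" "h1 43 = ?B" using h V by (auto simp: h1_def)
 have FRn: "FR < 40" "FR ~= 0" "FR ~= 2" "FR ~= 16" using FR by auto
 define h2 where "h2 = h1(40 := ?n + 0)"
 define h3 where "h3 = h2(42 := ?k + 0)"
 define h4 where "h4 = h3(41 := ?n + ?B)"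
 define h5 where "h5 = h4(41 := ?n + (?n + ?B))"
 define h6 where "h6 = h5(43 := ?k + ?B)"
 define h7 where "h7 = h6(43 := ?k + (?k + ?B))"
 define h8 where "h8 = h7(FR := ?n + h FR)"
 define h9 where "h9 = h8(FR := ?n + (?n + h FR))"
 define h10 where "h10 = h9(FR := ?k + (?n + (?n + h FR)))"
 define h11 where "h11 = h10(FR := ?k + (?k + (?n + (?n + h FR))))"
 define h12 where "h12 = h11(FR := Suc (?k + (?k + (?n + (?n + h FR)))))"
 define h13 where "h13 = h12(FR := Suc (Suc (?k + (?k + (?n + (?n + h FR))))))"
 note d = h2_def h3_def h4_def h5_def h6_def h7_def h8_def h9_def h10_def h11_def h12_def h13_def
 have v: "h1 0 = ?n" "h1 2 = 0" "h1 16 = ?k" "h1 FR = h FR" using f h FRn by simp_all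
 have v2: "h2 0 = ?n" "h2 2 = 0" "h2 16 = ?k" "h2 FR = h FR" "h2 41 = ?B" "h2 43 = ?B" "h2 42 = 0" using v f4 FRn by (simp_all add: h2_def)
 have v3: "h3 0 = ?n" "h3 2 = 0" "h3 16 = ?k" "h3 FR = h FR" "h3 41 = ?B" "h3 43 = ?B" using v2 f4 FRn by (simp_all add: h3_def)
 have v4: "h4 0 = ?n" "h4 2 = 0" "h4 16 = ?k" "h4 FR = h FR" "h4 41 = ?n + ?B" "h4 43 = ?B" using v3 f4 FRn by (simp_all add: h4_def)
 have v5: "h5 0 = ?n" "h5 2 = 0" "h5 16 = ?k" "h5 FR = h FR" "h5 43 = ?B" using v4 f4 FRn by (simp_all add: h5_def)
 have v6: "h6 0 = ?n" "h6 2 = 0" "h6 16 = ?k" "h6 FR = h FR" "h6 43 = ?k + ?B" using v5 f4 FRn by (simp_all add: h6_def)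
 have v7: "h7 0 = ?n" "h7 2 = 0" "h7 16 = ?k" "h7 FR = h FR"  using v6 f4 FRn by (simp_all add: h7_def)
 have v8: "h8 0 = ?n" "h8 2 = 0" "h8 16 = ?k" "h8 FR = ?n + h FR"  using v7 f4 FRn by (simp_all add: h8_def)
 have v9: "h9 0 = ?n" "h9 2 = 0" "h9 16 = ?k" "h9 FR = ?n + (?n + h FR)"  using v8 f4 FRn by (simp_all add: h9_def)
 have v10: "h10 0 = ?n" "h10 2 = 0" "h10 16 = ?k" "h10 FR = ?k + (?n + (?n + h FR))"  using v9 f4 FRn by (simp_all add: h10_def)
 have v11: "h11 0 = ?n" "h11 2 = 0" "h11 16 = ?k" "h11 FR = ?k + (?k + (?n + (?n + h FR)))"  using v10 f4 FRn by (simp_all add: h11_def)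
 have nq: "0 ~= FR" "16 ~= FR" "FR ~= 2" using FRn by simp_all
 have cp: "reach (copy a b) (U g, c) (U g', c) (8 * X + 2)" if "g 2 = 0" "a ~= b" "a ~= 2" "b ~= 2" "g' = g(b := g a + g b)" "g a \<le> X" for g g' a b
  unfolding that(5) by (rule reach_mono[OF reach_copyU[of g a b c]]) (use that in auto)
 have "reach (prepare V FR) (U h, c) (U h13, c) ((V * (8 * X + 2) + 2) + ((8 * X + 2) + ((8 * X + 2) + ((8 * X + 2) + ((8 * X + 2) + ((8 * X + 2) + ((8 * X + 2) + ((8 * X + 2) + ((8 * X + 2) + ((8 * X + 2) + ((8 * X + 2) + (1 + 1))))))))))))"
  unfolding prepare_def
 proof (intro reach_Seq)
  have "reach (heights V) (U h, c) (U h1, c) (V * (8 * ?B + 2) + 2)" using reach_heights[OF h] by (simp add: h1_def[abs_def])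
  then show "reach (heights V) (U h, c) (U h1, c) (V * (8 * X + 2) + 2)" by (rule reach_mono) (use X in simp)
  show "reach (copy 0 40) (U h1, c) (U h2, c) (8 * X + 2)" by (rule cp) (use v f4 X FRn in \<open>simp_all add: h2_def\<close>)
  show "reach (copy 16 42) (U h2, c) (U h3, c) (8 * X + 2)" by (rule cp) (use v2 f4 X FRn in \<open>simp_all add: h3_def\<close>)
  show "reach (copy 0 41) (U h3, c) (U h4, c) (8 * X + 2)" by (rule cp) (use v3 f4 X FRn in \<open>simp_all add: h4_def\<close>)
  show "reach (copy 0 41) (U h4, c) (U h5, c) (8 * X + 2)" by (rule cp) (use v4 f4 X FRn in \<open>simp_all add: h5_def\<close>)
  show "reach (copy 16 43) (U h5, c) (U h6, c) (8 * X + 2)" by (rule cp) (use v5 f4 X FRn in \<open>simp_all add: h6_def\<close>)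
  show "reach (copy 16 43) (U h6, c) (U h7, c) (8 * X + 2)" by (rule cp) (use v6 f4 X FRn in \<open>simp_all add: h7_def\<close>)
  show "reach (copy 0 FR) (U h7, c) (U h8, c) (8 * X + 2)" by (rule cp[of h7 0 FR h8, OF v7(2) nq(1) _ nq(3)]) (simp, simp only: h8_def v7, simp only: v7 X)
  show "reach (copy 0 FR) (U h8, c) (U h9, c) (8 * X + 2)" by (rule cp[of h8 0 FR h9, OF v8(2) nq(1) _ nq(3)]) (simp, simp only: h9_def v8, simp only: v8 X)
  show "reach (copy 16 FR) (U h9, c) (U h10, c) (8 * X + 2)" by (rule cp[of h9 16 FR h10, OF v9(2) nq(2) _ nq(3)]) (simp, simp only: h10_def v9, simp only: v9 X)
  show "reach (copy 16 FR) (U h10, c) (U h11, c) (8 * X + 2)" by (rule cp[of h10 16 FR h11, OF v10(2) nq(2) _ nq(3)]) (simp, simp only: h11_def v10, simp only: v10 X)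
  show "reach (Push FR True) (U h11, c) (U h12, c) 1"
   using reach_PushU[of FR h11 c] v11 by (simp add: h12_def)
  show "reach (Push FR True) (U h12, c) (U h13, c) 1"
   using reach_PushU[of FR h12 c] by (simp add: h13_def h12_def fun_upd_same)
 qed
 moreover have "U h13 = mk V FR ?B (inist ?n ?k) (h FR + 2 * (?n + ?k) + 2) (U h)"
 proof
  fix w :: nat
  consider "w < 40" | "w = 40" | "w = 41" | "w = 42" | "w = 43" | "44 \<le> w" by linarith
  then show "U h13 w = mk V FR ?B (inist ?n ?k) (h FR + 2 * (?n + ?k) + 2) (U h) w"
  proof cases
   case 1
   then show ?thesis using f[OF 1] by (cases "w = FR") (simp_all add: d mk_def algebra_simps numeral_2_eq_2)
  next
   case 6
   then have "(w - 40) div 2 ~= 0" "(w - 40) div 2 ~= 1" by auto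
   then have i: "inist ?n ?k ((w - 40) div 2) = []" by (simp add: inist_def)
   have "h13 w = h1 w" using 6 FRn by (simp add: d)
   then show ?thesis using 6 h i by (auto simp: mk_def h1_def)
  qed (use FRn V f4 in \<open>simp_all add: d mk_def inist_def\<close>)
 qed
 ultimately have "reach (prepare V FR) (U h, c) (mk V FR ?B (inist ?n ?k) (h FR + 2 * (?n + ?k) + 2) (U h), c)
   ((V * (8 * X + 2) + 2) + ((8 * X + 2) + ((8 * X + 2) + ((8 * X + 2) + ((8 * X + 2) + ((8 * X + 2) + ((8 * X + 2) + ((8 * X + 2) + ((8 * X + 2) + ((8 * X + 2) + ((8 * X + 2) + (1 + 1))))))))))))"
  by (simp only:)
 then show ?thesis by (rule reach_mono) (simp add: algebra_simps)
qed

fun clearall :: "nat => prog" where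
 "clearall 0 = skip"
| "clearall (Suc v) = Seq (clear (cs v)) (Seq (clear (hs v)) (clearall v))"

lemma reach_clearall:
 assumes "FR < 40" "\<forall>v. length (s v) \<le> L \<and> B + 2 * length (s v) \<le> L"
 shows "reach (clearall V) (mk V FR B s fr q, c) (%v. if v < 40 then if v = FR then un fr else q v else [], c) (V * (8 * L + 2) + 2)"
proof (induction V)
 case 0
 have "mk 0 FR B s fr q = (%v. if v < 40 then if v = FR then un fr else q v else [])" by (auto simp: mk_def)
 then show ?case using reach_skip[of "mk 0 FR B s fr q" c] by (simp only: clearall.simps mult_0 add_0)
next
 case (Suc V)
 let ?S = "mk (Suc V) FR B s fr q"
 have e: "?S(cs V := [], hs V := []) = mk V FR B s fr q"
 proof
  fix w
  have w: "w = cs V \<longleftrightarrow> 40 \<le> w \<and> even w \<and> (w - 40) div 2 = V" "w = hs V \<longleftrightarrow> 40 \<le> w \<and> odd w \<and> (w - 40) div 2 = V"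
   unfolding cs_def hs_def by presburger+
  show "(?S(cs V := [], hs V := [])) w = mk V FR B s fr q w"
   using w by (auto simp: mk_def less_Suc_eq)
 qed
 have 1: "reach (clear (cs V)) (?S, c) (?S(cs V := []), c) (4 * L + 1)"
  using reach_mono[OF reach_clear[of "cs V" ?S c]] assms by (simp add: mk_cs)
 have "(?S(cs V := [])) (hs V) = un (B + 2 * length (s V))" using cs_hs by (simp add: mk_hs)
 then have 2: "reach (clear (hs V)) (?S(cs V := []), c) (mk V FR B s fr q, c) (4 * L + 1)"
  using reach_mono[OF reach_clear[of "hs V" "?S(cs V := [])" c], of "4 * L + 1"] assms spec[OF assms(2), of V] by (simp add: e del: fun_upd_apply)
 show ?case using reach_mono[OF reach_Seq[OF 1 reach_Seq[OF 2 Suc]]] by simp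
qed

lemma mk_clear_U:
 assumes "\<forall>w\<ge>40. h w = 0" "FR < 40"
 shows "(%v. if v < 40 then if v = FR then un fr else U h v else []) = U (h(FR := fr))"
 using assms by (auto simp: fun_eq_iff U_def)

fun addg :: "circuit => nat gate list => circuit" where "addg (Circuit gs os) gs' = Circuit (gs @ gs') os"

lemma addg_nil: "addg C [] = C" by (cases C) simp

lemma addg_addg: "addg (addg C gs) gs' = addg C (gs @ gs')" by (cases C) simp

lemma (in simulation) sim_generates:
 assumes g: "generates P n k T c" and u: "uses P \<subseteq> {..<V}" and f: "B \<le> f0"
 shows "\<exists>es fr' s'. lefts es = gates c \<and> rights es = outs c \<and> f0 + 2 * (n + k) + 2 \<le> fr' \<and> fr' \<le> f0 + 2 * (n + k) + 2 + 2 * T \<and>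
  even (f0 + fr') \<and> (\<forall>w \<in> WL (gates c) \<union> set (outs c). B + 2 * w < fr') \<and> (\<forall>v. B + 2 * length (s' v) \<le> fr') \<and>
  reach (sim FR ap ou P) (mk V FR B (inist n k) (f0 + 2 * (n + k) + 2) q, C)
   (mk V FR B s' fr' (fst (evs B fA fO es (q, C))), snd (evs B fA fO es (q, C))) (H * T)"
proof -
 obtain s' where ex: "exec P (inist n k, Circuit [] []) T (s', c)" using g by (auto simp: generates_def inist_def)
 have "room (inist n k) (f0 + 2 * (n + k) + 2)" using f by (auto simp: room_def inist_def)
 from sim_exec[OF ex u this, of q C] obtain es fr' where 1: "c = Circuit ([] @ lefts es) ([] @ rights es)" "room s' fr'"
  "f0 + 2 * (n + k) + 2 \<le> fr'" "fr' \<le> f0 + 2 * (n + k) + 2 + 2 * T" "even (f0 + 2 * (n + k) + 2 + fr')"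
  "\<forall>w \<in> WL (lefts es) \<union> set (rights es). B + 2 * w < fr'"
  "reach (sim FR ap ou P) (mk V FR B (inist n k) (f0 + 2 * (n + k) + 2) q, C)
   (mk V FR B s' fr' (fst (evs B fA fO es (q, C))), snd (evs B fA fO es (q, C))) (H * T)" by blast
 have "even (f0 + fr')" using 1(5) by simp
 moreover have "\<forall>v. B + 2 * length (s' v) \<le> fr'" using 1(2) unfolding room_def by (simp add: less_imp_le)
 moreover have "lefts es = gates c" "rights es = outs c" using 1(1) by simp_all
 ultimately show ?thesis using 1(3,4,6,7) by metis
qed

text \<open>Four kinds of replay are used. \<open>ap1\<close> with \<open>ou1\<close> emits the
  gates, \<open>ap2\<close> with \<open>ou2\<close> swaps the outputs into a register,
  \<open>ap2\<close> with \<open>ou3\<close> adds selected outputs to the answer, and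
  \<open>ap1\<close> with \<open>ou4\<close> emits gates and outputs. Swaps and additions must
  follow all gates, but a generator may declare an output earlier; hence a separate replay for
  them.\<close>

definition ap1 :: "nat gate => prog" where "ap1 g = Apply (map_gate hs g)"
definition fA1 :: "nat gate => frame => frame" where "fA1 g f = (fst f, addg (snd f) [g])"
definition ou1 :: "nat => prog" where "ou1 v = skip"

lemma reach_ap1:
 assumes "set_gate g \<subseteq> {..<V}"
 shows "reach (ap1 g) (mk V FR B s fr q, C) (mk V FR B s fr q, addg C [map_gate (%v. pf B (length (s v))) g]) 1"
proof -
 have "map_gate (%v. length (mk V FR B s fr q v)) (map_gate hs g) = map_gate (%v. pf B (length (s v))) g"
  unfolding gate.map_comp comp_def by (rule gate.map_cong0) (use assms in \<open>auto simp: mk_hs pf_def\<close>)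
 then show ?thesis unfolding ap1_def using reach_Apply[of "map_gate hs g" "mk V FR B s fr q"] by (cases C) simp
qed

lemma sim1:
 assumes "FR = 3 \<or> FR = 4"
 shows "simulation V FR B 6 ap1 ou1 fA1 (%_ f. f)"
proof
 show "reach (ap1 g) (mk V FR B s fr q, C) (mk V FR B s fr (fst (fA1 (map_gate (%v. pf B (length (s v))) g) (q, C))),
   snd (fA1 (map_gate (%v. pf B (length (s v))) g) (q, C))) 6" if "set_gate g \<subseteq> {..<V}" for g s fr q C
  using reach_mono[OF reach_ap1[OF that]] by (simp add: fA1_def)
 show "reach (ou1 v) (mk V FR B s fr q, C) (mk V FR B s fr (fst (q, C)), snd (q, C)) 6" for v s fr q C
  using reach_mono[OF reach_skip] by (simp add: ou1_def)
qed (use assms in auto)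

definition ap2 :: "nat gate => prog" where "ap2 g = skip"

text \<open>Stack \<open>13\<close> addresses the next wire of the destination register. Stack
  \<open>14\<close> counts the filled wires and later serves as the input length of the
  learner.\<close>

definition ou2 :: "nat => prog" where
 "ou2 v = Seq (Apply (CNot (hs v) 13)) (Seq (Apply (CNot 13 (hs v))) (Seq (Apply (CNot (hs v) 13)) (Seq (Push 13 True) (Seq (Push 13 True) (Push 14 True)))))"

definition fO2 :: "nat => frame => frame" where
 "fO2 w f = ((fst f)(13 := True # True # fst f 13, 14 := True # fst f 14), addg (snd f) (swapg w (length (fst f 13))))"

lemma sim2: "simulation V 3 B 6 ap2 ou2 (%_ f. f) fO2"
proof
 show "reach (ap2 g) (mk V 3 B s fr q, C) (mk V 3 B s fr (fst (q, C)), snd (q, C)) 6" for g s fr q C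
  using reach_mono[OF reach_skip] by (simp add: ap2_def)
 fix v s fr q C assume v: "v < V"
 obtain gs os where C: "C = Circuit gs os" by (cases C) auto
 let ?S = "mk V 3 B s fr q" and ?w = "pf B (length (s v))" and ?d = "length (q 13)"
 have l: "length (?S (hs v)) = ?w" "length (?S 13) = ?d" using v by (simp_all add: mk_hs pf_def mk_low)
 have a: "reach (Apply (CNot x y)) (?S, Circuit gs' os) (?S, Circuit (gs' @ [CNot (length (?S x)) (length (?S y))]) os) 1" for x y gs'
  using reach_Apply[of "CNot x y" ?S gs' os] by simp
 let ?C' = "Circuit (((gs @ [CNot ?w ?d]) @ [CNot ?d ?w]) @ [CNot ?w ?d]) os"
 have "reach (ou2 v) (?S, C) (mk V 3 B s fr (q(13 := True # True # q 13, 14 := True # q 14)), ?C') (1 + (1 + (1 + (1 + (1 + 1)))))"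
  unfolding ou2_def C
 proof (intro reach_Seq)
  show "reach (Apply (CNot (hs v) 13)) (?S, Circuit gs os) (?S, Circuit (gs @ [CNot ?w ?d]) os) 1" using a[of "hs v" 13] by (simp add: l)
  show "reach (Apply (CNot 13 (hs v))) (?S, Circuit (gs @ [CNot ?w ?d]) os) (?S, Circuit ((gs @ [CNot ?w ?d]) @ [CNot ?d ?w]) os) 1"
   using a[of 13 "hs v" "gs @ [CNot ?w ?d]"] by (simp add: l)
  show "reach (Apply (CNot (hs v) 13)) (?S, Circuit ((gs @ [CNot ?w ?d]) @ [CNot ?d ?w]) os) (?S, ?C') 1"
   using a[of "hs v" 13 "(gs @ [CNot ?w ?d]) @ [CNot ?d ?w]"] by (simp add: l)
  show "reach (Push 13 True) (?S, ?C') (mk V 3 B s fr (q(13 := True # q 13)), ?C') 1"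
   by (rule reach_Push') (simp add: mk_upd_low mk_low)
  show "reach (Push 13 True) (mk V 3 B s fr (q(13 := True # q 13)), ?C') (mk V 3 B s fr (q(13 := True # True # q 13)), ?C') 1"
   by (rule reach_Push') (simp add: mk_upd_low mk_low)
  show "reach (Push 14 True) (mk V 3 B s fr (q(13 := True # True # q 13)), ?C') (mk V 3 B s fr (q(13 := True # True # q 13, 14 := True # q 14)), ?C') 1"
   by (rule reach_Push') (simp add: mk_upd_low mk_low)
 qed
 then show "reach (ou2 v) (?S, C) (mk V 3 B s fr (fst (fO2 ?w (q, C))), snd (fO2 ?w (q, C))) 6"
  by (rule back_subst[of "%x. reach _ _ x 6", OF reach_mono]) (simp_all add: fO2_def C swapg_def)
qed auto

text \<open>Stack \<open>30\<close> holds the rest of the mask, stack \<open>6\<close> the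
  activation wire, stack \<open>5\<close> the answer wire. Once the mask is used up the test fails
  and the pop has no effect, so further outputs are ignored, as \<open>zip\<close> does in
  \<open>tofs\<close>.\<close>

definition ou3 :: "nat => prog" where
 "ou3 v = Seq (IfElse (Top 30) (Apply (Toffoli 6 (hs v) 5)) skip) (Pop 30)"

definition fO3 :: "nat => frame => frame" where
 "fO3 w f = ((fst f)(30 := tl (fst f 30)), addg (snd f)
   (if fst f 30 ~= [] \<and> hd (fst f 30) then [Toffoli (length (fst f 6)) w (length (fst f 5))] else []))"

lemma sim3: "simulation V 4 B 6 ap2 ou3 (%_ f. f) fO3"
proof
 show "reach (ap2 g) (mk V 4 B s fr q, C) (mk V 4 B s fr (fst (q, C)), snd (q, C)) 6" for g s fr q C
  using reach_mono[OF reach_skip] by (simp add: ap2_def)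
 fix v s fr q C assume v: "v < V"
 obtain gs os where C: "C = Circuit gs os" by (cases C) auto
 let ?S = "mk V 4 B s fr q" and ?w = "pf B (length (s v))"
 have l: "length (?S (hs v)) = ?w" "?S 5 = q 5" "?S 6 = q 6" "?S 30 = q 30" using v by (simp_all add: mk_hs pf_def mk_low)
 have h: "holds (Top 30) (fst (?S, C)) \<longleftrightarrow> q 30 ~= [] \<and> hd (q 30)" using l by simp
 have 1: "reach (IfElse (Top 30) (Apply (Toffoli 6 (hs v) 5)) skip) (?S, C) (?S, snd (fO3 ?w (q, C))) (2 + 1)"
 proof (cases "q 30 ~= [] \<and> hd (q 30)")
  case True
  have "reach (Apply (Toffoli 6 (hs v) 5)) (?S, C) (?S, snd (fO3 ?w (q, C))) 2"
   using reach_mono[OF reach_Apply[of "Toffoli 6 (hs v) 5" ?S gs os], of 2] True l by (simp add: fO3_def C)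
  then show ?thesis by (rule reach_If_true[rotated]) (use True h in simp)
 next
  case False
  have "reach skip (?S, C) (?S, snd (fO3 ?w (q, C))) 2"
   using reach_skip False by (auto simp: fO3_def addg_nil)
  then show ?thesis by (rule reach_If_false[rotated]) (use False h in simp)
 qed
 have "reach (Pop 30) (?S, snd (fO3 ?w (q, C))) (mk V 4 B s fr (fst (fO3 ?w (q, C))), snd (fO3 ?w (q, C))) 1"
  by (rule reach_Pop') (simp add: mk_upd_low mk_low fO3_def)
 from reach_mono[OF reach_Seq[OF 1 this], of 6]
 show "reach (ou3 v) (?S, C) (mk V 4 B s fr (fst (fO3 ?w (q, C))), snd (fO3 ?w (q, C))) 6"
  by (simp add: ou3_def)
qed auto

definition ou4 :: "nat => prog" where "ou4 v = Output (hs v)"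

fun addo :: "circuit => nat list => circuit" where "addo (Circuit gs os) ws = Circuit gs (os @ ws)"

definition fO4 :: "nat => frame => frame" where "fO4 w f = (fst f, addo (snd f) [w])"

lemma sim4: "simulation V 3 B 6 ap1 ou4 fA1 fO4"
proof
 show "reach (ap1 g) (mk V 3 B s fr q, C) (mk V 3 B s fr (fst (fA1 (map_gate (%v. pf B (length (s v))) g) (q, C))),
   snd (fA1 (map_gate (%v. pf B (length (s v))) g) (q, C))) 6" if "set_gate g \<subseteq> {..<V}" for g s fr q C
  using reach_mono[OF reach_ap1[OF that]] by (simp add: fA1_def)
 fix v s fr q C assume v: "v < V"
 show "reach (ou4 v) (mk V 3 B s fr q, C) (mk V 3 B s fr (fst (fO4 (pf B (length (s v))) (q, C))), snd (fO4 (pf B (length (s v))) (q, C))) 6"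
  using reach_mono[OF reach_Output[of "hs v" "mk V 3 B s fr q"], of 6] v by (cases C) (simp add: ou4_def fO4_def mk_hs pf_def)
qed auto

lemma evs1: "evs B fA1 (%_ f. f) es (q, C) = (q, addg C (map (map_gate (pf B)) (lefts es)))"
proof (induction es arbitrary: C)
 case (Cons e es)
 then show ?case by (cases e) (simp_all add: evs_def fA1_def addg_addg)
qed (simp add: evs_def addg_nil)

lemma evs2:
 assumes "q 13 = un d" "q 14 = un k"
 shows "evs B (%_ f. f) fO2 es (q, C) = (q(13 := un (d + 2 * length (rights es)), 14 := un (k + length (rights es))),
  addg C (swaps (zip (map (pf B) (rights es)) (dsts d (length (rights es))))))"
 using assms
proof (induction es arbitrary: q d k C)
 case Nil
 then show ?case by (simp add: evs_def dsts_def swaps_def addg_nil fun_upd_idem)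
next
 case (Cons e es)
 show ?case
 proof (cases e)
  case (Inl g)
  then show ?thesis using Cons by (simp add: evs_def)
 next
  case (Inr w)
  let ?m = "length (rights es)"
  have d: "dsts d (Suc ?m) = d # dsts (d + 2) ?m" using dsts_add[of d 1 ?m] by (simp add: dsts_def)
  let ?q = "q(13 := un (Suc (Suc d)), 14 := un (Suc k))"
  have "evs B (%_ f. f) fO2 (e # es) (q, C) = evs B (%_ f. f) fO2 es (?q, addg C (swapg (pf B w) d))"
   using Cons.prems by (simp add: evs_def Inr fO2_def)
  also have "\<dots> = (?q(13 := un (Suc (Suc d) + 2 * ?m), 14 := un (Suc k + ?m)),
    addg (addg C (swapg (pf B w) d)) (swaps (zip (map (pf B) (rights es)) (dsts (Suc (Suc d)) ?m))))"
   by (rule Cons.IH) simp_all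
  also have "\<dots> = (q(13 := un (d + 2 * length (rights (e # es))), 14 := un (k + length (rights (e # es)))),
    addg C (swaps (zip (map (pf B) (rights (e # es))) (dsts d (length (rights (e # es)))))))"
   by (simp add: Inr addg_addg d swaps_def fun_upd_twist)
  finally show ?thesis .
 qed
qed

lemma evs3:
 assumes "q 6 = un \<kappa>" "q 5 = un t" "q 30 = S"
 shows "evs B (%_ f. f) fO3 es (q, C) = (q(30 := drop (length (rights es)) S), addg C (tofs \<kappa> t S (map (pf B) (rights es))))"
 using assms
proof (induction es arbitrary: q S C)
 case Nil
 then show ?case by (simp add: evs_def tofs_def addg_nil fun_upd_idem)
next
 case (Cons e es)
 show ?case
 proof (cases e)
  case (Inl g)
  then show ?thesis using Cons by (simp add: evs_def)
 next
  case (Inr w)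
  let ?g = "if S ~= [] \<and> hd S then [Toffoli \<kappa> (pf B w) t] else []"
  have "evs B (%_ f. f) fO3 (e # es) (q, C) = evs B (%_ f. f) fO3 es (q(30 := tl S), addg C ?g)"
   using Cons.prems by (simp add: evs_def Inr fO3_def)
  also have "\<dots> = ((q(30 := tl S))(30 := drop (length (rights es)) (tl S)), addg (addg C ?g) (tofs \<kappa> t (tl S) (map (pf B) (rights es))))"
   by (rule Cons.IH) (use Cons.prems in simp_all)
  also have "\<dots> = (q(30 := drop (length (rights (e # es))) S), addg C (tofs \<kappa> t S (map (pf B) (rights (e # es)))))"
   by (cases S) (simp_all add: Inr addg_addg tofs_def addg_nil)
  finally show ?thesis .
 qed
qed

lemma evs4: "evs B fA1 fO4 es (q, C) = (q, addo (addg C (map (map_gate (pf B)) (lefts es))) (map (pf B) (rights es)))"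
proof (induction es arbitrary: C)
 case Nil
 then show ?case by (cases C) (simp add: evs_def)
next
 case (Cons e es)
 then show ?case by (cases e; cases C) (simp_all add: evs_def fA1_def fO4_def)
qed

definition run1 :: "nat => nat => prog => prog" where
 "run1 V FR P = Seq (prepare V FR) (Seq skip (Seq (sim FR ap1 ou1 P) (Seq skip (clearall V))))"
definition run2 :: "nat => prog => prog" where
 "run2 V P = Seq (prepare V 3) (Seq skip (Seq (sim 3 ap2 ou2 P) (Seq skip (clearall V))))"
definition run3 :: "nat => bool => bool => prog => prog" where
 "run3 V S0 S1 P = Seq (prepare V 4) (Seq (Seq (Push 30 S1) (Push 30 S0)) (Seq (sim 4 ap2 ou3 P) (Seq (Seq (Pop 30) (Pop 30)) (clearall V))))"
definition run4 :: "nat => prog => prog" where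
 "run4 V P = Seq (prepare V 3) (Seq skip (Seq (sim 3 ap1 ou4 P) (Seq skip (clearall V))))"

definition simtime :: "nat => nat => nat => nat" where
 "simtime V X T = (V + 10) * (8 * X + 2) + 4 + (2 + (6 * T + (2 + (V * (8 * (5 * X + 2 + 2 * T) + 2) + 2))))"

definition clean :: "(nat => nat) => bool" where
 "clean h \<longleftrightarrow> h 2 = 0 \<and> h 30 = 0 \<and> (\<forall>w\<ge>40. h w = 0)"

text \<open>The constant \<open>2\<close> in \<open>grow\<close> is the distance by which the preparation lifts the fresh-wire stack.\<close>

definition grow :: "nat => nat => nat => nat" where "grow n k T = 2 * (n + k) + 2 + 2 * T"

definition fresh :: "circuit => (nat => nat) => nat => nat => nat => bool" where
 "fresh c h FR f T \<longleftrightarrow> h FR + 2 * (h 0 + h 16) + 2 \<le> f \<and> f \<le> h FR + grow (h 0) (h 16) T \<and> even (h FR + f) \<and>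
   (\<forall>w \<in> WL (gates c) \<union> set (outs c). h 15 + 2 * w < f)"

text \<open>The four replays share the set-up, the simulation and the clearing of the displaced
  stacks; they differ in \<open>pre\<close>, \<open>post\<close> and the effect of the events. The
  new frontier is only bounded, since it depends on the simulated run.\<close>

lemma run_skeleton:
 assumes g: "generates P (h 0) (h 16) T c" and u: "uses P \<subseteq> {..<V}" and V: "2 \<le> V" and cl: "clean h" and f: "h 15 \<le> h FR" and FR: "FR = 3 \<or> FR = 4"
  and X: "h 0 \<le> X" "h 15 \<le> X" "h 16 \<le> X" "h FR \<le> X"
  and sim: "\<And>B. simulation V FR B 6 ap ou fA fO"
  and pre: "\<And>s fr C. reach pre (mk V FR (h 15) s fr (U h), C) (mk V FR (h 15) s fr q0, C) 2"
  and post: "\<And>es s fr C. lefts es = gates c ==> rights es = outs c ==> 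
    reach post (mk V FR (h 15) s fr (fst (evs (h 15) fA fO es (q0, C))), snd (evs (h 15) fA fO es (q0, C))) (mk V FR (h 15) s fr (U h'), C' C) 2"
  and h': "\<forall>w\<ge>40. h' w = 0"
 shows "\<exists>f'. fresh c h FR f' T \<and> 
  reach (Seq (prepare V FR) (Seq pre (Seq (sim FR ap ou P) (Seq post (clearall V))))) (U h, C) (U (h'(FR := f')), C' C) (simtime V X T)"
proof -
 interpret si: simulation V FR "h 15" 6 ap ou fA fO by (rule sim)
 let ?f = "h FR + 2 * (h 0 + h 16) + 2"
 obtain es fr' s' where 1: "lefts es = gates c" "rights es = outs c" "?f \<le> fr'" "fr' \<le> ?f + 2 * T"
  "even (h FR + fr')" "\<forall>w \<in> WL (gates c) \<union> set (outs c). h 15 + 2 * w < fr'" "\<forall>v. h 15 + 2 * length (s' v) \<le> fr'"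
  and r: "reach (sim FR ap ou P) (mk V FR (h 15) (inist (h 0) (h 16)) ?f q0, C)
   (mk V FR (h 15) s' fr' (fst (evs (h 15) fA fO es (q0, C))), snd (evs (h 15) fA fO es (q0, C))) (6 * T)"
  using si.sim_generates[OF g u f, of q0 C] by blast
 have h2: "h 2 = 0" "\<forall>w\<ge>40. h w = 0" using cl by (auto simp: clean_def)
 \<comment> \<open>The bound \<open>5 * X\<close> arises from a frontier of at most \<open>X\<close>
   that is lifted by \<open>2 * (h 0 + h 16)\<close>.\<close>
 have L: "\<forall>v. length (s' v) \<le> 5 * X + 2 + 2 * T \<and> h 15 + 2 * length (s' v) \<le> 5 * X + 2 + 2 * T"
 proof
  fix v
  have "h 15 + 2 * length (s' v) \<le> fr'" using 1(7) by simp
  then have "h 15 + 2 * length (s' v) \<le> 5 * X + 2 + 2 * T" using 1(4) X by arith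
  then show "length (s' v) \<le> 5 * X + 2 + 2 * T \<and> h 15 + 2 * length (s' v) \<le> 5 * X + 2 + 2 * T" by simp
 qed
 have F40: "FR < 40" using FR by auto
 have "reach (Seq (prepare V FR) (Seq pre (Seq (sim FR ap ou P) (Seq post (clearall V))))) (U h, C) (U (h'(FR := fr')), C' C) (simtime V X T)"
  unfolding simtime_def
 proof (intro reach_Seq)
  show "reach (prepare V FR) (U h, C) (mk V FR (h 15) (inist (h 0) (h 16)) ?f (U h), C) ((V + 10) * (8 * X + 2) + 4)"
   by (rule reach_prepare[OF h2 FR V X(1-3)])
  show "reach (clearall V) (mk V FR (h 15) s' fr' (U h'), C' C) (U (h'(FR := fr')), C' C) (V * (8 * (5 * X + 2 + 2 * T) + 2) + 2)"
   using reach_clearall[OF F40 L, of V fr' "U h'" "C' C"] mk_clear_U[OF h' F40] by simp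
 qed (fact pre r post[OF 1(1,2)])+
 moreover have "fresh c h FR fr' T" using 1 by (simp add: fresh_def grow_def)
 ultimately show ?thesis by blast
qed


lemma simtime_mono: "V \<le> V' ==> X \<le> X' ==> T \<le> T' ==> simtime V X T \<le> simtime V' X' T'"
 unfolding simtime_def by (intro add_mono mult_mono) auto

lemma run1:
 assumes g: "generates P (h 0) (h 16) T c" "uses P \<subseteq> {..<V}" "2 \<le> V" "clean h" "h 15 \<le> h FR" and FR: "FR = 3 \<or> FR = 4"
  and X: "h 0 \<le> X" "h 15 \<le> X" "h 16 \<le> X" "h FR \<le> X"
 shows "\<exists>f'. fresh c h FR f' T \<and> reach (run1 V FR P) (U h, C) (U (h(FR := f')), addg C (map (map_gate (pf (h 15))) (gates c))) (simtime V X T)"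
 unfolding run1_def
proof (rule run_skeleton[OF g FR X sim1[OF FR], where ?q0.0 = "U h" and h' = h and C' = "%C. addg C (map (map_gate (pf (h 15))) (gates c))"])
 show "\<forall>w\<ge>40. h w = 0" using g(4) by (simp add: clean_def)
qed (simp_all only: evs1 fst_conv snd_conv reach_skip)

lemma run2:
 assumes g: "generates P (h 0) (h 16) T c" "uses P \<subseteq> {..<V}" "2 \<le> V" "clean h" "h 15 \<le> h 3"
  and X: "h 0 \<le> X" "h 15 \<le> X" "h 16 \<le> X" "h 3 \<le> X"
 shows "\<exists>f'. fresh c h 3 f' T \<and> reach (run2 V P) (U h, C) (U (h(13 := h 13 + 2 * length (outs c), 14 := h 14 + length (outs c), 3 := f')),
  addg C (swaps (zip (map (pf (h 15)) (outs c)) (dsts (h 13) (length (outs c)))))) (simtime V X T)"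
 unfolding run2_def
proof (rule run_skeleton[OF g _ X sim2, where ?q0.0 = "U h" and h' = "h(13 := h 13 + 2 * length (outs c), 14 := h 14 + length (outs c))"
   and C' = "%C. addg C (swaps (zip (map (pf (h 15)) (outs c)) (dsts (h 13) (length (outs c)))))"])
 show "reach skip (mk V 3 (h 15) s fr (fst (evs (h 15) (%_ f. f) fO2 es (U h, C))), snd (evs (h 15) (%_ f. f) fO2 es (U h, C)))
  (mk V 3 (h 15) s fr (U (h(13 := h 13 + 2 * length (outs c), 14 := h 14 + length (outs c)))),
   addg C (swaps (zip (map (pf (h 15)) (outs c)) (dsts (h 13) (length (outs c)))))) 2" if "rights es = outs c" for es s fr C
  unfolding evs2[of "U h", OF U_app U_app] fst_conv snd_conv that U_upd by (rule reach_skip)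
qed (use g(4) reach_skip in \<open>simp_all add: clean_def\<close>)

lemma run3:
 assumes g: "generates P (h 0) (h 16) T c" "uses P \<subseteq> {..<V}" "2 \<le> V" "clean h" "h 15 \<le> h 4"
  and X: "h 0 \<le> X" "h 15 \<le> X" "h 16 \<le> X" "h 4 \<le> X"
 shows "\<exists>f'. fresh c h 4 f' T \<and> reach (run3 V S0 S1 P) (U h, C) (U (h(4 := f')),
  addg C (tofs (h 6) (h 5) [S0, S1] (map (pf (h 15)) (outs c)))) (simtime V X T)"
 unfolding run3_def
proof (rule run_skeleton[OF g _ X sim3, where ?q0.0 = "(U h)(30 := [S0, S1])" and h' = h
   and C' = "%C. addg C (tofs (h 6) (h 5) [S0, S1] (map (pf (h 15)) (outs c)))"])
 have z: "U h 30 = []" using g(4) by (simp add: clean_def)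
 show "reach (Seq (Push 30 S1) (Push 30 S0)) (mk V 4 (h 15) s fr (U h), C) (mk V 4 (h 15) s fr ((U h)(30 := [S0, S1])), C) 2" for s fr C
 proof -
  have "reach (Push 30 S1) (mk V 4 (h 15) s fr (U h), C) (mk V 4 (h 15) s fr ((U h)(30 := [S1])), C) 1"
   by (rule reach_Push') (simp add: mk_upd_low mk_low z del: U_app)
  moreover have "reach (Push 30 S0) (mk V 4 (h 15) s fr ((U h)(30 := [S1])), C) (mk V 4 (h 15) s fr ((U h)(30 := [S0, S1])), C) 1"
   by (rule reach_Push') (simp add: mk_upd_low mk_low z del: U_app)
  ultimately have "reach (Seq (Push 30 S1) (Push 30 S0)) (mk V 4 (h 15) s fr (U h), C) (mk V 4 (h 15) s fr ((U h)(30 := [S0, S1])), C) (1 + 1)"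
   by (rule reach_Seq)
  then show ?thesis by (rule reach_mono) simp
 qed
 show "reach (Seq (Pop 30) (Pop 30)) (mk V 4 (h 15) s fr (fst (evs (h 15) (%_ f. f) fO3 es ((U h)(30 := [S0, S1]), C))), snd (evs (h 15) (%_ f. f) fO3 es ((U h)(30 := [S0, S1]), C)))
  (mk V 4 (h 15) s fr (U h), addg C (tofs (h 6) (h 5) [S0, S1] (map (pf (h 15)) (outs c)))) 2" if r: "rights es = outs c" for es s fr C
 proof -
  let ?D = "addg C (tofs (h 6) (h 5) [S0, S1] (map (pf (h 15)) (outs c)))" and ?l = "drop (length (outs c)) [S0, S1]"
  have e: "evs (h 15) (%_ f. f) fO3 es ((U h)(30 := [S0, S1]), C) = ((U h)(30 := ?l), ?D)"
   by (subst evs3[of _ "h 6" "h 5" "[S0, S1]"]) (simp_all add: r)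
  have pop: "reach (Pop 30) (mk V 4 (h 15) s fr ((U h)(30 := l)), ?D) (mk V 4 (h 15) s fr ((U h)(30 := tl l)), ?D) 1" for l
   by (rule reach_Pop') (simp add: mk_upd_low mk_low)
  have "tl (tl ?l) = []" by (cases "length (outs c)"; cases "length (outs c) - 1") auto
  then have "(U h)(30 := tl (tl ?l)) = U h" using z by (simp only: fun_upd_idem)
  with reach_Seq[OF pop pop, of ?l] show ?thesis unfolding e fst_conv snd_conv by (simp add: numeral_2_eq_2 del: U_app)
 qed
qed (use g(4) in \<open>simp_all add: clean_def\<close>)

lemma run4:
 assumes g: "generates P (h 0) (h 16) T c" "uses P \<subseteq> {..<V}" "2 \<le> V" "clean h" "h 15 \<le> h 3"
  and X: "h 0 \<le> X" "h 15 \<le> X" "h 16 \<le> X" "h 3 \<le> X"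
 shows "\<exists>f'. fresh c h 3 f' T \<and> reach (run4 V P) (U h, C) (U (h(3 := f')),
  addo (addg C (map (map_gate (pf (h 15))) (gates c))) (map (pf (h 15)) (outs c))) (simtime V X T)"
 unfolding run4_def
proof (rule run_skeleton[OF g _ X sim4, where ?q0.0 = "U h" and h' = h
   and C' = "%C. addo (addg C (map (map_gate (pf (h 15))) (gates c))) (map (pf (h 15)) (outs c))"])
 show "\<forall>w\<ge>40. h w = 0" using g(4) by (simp add: clean_def)
qed (simp_all only: evs4 fst_conv snd_conv reach_skip, simp)

section \<open>Programs as transformers of stack heights and gate lists\<close>

definition go :: "prog => (nat => nat) => (nat => nat) => nat gate list => nat => bool" where
 "go P h h' gs' T \<longleftrightarrow> (\<forall>gs. reach P (U h, Circuit gs []) (U h', Circuit (gs @ gs') []) T)"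

lemma go_cong: "go P h h' gs T ==> h1 = h ==> h2 = h' ==> gs' = gs ==> T \<le> T' ==> go P h1 h2 gs' T'"
 unfolding go_def using reach_mono by blast

lemma go_Seq: "go P h h1 gs m ==> go Q h1 h2 gs' n ==> go (Seq P Q) h h2 (gs @ gs') (m + n)"
 unfolding go_def by (metis append.assoc reach_Seq)

lemma go_skip: "go skip h h [] 2"
 unfolding go_def using reach_skip by simp

lemma go_copy: "h 2 = 0 ==> a ~= b ==> a ~= 2 ==> b ~= 2 ==> go (copy a b) h (h(b := h a + h b)) [] (8 * h a + 2)"
 unfolding go_def using reach_copyU by simp

lemma go_clear: "go (clear v) h (h(v := 0)) [] (4 * h v + 1)"
 unfolding go_def using reach_clearU by simp

lemma go_Push: "go (Push v True) h (h(v := Suc (h v))) [] 1"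
 unfolding go_def using reach_PushU by simp

lemma go_Pop: "go (Pop v) h (h(v := h v - 1)) [] 1"
proof -
 have "(U h)(v := tl (U h v)) = U (h(v := h v - 1))" by (simp add: un_tl U_upd)
 then show ?thesis unfolding go_def using reach_Pop[of v "U h"] by (metis append_Nil2)
qed

lemma go_Apply: "go (Apply g) h h [map_gate h g] 1"
 unfolding go_def using reach_ApplyU by simp

lemma go_while_done: "h v = 0 ==> go (While (Nonempty v) P) h h [] 1"
 unfolding go_def using reach_While_false[of "Nonempty v" "(U h, Circuit _ [])"] by simp

lemma go_while_step: "h v ~= 0 ==> go P h h1 gs m ==> go (While (Nonempty v) P) h1 h2 gs' n ==>
 go (While (Nonempty v) P) h h2 (gs @ gs') (m + n + 1)"
 unfolding go_def
proof
 fix gs0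
 assume a: "h v ~= 0" "\<forall>gs'. reach P (U h, Circuit gs' []) (U h1, Circuit (gs' @ gs) []) m"
  "\<forall>gs. reach (While (Nonempty v) P) (U h1, Circuit gs []) (U h2, Circuit (gs @ gs') []) n"
 show "reach (While (Nonempty v) P) (U h, Circuit gs0 []) (U h2, Circuit (gs0 @ gs @ gs') []) (m + n + 1)"
  by (rule reach_While_true[OF _ spec[OF a(2), of gs0]]) (use a(1) spec[OF a(3), of "gs0 @ gs"] in \<open>simp_all add: U_def\<close>)
qed

lemma go_if: "go P h h1 gs m ==> h v ~= 0 ==> go (IfElse (Nonempty v) P Q) h h1 gs (m + 1)"
 "go Q h h1 gs m ==> h v = 0 ==> go (IfElse (Nonempty v) P Q) h h1 gs (m + 1)"
proof -
 show "go (IfElse (Nonempty v) P Q) h h1 gs (m + 1)" if "go P h h1 gs m" "h v ~= 0"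
  unfolding go_def by (intro allI reach_If_true) (use that in \<open>simp_all add: go_def\<close>)
 show "go (IfElse (Nonempty v) P Q) h h1 gs (m + 1)" if "go Q h h1 gs m" "h v = 0"
  unfolding go_def by (intro allI reach_If_false) (use that in \<open>simp_all add: go_def\<close>)
qed

lemma go_for:
 assumes "I 0 h []" "h v = N"
  and step: "\<And>i h gs. i < N ==> I i h gs ==> h v = N - i ==>
   \<exists>h' gs'. go P (h(v := h v - 1)) h' gs' B \<and> h' v = h v - 1 \<and> I (Suc i) h' (gs @ gs')"
 shows "\<exists>h' gs'. go (for_loop v P) h h' gs' (N * (B + 2) + 1) \<and> h' v = 0 \<and> I N h' gs'"
proof -
 have "\<exists>h' gs'. go (for_loop v P) h h' gs' (j * (B + 2) + 1) \<and> h' v = 0 \<and> I N h' (gs @ gs')"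
  if "I (N - j) h gs" "h v = j" "j \<le> N" for j h gs
  using that
 proof (induction j arbitrary: h gs)
  case 0
  then have "go (for_loop v P) h h [] (0 * (B + 2) + 1)" unfolding for_loop_def using go_while_done by simp
  then show ?case using 0 by fastforce
 next
  case (Suc j)
  have e: "Suc (N - Suc j) = N - j" using Suc.prems by simp
  obtain h1 gs1 where 1: "go P (h(v := h v - 1)) h1 gs1 B" "h1 v = h v - 1" "I (Suc (N - Suc j)) h1 (gs @ gs1)"
   using step[of "N - Suc j" h gs] Suc.prems by auto
  obtain h2 gs2 where 2: "go (for_loop v P) h1 h2 gs2 (j * (B + 2) + 1)" "h2 v = 0" "I N h2 ((gs @ gs1) @ gs2)"
   using Suc.IH[of h1 "gs @ gs1"] 1 e Suc.prems by auto
  have "go (for_loop v P) h h2 (([] @ gs1) @ gs2) ((1 + B) + (j * (B + 2) + 1) + 1)"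
   unfolding for_loop_def
   by (rule go_while_step[OF _ go_Seq[OF go_Pop 1(1)]]) (use Suc.prems 2(1) in \<open>simp_all add: for_loop_def\<close>)
  then have "go (for_loop v P) h h2 (gs1 @ gs2) (Suc j * (B + 2) + 1)" by (rule go_cong) simp_all
  then show ?case using 2 by auto
 qed
 from this[of N h "[]"] assms(1,2) show ?thesis by simp
qed

text \<open>The varying registers: \<open>3\<close> and \<open>4\<close> are the frontiers of the
  even and the odd wires, \<open>6\<close> is the activation wire, \<open>13\<close> and
  \<open>14\<close> are the next destination and the number of filled wires of the learner's
  register, \<open>19\<close> is a scratch address.\<close>

definition R :: "(nat => nat) => nat => nat => nat => nat => nat => nat => nat => nat" where
 "R h e o' x d q s = h(3 := e, 4 := o', 6 := x, 13 := d, 14 := q, 19 := s)"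

lemma R_simps [simp]: "R h e o' x d q s 3 = e" "R h e o' x d q s 4 = o'" "R h e o' x d q s 6 = x" "R h e o' x d q s 13 = d"
 "R h e o' x d q s 14 = q" "R h e o' x d q s 19 = s"
 "v \<notin> {3, 4, 6, 13, 14, 19} ==> R h e o' x d q s v = h v"
 by (auto simp: R_def)

lemma R_upd [simp]: "(R h e o' x d q s)(3 := y) = R h y o' x d q s" "(R h e o' x d q s)(4 := y) = R h e y x d q s"
 "(R h e o' x d q s)(6 := y) = R h e o' y d q s" "(R h e o' x d q s)(13 := y) = R h e o' x y q s"
 "(R h e o' x d q s)(14 := y) = R h e o' x d y s" "(R h e o' x d q s)(19 := y) = R h e o' x d q y"
 "v \<notin> {3, 4, 6, 13, 14, 19} ==> (R h e o' x d q s)(v := y) = R (h(v := y)) e o' x d q s"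
 by (auto simp: R_def fun_eq_iff)

lemma copies_append: "copies g xs e d gs e1 ==> copies g ys e1 (d + 2 * (length (outs g) * length xs)) gs' e2 ==>
 copies g (xs @ ys) e d (gs @ gs') e2"
proof (induction xs arbitrary: e d gs)
 case (Cons b xs)
 obtain e0 hs where 1: "fits g e e0" "copies g xs e0 (d + 2 * length (outs g)) hs e1"
  "gs = copyg g (xp b e) (pf e) (dsts d (length (outs g))) @ hs" using Cons.prems(1) by auto
 have "d + 2 * (length (outs g) * length (b # xs)) = (d + 2 * length (outs g)) + 2 * (length (outs g) * length xs)"
  by (simp add: algebra_simps)
 then have "copies g (xs @ ys) e0 (d + 2 * length (outs g)) (hs @ gs') e2"
  using Cons.IH[OF 1(2)] Cons.prems(2) by metis
 then show ?case using 1 by auto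
qed simp

lemma slots_append: "slots g C k r S xs e o1 gs e1 o2 ==> slots g C k r S ys e1 o2 gs' e2 o3 ==> slots g C k r S (xs @ ys) e o1 (gs @ gs') e2 o3"
proof (induction xs arbitrary: e o1 gs)
 case (Cons x xs)
 then show ?case by (cases x) (fastforce simp: append.assoc)
qed simp

lemma gad_snoc: "gad e (Suc r) = gad e r @ [Had (e + 4 * r + 2), Toffoli (e + 4 * r) (e + 4 * r + 2) (e + 4 * r + 4)]"
proof (induction r arbitrary: e)
 case (Suc r)
 have "gad e (Suc (Suc r)) = Had (e + 2) # Toffoli e (e + 2) (e + 4) # gad (e + 4) (Suc r)" by simp
 then show ?case unfolding Suc[of "e + 4"] by (simp add: algebra_simps)
qed simp

lemma cswaps_snoc: "cswaps x (zip [0..<Suc j] (dsts d (Suc j))) = cswaps x (zip [0..<j] (dsts d j)) @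
 [CNot (d + 2 * j) j, Toffoli x j (d + 2 * j), CNot (d + 2 * j) j]"
 by (simp add: cswaps_def dsts_def)


text \<open>A program never reads the circuit that it writes, so a run from the empty circuit can be
  repeated behind any other circuit.\<close>

lemma exec_shift:
 "exec P a T b ==> \<exists>g2 o2. snd b = Circuit (gates (snd a) @ g2) (outs (snd a) @ o2) \<and>
  (\<forall>gs os. exec P (fst a, Circuit gs os) T (fst b, Circuit (gs @ g2) (os @ o2)))"
proof (induction rule: exec.induct)
 case (exec_Push v b s c)
 show ?case by (rule exI[of _ "[]"], rule exI[of _ "[]"]) (cases c; simp only: fst_conv snd_conv append_Nil2 circuit.sel exec.exec_Push simp_thms)
next
 case (exec_Pop v s c)
 show ?case by (rule exI[of _ "[]"], rule exI[of _ "[]"]) (cases c; simp only: fst_conv snd_conv append_Nil2 circuit.sel exec.exec_Pop simp_thms)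
next
 case (exec_Apply g s gs os)
 show ?case by (rule exI[of _ "[map_gate (%v. length (s v)) g]"], rule exI[of _ "[]"]) (use exec.exec_Apply in simp)
next
 case (exec_Output v s gs os)
 show ?case by (rule exI[of _ "[]"], rule exI[of _ "[length (s v)]"]) (use exec.exec_Output in simp)
next
 case (exec_Seq P a m b Q n d)
 then obtain g1 o1 g2 o2 where 1: "snd b = Circuit (gates (snd a) @ g1) (outs (snd a) @ o1)"
  "\<forall>gs os. exec P (fst a, Circuit gs os) m (fst b, Circuit (gs @ g1) (os @ o1))"
  "snd d = Circuit (gates (snd b) @ g2) (outs (snd b) @ o2)"
  "\<forall>gs os. exec Q (fst b, Circuit gs os) n (fst d, Circuit (gs @ g2) (os @ o2))" by blast
 have "exec (Seq P Q) (fst a, Circuit gs os) (m + n) (fst d, Circuit (gs @ g1 @ g2) (os @ o1 @ o2))" for gs os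
  by (rule exec.exec_Seq[OF spec[OF spec[OF 1(2)]]]) (use spec[OF spec[OF 1(4), of "gs @ g1"], of "os @ o1"] in simp)
 then show ?case using 1(1,3) by (intro exI[of _ "g1 @ g2"] exI[of _ "o1 @ o2"]) simp
next
 case (exec_If_true t a P m b Q)
 then show ?case using exec.exec_If_true by (metis fst_conv)
next
 case (exec_If_false t a Q m b P)
 then show ?case using exec.exec_If_false by (metis fst_conv)
next
 case (exec_While_false t a P)
 show ?case by (rule exI[of _ "[]"], rule exI[of _ "[]"]) (use exec_While_false exec.exec_While_false in simp)
next
 case (exec_While_true t a P m b n d)
 then obtain g1 o1 g2 o2 where 1: "snd b = Circuit (gates (snd a) @ g1) (outs (snd a) @ o1)"
  "\<forall>gs os. exec P (fst a, Circuit gs os) m (fst b, Circuit (gs @ g1) (os @ o1))"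
  "snd d = Circuit (gates (snd b) @ g2) (outs (snd b) @ o2)"
  "\<forall>gs os. exec (While t P) (fst b, Circuit gs os) n (fst d, Circuit (gs @ g2) (os @ o2))" by blast
 have "exec (While t P) (fst a, Circuit gs os) (Suc (m + n)) (fst d, Circuit (gs @ g1 @ g2) (os @ o1 @ o2))" for gs os
  by (rule exec.exec_While_true[OF _ spec[OF spec[OF 1(2)]]]) (use exec_While_true(1) spec[OF spec[OF 1(4), of "gs @ g1"], of "os @ o1"] in simp_all)
 then show ?case using 1(1,3) by (intro exI[of _ "g1 @ g2"] exI[of _ "o1 @ o2"]) simp
qed

lemma go_intro:
 assumes "reach P (U h, Circuit [] []) (U h', Circuit gs []) T"
 shows "go P h h' gs T"
proof -
 obtain T' where T: "T' \<le> T" "exec P (U h, Circuit [] []) T' (U h', Circuit gs [])" using assms by (auto simp: reach_def)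
 obtain g2 o2 where "Circuit gs [] = Circuit g2 o2" "\<forall>gs os. exec P (U h, Circuit gs os) T' (U h', Circuit (gs @ g2) (os @ o2))"
  using exec_shift[OF T(2)] by auto
 then show ?thesis using T(1) unfolding go_def reach_def by (metis append_Nil2 circuit.inject)
qed

section \<open>The program of the distinguisher\<close>

definition grun :: "nat => prog => prog => prog" where
 "grun V P prep = Seq (copy 3 15) (Seq prep (Seq (Push 16 True) (Seq (run1 V 3 P) (Seq (run2 V P) (Seq (clear 15) (clear 16))))))"

fun copiesp :: "nat => prog => bool list => prog" where
 "copiesp V P [] = skip"
| "copiesp V P (b # bs) = Seq (grun V P (if b then Apply (PauliX 15) else skip)) (copiesp V P bs)"

text \<open>The number of blocks is the height of stack \<open>c\<close>, known only at run time;
  the block \<open>bs\<close> is part of the program text.\<close>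

definition rep :: "nat => prog => nat => bool list => prog" where
 "rep V P c bs = Seq (copy c 17) (for_loop 17 (copiesp V P bs))"

definition arun :: "nat => prog => bool => bool => prog" where
 "arun V P S0 S1 = Seq (copy 4 15) (Seq (copy 14 16) (Seq (run1 V 4 P) (Seq (run3 V S0 S1 P) (Seq (clear 15) (clear 16)))))"

definition cswapsp :: prog where
 "cswapsp = Seq (copy 1 21) (Seq (for_loop 21 (Seq (Apply (CNot 19 18)) (Seq (Apply (Toffoli 6 18 19)) (Seq (Apply (CNot 19 18))
   (Seq (Push 18 True) (Seq (Push 19 True) (Push 19 True))))))) (clear 18))"

definition gadp :: prog where
 "gadp = Seq (clear 6) (Seq (copy 3 6) (Seq (copy 7 17) (for_loop 17 (Seq (Push 3 True) (Seq (Push 3 True) (Seq (Apply (Had 3)) (Seq (copy 3 19)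
   (Seq (Push 3 True) (Seq (Push 3 True) (Seq (Apply (Toffoli 6 19 3)) (Seq (clear 19) (Seq (clear 6) (copy 3 6)))))))))))))"

definition ok :: "nat => nat => (nat => nat) => bool" where
 "ok n k h \<longleftrightarrow> h 0 = n \<and> h 1 = k \<and> h 5 = k \<and> h 15 = 0 \<and> h 16 = 0 \<and> clean h"

lemma okD: "ok n k h ==> h 0 = n \<and> h 1 = k \<and> h 5 = k \<and> h 15 = 0 \<and> h 16 = 0 \<and> h 2 = 0 \<and> clean h"
 by (simp add: ok_def clean_def)

lemma clean_R [simp]: "clean (R h e o' x d q s) = clean h"
 by (auto simp: clean_def R_def)

lemma clean_upd [simp]: "v ~= 2 ==> v ~= 30 ==> v < 40 ==> clean (h(v := x)) = clean h"
 by (auto simp: clean_def)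

lemma ok_upd [simp]: "v \<notin> {0, 1, 2, 5, 15, 16, 30} ==> v < 40 ==> ok n k (h(v := x)) = ok n k h"
 by (auto simp: ok_def)

lemma go_copyI: "h 2 = 0 ==> a ~= b ==> a ~= 2 ==> b ~= 2 ==> h' = h(b := h a + h b) ==> 8 * h a + 2 \<le> T ==> go (copy a b) h h' [] T"
 using go_cong[OF go_copy] by blast

lemma go_clearI: "h' = h(v := 0) ==> 4 * h v + 1 \<le> T ==> go (clear v) h h' [] T"
 using go_cong[OF go_clear] by blast

lemma go_PushI: "h' = h(v := Suc (h v)) ==> 1 \<le> T ==> go (Push v True) h h' [] T"
 using go_cong[OF go_Push] by blast

lemma go_ApplyI: "h' = h ==> gs = [map_gate h g] ==> 1 \<le> T ==> go (Apply g) h h' gs T"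
 using go_cong[OF go_Apply] by blast

lemma go_skipI: "h' = h ==> gs = [] ==> 2 \<le> T ==> go skip h h' gs T"
 using go_cong[OF go_skip] by blast

lemma tri_le: "N \<le> T ==> N * (x::nat) \<le> T * x" by simp

text \<open>Uniform bounds at fixed \<open>n\<close> and \<open>k\<close>: \<open>Y\<close> for the
  stack heights, \<open>W\<close> for the cost of an elementary program at such heights,
  \<open>K0\<close> for the input length of the learner, and \<open>\<delta>\<close> for the
  movement of a frontier by one circuit. The factor 2 in front of \<open>grow\<close> is due to the
  two replays of each circuit.\<close>

locale asm =
 fixes VG VA n k TG TA Y W K0 \<delta> r T :: nat and PG' PA' :: prog and g :: circuit and C :: "nat => circuit"
 assumes genG: "generates PG' n 1 TG g" "uses PG' \<subseteq> {..<VG}" "2 \<le> VG"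
  and genA: "\<And>K. K \<le> K0 ==> \<exists>T\<le>TA. generates PA' n K T (C K)" "uses PA' \<subseteq> {..<VA}" "2 \<le> VA"
  and W: "simtime VG Y TG \<le> W" "simtime VA Y TA \<le> W" "8 * Y + 2 \<le> W"
  and \<delta>: "2 * grow n 1 TG \<le> \<delta>" "2 * grow n K0 TA \<le> \<delta>"
  and Y: "n \<le> Y" "1 \<le> Y" "k \<le> Y" "K0 \<le> Y" "r \<le> Y" "T \<le> Y"
begin

abbreviation "m \<equiv> length (outs g)"

lemma W10: "10 \<le> W" "x \<le> Y ==> 8 * x + 2 \<le> W" "x \<le> Y ==> 4 * x + 1 \<le> W" using W Y by auto

text \<open>Both replays use the displacement \<open>e\<close> saved in stack \<open>15\<close>. The
  frontier is beyond the circuit after the first one already; the second moves it further, which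
  \<open>fits\<close> permits.\<close>

lemma go_grun:
 assumes h: "ok n k h" and prep: "go prep (R (h(15 := e)) e o' x d q s) (R (h(15 := e)) e o' x d q s) pg W" and e: "e + \<delta> \<le> Y"
 shows "\<exists>e'. fits g e e' \<and> e' \<le> e + \<delta> \<and> go (grun VG PG' prep) (R h e o' x d q s) (R h e' o' x (d + 2 * m) (q + m) s)
  (copyg g pg (pf e) (dsts d m)) (7 * W)"
proof -
 note h' = okD[OF h]
 let ?h1 = "h(15 := e)" and ?h2 = "h(15 := e, 16 := 1)"
 have eY: "e \<le> Y" using e by simp
 have s1: "go (copy 3 15) (R h e o' x d q s) (R ?h1 e o' x d q s) [] W"
  by (rule go_copyI) (use h' W10(2)[OF eY] in simp_all)
 have s2: "go (Push 16 True) (R ?h1 e o' x d q s) (R ?h2 e o' x d q s) [] W"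
  by (rule go_PushI) (use h' W10(1) in simp_all)
 have "\<exists>f'. fresh g (R ?h2 e o' x d q s) 3 f' TG \<and> reach (run1 VG 3 PG') (U (R ?h2 e o' x d q s), Circuit [] [])
  (U ((R ?h2 e o' x d q s)(3 := f')), addg (Circuit [] []) (map (map_gate (pf (R ?h2 e o' x d q s 15))) (gates g))) (simtime VG Y TG)"
  by (rule run1) (use genG h' Y eY in simp_all)
 then obtain f1 where f1: "fresh g (R ?h2 e o' x d q s) 3 f1 TG" and r1: "reach (run1 VG 3 PG') (U (R ?h2 e o' x d q s), Circuit [] [])
  (U (R ?h2 f1 o' x d q s), Circuit (map (map_gate (pf e)) (gates g)) []) (simtime VG Y TG)" by auto
 have s3: "go (run1 VG 3 PG') (R ?h2 e o' x d q s) (R ?h2 f1 o' x d q s) (map (map_gate (pf e)) (gates g)) W"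
  by (rule go_cong[OF go_intro[OF r1]]) (use W in simp_all)
 have F1: "e < f1" "even (e + f1)" "f1 \<le> e + grow n 1 TG" "\<forall>w \<in> WL (gates g) \<union> set (outs g). e + 2 * w < f1"
  using f1 h' unfolding fresh_def by simp_all
 have f1Y: "f1 \<le> Y" using F1(3) \<delta>(1) e by linarith
 have "\<exists>f'. fresh g (R ?h2 f1 o' x d q s) 3 f' TG \<and> reach (run2 VG PG') (U (R ?h2 f1 o' x d q s), Circuit [] [])
  (U ((R ?h2 f1 o' x d q s)(13 := R ?h2 f1 o' x d q s 13 + 2 * m, 14 := R ?h2 f1 o' x d q s 14 + m, 3 := f')),
   addg (Circuit [] []) (swaps (zip (map (pf (R ?h2 f1 o' x d q s 15)) (outs g)) (dsts (R ?h2 f1 o' x d q s 13) m)))) (simtime VG Y TG)"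
  by (rule run2) (use genG h' Y eY f1Y F1 in simp_all)
 then obtain f2 where f2: "fresh g (R ?h2 f1 o' x d q s) 3 f2 TG" and r2: "reach (run2 VG PG') (U (R ?h2 f1 o' x d q s), Circuit [] [])
  (U (R ?h2 f2 o' x (d + 2 * m) (q + m) s), Circuit (swaps (zip (map (pf e) (outs g)) (dsts d m))) []) (simtime VG Y TG)" by auto
 have s4: "go (run2 VG PG') (R ?h2 f1 o' x d q s) (R ?h2 f2 o' x (d + 2 * m) (q + m) s) (swaps (zip (map (pf e) (outs g)) (dsts d m))) W"
  by (rule go_cong[OF go_intro[OF r2]]) (use W in simp_all)
 have F2: "f1 < f2" "even (f1 + f2)" "f2 \<le> f1 + grow n 1 TG" using f2 h' unfolding fresh_def by simp_all
 have s5: "go (clear 15) (R ?h2 f2 o' x (d + 2 * m) (q + m) s) (R (h(16 := 1)) f2 o' x (d + 2 * m) (q + m) s) [] W"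
  by (rule go_clearI) (use h' W10(3)[OF eY] in \<open>simp_all add: fun_upd_twist[of 15 16] fun_upd_idem\<close>)
 have s6: "go (clear 16) (R (h(16 := 1)) f2 o' x (d + 2 * m) (q + m) s) (R h f2 o' x (d + 2 * m) (q + m) s) [] W"
  by (rule go_clearI) (use h' W10(1) in \<open>simp_all add: fun_upd_idem\<close>)
 have "go (grun VG PG' prep) (R h e o' x d q s) (R h f2 o' x (d + 2 * m) (q + m) s) (copyg g pg (pf e) (dsts d m)) (7 * W)"
  unfolding grun_def
  by (rule go_cong[OF go_Seq[OF s1 go_Seq[OF prep go_Seq[OF s2 go_Seq[OF s3 go_Seq[OF s4 go_Seq[OF s5 s6]]]]]]]) (simp_all add: copyg_def)
 moreover have "fits g e f2" unfolding fits_def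
 proof (intro conjI ballI)
  show "even (e + f2)" using F1(2) F2(2) by presburger
  show "e + 2 * w < f2" if "w \<in> WL (gates g) \<union> set (outs g)" for w using F1(4) that F2(1) by (meson less_trans)
 qed (use F1(1) F2(1) in simp)
 moreover have "f2 \<le> e + \<delta>" using F1(3) F2(3) \<delta>(1) by linarith
 ultimately show ?thesis by blast
qed

lemma go_copies:
 assumes h: "ok n k h"
 shows "e + \<delta> * length bs \<le> Y ==> \<exists>e' gs. copies g bs e d gs e' \<and> e' \<le> e + \<delta> * length bs \<and>
  go (copiesp VG PG' bs) (R h e o' x d q s) (R h e' o' x (d + 2 * (m * length bs)) (q + m * length bs) s) gs ((length bs + 1) * (7 * W))"
proof (induction bs arbitrary: e d q)
 case Nil
 have "go skip (R h e o' x d q s) (R h e o' x d q s) [] (7 * W)" by (rule go_skipI) (use W10(1) in simp_all)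
 then show ?case by simp
next
 case (Cons b bs)
 note h' = okD[OF h]
 have eb: "e + \<delta> \<le> Y" using Cons.prems by simp
 have "go (if b then Apply (PauliX 15) else skip) (R (h(15 := e)) e o' x d q s) (R (h(15 := e)) e o' x d q s) (xp b e) W"
 proof (cases b)
  case True
  then show ?thesis by (simp, intro go_ApplyI) (use W10(1) in \<open>simp_all add: xp_def\<close>)
 next
  case False
  then show ?thesis by (simp, intro go_skipI) (use W10(1) in \<open>simp_all add: xp_def\<close>)
 qed
 from go_grun[OF h this eb] obtain e1 where 1: "fits g e e1" "e1 \<le> e + \<delta>"
  "go (grun VG PG' (if b then Apply (PauliX 15) else skip)) (R h e o' x d q s) (R h e1 o' x (d + 2 * m) (q + m) s) (copyg g (xp b e) (pf e) (dsts d m)) (7 * W)" by blast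
 have "e1 + \<delta> * length bs \<le> Y" using Cons.prems 1(2) by simp
 from Cons.IH[OF this, of "d + 2 * m" "q + m"] obtain e' gs where 2: "copies g bs e1 (d + 2 * m) gs e'" "e' \<le> e1 + \<delta> * length bs"
  "go (copiesp VG PG' bs) (R h e1 o' x (d + 2 * m) (q + m) s) (R h e' o' x (d + 2 * m + 2 * (m * length bs)) (q + m + m * length bs) s) gs ((length bs + 1) * (7 * W))" by blast
 have c: "copies g (b # bs) e d (copyg g (xp b e) (pf e) (dsts d m) @ gs) e'" using 1(1) 2(1) by auto
 have l: "e' \<le> e + \<delta> * length (b # bs)" using 1(2) 2(2) by simp
 have "go (copiesp VG PG' (b # bs)) (R h e o' x d q s) (R h e' o' x (d + 2 * (m * length (b # bs))) (q + m * length (b # bs)) s)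
  (copyg g (xp b e) (pf e) (dsts d m) @ gs) ((length (b # bs) + 1) * (7 * W))"
  unfolding copiesp.simps by (rule go_cong[OF go_Seq[OF 1(3) 2(3)]]) (simp_all add: algebra_simps)
 then show ?case using c l by blast
qed

lemma go_rep:
 assumes h: "ok n k h" "h 17 = 0" "h c = N" "N \<le> T" "c \<notin> {2, 3, 4, 6, 13, 14, 17, 19}"
  and bs: "length bs = 2" and e: "e + \<delta> * length (concat (replicate N bs)) \<le> Y"
 shows "\<exists>e' gs. copies g (concat (replicate N bs)) e d gs e' \<and> e' \<le> e + \<delta> * length (concat (replicate N bs)) \<and>
  go (rep VG PG' c bs) (R h e o' x d q s) (R h e' o' x (d + 2 * (m * length (concat (replicate N bs)))) (q + m * length (concat (replicate N bs))) s) gs ((23 * T + 2) * W)"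
proof -
 note h' = okD[OF h(1)]
 have len: "length (concat (replicate i bs)) = i * 2" for i using bs by (induction i) simp_all
 define I where "I i f gs \<longleftrightarrow> (\<exists>e'. f = R (h(17 := N - i)) e' o' x (d + 2 * (m * (i * 2))) (q + m * (i * 2)) s \<and>
  copies g (concat (replicate i bs)) e d gs e' \<and> e' \<le> e + \<delta> * (i * 2))" for i f gs
 have s1: "go (copy c 17) (R h e o' x d q s) (R (h(17 := N)) e o' x d q s) [] W"
  by (rule go_copyI) (use h h' W10(2)[of N] Y in simp_all)
 have "\<exists>f gs. go (for_loop 17 (copiesp VG PG' bs)) (R (h(17 := N)) e o' x d q s) f gs (N * (21 * W + 2) + 1) \<and> f 17 = 0 \<and> I N f gs"
 proof (rule go_for)
  show "I 0 (R (h(17 := N)) e o' x d q s) []" by (auto simp: I_def)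
  fix i f gs assume i: "i < N" "I i f gs" "f 17 = N - i"
  then obtain e1 where e1: "f = R (h(17 := N - i)) e1 o' x (d + 2 * (m * (i * 2))) (q + m * (i * 2)) s"
   "copies g (concat (replicate i bs)) e d gs e1" "e1 \<le> e + \<delta> * (i * 2)" by (auto simp: I_def)
  have okh: "ok n k (h(17 := N - Suc i))" using h(1) by simp
  have "\<delta> * (i * 2 + 2) \<le> \<delta> * (N * 2)" by (rule mult_le_mono2) (use i(1) in simp)
  then have "e1 + \<delta> * length bs \<le> Y" using e e1(3) unfolding len bs add_mult_distrib2 by linarith
  from go_copies[OF okh this, of "d + 2 * (m * (i * 2))" o' x "q + m * (i * 2)" s] obtain e2 gs2 where
   2: "copies g bs e1 (d + 2 * (m * (i * 2))) gs2 e2" "e2 \<le> e1 + \<delta> * 2" and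
   g2: "go (copiesp VG PG' bs) (R (h(17 := N - Suc i)) e1 o' x (d + 2 * (m * (i * 2))) (q + m * (i * 2)) s)
    (R (h(17 := N - Suc i)) e2 o' x (d + 2 * (m * (i * 2)) + 2 * (m * 2)) (q + m * (i * 2) + m * 2) s) gs2 (3 * (7 * W))"
   using bs by (auto simp: numeral_3_eq_3)
  let ?f = "R (h(17 := N - Suc i)) e2 o' x (d + 2 * (m * (Suc i * 2))) (q + m * (Suc i * 2)) s"
  have "go (copiesp VG PG' bs) (f(17 := f 17 - 1)) ?f gs2 (21 * W)"
   by (rule go_cong[OF g2]) (use i(3) in \<open>simp_all add: e1(1) algebra_simps\<close>)
  moreover have "?f 17 = f 17 - 1" using i(3) by simp
  moreover have "I (Suc i) ?f (gs @ gs2)"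
  proof -
   have "copies g (concat (replicate i bs) @ bs) e d (gs @ gs2) e2"
    by (rule copies_append[OF e1(2)]) (use 2(1) in \<open>simp add: len\<close>)
   moreover have "concat (replicate i bs) @ bs = concat (replicate (Suc i) bs)" by (induction i) simp_all
   ultimately show ?thesis unfolding I_def using 2(2) e1(3) by (intro exI[of _ e2]) auto
  qed
  ultimately show "\<exists>h' gs'. go (copiesp VG PG' bs) (f(17 := f 17 - 1)) h' gs' (21 * W) \<and> h' 17 = f 17 - 1 \<and> I (Suc i) h' (gs @ gs')" by blast
 qed simp
 then obtain f gs where f: "go (for_loop 17 (copiesp VG PG' bs)) (R (h(17 := N)) e o' x d q s) f gs (N * (21 * W + 2) + 1)" "I N f gs" by blast
 then obtain e' where e': "f = R h e' o' x (d + 2 * (m * (N * 2))) (q + m * (N * 2)) s"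
  "copies g (concat (replicate N bs)) e d gs e'" "e' \<le> e + \<delta> * (N * 2)" using h(2) by (auto simp: I_def fun_upd_idem)
 have "21 * W + 2 \<le> 23 * W" using W10(1) by simp
 then have "N * (21 * W + 2) \<le> T * (23 * W)" using h(4) by (intro mult_mono) simp_all
 then have t: "W + (N * (21 * W + 2) + 1) \<le> (23 * T + 2) * W" using W10(1) by (simp add: algebra_simps)
 have "go (rep VG PG' c bs) (R h e o' x d q s) (R h e' o' x (d + 2 * (m * (N * 2))) (q + m * (N * 2)) s) gs ((23 * T + 2) * W)"
  unfolding rep_def by (rule go_cong[OF go_Seq[OF s1 f(1)]]) (use e'(1) t in simp_all)
 then show ?thesis unfolding len using e' by blast
qed

lemma go_arun:
 assumes h: "ok n k h" and q: "q \<le> K0" and o: "o' + \<delta> \<le> Y"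
 shows "\<exists>o2. fits (C q) o' o2 \<and> o' + 2 * q \<le> o2 \<and> o2 \<le> o' + \<delta> \<and> go (arun VA PA' S0 S1) (R h e o' x d q s) (R h e o2 x d q s)
  (map (map_gate (pf o')) (gates (C q)) @ tofs x k [S0, S1] (map (pf o') (outs (C q)))) (6 * W)"
proof -
 note h' = okD[OF h]
 obtain TT where TT: "TT \<le> TA" "generates PA' n q TT (C q)" using genA(1)[OF q] by blast
 have st: "simtime VA Y TT \<le> W" using simtime_mono[OF order_refl order_refl TT(1), of VA Y] W(2) by linarith
 have gr: "grow n q TT \<le> grow n K0 TA" using TT(1) q by (simp add: grow_def)
 let ?h1 = "h(15 := o')" and ?h2 = "h(15 := o', 16 := q)"
 have oY: "o' \<le> Y" "q \<le> Y" using o q Y by simp_all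
 have s1: "go (copy 4 15) (R h e o' x d q s) (R ?h1 e o' x d q s) [] W"
  by (rule go_copyI) (use h' W10(2)[OF oY(1)] in simp_all)
 have s2: "go (copy 14 16) (R ?h1 e o' x d q s) (R ?h2 e o' x d q s) [] W"
  by (rule go_copyI) (use h' W10(2)[OF oY(2)] in simp_all)
 have "\<exists>f'. fresh (C q) (R ?h2 e o' x d q s) 4 f' TT \<and> reach (run1 VA 4 PA') (U (R ?h2 e o' x d q s), Circuit [] [])
  (U ((R ?h2 e o' x d q s)(4 := f')), addg (Circuit [] []) (map (map_gate (pf (R ?h2 e o' x d q s 15))) (gates (C q)))) (simtime VA Y TT)"
  by (rule run1) (use genA TT h' Y oY in simp_all)
 then obtain f1 where f1: "fresh (C q) (R ?h2 e o' x d q s) 4 f1 TT" and r1: "reach (run1 VA 4 PA') (U (R ?h2 e o' x d q s), Circuit [] [])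
  (U (R ?h2 e f1 x d q s), Circuit (map (map_gate (pf o')) (gates (C q))) []) (simtime VA Y TT)" by auto
 have s3: "go (run1 VA 4 PA') (R ?h2 e o' x d q s) (R ?h2 e f1 x d q s) (map (map_gate (pf o')) (gates (C q))) W"
  by (rule go_cong[OF go_intro[OF r1]]) (use st in simp_all)
 have F1: "o' + 2 * (n + q) + 2 \<le> f1" "even (o' + f1)" "f1 \<le> o' + grow n q TT" "\<forall>w \<in> WL (gates (C q)) \<union> set (outs (C q)). o' + 2 * w < f1"
  using f1 h' unfolding fresh_def by simp_all
 have f1Y: "f1 \<le> Y" using F1(3) \<delta>(2) o gr by linarith
 have "\<exists>f'. fresh (C q) (R ?h2 e f1 x d q s) 4 f' TT \<and> reach (run3 VA S0 S1 PA') (U (R ?h2 e f1 x d q s), Circuit [] [])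
  (U ((R ?h2 e f1 x d q s)(4 := f')),
   addg (Circuit [] []) (tofs (R ?h2 e f1 x d q s 6) (R ?h2 e f1 x d q s 5) [S0, S1] (map (pf (R ?h2 e f1 x d q s 15)) (outs (C q))))) (simtime VA Y TT)"
  by (rule run3) (use genA TT h' Y oY f1Y F1 in simp_all)
 then obtain f2 where f2: "fresh (C q) (R ?h2 e f1 x d q s) 4 f2 TT" and r2: "reach (run3 VA S0 S1 PA') (U (R ?h2 e f1 x d q s), Circuit [] [])
  (U (R ?h2 e f2 x d q s), Circuit (tofs x k [S0, S1] (map (pf o') (outs (C q)))) []) (simtime VA Y TT)" using h' by auto
 have s4: "go (run3 VA S0 S1 PA') (R ?h2 e f1 x d q s) (R ?h2 e f2 x d q s) (tofs x k [S0, S1] (map (pf o') (outs (C q)))) W"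
  by (rule go_cong[OF go_intro[OF r2]]) (use st in simp_all)
 have F2: "f1 < f2" "even (f1 + f2)" "f2 \<le> f1 + grow n q TT" using f2 h' unfolding fresh_def by simp_all
 have s5: "go (clear 15) (R ?h2 e f2 x d q s) (R (h(16 := q)) e f2 x d q s) [] W"
  by (rule go_clearI) (use h' W10(3)[OF oY(1)] in \<open>simp_all add: fun_upd_twist[of 15 16] fun_upd_idem\<close>)
 have s6: "go (clear 16) (R (h(16 := q)) e f2 x d q s) (R h e f2 x d q s) [] W"
  by (rule go_clearI) (use h' W10(3)[OF oY(2)] in \<open>simp_all add: fun_upd_idem\<close>)
 have "go (arun VA PA' S0 S1) (R h e o' x d q s) (R h e f2 x d q s)
  (map (map_gate (pf o')) (gates (C q)) @ tofs x k [S0, S1] (map (pf o') (outs (C q)))) (6 * W)"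
  unfolding arun_def
  by (rule go_cong[OF go_Seq[OF s1 go_Seq[OF s2 go_Seq[OF s3 go_Seq[OF s4 go_Seq[OF s5 s6]]]]]]) simp_all
 moreover have "fits (C q) o' f2" unfolding fits_def
 proof (intro conjI ballI)
  show "even (o' + f2)" using F1(2) F2(2) by presburger
  show "o' + 2 * w < f2" if "w \<in> WL (gates (C q)) \<union> set (outs (C q))" for w using F1(4) that F2(1) by (meson less_trans)
 qed (use F1(1) F2(1) in simp)
 moreover have "f2 \<le> o' + \<delta>" using F1(3) F2(3) \<delta>(2) gr by linarith
 moreover have "o' + 2 * q \<le> f2" using F1(1) F2(1) unfolding add_mult_distrib2 by linarith
 ultimately show ?thesis by blast
qed

lemma go_cswaps:
 assumes h: "ok n k h" "h 18 = 0" "h 21 = 0"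
 shows "go cswapsp (R h e o' x d q s) (R h e o' x d q (s + 2 * k)) (cswaps x (zip [0..<k] (dsts s k))) (2 * W + (k * 8 + 1))"
proof -
 note h' = okD[OF h(1)]
 define I where "I i f gs \<longleftrightarrow> f = R (h(21 := k - i, 18 := i)) e o' x d q (s + 2 * i) \<and> gs = cswaps x (zip [0..<i] (dsts s i))" for i f gs
 have s1: "go (copy 1 21) (R h e o' x d q s) (R (h(21 := k)) e o' x d q s) [] W"
  by (rule go_copyI) (use h h' W10(2)[of k] Y in simp_all)
 let ?P = "Seq (Apply (CNot 19 18)) (Seq (Apply (Toffoli 6 18 19)) (Seq (Apply (CNot 19 18))
   (Seq (Push 18 True) (Seq (Push 19 True) (Push 19 True)))))"
 have "\<exists>f gs. go (for_loop 21 ?P) (R (h(21 := k)) e o' x d q s) f gs (k * (6 + 2) + 1) \<and> f 21 = 0 \<and> I k f gs"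
 proof (rule go_for)
  show "I 0 (R (h(21 := k)) e o' x d q s) []" using h(2) by (simp add: I_def fun_upd_idem cswaps_def)
  fix i f gs assume i: "i < k" "I i f gs" "f 21 = k - i"
  let ?f = "R (h(21 := k - Suc i, 18 := Suc i)) e o' x d q (s + 2 * Suc i)"
   and ?gs = "[CNot (s + 2 * i) i, Toffoli x i (s + 2 * i), CNot (s + 2 * i) i]"
  have f: "f = R (h(21 := k - i, 18 := i)) e o' x d q (s + 2 * i)" "gs = cswaps x (zip [0..<i] (dsts s i))" using i(2) by (simp_all add: I_def)
  have "go ?P (f(21 := f 21 - 1)) ?f ?gs 6"
   by (rule go_cong[OF go_Seq[OF go_Apply[where h = "f(21 := f 21 - 1)"] go_Seq[OF go_Apply go_Seq[OF go_Apply go_Seq[OF go_Push go_Seq[OF go_Push go_Push]]]]]])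
    (use i(3) in \<open>simp_all add: f fun_upd_twist[of 21 18]\<close>)
  moreover have "I (Suc i) ?f (gs @ ?gs)" using f(2) unfolding I_def cswaps_snoc by simp
  moreover have "?f 21 = f 21 - 1" using i(3) by simp
  ultimately show "\<exists>h' gs'. go ?P (f(21 := f 21 - 1)) h' gs' 6 \<and> h' 21 = f 21 - 1 \<and> I (Suc i) h' (gs @ gs')" by blast
 qed simp
 then have s2: "go (for_loop 21 ?P) (R (h(21 := k)) e o' x d q s) (R (h(18 := k)) e o' x d q (s + 2 * k)) (cswaps x (zip [0..<k] (dsts s k))) (k * 8 + 1)"
  using h(3) by (auto simp: I_def fun_upd_idem)
 have s3: "go (clear 18) (R (h(18 := k)) e o' x d q (s + 2 * k)) (R h e o' x d q (s + 2 * k)) [] W"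
  by (rule go_clearI) (use h W10(3)[of k] Y in \<open>simp_all add: fun_upd_idem\<close>)
 show ?thesis unfolding cswapsp_def by (rule go_cong[OF go_Seq[OF s1 go_Seq[OF s2 s3]]]) simp_all
qed

lemma go_gad:
 assumes h: "ok n k h" "h 17 = 0" "h 7 = r" and x: "x \<le> Y" "e + 4 * r \<le> Y"
 shows "go gadp (R h e o' x d q 0) (R h (e + 4 * r) o' (e + 4 * r) d q 0) (gad e r) (3 * W + (r * (10 * W + 2) + 1))"
proof -
 note h' = okD[OF h(1)]
 define I where "I i f gs \<longleftrightarrow> f = R (h(17 := r - i)) (e + 4 * i) o' (e + 4 * i) d q 0 \<and> gs = gad e i" for i f gs
 have s0: "go (clear 6) (R h e o' x d q 0) (R h e o' 0 d q 0) [] W"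
  by (rule go_clearI) (use W10(3)[OF x(1)] in simp_all)
 have s1: "go (copy 3 6) (R h e o' 0 d q 0) (R h e o' e d q 0) [] W"
  by (rule go_copyI) (use h' W10(2)[of e] x in simp_all)
 have s2: "go (copy 7 17) (R h e o' e d q 0) (R (h(17 := r)) e o' e d q 0) [] W"
  by (rule go_copyI) (use h h' W10(2)[of r] Y in simp_all)
 let ?P = "Seq (Push 3 True) (Seq (Push 3 True) (Seq (Apply (Had 3)) (Seq (copy 3 19)
   (Seq (Push 3 True) (Seq (Push 3 True) (Seq (Apply (Toffoli 6 19 3)) (Seq (clear 19) (Seq (clear 6) (copy 3 6)))))))))"
 have "\<exists>f gs. go (for_loop 17 ?P) (R (h(17 := r)) e o' e d q 0) f gs (r * (10 * W + 2) + 1) \<and> f 17 = 0 \<and> I r f gs"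
 proof (rule go_for)
  show "I 0 (R (h(17 := r)) e o' e d q 0) []" by (simp add: I_def)
  fix i f gs assume i: "i < r" "I i f gs" "f 17 = r - i"
  let ?h = "h(17 := r - Suc i)" and ?e = "e + 4 * i"
  have b: "?e + 4 \<le> Y" using i(1) x(2) by simp
  have f: "f = R (h(17 := r - i)) ?e o' ?e d q 0" "gs = gad e i" using i(2) by (simp_all add: I_def)
  have 1: "go (Push 3 True) (f(17 := f 17 - 1)) (R ?h (?e + 1) o' ?e d q 0) [] W"
   by (rule go_PushI) (use f i(3) W10(1) in simp_all)
  have p: "go (Push 3 True) (R ?h y o' z d q w) (R ?h y' o' z d q w) [] W" if "y' = Suc y" for y y' z w
   by (rule go_PushI) (use that W10(1) in simp_all)
  have p1: "?e + 2 = Suc (?e + 1)" "?e + 3 = Suc (?e + 2)" "?e + 4 = Suc (?e + 3)" by simp_all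
  have 3: "go (Apply (Had 3)) (R ?h (?e + 2) o' ?e d q 0) (R ?h (?e + 2) o' ?e d q 0) [Had (?e + 2)] W"
   by (rule go_ApplyI) (use W10(1) in simp_all)
  have 4: "go (copy 3 19) (R ?h (?e + 2) o' ?e d q 0) (R ?h (?e + 2) o' ?e d q (?e + 2)) [] W"
   by (rule go_copyI) (use h' W10(2)[of "?e + 2"] b in simp_all)
  have 7: "go (Apply (Toffoli 6 19 3)) (R ?h (?e + 4) o' ?e d q (?e + 2)) (R ?h (?e + 4) o' ?e d q (?e + 2)) [Toffoli ?e (?e + 2) (?e + 4)] W"
   by (rule go_ApplyI) (use W10(1) in simp_all)
  have 8: "go (clear 19) (R ?h (?e + 4) o' ?e d q (?e + 2)) (R ?h (?e + 4) o' ?e d q 0) [] W"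
   by (rule go_clearI) (use W10(3)[of "?e + 2"] b in simp_all)
  have 9: "go (clear 6) (R ?h (?e + 4) o' ?e d q 0) (R ?h (?e + 4) o' 0 d q 0) [] W"
   by (rule go_clearI) (use W10(3)[of ?e] b in simp_all)
  have 10: "go (copy 3 6) (R ?h (?e + 4) o' 0 d q 0) (R ?h (e + 4 * Suc i) o' (e + 4 * Suc i) d q 0) [] W"
   by (rule go_copyI) (use h' W10(2)[of "?e + 4"] b in \<open>simp_all add: algebra_simps\<close>)
  let ?f = "R ?h (e + 4 * Suc i) o' (e + 4 * Suc i) d q 0"
  have "go ?P (f(17 := f 17 - 1)) ?f [Had (?e + 2), Toffoli ?e (?e + 2) (?e + 4)] (10 * W)"
   by (rule go_cong[OF go_Seq[OF 1 go_Seq[OF p[OF p1(1)] go_Seq[OF 3 go_Seq[OF 4 go_Seq[OF p[OF p1(2)] go_Seq[OF p[OF p1(3)] go_Seq[OF 7 go_Seq[OF 8 go_Seq[OF 9 10]]]]]]]]]]) simp_all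
  moreover have "I (Suc i) ?f (gs @ [Had (?e + 2), Toffoli ?e (?e + 2) (?e + 4)])" unfolding I_def f(2) gad_snoc by simp
  moreover have "?f 17 = f 17 - 1" using i(3) by simp
  ultimately show "\<exists>h' gs'. go ?P (f(17 := f 17 - 1)) h' gs' (10 * W) \<and> h' 17 = f 17 - 1 \<and> I (Suc i) h' (gs @ gs')" by blast
 qed simp
 then have s3: "go (for_loop 17 ?P) (R (h(17 := r)) e o' e d q 0) (R h (e + 4 * r) o' (e + 4 * r) d q 0) (gad e r) (r * (10 * W + 2) + 1)"
  using h(2) by (auto simp: I_def fun_upd_idem)
 show ?thesis unfolding gadp_def by (rule go_cong[OF go_Seq[OF s0 go_Seq[OF s1 go_Seq[OF s2 s3]]]]) simp_all
qed

end


definition trial :: "nat => prog => prog" where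
 "trial V P = Seq (copy 3 19) (Seq (Apply (Had 19)) (Seq (Push 3 True) (Seq (Push 3 True) (Seq (grun V P (Apply (CNot 19 15)))
   (Seq (Apply (Toffoli 6 19 5)) (clear 19))))))"

definition rewind :: prog where "rewind = Seq (clear 13) (Seq (clear 14) (copy 4 13))"

definition slotp :: "nat => prog => nat => prog => bool => bool => prog => prog => prog" where
 "slotp VG PG VA PA S0 S1 Pre Post = Seq (Apply (PauliX 3)) (Seq gadp (Seq (Push 3 True) (Seq (Push 3 True) (Seq rewind (Seq Pre
   (Seq (copy 13 19) (Seq (copiesp VG PG [False]) (Seq cswapsp (Seq (clear 19) (Seq Post (Seq (arun VA PA S0 S1)
   (Seq rewind (Seq Pre (Seq (trial VG PG) (Seq Post (arun VA PA S0 S1))))))))))))))))"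

definition mainp :: "prog => prog" where
 "mainp P = Seq (copy 8 11) (for_loop 11 (Seq (clear 12) (Seq (copy 8 22) (Seq (for_loop 22 (Seq P (Push 12 True))) (Push 10 True)))))"

context asm
begin

text \<open>All register contents are allowed, because the same program for a list of copies is used
  in both halves of a slot, at different frontiers.\<close>

definition blk :: "prog => bool list => nat => (nat => nat) => bool" where
 "blk P L t h \<longleftrightarrow> (\<forall>e o' x d q s. e + \<delta> * length L \<le> Y --> (\<exists>e' gs. copies g L e d gs e' \<and> e' \<le> e + \<delta> * length L \<and>
  go P (R h e o' x d q s) (R h e' o' x (d + 2 * (m * length L)) (q + m * length L) s) gs t))"

lemma blk_append:
 assumes "blk P L t h" "blk Q L' t' h"
 shows "blk (Seq P Q) (L @ L') (t + t') h"
 unfolding blk_def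
proof (intro allI impI)
 fix e o' x d q s assume e: "e + \<delta> * length (L @ L') \<le> Y"
 then have "e + \<delta> * length L \<le> Y" unfolding length_append add_mult_distrib2 by linarith
 then obtain e1 gs1 where 1: "copies g L e d gs1 e1" "e1 \<le> e + \<delta> * length L"
  "go P (R h e o' x d q s) (R h e1 o' x (d + 2 * (m * length L)) (q + m * length L) s) gs1 t"
  using assms(1) unfolding blk_def by blast
 have "e1 + \<delta> * length L' \<le> Y" using e 1(2) unfolding length_append add_mult_distrib2 by linarith
 then obtain e2 gs2 where 2: "copies g L' e1 (d + 2 * (m * length L)) gs2 e2" "e2 \<le> e1 + \<delta> * length L'"
  "go Q (R h e1 o' x (d + 2 * (m * length L)) (q + m * length L) s)
   (R h e2 o' x (d + 2 * (m * length L) + 2 * (m * length L')) (q + m * length L + m * length L') s) gs2 t'"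
  using assms(2) unfolding blk_def by blast
 have "go (Seq P Q) (R h e o' x d q s) (R h e2 o' x (d + 2 * (m * length (L @ L'))) (q + m * length (L @ L')) s) (gs1 @ gs2) (t + t')"
  by (rule go_cong[OF go_Seq[OF 1(3) 2(3)]]) (simp_all add: algebra_simps)
 moreover have "e2 \<le> e + \<delta> * length (L @ L')" using 1(2) 2(2) unfolding length_append add_mult_distrib2 by linarith
 ultimately show "\<exists>e' gs. copies g (L @ L') e d gs e' \<and> e' \<le> e + \<delta> * length (L @ L') \<and>
  go (Seq P Q) (R h e o' x d q s) (R h e' o' x (d + 2 * (m * length (L @ L'))) (q + m * length (L @ L')) s) gs (t + t')"
  using copies_append[OF 1(1) 2(1)] by blast
qed

lemma blk_copies: "ok n k h ==> blk (copiesp VG PG' bs) bs ((length bs + 1) * (7 * W)) h"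
 unfolding blk_def using go_copies by blast

lemma blk_rep: "ok n k h ==> h 17 = 0 ==> h c = N ==> N \<le> T ==> c \<notin> {2, 3, 4, 6, 13, 14, 17, 19} ==> length bs = 2 ==>
 blk (rep VG PG' c bs) (concat (replicate N bs)) ((23 * T + 2) * W) h"
 unfolding blk_def using go_rep by blast

lemma go_trial:
 assumes h: "ok n k h" and e: "e + 2 + \<delta> \<le> Y"
 shows "\<exists>e'. fits g (e + 2) e' \<and> e' \<le> e + 2 + \<delta> \<and> go (trial VG PG') (R h e o' x d q 0) (R h e' o' x (d + 2 * m) (q + m) 0)
  (Had e # copyg g [CNot e (e + 2)] (pf (e + 2)) (dsts d m) @ [Toffoli x e k]) (13 * W)"
proof -
 note h' = okD[OF h]
 have eY: "e \<le> Y" using e by simp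
 have "go (Apply (CNot 19 15)) (R (h(15 := e + 2)) (e + 2) o' x d q e) (R (h(15 := e + 2)) (e + 2) o' x d q e) [CNot e (e + 2)] W"
  by (rule go_ApplyI) (use W10(1) in simp_all)
 from go_grun[OF h this e] obtain e' where 1: "fits g (e + 2) e'" "e' \<le> e + 2 + \<delta>"
  "go (grun VG PG' (Apply (CNot 19 15))) (R h (e + 2) o' x d q e) (R h e' o' x (d + 2 * m) (q + m) e) (copyg g [CNot e (e + 2)] (pf (e + 2)) (dsts d m)) (7 * W)" by blast
 have s1: "go (copy 3 19) (R h e o' x d q 0) (R h e o' x d q e) [] W"
  by (rule go_copyI) (use h' W10(2)[OF eY] in simp_all)
 have s2: "go (Apply (Had 19)) (R h e o' x d q e) (R h e o' x d q e) [Had e] W"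
  by (rule go_ApplyI) (use W10(1) in simp_all)
 have s3: "go (Push 3 True) (R h e o' x d q e) (R h (e + 1) o' x d q e) [] W"
  by (rule go_PushI) (use W10(1) in simp_all)
 have s4: "go (Push 3 True) (R h (e + 1) o' x d q e) (R h (e + 2) o' x d q e) [] W"
  by (rule go_PushI) (use W10(1) in simp_all)
 have s6: "go (Apply (Toffoli 6 19 5)) (R h e' o' x (d + 2 * m) (q + m) e) (R h e' o' x (d + 2 * m) (q + m) e) [Toffoli x e k] W"
  by (rule go_ApplyI) (use h' W10(1) in simp_all)
 have s7: "go (clear 19) (R h e' o' x (d + 2 * m) (q + m) e) (R h e' o' x (d + 2 * m) (q + m) 0) [] W"
  by (rule go_clearI) (use W10(3)[OF eY] in simp_all)
 have "go (trial VG PG') (R h e o' x d q 0) (R h e' o' x (d + 2 * m) (q + m) 0)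
  (Had e # copyg g [CNot e (e + 2)] (pf (e + 2)) (dsts d m) @ [Toffoli x e k]) (13 * W)"
  unfolding trial_def
  by (rule go_cong[OF go_Seq[OF s1 go_Seq[OF s2 go_Seq[OF s3 go_Seq[OF s4 go_Seq[OF 1(3) go_Seq[OF s6 s7]]]]]]]) simp_all
 then show ?thesis using 1 by blast
qed

lemma go_rewind:
 assumes h: "ok n k h" and b: "d \<le> Y" "q \<le> Y" "o' \<le> Y"
 shows "go rewind (R h e o' x d q s) (R h e o' x o' 0 s) [] (3 * W)"
proof -
 have s1: "go (clear 13) (R h e o' x d q s) (R h e o' x 0 q s) [] W" by (rule go_clearI) (use W10(3)[OF b(1)] in simp_all)
 have s2: "go (clear 14) (R h e o' x 0 q s) (R h e o' x 0 0 s) [] W" by (rule go_clearI) (use W10(3)[OF b(2)] in simp_all)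
 have s3: "go (copy 4 13) (R h e o' x 0 0 s) (R h e o' x o' 0 s) [] W" by (rule go_copyI) (use okD[OF h] W10(2)[OF b(3)] in simp_all)
 show ?thesis unfolding rewind_def by (rule go_cong[OF go_Seq[OF s1 go_Seq[OF s2 s3]]]) simp_all
qed

text \<open>A slot runs the learner twice, hence \<open>2 * \<delta>\<close> for the odd frontier.
  The summand \<open>2 * K0 + 2 * k\<close> leaves room for the addresses of the register
  wires.\<close>

definition slot_ok :: "prog => bool list => bool list \<times> bool list => nat => nat => (nat => nat) => bool" where
 "slot_ok P S X E t h \<longleftrightarrow> (\<forall>e o' x d q. x \<le> Y --> d \<le> Y --> q \<le> Y --> e + E \<le> Y --> o' + 2 * \<delta> + 2 * K0 + 2 * k \<le> Y -->
  (\<exists>gs e' o3 x' d' q'. slots g C k r S [X] e o' gs e' o3 \<and> e' \<le> e + E \<and> o3 \<le> o' + 2 * \<delta> \<and> x' \<le> Y \<and> d' \<le> Y \<and> q' \<le> Y \<and>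
    go P (R h e o' x d q 0) (R h e' o3 x' d' q' 0) gs t))"

lemma slot_okD:
 assumes "slot_ok P S X E t h" "x \<le> Y" "d \<le> Y" "q \<le> Y" "e + E \<le> Y" "o' + 2 * \<delta> + 2 * K0 + 2 * k \<le> Y"
 obtains gs e' o3 x' d' q' where "slots g C k r S [X] e o' gs e' o3" "e' \<le> e + E" "o3 \<le> o' + 2 * \<delta>" "x' \<le> Y" "d' \<le> Y" "q' \<le> Y"
  "go P (R h e o' x d q 0) (R h e' o3 x' d' q' 0) gs t"
 using assms(1)[unfolded slot_ok_def, rule_format, OF assms(2-6)] by (elim exE conjE) (rule that)

lemma go_slot:
 assumes h: "ok n k h" "h 17 = 0" "h 18 = 0" "h 21 = 0" "h 7 = r"
  and P: "blk Pre pre t1 h" and Q: "blk Post post t2 h" and K: "m * (length pre + 1 + length post) \<le> K0"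
  and E: "4 * r + 4 + 2 * (\<delta> * (length pre + 1 + length post)) \<le> E"
 shows "slot_ok (slotp VG PG' VA PA' S0 S1 Pre Post) [S0, S1] (pre, post) E (60 * W + 2 * (t1 + t2) + r * (10 * W + 2) + k * 8 + 2) h"
 unfolding slot_ok_def
proof (intro allI impI)
 fix e o' x d q assume x: "x \<le> Y" "d \<le> Y" "q \<le> Y" and e: "e + E \<le> Y" and o: "o' + 2 * \<delta> + 2 * K0 + 2 * k \<le> Y"
 note h' = okD[OF h(1)]
 define p where "p = length pre"
 define u where "u = length post"
 let ?x = "e + 4 * r"
 have E': "4 * r + 4 + 2 * (\<delta> * p + \<delta> + \<delta> * u) \<le> E" using E unfolding p_def u_def by (simp add: algebra_simps)
 have K': "m * p + m * 1 + m * u \<le> K0" using K unfolding p_def u_def by (simp add: algebra_simps)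
 have oY: "o' \<le> Y" using o by simp
 have s1: "go (Apply (PauliX 3)) (R h e o' x d q 0) (R h e o' x d q 0) [PauliX e] W" by (rule go_ApplyI) (use W10(1) in simp_all)
 have s2: "go gadp (R h e o' x d q 0) (R h ?x o' ?x d q 0) (gad e r) (3 * W + (r * (10 * W + 2) + 1))"
  by (rule go_gad[OF h(1,2,5) x(1)]) (use e E' in linarith)
 have s3: "go (Push 3 True) (R h ?x o' ?x d q 0) (R h (?x + 1) o' ?x d q 0) [] W" by (rule go_PushI) (use W10(1) in simp_all)
 have s4: "go (Push 3 True) (R h (?x + 1) o' ?x d q 0) (R h (?x + 2) o' ?x d q 0) [] W" by (rule go_PushI) (use W10(1) in simp_all)
 have s5: "go rewind (R h (?x + 2) o' ?x d q 0) (R h (?x + 2) o' ?x o' 0 0) [] (3 * W)" by (rule go_rewind[OF h(1) x(2,3) oY])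
 have "?x + 2 + \<delta> * length pre \<le> Y" using e E' unfolding p_def by simp
 then obtain e1 P1 where c1: "copies g pre (?x + 2) o' P1 e1" "e1 \<le> ?x + 2 + \<delta> * p" and
  s6: "go Pre (R h (?x + 2) o' ?x o' 0 0) (R h e1 o' ?x (o' + 2 * (m * p)) (0 + m * p) 0) P1 t1" using P unfolding blk_def p_def by blast
 have dY: "o' + 2 * (m * p) \<le> Y" using o K' by linarith
 have s7: "go (copy 13 19) (R h e1 o' ?x (o' + 2 * (m * p)) (0 + m * p) 0) (R h e1 o' ?x (o' + 2 * (m * p)) (0 + m * p) (o' + 2 * (m * p))) [] W"
  by (rule go_copyI) (use h' W10(2)[OF dY] in simp_all)
 have "e1 + \<delta> * length [False] \<le> Y" using e E' c1(2) by simp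
 then obtain e2 G where c2: "copies g [False] e1 (o' + 2 * (m * p)) G e2" "e2 \<le> e1 + \<delta> * length [False]" and
  s8: "go (copiesp VG PG' [False]) (R h e1 o' ?x (o' + 2 * (m * p)) (0 + m * p) (o' + 2 * (m * p)))
   (R h e2 o' ?x (o' + 2 * (m * p) + 2 * (m * length [False])) (0 + m * p + m * length [False]) (o' + 2 * (m * p))) G ((length [False] + 1) * (7 * W))"
  using blk_copies[OF h(1), of "[False]"] unfolding blk_def by blast
 have c2': "fits g e1 e2" "G = copyg g [] (pf e1) (dsts (o' + 2 * (m * p)) m)" using c2(1) by (auto simp: xp_def)
 let ?d2 = "o' + 2 * (m * p) + 2 * (m * length [False])" and ?q2 = "0 + m * p + m * length [False]"
 have s9: "go cswapsp (R h e2 o' ?x ?d2 ?q2 (o' + 2 * (m * p))) (R h e2 o' ?x ?d2 ?q2 (o' + 2 * (m * p) + 2 * k))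
  (cswaps ?x (zip [0..<k] (dsts (o' + 2 * (m * p)) k))) (2 * W + (k * 8 + 1))" by (rule go_cswaps[OF h(1,3,4)])
 have "o' + 2 * (m * p) + 2 * k \<le> Y" using o K' by linarith
 then have s10: "go (clear 19) (R h e2 o' ?x ?d2 ?q2 (o' + 2 * (m * p) + 2 * k)) (R h e2 o' ?x ?d2 ?q2 0) [] W"
  by (intro go_clearI) (use W10(3)[of "o' + 2 * (m * p) + 2 * k"] in simp_all)
 have "e2 + \<delta> * length post \<le> Y" using e E' c1(2) c2(2) unfolding u_def by simp
 then obtain e3 Q1 where c3: "copies g post e2 ?d2 Q1 e3" "e3 \<le> e2 + \<delta> * u" and
  s11: "go Post (R h e2 o' ?x ?d2 ?q2 0) (R h e3 o' ?x (?d2 + 2 * (m * u)) (?q2 + m * u) 0) Q1 t2" using Q unfolding blk_def u_def by blast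
 have q: "?q2 + m * u \<le> K0" using K' by simp
 have od: "o' + \<delta> \<le> Y" using o by simp
 from go_arun[OF h(1) q od, of S0 S1 e3 ?x "?d2 + 2 * (m * u)" 0] obtain o2 where
  c4: "fits (C (?q2 + m * u)) o' o2" "o' + 2 * (?q2 + m * u) \<le> o2" "o2 \<le> o' + \<delta>" and
  s12: "go (arun VA PA' S0 S1) (R h e3 o' ?x (?d2 + 2 * (m * u)) (?q2 + m * u) 0) (R h e3 o2 ?x (?d2 + 2 * (m * u)) (?q2 + m * u) 0)
   (map (map_gate (pf o')) (gates (C (?q2 + m * u))) @ tofs ?x k [S0, S1] (map (pf o') (outs (C (?q2 + m * u))))) (6 * W)" by blast
 have b13: "?d2 + 2 * (m * u) \<le> Y" "?q2 + m * u \<le> Y" "o2 \<le> Y" using o K' c4(3) by simp_all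
 have s13: "go rewind (R h e3 o2 ?x (?d2 + 2 * (m * u)) (?q2 + m * u) 0) (R h e3 o2 ?x o2 0 0) [] (3 * W)"
  by (rule go_rewind[OF h(1) b13])
 have "e3 + \<delta> * length pre \<le> Y" using e E' c1(2) c2(2) c3(2) unfolding p_def by simp
 then obtain e4 P2 where c5: "copies g pre e3 o2 P2 e4" "e4 \<le> e3 + \<delta> * p" and
  s14: "go Pre (R h e3 o2 ?x o2 0 0) (R h e4 o2 ?x (o2 + 2 * (m * p)) (0 + m * p) 0) P2 t1" using P unfolding blk_def p_def by blast
 have "e4 + 2 + \<delta> \<le> Y" using e E' c1(2) c2(2) c3(2) c5(2) by simp
 from go_trial[OF h(1) this, of o2 ?x "o2 + 2 * (m * p)" "0 + m * p"] obtain e5 where c6: "fits g (e4 + 2) e5" "e5 \<le> e4 + 2 + \<delta>" and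
  s15: "go (trial VG PG') (R h e4 o2 ?x (o2 + 2 * (m * p)) (0 + m * p) 0) (R h e5 o2 ?x (o2 + 2 * (m * p) + 2 * m) (0 + m * p + m) 0)
   (Had e4 # copyg g [CNot e4 (e4 + 2)] (pf (e4 + 2)) (dsts (o2 + 2 * (m * p)) m) @ [Toffoli ?x e4 k]) (13 * W)" by blast
 have "e5 + \<delta> * length post \<le> Y" using e E' c1(2) c2(2) c3(2) c5(2) c6(2) unfolding u_def by simp
 then obtain e' Q2 where c7: "copies g post e5 (o2 + 2 * (m * p) + 2 * m) Q2 e'" "e' \<le> e5 + \<delta> * u" and
  s16: "go Post (R h e5 o2 ?x (o2 + 2 * (m * p) + 2 * m) (0 + m * p + m) 0) (R h e' o2 ?x (o2 + 2 * (m * p) + 2 * m + 2 * (m * u)) (0 + m * p + m + m * u) 0) Q2 t2"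
  using Q unfolding blk_def u_def by blast
 have qq: "0 + m * p + m + m * u \<le> K0" using K' by simp
 have o2d: "o2 + \<delta> \<le> Y" using o c4(3) by simp
 from go_arun[OF h(1) qq o2d, of S0 S1 e' ?x "o2 + 2 * (m * p) + 2 * m + 2 * (m * u)" 0] obtain o3 where
  c8: "fits (C (0 + m * p + m + m * u)) o2 o3" "o2 + 2 * (0 + m * p + m + m * u) \<le> o3" "o3 \<le> o2 + \<delta>" and
  s17: "go (arun VA PA' S0 S1) (R h e' o2 ?x (o2 + 2 * (m * p) + 2 * m + 2 * (m * u)) (0 + m * p + m + m * u) 0)
    (R h e' o3 ?x (o2 + 2 * (m * p) + 2 * m + 2 * (m * u)) (0 + m * p + m + m * u) 0)
   (map (map_gate (pf o2)) (gates (C (0 + m * p + m + m * u))) @ tofs ?x k [S0, S1] (map (pf o2) (outs (C (0 + m * p + m + m * u))))) (6 * W)" by blast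
 let ?gs = "PauliX e # gad e r @ P1 @ G @ cswaps ?x (zip [0..<k] (dsts (o' + 2 * (m * p)) k)) @
   Q1 @ map (map_gate (pf o')) (gates (C (m * (p + 1 + u)))) @ tofs ?x k [S0, S1] (map (pf o') (outs (C (m * (p + 1 + u))))) @
   P2 @ (Had e4 # copyg g [CNot e4 (e4 + 2)] (pf (e4 + 2)) (dsts (o2 + 2 * (m * p)) m)) @ [Toffoli ?x e4 k] @
   Q2 @ map (map_gate (pf o2)) (gates (C (m * (p + 1 + u)))) @ tofs ?x k [S0, S1] (map (pf o2) (outs (C (m * (p + 1 + u)))))"
 have qe: "?q2 + m * u = m * (p + 1 + u)" "0 + m * p + m + m * u = m * (p + 1 + u)" by (simp_all add: algebra_simps)
 have de: "?d2 = o' + 2 * (m * p + m)" "o2 + 2 * (m * p) + 2 * m = o2 + 2 * (m * p + m)" by (simp_all add: algebra_simps)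
 note big = go_Seq[OF s1 go_Seq[OF s2 go_Seq[OF s3 go_Seq[OF s4 go_Seq[OF s5 go_Seq[OF s6 go_Seq[OF s7 go_Seq[OF s8 go_Seq[OF s9
  go_Seq[OF s10 go_Seq[OF s11 go_Seq[OF s12 go_Seq[OF s13 go_Seq[OF s14 go_Seq[OF s15 go_Seq[OF s16 s17]]]]]]]]]]]]]]]]
 have "go (slotp VG PG' VA PA' S0 S1 Pre Post) (R h e o' x d q 0)
  (R h e' o3 ?x (o2 + 2 * (m * p) + 2 * m + 2 * (m * u)) (0 + m * p + m + m * u) 0) ?gs (60 * W + 2 * (t1 + t2) + r * (10 * W + 2) + k * 8 + 2)"
  unfolding slotp_def
 proof (rule go_cong[OF big], goal_cases)
  case 3
  show ?case unfolding qe append_Cons append_Nil append.assoc ..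
 next
  case 4
  show ?case by simp
 qed (rule refl)+
 moreover have "slot g (C (m * (p + 1 + u))) k r [S0, S1] pre post e o' ?gs e' o3"
  unfolding slot_def Let_def
 proof (intro exI conjI)
  show "copies g pre (e + 4 * r + 2) o' P1 e1" by (fact c1)
  show "fits g e1 e2" by (fact c2')
  show "copies g post e2 (o' + 2 * (m * length pre + m)) Q1 e3" using c3(1) de(1) by (simp only: p_def)
  show "fits (C (m * (p + 1 + u))) o' o2" using c4(1) unfolding qe .
  show "o' + 2 * (m * length pre + m + m * length post) \<le> o2" using c4(2) unfolding p_def u_def by simp
  show "copies g pre e3 o2 P2 e4" by (fact c5)
  show "fits g (e4 + 2) e5" by (fact c6)
  show "copies g post e5 (o2 + 2 * (m * length pre + m)) Q2 e'" using c7(1) de(2) by (simp only: p_def)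
  show "fits (C (m * (p + 1 + u))) o2 o3" using c8(1) unfolding qe .
  show "o2 + 2 * (m * length pre + m + m * length post) \<le> o3" using c8(2) unfolding p_def u_def by simp
  show "?gs = PauliX e # gad e r @ P1 @ copyg g [] (pf e1) (dsts (o' + 2 * (m * length pre)) m) @
   cswaps (e + 4 * r) (zip [0..<k] (dsts (o' + 2 * (m * length pre)) k)) @
   Q1 @ map (map_gate (pf o')) (gates (C (m * (p + 1 + u)))) @ tofs ?x k [S0, S1] (map (pf o') (outs (C (m * (p + 1 + u))))) @
   P2 @ (Had e4 # copyg g [CNot e4 (e4 + 2)] (pf (e4 + 2)) (dsts (o2 + 2 * (m * length pre)) m)) @ [Toffoli (e + 4 * r) e4 k] @
   Q2 @ map (map_gate (pf o2)) (gates (C (m * (p + 1 + u)))) @ tofs ?x k [S0, S1] (map (pf o2) (outs (C (m * (p + 1 + u)))))"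
   unfolding c2'(2) p_def ..
 qed
 then have "slots g C k r [S0, S1] [(pre, post)] e o' ?gs e' o3" unfolding p_def u_def slots.simps by simp
 moreover have "e' \<le> e + E" using E' c1(2) c2(2) c3(2) c5(2) c6(2) c7(2) by simp
 moreover have "o3 \<le> o' + 2 * \<delta>" using c4(3) c8(3) by simp
 moreover have "?x \<le> Y" using e E' by linarith
 moreover have "o2 + 2 * (m * p) + 2 * m + 2 * (m * u) \<le> Y" "0 + m * p + m + m * u \<le> Y" using o c4(3) K' by simp_all
 ultimately show "\<exists>gs e' o3 x' d' q'. slots g C k r [S0, S1] [(pre, post)] e o' gs e' o3 \<and> e' \<le> e + E \<and> o3 \<le> o' + 2 * \<delta> \<and> x' \<le> Y \<and> d' \<le> Y \<and> q' \<le> Y \<and>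
    go (slotp VG PG' VA PA' S0 S1 Pre Post) (R h e o' x d q 0) (R h e' o3 x' d' q' 0) gs (60 * W + 2 * (t1 + t2) + r * (10 * W + 2) + k * 8 + 2)" by blast
qed

text \<open>Stacks \<open>10\<close> and \<open>12\<close> hold \<open>a\<close> and
  \<open>z\<close>, the numbers of blocks before and after the challenge; \<open>11\<close> and
  \<open>22\<close> are the loop counters that run down from \<open>T\<close>. The invariants record
  only bounds for the frontiers.\<close>

lemma go_main:
 assumes h: "ok n k h" "h 8 = T" "h 10 = 0" "h 11 = 0" "h 22 = 0" "h 12 \<le> Y"
  and sl: "\<And>h' a z. a < T ==> z < T ==> \<forall>v. v \<notin> {10, 11, 12, 22} --> h' v = h v ==> h' 10 = a ==> h' 12 = z ==> slot_ok P S (X a z) E t h'"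
  and b: "x \<le> Y" "d \<le> Y" "q \<le> Y" "e + T * (T * E) \<le> Y" "o' + T * (T * (2 * \<delta>)) + 2 * K0 + 2 * k \<le> Y"
 shows "\<exists>h' gs e' o3. slots g C k r S (concat (map (%a. map (X a) [0..<T]) [0..<T])) e o' gs e' o3 \<and> h' 5 = k \<and>
  go (mainp P) (R h e o' x d q 0) h' gs (2 * W + T * ((4 * W + T * (t + 3)) + 2))"
proof -
 note h' = okD[OF h(1)]
 have s1: "go (copy 8 11) (R h e o' x d q 0) (R (h(11 := T)) e o' x d q 0) [] W"
  by (rule go_copyI) (use h h' W10(2)[of T] Y in simp_all)
 let ?in = "Seq P (Push 12 True)"
 have inner: "\<exists>e2 o2 x2 d2 q2 gs. go (for_loop 22 ?in) (R (f(12 := 0, 22 := T)) e1 o1 x1 d1 q1 0) (R (f(12 := T)) e2 o2 x2 d2 q2 0) gs (T * (t + 3) + 1) \<and>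
   x2 \<le> Y \<and> d2 \<le> Y \<and> q2 \<le> Y \<and> slots g C k r S (map (X a) [0..<T]) e1 o1 gs e2 o2 \<and> e2 \<le> e1 + T * E \<and> o2 \<le> o1 + T * (2 * \<delta>)"
  if a: "a < T" and f: "\<forall>v. v \<notin> {10, 11, 12, 22} --> f v = h v" "f 10 = a" "f 22 = 0" and x1: "x1 \<le> Y" "d1 \<le> Y" "q1 \<le> Y"
   and e1: "e1 + T * E \<le> Y" and o1: "o1 + T * (2 * \<delta>) + 2 * K0 + 2 * k \<le> Y" for a f e1 o1 x1 d1 q1
 proof -
  define I where "I i s gs \<longleftrightarrow> (\<exists>e2 o2 x2 d2 q2. s = R (f(12 := i, 22 := T - i)) e2 o2 x2 d2 q2 0 \<and>
   x2 \<le> Y \<and> d2 \<le> Y \<and> q2 \<le> Y \<and> slots g C k r S (map (X a) [0..<i]) e1 o1 gs e2 o2 \<and> e2 \<le> e1 + i * E \<and> o2 \<le> o1 + i * (2 * \<delta>))" for i s gs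
  have "\<exists>s gs. go (for_loop 22 ?in) (R (f(12 := 0, 22 := T)) e1 o1 x1 d1 q1 0) s gs (T * ((t + 1) + 2) + 1) \<and> s 22 = 0 \<and> I T s gs"
  proof (rule go_for)
   show "I 0 (R (f(12 := 0, 22 := T)) e1 o1 x1 d1 q1 0) []" unfolding I_def
    by (rule exI[of _ e1], rule exI[of _ o1], rule exI[of _ x1], rule exI[of _ d1], rule exI[of _ q1]) (use x1 in simp)
   fix i s gs assume i: "i < T" "I i s gs" "s 22 = T - i"
   then obtain e2 o2 x2 d2 q2 where 1: "s = R (f(12 := i, 22 := T - i)) e2 o2 x2 d2 q2 0" "x2 \<le> Y" "d2 \<le> Y" "q2 \<le> Y"
    "slots g C k r S (map (X a) [0..<i]) e1 o1 gs e2 o2" "e2 \<le> e1 + i * E" "o2 \<le> o1 + i * (2 * \<delta>)" unfolding I_def by blast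
   have m: "i * E + E \<le> T * E" "i * (2 * \<delta>) + 2 * \<delta> \<le> T * (2 * \<delta>)"
    using tri_le[of "Suc i" T E] tri_le[of "Suc i" T "2 * \<delta>"] i(1) by simp_all
   have so: "slot_ok P S (X a i) E t (f(12 := i, 22 := T - Suc i))" by (rule sl[OF a i(1)]) (use f in simp_all)
   have be: "e2 + E \<le> Y" "o2 + 2 * \<delta> + 2 * K0 + 2 * k \<le> Y" using 1(6,7) m e1 o1 by linarith+
   obtain gs3 e3 o3 x3 d3 q3 where 3: "slots g C k r S [X a i] e2 o2 gs3 e3 o3" "e3 \<le> e2 + E" "o3 \<le> o2 + 2 * \<delta>" "x3 \<le> Y" "d3 \<le> Y" "q3 \<le> Y"
    "go P (R (f(12 := i, 22 := T - Suc i)) e2 o2 x2 d2 q2 0) (R (f(12 := i, 22 := T - Suc i)) e3 o3 x3 d3 q3 0) gs3 t"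
    by (rule slot_okD[OF so 1(2-4) be])
   let ?s = "R (f(12 := Suc i, 22 := T - Suc i)) e3 o3 x3 d3 q3 0"
   have p: "go (Push 12 True) (R (f(12 := i, 22 := T - Suc i)) e3 o3 x3 d3 q3 0) ?s [] 1" 
    by (rule go_PushI) (simp_all add: fun_upd_twist[of 22 12])
   have "go ?in (s(22 := s 22 - 1)) ?s gs3 (t + 1)"
    by (rule go_cong[OF go_Seq[OF 3(7) p]]) (use i(3) in \<open>simp_all add: 1(1)\<close>)
   moreover have "I (Suc i) ?s (gs @ gs3)" unfolding I_def
   proof (intro exI conjI)
    show "slots g C k r S (map (X a) [0..<Suc i]) e1 o1 (gs @ gs3) e3 o3" using slots_append[OF 1(5) 3(1)] by simp
    show "e3 \<le> e1 + Suc i * E" "o3 \<le> o1 + Suc i * (2 * \<delta>)" using 1(6,7) 3(2,3) by simp_all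
   qed (fact refl 3)+
   moreover have "?s 22 = s 22 - 1" using i(3) by simp
   ultimately show "\<exists>h' gs'. go ?in (s(22 := s 22 - 1)) h' gs' (t + 1) \<and> h' 22 = s 22 - 1 \<and> I (Suc i) h' (gs @ gs')" by blast
  qed simp
  moreover have tt: "T * ((t + 1) + 2) + 1 = T * (t + 3) + 1" by (simp add: algebra_simps)
  ultimately obtain s gs where s: "go (for_loop 22 ?in) (R (f(12 := 0, 22 := T)) e1 o1 x1 d1 q1 0) s gs (T * (t + 3) + 1)" "I T s gs"
   unfolding tt by blast
  from s(2) obtain e2 o2 x2 d2 q2 where 1: "s = R (f(12 := T, 22 := T - T)) e2 o2 x2 d2 q2 0" "x2 \<le> Y" "d2 \<le> Y" "q2 \<le> Y"
    "slots g C k r S (map (X a) [0..<T]) e1 o1 gs e2 o2" "e2 \<le> e1 + T * E" "o2 \<le> o1 + T * (2 * \<delta>)" unfolding I_def by blast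
  have "f(12 := T, 22 := T - T) = f(12 := T)" using f(3) by (simp add: fun_upd_idem)
  then show ?thesis using s(1) 1 by metis
 qed
 let ?out = "Seq (clear 12) (Seq (copy 8 22) (Seq (for_loop 22 ?in) (Push 10 True)))"
 define J where "J i s gs \<longleftrightarrow> (\<exists>e2 o2 x2 d2 q2 w. s = R (h(11 := T - i, 10 := i, 12 := w)) e2 o2 x2 d2 q2 0 \<and> w \<le> Y \<and>
   x2 \<le> Y \<and> d2 \<le> Y \<and> q2 \<le> Y \<and> slots g C k r S (concat (map (%a. map (X a) [0..<T]) [0..<i])) e o' gs e2 o2 \<and>
   e2 \<le> e + i * (T * E) \<and> o2 \<le> o' + i * (T * (2 * \<delta>)))" for i s gs
 have "\<exists>s gs. go (for_loop 11 ?out) (R (h(11 := T)) e o' x d q 0) s gs (T * ((W + (W + (T * (t + 3) + 1 + 1))) + 2) + 1) \<and> s 11 = 0 \<and> J T s gs"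
 proof (rule go_for)
  show "J 0 (R (h(11 := T)) e o' x d q 0) []" unfolding J_def
   by (rule exI[of _ e], rule exI[of _ o'], rule exI[of _ x], rule exI[of _ d], rule exI[of _ q], rule exI[of _ "h 12"])
    (use b h(3,6) in \<open>simp add: fun_upd_idem\<close>)
  fix i s gs assume i: "i < T" "J i s gs" "s 11 = T - i"
  then obtain e2 o2 x2 d2 q2 w where 1: "s = R (h(11 := T - i, 10 := i, 12 := w)) e2 o2 x2 d2 q2 0" "w \<le> Y" "x2 \<le> Y" "d2 \<le> Y" "q2 \<le> Y"
   "slots g C k r S (concat (map (%a. map (X a) [0..<T]) [0..<i])) e o' gs e2 o2" "e2 \<le> e + i * (T * E)" "o2 \<le> o' + i * (T * (2 * \<delta>))"
   unfolding J_def by blast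
  have m: "i * (T * E) + T * E \<le> T * (T * E)" "i * (T * (2 * \<delta>)) + T * (2 * \<delta>) \<le> T * (T * (2 * \<delta>))"
   using tri_le[of "Suc i" T "T * E"] tri_le[of "Suc i" T "T * (2 * \<delta>)"] i(1) by simp_all
  let ?f = "h(11 := T - Suc i, 10 := i)"
  have "e2 + T * E \<le> Y" "o2 + T * (2 * \<delta>) + 2 * K0 + 2 * k \<le> Y" using 1(7,8) m b(4,5) by linarith+
  from inner[OF i(1) _ _ _ 1(3-5) this, of ?f] h(5) obtain e3 o3 x3 d3 q3 gs3 where
   3: "go (for_loop 22 ?in) (R (?f(12 := 0, 22 := T)) e2 o2 x2 d2 q2 0) (R (?f(12 := T)) e3 o3 x3 d3 q3 0) gs3 (T * (t + 3) + 1)"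
    "x3 \<le> Y" "d3 \<le> Y" "q3 \<le> Y" "slots g C k r S (map (X i) [0..<T]) e2 o2 gs3 e3 o3" "e3 \<le> e2 + T * E" "o3 \<le> o2 + T * (2 * \<delta>)" by auto
  have s1: "go (clear 12) (R (?f(12 := w)) e2 o2 x2 d2 q2 0) (R (?f(12 := 0)) e2 o2 x2 d2 q2 0) [] W"
   by (rule go_clearI) (use W10(3)[OF 1(2)] in simp_all)
  have s2: "go (copy 8 22) (R (?f(12 := 0)) e2 o2 x2 d2 q2 0) (R (?f(12 := 0, 22 := T)) e2 o2 x2 d2 q2 0) [] W"
   by (rule go_copyI) (use h h' W10(2)[of T] Y in simp_all)
  let ?s = "R (h(11 := T - Suc i, 10 := Suc i, 12 := T)) e3 o3 x3 d3 q3 0"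
  have s4: "go (Push 10 True) (R (?f(12 := T)) e3 o3 x3 d3 q3 0) ?s [] 1"
   by (rule go_PushI) (simp_all add: fun_upd_twist[of 12 10])
  have "go ?out (s(11 := s 11 - 1)) ?s gs3 (W + (W + (T * (t + 3) + 1 + 1)))"
   by (rule go_cong[OF go_Seq[OF s1 go_Seq[OF s2 go_Seq[OF 3(1) s4]]]])
    (use i(3) in \<open>simp_all add: 1(1) fun_upd_twist[of 12 11] fun_upd_twist[of 10 11]\<close>)
  moreover have "J (Suc i) ?s (gs @ gs3)" unfolding J_def
  proof (intro exI conjI)
   show "slots g C k r S (concat (map (%a. map (X a) [0..<T]) [0..<Suc i])) e o' (gs @ gs3) e3 o3" using slots_append[OF 1(6) 3(5)] by simp
   show "e3 \<le> e + Suc i * (T * E)" "o3 \<le> o' + Suc i * (T * (2 * \<delta>))" using 1(7,8) 3(6,7) by simp_all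
   show "T \<le> Y" by (fact Y)
  qed (fact refl 3)+
  moreover have "?s 11 = s 11 - 1" using i(3) by simp
  ultimately show "\<exists>h' gs'. go ?out (s(11 := s 11 - 1)) h' gs' (W + (W + (T * (t + 3) + 1 + 1))) \<and> h' 11 = s 11 - 1 \<and> J (Suc i) h' (gs @ gs')" by blast
 qed simp
 then obtain s gs where s2: "go (for_loop 11 ?out) (R (h(11 := T)) e o' x d q 0) s gs (T * ((W + (W + (T * (t + 3) + 1 + 1))) + 2) + 1)" "J T s gs" by blast
 have "go (mainp P) (R h e o' x d q 0) s gs (2 * W + T * ((4 * W + T * (t + 3)) + 2))"
  unfolding mainp_def
 proof (rule go_cong[OF go_Seq[OF s1 s2(1)]])
  have "T * (W + (W + (T * (t + 3) + 1 + 1)) + 2) \<le> T * (4 * W + T * (t + 3) + 2)" by (rule mult_le_mono2) (use W10(1) in linarith)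
  then show "W + (T * (W + (W + (T * (t + 3) + 1 + 1)) + 2) + 1) \<le> 2 * W + T * (4 * W + T * (t + 3) + 2)"
   using W10(1) by linarith
 qed simp_all
 moreover have "s 5 = k" using s2(2) h' unfolding J_def by auto
 ultimately show ?thesis using s2(2) unfolding J_def by blast
qed

end


section \<open>Polynomial bounds and arithmetic on stack heights\<close>

definition pb :: "(nat => nat => nat) => bool" where
 "pb f \<longleftrightarrow> (\<exists>a b. \<forall>n k. f n k \<le> a * (n + k + 1) ^ b)"

lemma pb_mono: "pb g ==> (\<And>n k. f n k \<le> g n k) ==> pb f"
 unfolding pb_def by (meson le_trans)

lemma pb_const [intro, simp]: "pb (%n k. c)"
 unfolding pb_def by (rule exI[of _ c], rule exI[of _ 0]) simp

lemma pb_vars [intro, simp]: "pb (%n k. n)" "pb (%n k. k)"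
 unfolding pb_def by (rule exI[of _ 1], rule exI[of _ 1], simp)+

lemma pb_add [intro]:
 assumes "pb f" "pb g" shows "pb (%n k. f n k + g n k)"
proof -
 obtain a b c d where 1: "\<And>n k. f n k \<le> a * (n + k + 1) ^ b" "\<And>n k. g n k \<le> c * (n + k + 1) ^ d"
  using assms unfolding pb_def by blast
 have "f n k + g n k \<le> (a + c) * (n + k + 1) ^ (b + d)" for n k
 proof -
  have "(n + k + 1) ^ b \<le> (n + k + 1) ^ (b + d)" "(n + k + 1) ^ d \<le> (n + k + 1) ^ (b + d)" by (rule power_increasing; simp)+
  from mult_le_mono2[OF this(1), of a] mult_le_mono2[OF this(2), of c] show ?thesis using 1[of n k] unfolding add_mult_distrib by linarith
 qed
 then show ?thesis unfolding pb_def by blast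
qed

lemma pb_mult [intro]:
 assumes "pb f" "pb g" shows "pb (%n k. f n k * g n k)"
proof -
 obtain a b c d where 1: "\<And>n k. f n k \<le> a * (n + k + 1) ^ b" "\<And>n k. g n k \<le> c * (n + k + 1) ^ d"
  using assms unfolding pb_def by blast
 have "f n k * g n k \<le> (a * c) * (n + k + 1) ^ (b + d)" for n k
  using mult_le_mono[OF 1] by (simp add: power_add mult_ac)
 then show ?thesis unfolding pb_def by blast
qed

lemma pb_power [intro]: "pb f ==> pb (%n k. f n k ^ d)"
 by (induction d) (auto intro: pb_mult)

lemma pb_polynomial:
 assumes "pb f" shows "\<exists>p. polynomial p \<and> (\<forall>n k. f n k \<le> p (n + k))"
proof -
 obtain a b where 1: "\<And>n k. f n k \<le> a * (n + k + 1) ^ b" using assms unfolding pb_def by blast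
 let ?c = "a * 2 ^ b + b"
 have "a * (x + 1) ^ b \<le> ?c * x ^ ?c" if "x > 0" for x :: nat
 proof -
  have "(x + 1) ^ b \<le> (2 * x) ^ b" by (rule power_mono) (use that in simp_all)
  also have "\<dots> = 2 ^ b * x ^ b" by (simp add: power_mult_distrib)
  also have "\<dots> \<le> 2 ^ b * x ^ ?c" by (rule mult_le_mono2, rule power_increasing) (use that in simp_all)
  finally have "a * (x + 1) ^ b \<le> a * (2 ^ b * x ^ ?c)" by (rule mult_le_mono2)
  then show ?thesis by (simp add: add_mult_distrib mult.assoc trans_le_add1)
 qed
 then have "polynomial (%x. a * (x + 1) ^ b)" unfolding polynomial_def by blast
 then show ?thesis using 1 by blast
qed

text \<open>The definition leaves the value at 0 free, so this value is added to the
  constant.\<close>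

lemma polynomial_bound:
 assumes "polynomial p" obtains c where "\<And>x. p x \<le> c * (x + 1) ^ c"
proof -
 obtain c where c: "\<And>x. x > 0 ==> p x \<le> c * x ^ c" using assms unfolding polynomial_def by blast
 have "p x \<le> (c + p 0) * (x + 1) ^ (c + p 0)" for x
 proof (cases "x = 0")
  case False
  have "p x \<le> c * x ^ c" using c False by simp
  also have "\<dots> \<le> (c + p 0) * (x + 1) ^ (c + p 0)"
   by (rule mult_le_mono) (use power_mono[of x "x + 1" c] power_increasing[of c "c + p 0" "x + 1"] in simp_all)
  finally show ?thesis .
 qed simp
 then show ?thesis using that by blast
qed

lemma exec_outs: "exec P a T b ==> length (outs (snd b)) \<le> length (outs (snd a)) + T"
 by (induction rule: exec.induct) auto

lemma generates_outs: "generates P n k T c ==> length (outs c) \<le> T"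
 unfolding generates_def using exec_outs by fastforce

text \<open>The bit length. For positive \<open>x\<close> the power \<open>2 ^ blen x\<close>
  exceeds \<open>x\<close> and is at most \<open>2 * x\<close>; coins can thus realise a probability
  comparable to \<open>1 / x\<^sup>2\<close>.\<close>

fun blen :: "nat => nat" where
 "blen x = (if x = 0 then 0 else Suc (blen (x div 2)))"

declare blen.simps [simp del]

lemma blen_0 [simp]: "blen 0 = 0" by (simp add: blen.simps)

lemma blen_pos: "x > 0 ==> blen x = Suc (blen (x div 2))" by (simp add: blen.simps)

lemma blen_bounds: "x < 2 ^ blen x \<and> (x > 0 --> 2 ^ blen x \<le> 2 * x) \<and> blen x \<le> x"
proof (induction x rule: less_induct)
 case (less x)
 show ?case
 proof (cases "x = 0")
  case False
  then have "x div 2 < x" by simp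
  note IH = less[OF this]
  have b: "blen x = Suc (blen (x div 2))" using False blen_pos by simp
  have "(2::nat) ^ blen (x div 2) \<le> x"
  proof (cases "x div 2 = 0")
   case True
   then show ?thesis using False by simp
  next
   case False
   then have "2 ^ blen (x div 2) \<le> 2 * (x div 2)" using IH by simp
   then show ?thesis by linarith
  qed
  moreover have "x < 2 * 2 ^ blen (x div 2)" using IH by linarith
  moreover have "Suc (x div 2) \<le> x" using False by linarith
  ultimately show ?thesis using IH unfolding b power_Suc by linarith
 qed simp
qed

lemma go_congT: "go P h h' gs T ==> gs' = gs ==> T \<le> T' ==> go P h h' gs' T'"
 using go_cong by blast

definition mulp :: prog where
 "mulp = Seq (copy 0 17) (Seq (for_loop 17 (copy 8 18)) (Seq (clear 8) (Seq (copy 18 8) (clear 18))))"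

fun powp :: "nat => prog" where
 "powp 0 = skip"
| "powp (Suc c) = Seq (powp c) mulp"

fun pushes :: "nat => nat => prog" where
 "pushes v 0 = skip"
| "pushes v (Suc c) = Seq (pushes v c) (Push v True)"

lemma go_pushes: "go (pushes v c) h (h(v := h v + c)) [] (c + 2)"
proof (induction c)
 case 0
 show ?case by (simp, intro go_skipI) simp_all
next
 case (Suc c)
 have "go (Push v True) (h(v := h v + c)) (h(v := h v + Suc c)) [] 1" by (rule go_PushI) simp_all
 from go_Seq[OF Suc this] show ?case unfolding pushes.simps by (rule go_congT) simp_all
qed

lemma go_mul:
 assumes h: "h 2 = 0" "h 17 = 0" "h 18 = 0" "h 0 = n" and Y: "n \<le> Y" "v \<le> Y" "n * v \<le> Y" and W: "8 * Y + 2 \<le> W"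
 shows "go mulp (h(8 := v)) (h(8 := n * v)) [] (5 * W + n * (W + 2))"
proof -
 have w: "x \<le> Y ==> 8 * x + 2 \<le> W" "x \<le> Y ==> 4 * x + 1 \<le> W" for x using W by auto
 have s1: "go (copy 0 17) (h(8 := v)) (h(8 := v, 17 := n)) [] W"
  by (rule go_copyI) (use h w[of n] Y in simp_all)
 define I where "I i f gs \<longleftrightarrow> f = h(8 := v, 17 := n - i, 18 := i * v) \<and> gs = []" for i f and gs :: "nat gate list"
 have "\<exists>f gs. go (for_loop 17 (copy 8 18)) (h(8 := v, 17 := n)) f gs (n * (W + 2) + 1) \<and> f 17 = 0 \<and> I n f gs"
 proof (rule go_for)
  show "I 0 (h(8 := v, 17 := n)) []" using h by (simp add: I_def fun_upd_idem)
  fix i f gs assume i: "i < n" "I i f gs" "f 17 = n - i"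
  have f: "f = h(8 := v, 17 := n - i, 18 := i * v)" "gs = []" using i(2) by (simp_all add: I_def)
  have "go (copy 8 18) (f(17 := f 17 - 1)) (h(8 := v, 17 := n - Suc i, 18 := Suc i * v)) [] W"
   by (rule go_copyI) (use h i(3) w[of v] Y in \<open>simp_all add: f fun_upd_twist[of 18 17]\<close>)
  moreover have "I (Suc i) (h(8 := v, 17 := n - Suc i, 18 := Suc i * v)) (gs @ [])" using f by (simp add: I_def)
  moreover have "(h(8 := v, 17 := n - Suc i, 18 := Suc i * v)) 17 = f 17 - 1" using i(3) by simp
  ultimately show "\<exists>h' gs'. go (copy 8 18) (f(17 := f 17 - 1)) h' gs' W \<and> h' 17 = f 17 - 1 \<and> I (Suc i) h' (gs @ gs')" by blast
 qed simp
 then have s2: "go (for_loop 17 (copy 8 18)) (h(8 := v, 17 := n)) (h(8 := v, 18 := n * v)) [] (n * (W + 2) + 1)"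
  using h(2) by (auto simp: I_def fun_upd_idem)
 have s3: "go (clear 8) (h(8 := v, 18 := n * v)) (h(8 := 0, 18 := n * v)) [] W"
  by (rule go_clearI) (use w[of v] Y in \<open>simp_all add: fun_upd_twist[of 18 8]\<close>)
 have s4: "go (copy 18 8) (h(8 := 0, 18 := n * v)) (h(8 := n * v, 18 := n * v)) [] W"
  by (rule go_copyI) (use h w[of "n * v"] Y in \<open>simp_all add: fun_upd_twist[of 18 8]\<close>)
 have s5: "go (clear 18) (h(8 := n * v, 18 := n * v)) (h(8 := n * v)) [] W"
  by (rule go_clearI) (use h w[of "n * v"] Y in \<open>simp_all add: fun_upd_idem\<close>)
 show ?thesis unfolding mulp_def
  by (rule go_cong[OF go_Seq[OF s1 go_Seq[OF s2 go_Seq[OF s3 go_Seq[OF s4 s5]]]]]) (use W in simp_all)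
qed

lemma go_pow:
 assumes h: "h 2 = 0" "h 17 = 0" "h 18 = 0" "h 0 = n" and Y: "n \<le> Y" "v * (n + 1) ^ c \<le> Y" and W: "8 * Y + 2 \<le> W"
 shows "go (powp c) (h(8 := v)) (h(8 := v * n ^ c)) [] (c * (5 * W + n * (W + 2)) + 2)"
 using Y(2)
proof (induction c)
 case 0
 show ?case by (simp, intro go_skipI) simp_all
next
 case (Suc c)
 have "v * (n + 1) ^ c \<le> v * (n + 1) ^ Suc c" by (rule mult_le_mono2) simp
 then have le: "v * (n + 1) ^ c \<le> Y" using Suc.prems by (rule le_trans)
 have a: "v * n ^ c \<le> v * (n + 1) ^ c" by (rule mult_le_mono2, rule power_mono) simp_all
 have b: "v * n ^ Suc c \<le> v * (n + 1) ^ Suc c" by (rule mult_le_mono2, rule power_mono) simp_all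
 have "n * (v * n ^ c) \<le> Y" using le_trans[OF b Suc.prems] by (simp add: mult_ac)
 from go_mul[OF h Y(1) le_trans[OF a le] this W] have "go mulp (h(8 := v * n ^ c)) (h(8 := v * n ^ Suc c)) [] (5 * W + n * (W + 2))" by (simp add: mult_ac)
 from go_Seq[OF Suc.IH[OF le] this] show ?case unfolding powp.simps by (rule go_congT) simp_all
qed

definition halfp :: prog where
 "halfp = While (Nonempty 18) (Seq (Pop 18) (IfElse (Nonempty 18) (Seq (Pop 18) (Push 19 True)) skip))"

lemma go_half: "go halfp (h(18 := x, 19 := y)) (h(18 := 0, 19 := y + x div 2)) [] (5 * x + 1)"
proof (induction x arbitrary: y rule: less_induct)
 case (less x)
 consider "x = 0" | "x = 1" | "2 \<le> x" by linarith
 then show ?case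
 proof cases
  case 1
  have "go halfp (h(18 := 0, 19 := y)) (h(18 := 0, 19 := y)) [] 1" unfolding halfp_def by (rule go_while_done) simp
  then show ?thesis unfolding 1 by (simp only: div_0 add_0_right mult_0_right add_0)
 next
  case 2
  let ?h = "h(18 := 0, 19 := y)"
  have a: "go (Pop 18) (h(18 := x, 19 := y)) ?h [] 1"
   using go_Pop[of 18 "h(18 := x, 19 := y)"] 2 by (simp add: fun_upd_twist[of 19 18])
  have b: "go (IfElse (Nonempty 18) (Seq (Pop 18) (Push 19 True)) skip) ?h ?h [] (2 + 1)"
   by (rule go_if(2)[OF go_skip]) simp
  have "go halfp (h(18 := x, 19 := y)) ?h (([] @ []) @ []) (1 + (2 + 1) + 1 + 1)" unfolding halfp_def
   by (rule go_while_step[OF _ go_Seq[OF a b] go_while_done]) (use 2 in simp_all)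
  then have "go halfp (h(18 := x, 19 := y)) ?h [] (5 * x + 1)" by (rule go_congT) (use 2 in simp_all)
  moreover have "y + x div 2 = y" using 2 by simp
  ultimately show ?thesis by (simp only:)
 next
  case 3
  let ?h1 = "h(18 := x - 1, 19 := y)" and ?h2 = "h(18 := x - 2, 19 := y)" and ?h3 = "h(18 := x - 2, 19 := Suc y)"
  have a: "go (Pop 18) (h(18 := x, 19 := y)) ?h1 [] 1"
   using go_Pop[of 18 "h(18 := x, 19 := y)"] by (simp add: fun_upd_twist[of 19 18])
  have b: "go (Pop 18) ?h1 ?h2 [] 1"
   using go_Pop[of 18 ?h1] 3 by (simp add: fun_upd_twist[of 19 18] numeral_2_eq_2)
  have c: "go (Push 19 True) ?h2 ?h3 [] 1" by (rule go_PushI) simp_all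
  have d: "go (IfElse (Nonempty 18) (Seq (Pop 18) (Push 19 True)) skip) ?h1 ?h3 ([] @ []) (1 + 1 + 1)"
   by (rule go_if(1)[OF go_Seq[OF b c]]) (use 3 in simp)
  have "go halfp ?h3 (h(18 := 0, 19 := Suc y + (x - 2) div 2)) [] (5 * (x - 2) + 1)" by (rule less) (use 3 in simp)
  then have "go halfp (h(18 := x, 19 := y)) (h(18 := 0, 19 := Suc y + (x - 2) div 2)) (([] @ ([] @ [])) @ []) ((1 + (1 + 1 + 1)) + (5 * (x - 2) + 1) + 1)"
   unfolding halfp_def by (intro go_while_step[OF _ go_Seq[OF a d]]) (use 3 in simp_all)
  moreover have "Suc y + (x - 2) div 2 = y + x div 2" using 3 by linarith
  ultimately have "go halfp (h(18 := x, 19 := y)) (h(18 := 0, 19 := y + x div 2)) (([] @ ([] @ [])) @ []) ((1 + (1 + 1 + 1)) + (5 * (x - 2) + 1) + 1)"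
   by (simp only:)
  then show ?thesis by (rule go_congT) (use 3 in simp_all)
 qed
qed

text \<open>Repeated halving. Each round adds two to stack \<open>7\<close>, because the length of
  the activation chain contains twice the bit length.\<close>

definition lenp :: prog where
 "lenp = While (Nonempty 18) (Seq halfp (Seq (copy 19 18) (Seq (clear 19) (Seq (Push 7 True) (Push 7 True)))))"

lemma go_len:
 assumes h: "h 2 = 0" "h 19 = 0" and W: "8 * Y + 10 \<le> W"
 shows "x \<le> Y ==> go lenp (h(18 := x, 7 := y)) (h(18 := 0, 7 := y + 2 * blen x)) [] (x * (5 * W) + 1)"
proof (induction x arbitrary: y rule: less_induct)
 case (less x)
 show ?case
 proof (cases "x = 0")
  case True
  have "go lenp (h(18 := 0, 7 := y)) (h(18 := 0, 7 := y)) [] 1" unfolding lenp_def by (rule go_while_done) simp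
  then show ?thesis unfolding True by (simp only: blen_0 add_0_right mult_0 mult_0_right add_0)
 next
  case False
  let ?z = "x div 2"
  have z: "?z \<le> Y" "?z < x" using False less.prems by simp_all
  have hh: "h(18 := u, 7 := y, 19 := 0) = h(18 := u, 7 := y)" for u using h by (simp add: fun_upd_idem)
  have tw: "h(7 := y, 18 := u, 19 := w) = h(18 := u, 7 := y, 19 := w)" "h(7 := y, 18 := u) = h(18 := u, 7 := y)" for u w by (simp_all add: fun_upd_twist[of 7 18])
  have s1: "go halfp (h(18 := x, 7 := y)) (h(18 := 0, 7 := y, 19 := ?z)) [] (5 * x + 1)"
   using go_half[of "h(7 := y)" x 0] by (simp add: tw hh)
  have s2: "go (copy 19 18) (h(18 := 0, 7 := y, 19 := ?z)) (h(18 := ?z, 7 := y, 19 := ?z)) [] W"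
   by (rule go_copyI) (use h W z in \<open>simp_all add: fun_upd_twist[of 19 18] fun_upd_twist[of 7 18]\<close>)
  have s3: "go (clear 19) (h(18 := ?z, 7 := y, 19 := ?z)) (h(18 := ?z, 7 := y)) [] W"
   by (rule go_clearI) (use h W z in \<open>simp_all add: hh\<close>)
  have s4: "go (Push 7 True) (h(18 := ?z, 7 := y)) (h(18 := ?z, 7 := y + 1)) [] 1" by (rule go_PushI) simp_all
  have s5: "go (Push 7 True) (h(18 := ?z, 7 := y + 1)) (h(18 := ?z, 7 := y + 2)) [] 1" by (rule go_PushI) simp_all
  from less.IH[OF z(2,1), of "y + 2"] have s6: "go lenp (h(18 := ?z, 7 := y + 2)) (h(18 := 0, 7 := y + 2 + 2 * blen ?z)) [] (?z * (5 * W) + 1)" .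
  have b: "y + 2 + 2 * blen ?z = y + 2 * blen x" using False by (simp add: blen_pos)
  have "go lenp (h(18 := x, 7 := y)) (h(18 := 0, 7 := y + 2 * blen x)) (([] @ [] @ [] @ [] @ []) @ [])
   (((5 * x + 1) + (W + (W + (1 + 1)))) + (?z * (5 * W) + 1) + 1)"
   unfolding b[symmetric] lenp_def
   by (rule go_while_step[OF _ go_Seq[OF s1 go_Seq[OF s2 go_Seq[OF s3 go_Seq[OF s4 s5]]]] s6[unfolded lenp_def]]) (use False in simp)
  then show ?thesis
  proof (rule go_congT)
   have "(?z + 1) * (5 * W) \<le> x * (5 * W)" by (rule mult_le_mono1) (use False in linarith)
   then show "((5 * x + 1) + (W + (W + (1 + 1)))) + (?z * (5 * W) + 1) + 1 \<le> x * (5 * W) + 1"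
    using W less.prems unfolding add_mult_distrib by linarith
  qed simp_all
 qed
qed

text \<open>Stack \<open>8\<close> receives the bound \<open>T = c * n ^ c\<close>, stack
  \<open>7\<close> the length of the activation chain. The frontiers \<open>2 * k + 2\<close> and
  \<open>2 * k + 3\<close> are an even and an odd wire beyond the challenge and the answer wire
  \<open>k\<close>; doubling fixes the parity for every \<open>k\<close>.\<close>

definition initp :: "nat => prog" where
 "initp c = Seq (copy 1 5) (Seq (copy 1 3) (Seq (copy 1 3) (Seq (pushes 3 2) (Seq (copy 1 4) (Seq (copy 1 4) (Seq (pushes 4 3)
   (Seq (pushes 8 c) (Seq (powp c) (Seq (copy 8 18) (Seq lenp (pushes 7 2)))))))))))"

lemma go_init:
 assumes W: "8 * Y + 10 \<le> W" and Y: "n \<le> Y" "k \<le> Y" "c * (n + 1) ^ c \<le> Y"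
 defines "T \<equiv> c * n ^ c"
 shows "go (initp c) ((%_. 0)(0 := n, 1 := k)) (R ((%_. 0)(0 := n, 1 := k, 5 := k, 8 := T, 7 := 2 * blen T + 2)) (2 * k + 2) (2 * k + 3) 0 0 0 0) []
  (20 * W + c + c * (5 * W + n * (W + 2)) + Y * (5 * W))"
proof -
 define z where "z = ((%_. 0)(0 := n, 1 := k, 5 := k) :: nat => nat)"
 have T: "T \<le> Y"
 proof -
  have "c * n ^ c \<le> c * (n + 1) ^ c" by (rule mult_le_mono2, rule power_mono) simp_all
  then show ?thesis using Y(3) unfolding T_def by linarith
 qed
 have w: "x \<le> Y ==> 8 * x + 2 \<le> W" for x using W by simp
 have zv: "z 0 = n" "z 1 = k" "v \<notin> {0, 1, 5} ==> z v = 0" for v by (simp_all add: z_def)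
 have s1: "go (copy 1 5) ((%_. 0)(0 := n, 1 := k)) z [] W"
  by (rule go_copyI) (use w Y in \<open>simp_all add: z_def\<close>)
 have s2: "go (copy 1 3) z (z(3 := k)) [] W" by (rule go_copyI) (use w[OF Y(2)] zv in simp_all)
 have s3: "go (copy 1 3) (z(3 := k)) (z(3 := 2 * k)) [] W" by (rule go_copyI) (use w[OF Y(2)] zv in \<open>simp_all add: mult_2\<close>)
 have s4: "go (pushes 3 2) (z(3 := 2 * k)) (z(3 := 2 * k + 2)) [] (2 + 2)" by (rule go_cong[OF go_pushes[of _ _ "z(3 := 2 * k)"]]) simp_all
 let ?a = "z(3 := 2 * k + 2)"
 have s5: "go (copy 1 4) ?a (?a(4 := k)) [] W" by (rule go_copyI) (use w[OF Y(2)] zv in simp_all)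
 have s6: "go (copy 1 4) (?a(4 := k)) (?a(4 := 2 * k)) [] W" by (rule go_copyI) (use w[OF Y(2)] zv in \<open>simp_all add: mult_2\<close>)
 have s7: "go (pushes 4 3) (?a(4 := 2 * k)) (?a(4 := 2 * k + 3)) [] (3 + 2)" by (rule go_cong[OF go_pushes[of _ _ "?a(4 := 2 * k)"]]) simp_all
 let ?b = "?a(4 := 2 * k + 3)"
 have s8: "go (pushes 8 c) ?b (?b(8 := c)) [] (c + 2)" by (rule go_cong[OF go_pushes[of _ _ ?b]]) (use zv in simp_all)
 have "8 * Y + 2 \<le> W" using W by simp
 then have s9: "go (powp c) (?b(8 := c)) (?b(8 := T)) [] (c * (5 * W + n * (W + 2)) + 2)"
  unfolding T_def by (intro go_pow) (use zv Y in simp_all)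
 let ?d = "?b(8 := T)"
 have s10: "go (copy 8 18) ?d (?d(18 := T)) [] W" by (rule go_copyI) (use w[OF T] zv in simp_all)
 have "?d(18 := T, 7 := 0) = ?d(18 := T)" "?d(18 := 0, 7 := u) = ?d(7 := u)" for u using zv by (simp_all add: fun_upd_idem)
 then have s11: "go lenp (?d(18 := T)) (?d(7 := 2 * blen T)) [] (T * (5 * W) + 1)"
  using go_len[of ?d, OF _ _ W T, of 0] zv by simp
 have s12: "go (pushes 7 2) (?d(7 := 2 * blen T)) (?d(7 := 2 * blen T + 2)) [] (2 + 2)"
  by (rule go_cong[OF go_pushes[of _ _ "?d(7 := 2 * blen T)"]]) simp_all
 have e: "R ((%_. 0)(0 := n, 1 := k, 5 := k, 8 := T, 7 := 2 * blen T + 2)) (2 * k + 2) (2 * k + 3) 0 0 0 0 = ?d(7 := 2 * blen T + 2)"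
  by (simp add: R_def z_def fun_eq_iff)
 have TY: "T * (5 * W) \<le> Y * (5 * W)" by (rule mult_le_mono1[OF T])
 show ?thesis unfolding initp_def e
 proof (rule go_cong[OF go_Seq[OF s1 go_Seq[OF s2 go_Seq[OF s3 go_Seq[OF s4 go_Seq[OF s5 go_Seq[OF s6 go_Seq[OF s7 go_Seq[OF s8
   go_Seq[OF s9 go_Seq[OF s10 go_Seq[OF s11 s12]]]]]]]]]]]], goal_cases)
  case 4
  show ?case using W TY by linarith
 qed simp_all
qed


section \<open>Spectral theorem and variational form of the trace norm\<close>

lemma order_linear_prod: "Polynomial.order e (\<Prod>a\<leftarrow>as. [:- a, 1:]) = count_list as (e :: complex)"
proof (induction as)
 case (Cons a as)
 have "(\<Prod>a\<leftarrow>a # as. [:- a, 1:]) ~= (0 :: complex poly)" by (subst prod_list_zero_iff) auto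
 then have "Polynomial.order e ([:- a, 1:] * (\<Prod>a\<leftarrow>as. [:- a, 1:])) = Polynomial.order e [:- a, 1:] + Polynomial.order e (\<Prod>a\<leftarrow>as. [:- a, 1:])"
  by (intro order_mult) simp
 then show ?case using Cons by (simp add: order_linear')
qed simp

text \<open>Turns the sum over distinct roots with multiplicities, as in \<open>trace_norm\<close>,
  into a sum over a list of linear factors.\<close>

lemma sum_roots:
 fixes p :: "complex poly"
 assumes "p = (\<Prod>a\<leftarrow>as. [:- a, 1:])"
 shows "(\<Sum>e | poly p e = 0. real (Polynomial.order e p) * f e) = (\<Sum>a\<leftarrow>as. f a)"
proof -
 have "{e. poly p e = 0} = set as" unfolding assms by (induction as) auto
 moreover have "(\<Sum>e\<in>S. real (count_list as e) * f e) = (\<Sum>a\<leftarrow>as. f a)" if "finite S" "set as \<subseteq> S" for S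
  using that(2)
 proof (induction as)
  case (Cons a as)
  have "(\<Sum>e\<in>S. real (count_list (a # as) e) * f e) = (\<Sum>e\<in>S. (if e = a then f e else 0) + real (count_list as e) * f e)"
   by (intro sum.cong refl) (simp add: algebra_simps)
  also have "\<dots> = f a + (\<Sum>a\<leftarrow>as. f a)" using Cons that(1) by (simp add: sum.distrib)
  finally show ?case by simp
 qed simp
 ultimately show ?thesis unfolding assms order_linear_prod by simp
qed

text \<open>A Schur form carries the eigenvalues on its diagonal, and similar matrices have the same
  trace.\<close>

lemma ex_eigen:
 fixes y :: "nat => nat => complex"
 shows "\<exists>es. length es = N \<and> sum_list es = (\<Sum>a<N. y a a) \<and>
  (\<forall>e\<in>set es. \<exists>w. (\<exists>a<N. w a ~= 0) \<and> (\<forall>a<N. (\<Sum>b<N. y a b * w b) = e * w a))"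
proof -
 let ?A = "mat N N (%(a, b). y a b)"
 have A: "?A \<in> carrier_mat N N" by simp
 obtain es where es: "char_poly ?A = (\<Prod>a\<leftarrow>es. [:- a, 1:])" "length es = N" using char_poly_factorized[OF A] by blast
 obtain B P Q where d: "schur_decomposition ?A es = (B, P, Q)" using prod_cases3 by blast
 have sim: "similar_mat_wit ?A B P Q" and diag: "diag_mat B = es" using schur_decomposition[OF A es(1) d] by auto
 note w = similar_mat_witD2[OF A sim]
 have BN: "B \<in> carrier_mat N N" "P \<in> carrier_mat N N" "Q \<in> carrier_mat N N" using w by auto
 have "y a a = (P * B * Q) $$ (a, a)" if "a < N" for a using arg_cong[OF w(3), of "%M. M $$ (a, a)"] that by simp
 then have "(\<Sum>a<N. y a a) = (\<Sum>a<N. \<Sum>j<N. \<Sum>l<N. P $$ (a, j) * B $$ (j, l) * Q $$ (l, a))"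
  using BN by (intro sum.cong refl) (simp add: scalar_prod_def atLeast0LessThan sum_distrib_left mult.assoc)
 also have "\<dots> = (\<Sum>j<N. \<Sum>a<N. \<Sum>l<N. P $$ (a, j) * B $$ (j, l) * Q $$ (l, a))" by (rule sum.swap)
 also have "\<dots> = (\<Sum>j<N. \<Sum>l<N. \<Sum>a<N. P $$ (a, j) * B $$ (j, l) * Q $$ (l, a))" by (intro sum.cong refl sum.swap)
 also have "\<dots> = (\<Sum>j<N. \<Sum>l<N. B $$ (j, l) * (\<Sum>a<N. Q $$ (l, a) * P $$ (a, j)))"
  by (simp add: sum_distrib_left mult_ac)
 also have "\<dots> = (\<Sum>j<N. \<Sum>l<N. B $$ (j, l) * (Q * P) $$ (l, j))"
  using BN by (intro sum.cong refl) (simp add: scalar_prod_def atLeast0LessThan)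
 also have "\<dots> = (\<Sum>j<N. \<Sum>l<N. if l = j then B $$ (j, l) else 0)"
  unfolding w(2) by (intro sum.cong refl) auto
 also have "\<dots> = (\<Sum>l<N. B $$ (l, l))" by simp
 also have "\<dots> = sum_list es" unfolding diag[symmetric] using BN by (simp add: diag_mat_def interv_sum_list_conv_sum_set_nat atLeast0LessThan)
 finally have tr: "sum_list es = (\<Sum>a<N. y a a)" by simp
 have "\<exists>w. (\<exists>a<N. w a ~= 0) \<and> (\<forall>a<N. (\<Sum>b<N. y a b * w b) = e * w a)" if "e \<in> set es" for e
 proof -
  have "poly (char_poly ?A) e = 0" unfolding es(1) using that by (induction es) auto
  then obtain v where "eigenvector ?A v e" using eigenvalue_root_char_poly[OF A] unfolding eigenvalue_def by blast
  then have v: "v \<in> carrier_vec N" "v ~= 0\<^sub>v N" "?A *\<^sub>v v = e \<cdot>\<^sub>v v" by (auto simp: eigenvector_def)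
  have "\<exists>a<N. v $ a ~= 0"
  proof (rule ccontr)
   assume "\<not> ?thesis"
   then have "v = 0\<^sub>v N" using v(1) by (intro eq_vecI) auto
   then show False using v(2) by simp
  qed
  moreover have "(\<Sum>b<N. y a b * v $ b) = e * v $ a" if "a < N" for a
   using arg_cong[OF v(3), of "%u. u $ a"] that v(1) by (simp add: scalar_prod_def atLeast0LessThan)
  ultimately show ?thesis by blast
 qed
 then show ?thesis using es(2) tr by blast
qed

definition ip :: "nat => (nat => complex) => (nat => complex) => complex" where "ip N u w = (\<Sum>a<N. cnj (u a) * w a)"

lemma ip_cnj: "cnj (ip N u w) = ip N w u" by (simp add: ip_def mult.commute)

lemma ip_self: "ip N u u = complex_of_real (\<Sum>a<N. (cmod (u a))\<^sup>2)"
 unfolding ip_def of_real_sum complex_norm_square by (simp add: mult.commute)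

lemma ip_herm:
 assumes "\<And>a b. a < N ==> b < N ==> y b a = cnj (y a b)"
 shows "ip N u (%a. \<Sum>b<N. y a b * w b) = ip N (%a. \<Sum>b<N. y a b * u b) w"
proof -
 have "ip N u (%a. \<Sum>b<N. y a b * w b) = (\<Sum>b<N. \<Sum>a<N. cnj (u a) * (y a b * w b))"
  unfolding ip_def sum_distrib_left by (rule sum.swap)
 also have "\<dots> = ip N (%a. \<Sum>b<N. y a b * u b) w"
  unfolding ip_def cnj_sum sum_distrib_right
 proof (intro sum.cong refl)
  fix a b assume "b \<in> {..<N}" "a \<in> {..<N}"
  then have "y a b = cnj (y b a)" using assms[of b a] by simp
  then show "cnj (u a) * (y a b * w b) = cnj (y b a * u a) * w b" by (simp only: complex_cnj_mult mult_ac)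
 qed
 finally show ?thesis .
qed

text \<open>Deflation: \<open>y\<close> differs from \<open>x\<close> by moving the eigenvalues
  found so far to one value \<open>\<mu>\<close>. An eigenvalue \<open>e \<noteq> \<mu>\<close> of
  \<open>y\<close> has an eigenvector orthogonal to the earlier ones, on which \<open>x\<close> and
  \<open>y\<close> agree.\<close>

lemma herm_eigenvectors:
 fixes x :: "nat => nat => complex"
 assumes x: "\<And>a b. a < N ==> b < N ==> x b a = cnj (x a b)"
 shows "k \<le> N ==> \<exists>v (d :: nat => real). (\<forall>i<k. \<forall>j<k. ip N (v i) (v j) = of_bool (i = j)) \<and>
  (\<forall>i<k. \<forall>a<N. (\<Sum>b<N. x a b * v i b) = of_real (d i) * v i a)"
proof (induction k)
 case (Suc k)
 then obtain v d where v: "\<forall>i<k. \<forall>j<k. ip N (v i) (v j) = of_bool (i = j)"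
  "\<forall>i<k. \<forall>a<N. (\<Sum>b<N. x a b * v i b) = of_real (d i) * v i a" by auto
 define tau where "tau = (\<Sum>a<N. x a a) - (\<Sum>i<k. complex_of_real (d i))"
 \<comment> \<open>\<open>tau\<close> is what the trace leaves for the missing eigenvalues. If
   \<open>y\<close> had only the eigenvalue \<open>\<mu>\<close>, its trace would give
   \<open>tau = (N - k) * \<mu>\<close>, which fails because \<open>\<mu>\<close> exceeds
   \<open>cmod tau\<close> and \<open>N - k\<close> is at least one.\<close>
 define \<mu> where "\<mu> = 1 + cmod tau"
 define y where "y a b = x a b + (\<Sum>i<k. of_real (\<mu> - d i) * (v i a * cnj (v i b)))" for a b
 have y: "y b a = cnj (y a b)" if "a < N" "b < N" for a b using x[OF that] by (simp add: y_def mult_ac)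
 have app: "(\<Sum>b<N. y a b * w b) = (\<Sum>b<N. x a b * w b) + (\<Sum>i<k. of_real (\<mu> - d i) * v i a * ip N (v i) w)" for a w
 proof -
  have "(\<Sum>b<N. (\<Sum>i<k. of_real (\<mu> - d i) * (v i a * cnj (v i b))) * w b) = (\<Sum>i<k. \<Sum>b<N. of_real (\<mu> - d i) * (v i a * cnj (v i b)) * w b)"
   unfolding sum_distrib_right by (rule sum.swap)
  also have "\<dots> = (\<Sum>i<k. of_real (\<mu> - d i) * v i a * ip N (v i) w)"
   unfolding ip_def sum_distrib_left by (simp add: mult.assoc)
  finally show ?thesis by (simp add: y_def distrib_right sum.distrib)
 qed
 obtain es where es: "length es = N" "sum_list es = (\<Sum>a<N. y a a)"
  "\<forall>e\<in>set es. \<exists>w. (\<exists>a<N. w a ~= 0) \<and> (\<forall>a<N. (\<Sum>b<N. y a b * w b) = e * w a)" using ex_eigen by blast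
 have "(\<Sum>a<N. y a a) = tau + of_nat k * of_real \<mu>"
 proof -
  have "(\<Sum>a<N. \<Sum>i<k. of_real (\<mu> - d i) * (v i a * cnj (v i a))) = (\<Sum>i<k. of_real (\<mu> - d i) * ip N (v i) (v i))"
   unfolding ip_def sum_distrib_left by (subst sum.swap) (simp add: mult_ac)
  also have "\<dots> = (\<Sum>i<k. complex_of_real (\<mu> - d i))" using v(1) by simp
  finally show ?thesis by (simp add: y_def sum.distrib tau_def sum_subtractf)
 qed
 moreover have "sum_list es = of_nat N * of_real \<mu>" if all: "\<forall>e\<in>set es. e = of_real \<mu>"
 proof -
  have "sum_list es = of_nat (length es) * of_real \<mu>" using all by (induction es) (simp_all add: algebra_simps)
  then show ?thesis using es(1) by simp
 qed
 ultimately have "\<exists>e\<in>set es. e ~= of_real \<mu>"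
 proof (rule_tac ccontr)
  assume s: "(\<Sum>a<N. y a a) = tau + of_nat k * of_real \<mu>" "\<forall>e\<in>set es. e = of_real \<mu> ==> sum_list es = of_nat N * of_real \<mu>"
   "\<not> (\<exists>e\<in>set es. e ~= of_real \<mu>)"
  then have "tau = of_real ((real N - real k) * \<mu>)" using es(2) by (simp add: algebra_simps)
  then have "cmod tau = \<bar>(real N - real k) * \<mu>\<bar>" by (metis norm_of_real)
  moreover have "0 \<le> (real N - real k) * \<mu>" using Suc.prems by (simp add: \<mu>_def)
  ultimately have "cmod tau = (real N - real k) * \<mu>" by linarith
  moreover have "1 * \<mu> \<le> (real N - real k) * \<mu>" by (rule mult_right_mono) (use Suc.prems in \<open>simp_all add: \<mu>_def\<close>)
  ultimately show False by (simp add: \<mu>_def)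
 qed
 then obtain e w where e: "e ~= of_real \<mu>" "\<exists>a<N. w a ~= 0" "\<forall>a<N. (\<Sum>b<N. y a b * w b) = e * w a" using es(3) by blast
 have orth: "ip N (v j) w = 0" if j: "j < k" for j
 proof -
  have "(\<Sum>b<N. y a b * v j b) = of_real \<mu> * v j a" if a: "a < N" for a
  proof -
   have "(\<Sum>i<k. of_real (\<mu> - d i) * v i a * ip N (v i) (v j)) = (\<Sum>i<k. if i = j then of_real (\<mu> - d i) * v i a else 0)"
    using v(1) j by (intro sum.cong) auto
   also have "\<dots> = of_real (\<mu> - d j) * v j a" using j by simp
   finally show ?thesis unfolding app using v(2) j a by (simp add: algebra_simps)
  qed
  then have "ip N (%a. \<Sum>b<N. y a b * v j b) w = of_real \<mu> * ip N (v j) w"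
   by (simp add: ip_def sum_distrib_left mult.assoc)
  moreover have "ip N (v j) (%a. \<Sum>b<N. y a b * w b) = e * ip N (v j) w"
   using e(3) by (simp add: ip_def sum_distrib_left mult_ac)
  ultimately have "e * ip N (v j) w = of_real \<mu> * ip N (v j) w" using ip_herm[of N y "v j" w, OF y] by metis
  then show ?thesis using e(1) by simp
 qed
 have xw: "(\<Sum>b<N. x a b * w b) = e * w a" if "a < N" for a using e(3) that app[of a w] orth by simp
 define s where "s = (\<Sum>a<N. (cmod (w a))\<^sup>2)"
 obtain a where a: "a < N" "w a ~= 0" using e(2) by blast
 have s: "s > 0" unfolding s_def by (rule sum_pos2[of _ a]) (use a in auto)
 have "e * ip N w w = cnj e * ip N w w"
 proof -
  have "ip N w (%a. \<Sum>b<N. x a b * w b) = e * ip N w w" using xw by (simp add: ip_def sum_distrib_left mult_ac)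
  moreover have "ip N (%a. \<Sum>b<N. x a b * w b) w = cnj e * ip N w w" using xw by (simp add: ip_def sum_distrib_left mult_ac)
  ultimately show ?thesis using ip_herm[of N x w w, OF x] by metis
 qed
 then have er: "e = of_real (Re e)" using s unfolding ip_self s_def[symmetric] by (simp add: complex_eq_iff)
 define u where "u a = w a / of_real (sqrt s)" for a
 have "ip N u u = 1" 
 proof -
  have "complex_of_real (sqrt s) * complex_of_real (sqrt s) = of_real s" using s by (simp flip: of_real_mult)
  then have "ip N u u = ip N w w / of_real s" by (simp add: ip_def u_def sum_divide_distrib)
  then show ?thesis using s unfolding ip_self s_def[symmetric] by simp
 qed
 moreover have "ip N (v j) u = 0" "ip N u (v j) = 0" if "j < k" for j
 proof -
  show 1: "ip N (v j) u = 0" using orth[OF that] by (simp add: ip_def u_def flip: sum_divide_distrib)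
  show "ip N u (v j) = 0" using 1 ip_cnj[of N "v j" u] by simp
 qed
 moreover have "(\<Sum>b<N. x a b * u b) = of_real (Re e) * u a" if "a < N" for a
  using xw[OF that] er by (simp add: u_def flip: sum_divide_distrib)
 ultimately show ?case using v
  by (intro exI[of _ "v(k := u)"] exI[of _ "d(k := Re e)"]) (auto simp: less_Suc_eq)
qed simp

text \<open>For a Hermitian matrix, \<open>mat_adjoint X * X\<close> has the eigenvalues
  \<open>(d i)\<^sup>2\<close> in the same eigenbasis, so the singular values are the
  \<open>\<bar>d i\<bar>\<close>.\<close>

lemma spectral:
 assumes X: "X \<in> carrier_mat N N" and h: "\<And>a b. a < N ==> b < N ==> X $$ (b, a) = cnj (X $$ (a, b))"
 shows "\<exists>v (d :: nat => real). (\<forall>i<N. \<forall>j<N. ip N (v i) (v j) = of_bool (i = j)) \<and>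
  (\<forall>a<N. \<forall>b<N. (\<Sum>i<N. v i a * cnj (v i b)) = of_bool (a = b)) \<and>
  (\<forall>a<N. \<forall>b<N. X $$ (a, b) = (\<Sum>i<N. of_real (d i) * (v i a * cnj (v i b)))) \<and>
  trace_norm X = (\<Sum>i<N. \<bar>d i\<bar>)"
proof -
 obtain v d where v: "\<forall>i<N. \<forall>j<N. ip N (v i) (v j) = of_bool (i = j)"
  "\<forall>i<N. \<forall>a<N. (\<Sum>b<N. X $$ (a, b) * v i b) = of_real (d i) * v i a"
  using herm_eigenvectors[of N "%a b. X $$ (a, b)", OF h order_refl] by blast
 let ?V = "mat N N (%(a, i). v i a)" and ?W = "mat N N (%(i, b). cnj (v i b))"
 have "?W * ?V = 1\<^sub>m N"
 proof (rule eq_matI)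
  fix i j assume ij: "i < dim_row (1\<^sub>m N :: complex mat)" "j < dim_col (1\<^sub>m N :: complex mat)"
  then have "(?W * ?V) $$ (i, j) = ip N (v i) (v j)" by (simp add: scalar_prod_def ip_def atLeast0LessThan)
  then show "(?W * ?V) $$ (i, j) = 1\<^sub>m N $$ (i, j)" using v(1) ij by simp
 qed simp_all
 then have VW: "?V * ?W = 1\<^sub>m N" by (rule mat_mult_left_right_inverse[rotated 2]) simp_all
 have comp: "(\<Sum>i<N. v i a * cnj (v i b)) = of_bool (a = b)" if "a < N" "b < N" for a b
  using arg_cong[OF VW, of "%M. M $$ (a, b)"] that by (simp add: scalar_prod_def atLeast0LessThan)
 have ent: "X $$ (a, b) = (\<Sum>i<N. of_real (d i) * (v i a * cnj (v i b)))" if ab: "a < N" "b < N" for a b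
 proof -
  have "(\<Sum>i<N. of_real (d i) * (v i a * cnj (v i b))) = (\<Sum>i<N. \<Sum>c<N. X $$ (a, c) * v i c * cnj (v i b))"
   by (intro sum.cong refl) (use v(2) ab in \<open>simp flip: sum_distrib_right mult.assoc\<close>)
  also have "\<dots> = (\<Sum>c<N. \<Sum>i<N. X $$ (a, c) * (v i c * cnj (v i b)))" by (subst sum.swap) (simp add: mult.assoc)
  also have "\<dots> = (\<Sum>c<N. X $$ (a, c) * (\<Sum>i<N. v i c * cnj (v i b)))" by (simp add: sum_distrib_left)
  also have "\<dots> = (\<Sum>c<N. if c = b then X $$ (a, c) else 0)" by (intro sum.cong refl) (use comp ab in simp)
  finally show ?thesis using ab by simp
 qed
 have adj: "mat_adjoint X = X"
 proof (rule eq_matI)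
  fix i j assume ij: "i < dim_row X" "j < dim_col X"
  then have "i < N" "j < N" using X by auto
  then show "mat_adjoint X $$ (i, j) = X $$ (i, j)" using ij X h[of j i] by (simp add: mat_adjoint_index)
 qed (use X in auto)
 let ?D = "mat N N (%(i, j). if i = j then complex_of_real ((d i)\<^sup>2) else 0)"
 have "X * X = ?V * ?D * ?W"
 proof (rule eq_matI)
  fix a b assume "a < dim_row (?V * ?D * ?W)" "b < dim_col (?V * ?D * ?W)"
  then have ab: "a < N" "b < N" by simp_all
  have VD: "(?V * ?D) $$ (a, i) = v i a * of_real ((d i)\<^sup>2)" if "i < N" for i
  proof -
   have "(?V * ?D) $$ (a, i) = (\<Sum>j<N. v j a * (if j = i then complex_of_real ((d j)\<^sup>2) else 0))"
    using that ab by (simp add: scalar_prod_def atLeast0LessThan)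
   also have "\<dots> = (\<Sum>j<N. if j = i then v j a * complex_of_real ((d j)\<^sup>2) else 0)" by (intro sum.cong) auto
   finally show ?thesis using that by simp
  qed
  have "(X * X) $$ (a, b) = (\<Sum>c<N. X $$ (a, c) * X $$ (c, b))" using X ab by (simp add: scalar_prod_def atLeast0LessThan)
  also have "\<dots> = (\<Sum>c<N. \<Sum>i<N. X $$ (a, c) * v i c * (of_real (d i) * cnj (v i b)))"
  proof (intro sum.cong refl)
   fix c assume "c \<in> {..<N}"
   then have c: "c < N" by simp
   show "X $$ (a, c) * X $$ (c, b) = (\<Sum>i<N. X $$ (a, c) * v i c * (of_real (d i) * cnj (v i b)))"
    unfolding ent[OF c ab(2)] sum_distrib_left by (simp add: mult_ac)
  qed
  also have "\<dots> = (\<Sum>i<N. (\<Sum>c<N. X $$ (a, c) * v i c) * (of_real (d i) * cnj (v i b)))"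
   unfolding sum_distrib_right by (rule sum.swap)
  also have "\<dots> = (\<Sum>i<N. (?V * ?D) $$ (a, i) * ?W $$ (i, b))"
   by (intro sum.cong refl) (use v(2) ab VD in \<open>simp add: power2_eq_square mult_ac\<close>)
  also have "\<dots> = (?V * ?D * ?W) $$ (a, b)" using ab by (simp add: scalar_prod_def atLeast0LessThan)
  finally show "(X * X) $$ (a, b) = (?V * ?D * ?W) $$ (a, b)" .
 qed (use X in auto)
 then have "similar_mat_wit (X * X) ?D ?V ?W"
  unfolding similar_mat_wit_def Let_def using VW \<open>?W * ?V = 1\<^sub>m N\<close> X by auto
 then have "char_poly (X * X) = char_poly ?D" by (intro char_poly_similar) (auto simp: similar_mat_def)
 also have "\<dots> = (\<Prod>a\<leftarrow>diag_mat ?D. [:- a, 1:])" by (rule char_poly_upper_triangular[of _ N]) (auto simp: upper_triangular_def)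
 finally have cp: "char_poly (X * X) = (\<Prod>a\<leftarrow>diag_mat ?D. [:- a, 1:])" .
 have XX: "X * X \<in> carrier_mat N N" using X by simp
 have "trace_norm X = (\<Sum>a\<leftarrow>diag_mat ?D. sqrt (Re a))"
  unfolding trace_norm_def Let_def adj eigenvalue_root_char_poly[OF XX] by (rule sum_roots[OF cp])
 also have "\<dots> = (\<Sum>i<N. \<bar>d i\<bar>)" by (simp add: diag_mat_def comp_def interv_sum_list_conv_sum_set_nat atLeast0LessThan)
 finally have tn: "trace_norm X = (\<Sum>i<N. \<bar>d i\<bar>)" .
 show ?thesis by (rule exI[of _ v], rule exI[of _ d]) (use v(1) comp ent tn in blast)
qed

text \<open>The pairing of \<open>X\<close> with \<open>B\<close> combines the values of the
  quadratic form of \<open>B\<close> at the unit eigenvectors of \<open>X\<close>, with the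
  eigenvalues as weights. A bound on the numerical radius of \<open>B\<close> therefore
  suffices.\<close>

lemma trace_norm_dual:
 assumes X: "X \<in> carrier_mat N N" and h: "\<And>a b. a < N ==> b < N ==> X $$ (b, a) = cnj (X $$ (a, b))"
  and B: "\<And>u. cmod (\<Sum>a<N. \<Sum>b<N. cnj (u a) * B a b * u b) \<le> (\<Sum>a<N. (cmod (u a))\<^sup>2)"
 shows "cmod (\<Sum>a<N. \<Sum>b<N. X $$ (b, a) * B a b) \<le> trace_norm X"
proof -
 obtain v and d :: "nat => real" where sp: "\<forall>i<N. \<forall>j<N. ip N (v i) (v j) = of_bool (i = j)"
  "\<forall>a<N. \<forall>b<N. (\<Sum>i<N. v i a * cnj (v i b)) = of_bool (a = b)"
  "\<forall>a<N. \<forall>b<N. X $$ (a, b) = (\<Sum>i<N. of_real (d i) * (v i a * cnj (v i b)))"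
  "trace_norm X = (\<Sum>i<N. \<bar>d i\<bar>)" using spectral[OF X h] by blast
 note v = sp(1)[rule_format] sp(2)[rule_format] sp(3)[rule_format] sp(4)
 have "(\<Sum>a<N. \<Sum>b<N. X $$ (b, a) * B a b) = (\<Sum>a<N. \<Sum>b<N. \<Sum>i<N. of_real (d i) * (cnj (v i a) * B a b * v i b))"
  by (intro sum.cong refl) (use v(3) in \<open>simp add: sum_distrib_right sum_distrib_left mult_ac\<close>)
 also have "\<dots> = (\<Sum>a<N. \<Sum>i<N. \<Sum>b<N. of_real (d i) * (cnj (v i a) * B a b * v i b))" by (intro sum.cong refl sum.swap)
 also have "\<dots> = (\<Sum>i<N. of_real (d i) * (\<Sum>a<N. \<Sum>b<N. cnj (v i a) * B a b * v i b))"
  by (subst sum.swap) (simp add: sum_distrib_left)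
 also have "cmod \<dots> \<le> (\<Sum>i<N. \<bar>d i\<bar> * 1)"
 proof (rule sum_norm_le)
  fix i assume "i \<in> {..<N}"
  then have "complex_of_real (\<Sum>a<N. (cmod (v i a))\<^sup>2) = 1" using v(1)[of i i] unfolding ip_self[symmetric] by simp
  then have "(\<Sum>a<N. (cmod (v i a))\<^sup>2) = 1" by (simp only: of_real_eq_1_iff)
  then show "cmod (of_real (d i) * (\<Sum>a<N. \<Sum>b<N. cnj (v i a) * B a b * v i b)) \<le> \<bar>d i\<bar> * 1"
   using B[of "v i"] unfolding norm_mult by (intro mult_mono) simp_all
 qed
 finally show ?thesis using v(4) by simp
qed

text \<open>The extremal \<open>B\<close> is the sign of \<open>X\<close> in its eigenbasis;
  Parseval's identity shows that its quadratic form is admissible.\<close>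

lemma trace_norm_attained:
 assumes X: "X \<in> carrier_mat N N" and h: "\<And>a b. a < N ==> b < N ==> X $$ (b, a) = cnj (X $$ (a, b))"
 obtains B where "\<And>u. cmod (\<Sum>a<N. \<Sum>b<N. cnj (u a) * B a b * u b) \<le> (\<Sum>a<N. (cmod (u a))\<^sup>2)"
  "cmod (\<Sum>a<N. \<Sum>b<N. X $$ (b, a) * B a b) = trace_norm X"
proof -
 obtain v and d :: "nat => real" where sp: "\<forall>i<N. \<forall>j<N. ip N (v i) (v j) = of_bool (i = j)"
  "\<forall>a<N. \<forall>b<N. (\<Sum>i<N. v i a * cnj (v i b)) = of_bool (a = b)"
  "\<forall>a<N. \<forall>b<N. X $$ (a, b) = (\<Sum>i<N. of_real (d i) * (v i a * cnj (v i b)))"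
  "trace_norm X = (\<Sum>i<N. \<bar>d i\<bar>)" using spectral[OF X h] by blast
 note v = sp(1)[rule_format] sp(2)[rule_format] sp(3)[rule_format] sp(4)
 define B where "B a b = (\<Sum>i<N. of_real (sgn (d i)) * (v i a * cnj (v i b)))" for a b
 have "(\<Sum>a<N. \<Sum>b<N. cnj (u a) * B a b * u b) = (\<Sum>i<N. of_real (sgn (d i)) * (cnj (ip N (v i) u) * ip N (v i) u))" for u
 proof -
  have "(\<Sum>a<N. \<Sum>b<N. cnj (u a) * B a b * u b) = (\<Sum>a<N. \<Sum>b<N. \<Sum>i<N. of_real (sgn (d i)) * ((cnj (u a) * v i a) * (cnj (v i b) * u b)))"
   unfolding B_def by (intro sum.cong refl) (simp add: sum_distrib_left sum_distrib_right mult_ac)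
  also have "\<dots> = (\<Sum>a<N. \<Sum>i<N. \<Sum>b<N. of_real (sgn (d i)) * ((cnj (u a) * v i a) * (cnj (v i b) * u b)))" by (intro sum.cong refl sum.swap)
  also have "\<dots> = (\<Sum>i<N. \<Sum>a<N. \<Sum>b<N. of_real (sgn (d i)) * ((cnj (u a) * v i a) * (cnj (v i b) * u b)))" by (rule sum.swap)
  finally show ?thesis unfolding ip_cnj by (simp add: ip_def sum_product flip: sum_distrib_left)
 qed
 moreover have "(\<Sum>i<N. (cmod (ip N (v i) u))\<^sup>2) = (\<Sum>a<N. (cmod (u a))\<^sup>2)" for u
 proof -
  have "complex_of_real (\<Sum>i<N. (cmod (ip N (v i) u))\<^sup>2) = (\<Sum>i<N. ip N u (v i) * ip N (v i) u)"
   unfolding of_real_sum complex_norm_square ip_cnj by (simp add: mult.commute)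
  also have "\<dots> = (\<Sum>i<N. \<Sum>a<N. \<Sum>b<N. cnj (u a) * u b * (v i a * cnj (v i b)))"
   unfolding ip_def sum_product by (intro sum.cong refl) (simp add: mult_ac)
  also have "\<dots> = (\<Sum>a<N. \<Sum>b<N. cnj (u a) * u b * (\<Sum>i<N. v i a * cnj (v i b)))"
   unfolding sum_distrib_left by (subst sum.swap, intro sum.cong refl sum.swap)
  also have "\<dots> = (\<Sum>a<N. \<Sum>b<N. if b = a then cnj (u a) * u b else 0)" using v(2) by (intro sum.cong refl) auto
  also have "\<dots> = ip N u u" by (simp add: ip_def)
  finally show ?thesis unfolding ip_self by (simp only: of_real_eq_iff)
 qed
 moreover have "cmod (of_real (sgn (d i)) * (cnj z * z)) \<le> (cmod z)\<^sup>2" for i z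
  by (simp add: norm_mult power2_eq_square sgn_if)
 ultimately have 1: "cmod (\<Sum>a<N. \<Sum>b<N. cnj (u a) * B a b * u b) \<le> (\<Sum>a<N. (cmod (u a))\<^sup>2)" for u
  using sum_norm_le[of "{..<N}" "%i. of_real (sgn (d i)) * (cnj (ip N (v i) u) * ip N (v i) u)" "%i. (cmod (ip N (v i) u))\<^sup>2"] by simp
 have "(\<Sum>a<N. \<Sum>b<N. X $$ (b, a) * B a b) = (\<Sum>a<N. \<Sum>b<N. \<Sum>i<N. \<Sum>j<N. of_real (d i * sgn (d j)) * ((cnj (v i a) * v j a) * (cnj (v j b) * v i b)))"
  by (intro sum.cong refl) (use v(3) in \<open>simp add: B_def sum_product mult_ac\<close>)
 also have "\<dots> = (\<Sum>a<N. \<Sum>i<N. \<Sum>b<N. \<Sum>j<N. of_real (d i * sgn (d j)) * ((cnj (v i a) * v j a) * (cnj (v j b) * v i b)))"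
  by (intro sum.cong refl sum.swap)
 also have "\<dots> = (\<Sum>i<N. \<Sum>a<N. \<Sum>b<N. \<Sum>j<N. of_real (d i * sgn (d j)) * ((cnj (v i a) * v j a) * (cnj (v j b) * v i b)))" by (rule sum.swap)
 also have "\<dots> = (\<Sum>i<N. \<Sum>a<N. \<Sum>j<N. \<Sum>b<N. of_real (d i * sgn (d j)) * ((cnj (v i a) * v j a) * (cnj (v j b) * v i b)))"
  by (intro sum.cong refl sum.swap)
 also have "\<dots> = (\<Sum>i<N. \<Sum>j<N. \<Sum>a<N. \<Sum>b<N. of_real (d i * sgn (d j)) * ((cnj (v i a) * v j a) * (cnj (v j b) * v i b)))"
  by (intro sum.cong refl sum.swap)
 also have "\<dots> = (\<Sum>i<N. \<Sum>j<N. of_real (d i * sgn (d j)) * (ip N (v i) (v j) * ip N (v j) (v i)))"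
  unfolding ip_def unfolding sum_product unfolding sum_distrib_left by (simp add: mult.assoc)
 also have "\<dots> = (\<Sum>i<N. \<Sum>j<N. if j = i then complex_of_real \<bar>d i\<bar> else 0)"
  using v(1) by (intro sum.cong refl) (auto simp: abs_sgn mult.commute)
 also have "\<dots> = complex_of_real (trace_norm X)" unfolding v(4) by simp
 finally have "cmod (\<Sum>a<N. \<Sum>b<N. X $$ (b, a) * B a b) = \<bar>trace_norm X\<bar>" by (simp only: norm_of_real)
 moreover have "trace_norm X \<ge> 0" unfolding v(4) by (intro sum_nonneg) simp
 ultimately have 2: "cmod (\<Sum>a<N. \<Sum>b<N. X $$ (b, a) * B a b) = trace_norm X" by simp
 show ?thesis by (rule that[of B]) (fact 1, fact 2)
qed


section \<open>Uniform programs for the distinguisher, the pair algorithm and the sampler\<close>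

definition rr :: "nat => nat" where "rr T = 2 * blen T + 2"

text \<open>\<open>a\<close> and \<open>z\<close> range independently because the distinguisher does
  not know the number of copies. For \<open>t\<close> copies, the hybrids sit at the slots with
  \<open>a + z + 1 = t\<close>.\<close>

definition grid :: "nat => bool list => bool list => bool list => bool list => (bool list \<times> bool list) list" where
 "grid T xb p q xa = concat (map (%a. map (%z. (concat (replicate a xb) @ p, q @ concat (replicate z xa))) [0..<T]) [0..<T])"

lemma QPT_program:
 assumes "QPT G"
 shows "\<exists>P V c. 2 \<le> V \<and> uses P \<subseteq> {..<V} \<and> (\<forall>n k. \<exists>T \<le> c * (n + k + 1) ^ c. generates P n k T (G n k))"
proof -
 obtain P p where p: "polynomial p" "\<And>n k. \<exists>T \<le> p (n + k). generates P n k T (G n k)" using assms unfolding QPT_def by blast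
 obtain c where c: "\<And>x. p x \<le> c * (x + 1) ^ c" using polynomial_bound[OF p(1)] by blast
 obtain V where V: "\<forall>v\<in>uses P. v < V" using finite_uses finite_nat_set_iff_bounded by blast
 have "\<forall>n k. \<exists>T \<le> c * (n + k + 1) ^ c. generates P n k T (G n k)"
 proof (intro allI)
  show "\<exists>T \<le> c * (n + k + 1) ^ c. generates P n k T (G n k)" for n k using p(2)[of n k] c[of "n + k"] by (meson le_trans)
 qed
 moreover have "uses P \<subseteq> {..<max 2 V}" "2 \<le> max 2 V" using V by auto
 ultimately show ?thesis by blast
qed

lemma start_state: "(%_. [])(0 := un n, 1 := un k) = U ((%_. 0)(0 := n, 1 := k))"
 by (auto simp: U_def fun_eq_iff)

lemma length_concat_replicate: "length (concat (replicate a xs)) = a * length xs"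
 by (induction a) simp_all

text \<open>The constants \<open>c\<close>, \<open>S0\<close>, \<open>S1\<close> and the four bit
  lists are built into the program; \<open>T\<close>, the slot indices and the wires are computed
  from \<open>n\<close> and \<open>k\<close>.\<close>

lemma ex_distinguisher:
 assumes G: "QPT G" and A: "QPT A" and len: "length xa = 2" "length xb = 2" "length p \<le> 1" "length q \<le> 1"
 shows "\<exists>D. QPT D \<and> (\<forall>n k. \<exists>gs e' o3. D n k = Circuit gs [k] \<and>
  slots (G n 1) (A n) k (rr (c * n ^ c)) [S0, S1] (grid (c * n ^ c) xb p q xa) (2 * k + 2) (2 * k + 3) gs e' o3)"
proof -
 obtain PG VG cG where PG: "2 \<le> VG" "uses PG \<subseteq> {..<VG}" "\<forall>n k. \<exists>T \<le> cG * (n + k + 1) ^ cG. generates PG n k T (G n k)"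
  using QPT_program[OF G] by (elim exE conjE) (rule that)
 obtain PA VA cA where PA: "2 \<le> VA" "uses PA \<subseteq> {..<VA}" "\<forall>n k. \<exists>T \<le> cA * (n + k + 1) ^ cA. generates PA n k T (A n k)"
  using QPT_program[OF A] by (elim exE conjE) (rule that)
 define T where "T n k = c * n ^ c" for n k :: nat
 define r where "r n k = rr (T n k)" for n k
 define MG where "MG n k = cG * (n + 1 + 1) ^ cG" for n k :: nat
 \<comment> \<open>\<open>4 * T n k + 1\<close> bounds the number of copies in a trial, challenge
   included: fewer than \<open>T\<close> blocks of two and at most one extra copy on each side.
   \<open>MG\<close> bounds the output length of each copy.\<close>
 define K0 where "K0 n k = MG n k * (4 * T n k + 1)" for n k
 define MA where "MA n k = cA * (n + K0 n k + 1) ^ cA" for n k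
 define \<delta> where "\<delta> n k = 2 * grow n 1 (MG n k) + 2 * grow n (K0 n k) (MA n k)" for n k
 define E where "E n k = 4 * r n k + 4 + 2 * (\<delta> n k * (4 * T n k + 1))" for n k
 define Y where "Y n k = 2 * k + 3 + T n k * (T n k * E n k) + T n k * (T n k * (2 * \<delta> n k)) + 2 * K0 n k + 2 * k + n + 1 + r n k + T n k + c * (n + 1) ^ c" for n k
 define W where "W n k = simtime VG (Y n k) (MG n k) + simtime VA (Y n k) (MA n k) + (8 * Y n k + 10)" for n k
 define t1 where "t1 n k = (23 * T n k + 2) * W n k + (length p + 1) * (7 * W n k)" for n k
 define t2 where "t2 n k = (length q + 1) * (7 * W n k) + (23 * T n k + 2) * W n k" for n k
 define t where "t n k = 60 * W n k + 2 * (t1 n k + t2 n k) + r n k * (10 * W n k + 2) + k * 8 + 2" for n k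
 define tot where "tot n k = (20 * W n k + c + c * (5 * W n k + n * (W n k + 2)) + Y n k * (5 * W n k)) +
  ((2 * W n k + T n k * ((4 * W n k + T n k * (t n k + 3)) + 2)) + 1)" for n k
 note I = pb_add pb_mult pb_power pb_const pb_vars
 have pT: "pb T" unfolding T_def[abs_def] by (intro I)
 have pr: "pb r" by (rule pb_mono[of "%n k. 2 * T n k + 2"]) (intro I pT, use blen_bounds in \<open>simp add: r_def rr_def\<close>)
 have pMG: "pb MG" unfolding MG_def[abs_def] by (intro I)
 have pK: "pb K0" unfolding K0_def[abs_def] by (intro I pT pMG)
 have pMA: "pb MA" unfolding MA_def[abs_def] by (intro I pK)
 have pd: "pb \<delta>" unfolding \<delta>_def[abs_def] grow_def by (intro I pK pMG pMA)
 have pE: "pb E" unfolding E_def[abs_def] by (intro I pr pd pT)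
 have pY: "pb Y" unfolding Y_def[abs_def] by (intro I pr pd pT pE pK)
 have pW: "pb W" unfolding W_def[abs_def] simtime_def by (intro I pY pMG pMA)
 have pt: "pb t" unfolding t_def[abs_def] t1_def t2_def by (intro I pT pW pr)
 have ptot: "pb tot" unfolding tot_def[abs_def] by (intro I pT pW pt pY)
 let ?slot = "slotp VG PG VA PA S0 S1 (Seq (rep VG PG 10 xb) (copiesp VG PG p)) (Seq (copiesp VG PG q) (rep VG PG 12 xa))"
 let ?P = "Seq (initp c) (Seq (mainp ?slot) (Output 5))"
 define gen where "gen n k gs \<longleftrightarrow> (\<exists>T' \<le> tot n k. generates ?P n k T' (Circuit gs [k]))" for n k gs
 define good where "good n k cc \<longleftrightarrow> (\<exists>gs e' o3. cc = Circuit gs [k] \<and> gen n k gs \<and>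
  slots (G n 1) (A n) k (rr (c * n ^ c)) [S0, S1] (grid (c * n ^ c) xb p q xa) (2 * k + 2) (2 * k + 3) gs e' o3)" for n k cc
 have ex: "\<exists>cc. good n k cc" for n k
 proof -
  let ?T = "T n k" and ?Y = "Y n k" and ?W = "W n k" and ?r = "r n k" and ?K = "K0 n k"
  obtain TG where TG: "TG \<le> MG n k" "generates PG n 1 TG (G n 1)" using PG(3)[rule_format, of n 1] by (auto simp: MG_def)
  have m: "length (outs (G n 1)) \<le> MG n k" using generates_outs[OF TG(2)] TG(1) by simp
  interpret a: asm VG VA n k TG "MA n k" ?Y ?W ?K "\<delta> n k" ?r ?T PG PA "G n 1" "A n"
  proof
   show "\<exists>T' \<le> MA n k. generates PA n K T' (A n K)" if "K \<le> ?K" for K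
   proof -
    have "cA * (n + K + 1) ^ cA \<le> MA n k" unfolding MA_def using that by (intro mult_le_mono2 power_mono) simp_all
    then show ?thesis using PA(3)[rule_format, of n K] by (meson le_trans)
   qed
   show "simtime VG ?Y TG \<le> ?W" using simtime_mono[OF order_refl order_refl TG(1), of VG ?Y] unfolding W_def by linarith
   show "2 * grow n 1 TG \<le> \<delta> n k" using TG(1) by (simp add: \<delta>_def grow_def)
  qed (use PG PA TG in \<open>simp_all add: W_def \<delta>_def Y_def\<close>)
  define h0 :: "nat => nat" where "h0 = (%_. 0)(0 := n, 1 := k, 5 := k, 8 := ?T, 7 := ?r)"
  have i: "go (initp c) ((%_. 0)(0 := n, 1 := k)) (R h0 (2 * k + 2) (2 * k + 3) 0 0 0 0) []
   (20 * ?W + c + c * (5 * ?W + n * (?W + 2)) + ?Y * (5 * ?W))"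
   using go_init[of ?Y ?W n k c] unfolding h0_def T_def r_def rr_def by (simp add: W_def Y_def[of n k] T_def)
  define X where "X a z = (concat (replicate a xb) @ p, q @ concat (replicate z xa))" for a z
  have "\<exists>h' gs e' o3. slots (G n 1) (A n) k ?r [S0, S1] (concat (map (%a. map (X a) [0..<?T]) [0..<?T])) (2 * k + 2) (2 * k + 3) gs e' o3 \<and> h' 5 = k \<and>
   go (mainp ?slot) (R h0 (2 * k + 2) (2 * k + 3) 0 0 0 0) h' gs (2 * ?W + ?T * ((4 * ?W + ?T * (t n k + 3)) + 2))"
  proof (rule a.go_main)
   show "ok n k h0" by (simp add: ok_def clean_def h0_def)
   fix h' a z assume az: "a < ?T" "z < ?T" and hh: "\<forall>v. v \<notin> {10, 11, 12, 22} --> h' v = h0 v" and h10: "h' 10 = a" "h' 12 = z"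
   have v: "h' v = h0 v" if "v \<notin> {10, 11, 12, 22}" for v using hh that by blast
   have ok: "ok n k h'" unfolding ok_def clean_def by (simp add: v h0_def)
   have z: "h' 17 = 0" "h' 18 = 0" "h' 21 = 0" "h' 7 = ?r" by (simp_all add: v h0_def)
   have P: "a.blk (Seq (rep VG PG 10 xb) (copiesp VG PG p)) (concat (replicate a xb) @ p) (t1 n k) h'"
    unfolding t1_def by (rule a.blk_append[OF a.blk_rep[OF ok z(1) h10(1) _ _ len(2)] a.blk_copies[OF ok]]) (use az in simp_all)
   have Q: "a.blk (Seq (copiesp VG PG q) (rep VG PG 12 xa)) (q @ concat (replicate z xa)) (t2 n k) h'"
    unfolding t2_def by (rule a.blk_append[OF a.blk_copies[OF ok] a.blk_rep[OF ok z(1) h10(2) _ _ len(1)]]) (use az in simp_all)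
   have l: "length (concat (replicate a xb) @ p) + 1 + length (q @ concat (replicate z xa)) \<le> 4 * ?T + 1"
    using az len by (simp add: length_concat_replicate)
   show "a.slot_ok ?slot [S0, S1] (X a z) (E n k) (t n k) h'" unfolding X_def t_def
   proof (rule a.go_slot[OF ok z P Q])
    show "length (outs (G n 1)) * (length (concat (replicate a xb) @ p) + 1 + length (q @ concat (replicate z xa))) \<le> ?K"
     unfolding K0_def by (rule mult_le_mono[OF m l])
    show "4 * ?r + 4 + 2 * (\<delta> n k * (length (concat (replicate a xb) @ p) + 1 + length (q @ concat (replicate z xa)))) \<le> E n k"
     unfolding E_def by (intro add_left_mono mult_le_mono2 l)
   qed
  qed (simp_all add: h0_def Y_def)
  then obtain h' gs e' o3 where s: "slots (G n 1) (A n) k ?r [S0, S1] (concat (map (%a. map (X a) [0..<?T]) [0..<?T])) (2 * k + 2) (2 * k + 3) gs e' o3" "h' 5 = k"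
   "go (mainp ?slot) (R h0 (2 * k + 2) (2 * k + 3) 0 0 0 0) h' gs (2 * ?W + ?T * ((4 * ?W + ?T * (t n k + 3)) + 2))" by blast
  have gr: "concat (map (%a. map (X a) [0..<?T]) [0..<?T]) = grid (c * n ^ c) xb p q xa" by (simp add: grid_def X_def[abs_def] T_def)
  have "reach ?P (U ((%_. 0)(0 := n, 1 := k)), Circuit [] []) (U h', Circuit gs [k]) (tot n k)" unfolding tot_def
  proof (intro reach_Seq)
   show "reach (initp c) (U ((%_. 0)(0 := n, 1 := k)), Circuit [] []) (U (R h0 (2 * k + 2) (2 * k + 3) 0 0 0 0), Circuit [] [])
    (20 * ?W + c + c * (5 * ?W + n * (?W + 2)) + ?Y * (5 * ?W))" using i unfolding go_def by (metis append_Nil)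
   show "reach (mainp ?slot) (U (R h0 (2 * k + 2) (2 * k + 3) 0 0 0 0), Circuit [] []) (U h', Circuit gs [])
    (2 * ?W + ?T * ((4 * ?W + ?T * (t n k + 3)) + 2))" using s(3) unfolding go_def by (metis append_Nil)
   show "reach (Output 5) (U h', Circuit gs []) (U h', Circuit gs [k]) 1" using reach_Output[of 5 "U h'" gs "[]"] s(2) by simp
  qed
  then obtain T' where "T' \<le> tot n k" "generates ?P n k T' (Circuit gs [k])"
   unfolding reach_def generates_def start_state by blast
  then have a: "gen n k gs" unfolding gen_def by blast
  show ?thesis unfolding good_def
   by (rule exI[of _ "Circuit gs [k]"], rule exI[of _ gs], rule exI[of _ e'], rule exI[of _ o3], intro conjI refl a s(1)[unfolded gr, unfolded r_def T_def])
 qed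
 \<comment> \<open>The frontiers, and with them the circuit, depend on runs of which only existence
   and bounds are known. \<open>D\<close> is therefore chosen among the circuits that the program
   generates in the required form.\<close>
 define D where "D n k = (SOME cc. good n k cc)" for n k
 have D: "good n k (D n k)" for n k unfolding D_def by (rule someI_ex[OF ex])
 obtain pp where pp: "polynomial pp" "\<And>n k. tot n k \<le> pp (n + k)" using pb_polynomial[OF ptot] by blast
 have wD: "wf_circuit (D n k)" "\<exists>T' \<le> pp (n + k). generates ?P n k T' (D n k)" for n k
 proof -
  obtain gs e' o3 where d: "D n k = Circuit gs [k]" "gen n k gs"
   "slots (G n 1) (A n) k (rr (c * n ^ c)) [S0, S1] (grid (c * n ^ c) xb p q xa) (2 * k + 2) (2 * k + 3) gs e' o3"
   using D[of n k] unfolding good_def by (elim exE conjE) (rule that)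
  have w: "wf_circuit (G n 1)" "\<And>j. wf_circuit (A n j)" using G A by (auto simp: QPT_def)
  have "\<forall>h\<in>set gs. wfg h" using slots_wf[OF w d(3)] by simp
  then show "wf_circuit (D n k)" unfolding d(1) by (simp add: wf_circuit_def wfg_def)
  show "\<exists>T' \<le> pp (n + k). generates ?P n k T' (D n k)" using d(2) pp(2)[of n k] unfolding d(1) gen_def by (meson le_trans)
 qed
 have "QPT D" unfolding QPT_def using wD pp(1) by blast
 then show ?thesis
 proof (intro exI[of _ D] conjI allI)
  fix n k
  show "\<exists>gs e' o3. D n k = Circuit gs [k] \<and>
   slots (G n 1) (A n) k (rr (c * n ^ c)) [S0, S1] (grid (c * n ^ c) xb p q xa) (2 * k + 2) (2 * k + 3) gs e' o3"
   using D[of n k] unfolding good_def by (elim exE conjE) (intro exI conjI)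
 qed
qed

text \<open>The frontier left by the first replay of the generator serves as the displacement
  \<open>B'\<close> of the second run. The program ignores \<open>k\<close>, the length of the
  input.\<close>

lemma ex_pair_algorithm:
 assumes G: "QPT G"
 shows "\<exists>C. QPT C \<and> (\<forall>n k. \<exists>B'. fits (G n 1) 2 B' \<and> C n k = pairc (G n 1) 2 B')"
proof -
 obtain P V c where P: "2 \<le> V" "uses P \<subseteq> {..<V}" "\<forall>n k. \<exists>T \<le> c * (n + k + 1) ^ c. generates P n k T (G n k)"
  using QPT_program[OF G] by (elim exE conjE) (rule that)
 define M where "M n k = c * (n + 1 + 1) ^ c" for n k :: nat
 define Y where "Y n k = n + 3 + grow n 1 (M n k)" for n k
 define W where "W n k = simtime V (Y n k) (M n k) + 8 * Y n k + 10" for n k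
 note I = pb_add pb_mult pb_power pb_const pb_vars
 have pM: "pb M" unfolding M_def[abs_def] by (intro I)
 have pY: "pb Y" unfolding Y_def[abs_def] grow_def by (intro I pM)
 have pW: "pb W" unfolding W_def[abs_def] simtime_def by (intro I pY pM)
 have "pb (%n k. 12 * W n k)" by (intro I pW)
 then obtain pp where pp: "polynomial pp" "\<And>n k. 12 * W n k \<le> pp (n + k)" using pb_polynomial by blast
 \<comment> \<open>Stack \<open>19\<close> addresses the input wire, first 0 and after one push 1.
   The displacement starts at 2, above both input wires.\<close>
 let ?P = "Seq (pushes 3 2) (Seq (copy 3 15) (Seq (Apply (CNot 19 15)) (Seq (Push 16 True) (Seq (run4 V P) (Seq (clear 15) (Seq (clear 16)
  (Seq (copy 3 15) (Seq (Push 19 True) (Seq (Apply (CNot 19 15)) (Seq (Push 16 True) (run4 V P)))))))))))"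
 have ex: "\<exists>B'. fits (G n 1) 2 B' \<and> (\<exists>T \<le> 12 * W n k. generates ?P n k T (pairc (G n 1) 2 B'))" for n k
 proof -
  let ?g = "G n 1" and ?W = "W n k" and ?Y = "Y n k"
  obtain TG where TG: "TG \<le> M n k" "generates P n 1 TG ?g" using P(3)[rule_format, of n 1] by (auto simp: M_def)
  have st: "simtime V ?Y TG \<le> ?W" using simtime_mono[OF order_refl order_refl TG(1), of V ?Y] unfolding W_def by linarith
  have w: "x \<le> ?Y ==> 8 * x + 2 \<le> ?W" "x \<le> ?Y ==> 4 * x + 1 \<le> ?W" "10 \<le> ?W" for x unfolding W_def by auto
  define z :: "nat => nat" where "z = (%_. 0)(0 := n, 1 := k)"
  have zv: "z 0 = n" "v \<notin> {0, 1} ==> z v = 0" for v by (simp_all add: z_def)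
  have cl: "clean z" by (simp add: clean_def z_def)
  have Y3: "2 \<le> ?Y" "n \<le> ?Y" "1 \<le> ?Y" by (simp_all add: Y_def)
  let ?h = "z(3 := 2, 15 := 2, 16 := 1)"
  let ?c0 = "Circuit [CNot 0 2] []"
  have "\<exists>f'. fresh ?g ?h 3 f' TG \<and> reach (run4 V P) (U ?h, ?c0) (U (?h(3 := f')),
   addo (addg ?c0 (map (map_gate (pf (?h 15))) (gates ?g))) (map (pf (?h 15)) (outs ?g))) (simtime V ?Y TG)"
   by (rule run4) (use TG P zv cl Y3 in simp_all)
  then obtain f where f: "fresh ?g ?h 3 f TG" and r1: "reach (run4 V P) (U ?h, ?c0) (U (z(3 := f, 15 := 2, 16 := 1)),
   Circuit (CNot 0 2 # map (map_gate (pf 2)) (gates ?g)) (map (pf 2) (outs ?g))) (simtime V ?Y TG)"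
   by (auto simp: fun_upd_twist[of 15 3] fun_upd_twist[of 16 3])
  have F: "fits ?g 2 f" "f \<le> ?Y" using f TG(1) zv unfolding fresh_def fits_def Y_def by (auto simp: grow_def)
  let ?c1 = "Circuit (CNot 0 2 # map (map_gate (pf 2)) (gates ?g)) (map (pf 2) (outs ?g))"
  let ?h2 = "z(3 := f, 15 := f, 19 := 1, 16 := 1)"
  let ?c2 = "Circuit ((CNot 0 2 # map (map_gate (pf 2)) (gates ?g)) @ [CNot 1 f]) (map (pf 2) (outs ?g))"
  have "\<exists>f'. fresh ?g ?h2 3 f' TG \<and> reach (run4 V P) (U ?h2, ?c2) (U (?h2(3 := f')),
   addo (addg ?c2 (map (map_gate (pf (?h2 15))) (gates ?g))) (map (pf (?h2 15)) (outs ?g))) (simtime V ?Y TG)"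
   by (rule run4) (use TG P zv cl Y3 F in simp_all)
  then obtain f2 where r2: "reach (run4 V P) (U ?h2, ?c2) (U (?h2(3 := f2)), pairc ?g 2 f) (simtime V ?Y TG)"
   by (auto simp: pairc_def)
  have "reach ?P (U z, Circuit [] []) (U (?h2(3 := f2)), pairc ?g 2 f)
   (?W + (?W + (?W + (?W + (?W + (?W + (?W + (?W + (?W + (?W + (?W + ?W)))))))))))"
  proof (intro reach_Seq)
   have g: "reach Pr (U s, Circuit gs os) (U s', Circuit gs os) ?W" if "reach Pr (U s, Circuit gs os) (U s'', Circuit gs os) x" "s'' = s'" "x \<le> ?W" for Pr s s' s'' x gs os
    using reach_mono[OF that(1,3)] that(2) by simp
   have "go (pushes 3 2) z (z(3 := 2)) [] ?W" by (rule go_cong[OF go_pushes[of 3 2 z]]) (use zv w(3) in \<open>simp_all add: numeral_2_eq_2\<close>)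
   then show "reach (pushes 3 2) (U z, Circuit [] []) (U (z(3 := 2)), Circuit [] []) ?W" unfolding go_def by (metis append_Nil)
   show "reach (copy 3 15) (U (z(3 := 2)), Circuit [] []) (U (z(3 := 2, 15 := 2)), Circuit [] []) ?W"
    by (rule g[OF reach_copyU]) (use zv w(1)[OF Y3(1)] in simp_all)
   show "reach (Apply (CNot 19 15)) (U (z(3 := 2, 15 := 2)), Circuit [] []) (U (z(3 := 2, 15 := 2)), ?c0) ?W"
    using reach_mono[OF reach_ApplyU[of "CNot 19 15" "z(3 := 2, 15 := 2)" "[]" "[]"], of ?W] w(3) zv by simp
   show "reach (Push 16 True) (U (z(3 := 2, 15 := 2)), ?c0) (U ?h, ?c0) ?W"
    by (rule g[OF reach_PushU]) (use zv w(3) in simp_all)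
   show "reach (run4 V P) (U ?h, ?c0) (U (z(3 := f, 15 := 2, 16 := 1)), ?c1) ?W" by (rule reach_mono[OF r1 st])
   show "reach (clear 15) (U (z(3 := f, 15 := 2, 16 := 1)), ?c1) (U (z(3 := f, 16 := 1)), ?c1) ?W"
    by (rule g[OF reach_clearU]) (use zv w(2)[OF Y3(1)] in \<open>auto simp: fun_eq_iff\<close>)
   show "reach (clear 16) (U (z(3 := f, 16 := 1)), ?c1) (U (z(3 := f)), ?c1) ?W"
    by (rule g[OF reach_clearU]) (use zv w(2)[OF Y3(3)] in \<open>auto simp: fun_eq_iff\<close>)
   show "reach (copy 3 15) (U (z(3 := f)), ?c1) (U (z(3 := f, 15 := f)), ?c1) ?W"
    by (rule g[OF reach_copyU]) (use zv w(1)[OF F(2)] in simp_all)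
   show "reach (Push 19 True) (U (z(3 := f, 15 := f)), ?c1) (U (z(3 := f, 15 := f, 19 := 1)), ?c1) ?W"
    by (rule g[OF reach_PushU]) (use zv w(3) in simp_all)
   show "reach (Apply (CNot 19 15)) (U (z(3 := f, 15 := f, 19 := 1)), ?c1) (U (z(3 := f, 15 := f, 19 := 1)), ?c2) ?W"
    using reach_mono[OF reach_ApplyU[of "CNot 19 15" "z(3 := f, 15 := f, 19 := 1)" "CNot 0 2 # map (map_gate (pf 2)) (gates ?g)" "map (pf 2) (outs ?g)"], of ?W] w(3) zv by simp
   show "reach (Push 16 True) (U (z(3 := f, 15 := f, 19 := 1)), ?c2) (U ?h2, ?c2) ?W"
    by (rule g[OF reach_PushU]) (use zv w(3) in simp_all)
   show "reach (run4 V P) (U ?h2, ?c2) (U (?h2(3 := f2)), pairc ?g 2 f) ?W" by (rule reach_mono[OF r2 st])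
  qed
  then have "reach ?P (U z, Circuit [] []) (U (?h2(3 := f2)), pairc ?g 2 f) (12 * ?W)" by (rule reach_mono) simp
  then have "\<exists>T \<le> 12 * ?W. generates ?P n k T (pairc ?g 2 f)" unfolding reach_def generates_def start_state z_def by blast
  then show ?thesis using F by blast
 qed
 then obtain B' where B': "\<And>n k. fits (G n 1) 2 (B' n k) \<and> (\<exists>T \<le> 12 * W n k. generates ?P n k T (pairc (G n 1) 2 (B' n k)))" by metis
 have "wf_circuit (pairc (G n 1) 2 (B' n k))" for n k by (rule pairc_facts(1)) (use B' G in \<open>auto simp: QPT_def\<close>)
 moreover have "\<exists>T \<le> pp (n + k). generates ?P n k T (pairc (G n 1) 2 (B' n k))" for n k using B'[of n k] pp(2)[of n k] by (meson le_trans)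
 ultimately have "QPT (%n k. pairc (G n 1) 2 (B' n k))" unfolding QPT_def using pp(1) by blast
 then show ?thesis using B' by (intro exI[of _ "%n k. pairc (G n 1) 2 (B' n k)"]) blast
qed

lemma QPT_coins: "QPT (%n k. Circuit [Had 0, Had 1] [0, 1])"
proof -
 let ?P = "Seq (Apply (Had 2)) (Seq (Output 2) (Seq (Push 2 True) (Seq (Apply (Had 2)) (Output 2))))"
 have "6 \<le> 6 * n ^ 6" if "n > 0" for n :: nat using that by simp
 then have p: "polynomial (%n. 6)" unfolding polynomial_def by blast
 have "\<exists>T\<le>6. generates ?P n k T (Circuit [Had 0, Had 1] [0, 1])" for n k
 proof -
  define z :: "nat => nat" where "z = (%_. 0)(0 := n, 1 := k)"
  have "reach ?P (U z, Circuit [] []) (U (z(2 := 1)), Circuit [Had 0, Had 1] [0, 1]) (1 + (1 + (1 + (1 + 1))))"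
  proof (intro reach_Seq)
   show "reach (Apply (Had 2)) (U z, Circuit [] []) (U z, Circuit [Had 0] []) 1" using reach_ApplyU[of "Had 2" z "[]" "[]"] by (simp add: z_def)
   show "reach (Output 2) (U z, Circuit [Had 0] []) (U z, Circuit [Had 0] [0]) 1" using reach_Output[of 2 "U z" "[Had 0]" "[]"] by (simp add: z_def)
   have "z(2 := Suc (z 2)) = z(2 := 1)" by (simp add: z_def)
   then show "reach (Push 2 True) (U z, Circuit [Had 0] [0]) (U (z(2 := 1)), Circuit [Had 0] [0]) 1"
    using reach_PushU[of 2 z] by (simp only:)
   show "reach (Apply (Had 2)) (U (z(2 := 1)), Circuit [Had 0] [0]) (U (z(2 := 1)), Circuit [Had 0, Had 1] [0]) 1"
    using reach_ApplyU[of "Had 2" "z(2 := 1)" "[Had 0]" "[0]"] by simp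
   show "reach (Output 2) (U (z(2 := 1)), Circuit [Had 0, Had 1] [0]) (U (z(2 := 1)), Circuit [Had 0, Had 1] [0, 1]) 1"
    using reach_Output[of 2 "U (z(2 := 1))" "[Had 0, Had 1]" "[0]"] by simp
  qed
  then have "reach ?P (U z, Circuit [] []) (U (z(2 := 1)), Circuit [Had 0, Had 1] [0, 1]) 6" by (rule reach_mono) simp
  then show ?thesis unfolding reach_def generates_def start_state z_def by blast
 qed
 then show ?thesis unfolding QPT_def using p by (auto simp: wf_circuit_def)
qed


section \<open>Trace distance of tensor products\<close>

lemma sum_div_mod: "(\<Sum>a<n * m. f (a div m) (a mod m)) = (\<Sum>i<n. \<Sum>j<m. f i j)" for n m :: nat
proof -
 have "(\<Sum>a<n * m. f (a div m) (a mod m)) = (\<Sum>(i, j)\<in>{..<n} \<times> {..<m}. f i j)"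
 proof (rule sum.reindex_bij_witness[of _ "%(i, j). i * m + j" "%a. (a div m, a mod m)"])
  fix a assume "a \<in> {..<n * m}"
  then have a: "a < n * m" by simp
  then have "m > 0" by (cases m) auto
  then show "(a div m, a mod m) \<in> {..<n} \<times> {..<m}" using a by (simp add: less_mult_imp_div_less)
 next
  fix b assume "b \<in> {..<n} \<times> {..<m}"
  then obtain i j where b: "b = (i, j)" "i < n" "j < m" by auto
  have "i * m + j < Suc i * m" using b by simp
  also have "\<dots> \<le> n * m" by (rule mult_le_mono1) (use b in simp)
  finally show "(%(i, j). i * m + j) b \<in> {..<n * m}" using b by simp
  show "((%(i, j). i * m + j) b div m, (%(i, j). i * m + j) b mod m) = b" using b by simp
 qed auto
 then show ?thesis by (simp add: sum.cartesian_product)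
qed

lemma sum_div_mod2:
 fixes n m :: nat
 shows "(\<Sum>a<n * m. \<Sum>b<n * m. F (a div m) (a mod m) (b div m) (b mod m)) = (\<Sum>i<n. \<Sum>j<m. \<Sum>i'<n. \<Sum>j'<m. F i j i' j')"
 using sum_div_mod[of "%i j. \<Sum>b<n * m. F i j (b div m) (b mod m)" m n] by (simp add: sum_div_mod)

definition herm :: "nat => complex mat => bool" where
 "herm N A \<longleftrightarrow> A \<in> carrier_mat N N \<and> (\<forall>a<N. \<forall>b<N. A $$ (b, a) = cnj (A $$ (a, b)))"

lemma herm_diff: "herm N A ==> herm N B ==> herm N (A - B)"
 unfolding herm_def
proof (intro conjI allI impI)
 fix a b assume h: "A \<in> carrier_mat N N \<and> (\<forall>a<N. \<forall>b<N. A $$ (b, a) = cnj (A $$ (a, b)))"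
  "B \<in> carrier_mat N N \<and> (\<forall>a<N. \<forall>b<N. B $$ (b, a) = cnj (B $$ (a, b)))" and ab: "a < N" "b < N"
 have d: "dim_row B = N" "dim_col B = N" using h(2) by auto
 have e: "A $$ (b, a) = cnj (A $$ (a, b))" "B $$ (b, a) = cnj (B $$ (a, b))" using h ab by blast+
 have "(A - B) $$ (b, a) = A $$ (b, a) - B $$ (b, a)" "(A - B) $$ (a, b) = A $$ (a, b) - B $$ (a, b)" using d ab by simp_all
 then show "(A - B) $$ (b, a) = cnj ((A - B) $$ (a, b))" by (simp only: e complex_cnj_diff)
qed auto

lemma herm_kron: "herm n A ==> herm m B ==> herm (n * m) (kron A B)"
 unfolding herm_def
proof (intro conjI allI impI)
 fix a b assume h: "A \<in> carrier_mat n n \<and> (\<forall>a<n. \<forall>b<n. A $$ (b, a) = cnj (A $$ (a, b)))"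
  "B \<in> carrier_mat m m \<and> (\<forall>a<m. \<forall>b<m. B $$ (b, a) = cnj (B $$ (a, b)))" and ab: "a < n * m" "b < n * m"
 have "m > 0" using ab by (cases m) auto
 then have d: "a div m < n" "b div m < n" "a mod m < m" "b mod m < m" using ab by (simp_all add: less_mult_imp_div_less)
 have "A $$ (b div m, a div m) = cnj (A $$ (a div m, b div m))" "B $$ (b mod m, a mod m) = cnj (B $$ (a mod m, b mod m))"
  using h d by blast+
 moreover have "dim_row A = n" "dim_col A = n" "dim_row B = m" "dim_col B = m" using h by auto
 then have "kron A B $$ (b, a) = A $$ (b div m, a div m) * B $$ (b mod m, a mod m)"
  "kron A B $$ (a, b) = A $$ (a div m, b div m) * B $$ (a mod m, b mod m)" using ab by (simp_all add: kron_def)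
 ultimately show "kron A B $$ (b, a) = cnj (kron A B $$ (a, b))" by (simp only: complex_cnj_mult)
qed (auto simp: kron_def)

text \<open>By the variational formula it is enough to carry each admissible matrix for
  \<open>X\<close> to an admissible one for \<open>Y\<close> with the same modulus of the
  pairing.\<close>

lemma trace_norm_le:
 assumes X: "herm N X" and Y: "herm M Y"
  and t: "\<And>U. (\<And>u. cmod (\<Sum>a<N. \<Sum>b<N. cnj (u a) * U a b * u b) \<le> (\<Sum>a<N. (cmod (u a))\<^sup>2)) ==>
   \<exists>V. (\<forall>u. cmod (\<Sum>a<M. \<Sum>b<M. cnj (u a) * V a b * u b) \<le> (\<Sum>a<M. (cmod (u a))\<^sup>2)) \<and>
    cmod (\<Sum>a<M. \<Sum>b<M. Y $$ (b, a) * V a b) = cmod (\<Sum>a<N. \<Sum>b<N. X $$ (b, a) * U a b)"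
 shows "trace_norm X \<le> trace_norm Y"
proof -
 have h: "X \<in> carrier_mat N N" "\<And>a b. a < N ==> b < N ==> X $$ (b, a) = cnj (X $$ (a, b))"
  "Y \<in> carrier_mat M M" "\<And>a b. a < M ==> b < M ==> Y $$ (b, a) = cnj (Y $$ (a, b))" using X Y unfolding herm_def by blast+
 obtain U where U: "\<And>u. cmod (\<Sum>a<N. \<Sum>b<N. cnj (u a) * U a b * u b) \<le> (\<Sum>a<N. (cmod (u a))\<^sup>2)"
  "cmod (\<Sum>a<N. \<Sum>b<N. X $$ (b, a) * U a b) = trace_norm X" using trace_norm_attained[OF h(1,2)] by blast
 obtain V where V: "\<forall>u. cmod (\<Sum>a<M. \<Sum>b<M. cnj (u a) * V a b * u b) \<le> (\<Sum>a<M. (cmod (u a))\<^sup>2)"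
  "cmod (\<Sum>a<M. \<Sum>b<M. Y $$ (b, a) * V a b) = cmod (\<Sum>a<N. \<Sum>b<N. X $$ (b, a) * U a b)" using t[OF U(1)] by blast
 show ?thesis using trace_norm_dual[OF h(3,4) V(1)[rule_format]] V(2) U(2) by simp
qed

lemma trace_norm_minus:
 assumes "herm N A" "herm N B" shows "trace_norm (A - B) \<le> trace_norm (B - A)"
proof (rule trace_norm_le[OF herm_diff[OF assms] herm_diff[OF assms(2,1)]])
 fix U :: "nat => nat => complex"
 assume U: "\<And>u. cmod (\<Sum>a<N. \<Sum>b<N. cnj (u a) * U a b * u b) \<le> (\<Sum>a<N. (cmod (u a))\<^sup>2)"
 have ca: "A \<in> carrier_mat N N" "B \<in> carrier_mat N N" using assms unfolding herm_def by blast+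
 have "(\<Sum>a<N. \<Sum>b<N. (B - A) $$ (b, a) * U a b) = - (\<Sum>a<N. \<Sum>b<N. (A - B) $$ (b, a) * U a b)"
  unfolding sum_negf[symmetric] by (intro sum.cong refl) (use ca in \<open>simp add: algebra_simps\<close>)
 then have "cmod (\<Sum>a<N. \<Sum>b<N. (B - A) $$ (b, a) * U a b) = cmod (\<Sum>a<N. \<Sum>b<N. (A - B) $$ (b, a) * U a b)" by (simp only: norm_minus_cancel)
 then show "\<exists>V. (\<forall>u. cmod (\<Sum>a<N. \<Sum>b<N. cnj (u a) * V a b * u b) \<le> (\<Sum>a<N. (cmod (u a))\<^sup>2)) \<and>
    cmod (\<Sum>a<N. \<Sum>b<N. (B - A) $$ (b, a) * V a b) = cmod (\<Sum>a<N. \<Sum>b<N. (A - B) $$ (b, a) * U a b)" using U by blast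
qed

lemma kron_diff_entry:
 assumes "A1 \<in> carrier_mat n n" "A2 \<in> carrier_mat n n" "B1 \<in> carrier_mat m m" "B2 \<in> carrier_mat m m" "a < n * m" "b < n * m"
 shows "(kron A1 B1 - kron A2 B2) $$ (b, a) = A1 $$ (b div m, a div m) * B1 $$ (b mod m, a mod m) - A2 $$ (b div m, a div m) * B2 $$ (b mod m, a mod m)"
 using assms by (simp add: kron_def)

text \<open>Monotonicity under a partial trace. The witness is \<open>U\<close> tensored with the
  identity: its quadratic form splits over the second index, and the pairing traces out the second
  factors, which may differ but have unit trace.\<close>

lemma trace_norm_kron_left:
 assumes h: "herm n A1" "herm n A2" "herm m B1" "herm m B2" and tr: "(\<Sum>j<m. B1 $$ (j, j)) = 1" "(\<Sum>j<m. B2 $$ (j, j)) = 1"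
 shows "trace_norm (A1 - A2) \<le> trace_norm (kron A1 B1 - kron A2 B2)"
proof (rule trace_norm_le[OF herm_diff[OF h(1,2)] herm_diff[OF herm_kron[OF h(1,3)] herm_kron[OF h(2,4)]]])
 fix U :: "nat => nat => complex"
 assume U: "\<And>u. cmod (\<Sum>a<n. \<Sum>b<n. cnj (u a) * U a b * u b) \<le> (\<Sum>a<n. (cmod (u a))\<^sup>2)"
 have ca: "A1 \<in> carrier_mat n n" "A2 \<in> carrier_mat n n" "B1 \<in> carrier_mat m m" "B2 \<in> carrier_mat m m" using h unfolding herm_def by blast+
 define V where "V a b = U (a div m) (b div m) * of_bool (a mod m = b mod m)" for a b
 have diag: "(\<Sum>i<n. \<Sum>j<m. \<Sum>i'<n. \<Sum>j'<m. F i j i' j' * of_bool (j = j')) = (\<Sum>j<m. \<Sum>i<n. \<Sum>i'<n. F i j i' j)" for F :: "nat => nat => nat => nat => complex"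
 proof -
  have "(\<Sum>j'<m. F i j i' j' * of_bool (j = j')) = F i j i' j" if "j < m" for i j i'
  proof -
   have "(\<Sum>j'<m. F i j i' j' * of_bool (j = j')) = (\<Sum>j'<m. if j' = j then F i j i' j' else 0)" by (intro sum.cong) auto
   then show ?thesis using that by simp
  qed
  then have "(\<Sum>i<n. \<Sum>j<m. \<Sum>i'<n. \<Sum>j'<m. F i j i' j' * of_bool (j = j')) = (\<Sum>i<n. \<Sum>j<m. \<Sum>i'<n. F i j i' j)" by simp
  also have "\<dots> = (\<Sum>j<m. \<Sum>i<n. \<Sum>i'<n. F i j i' j)" by (rule sum.swap)
  finally show ?thesis .
 qed
 have "cmod (\<Sum>a<n * m. \<Sum>b<n * m. cnj (u a) * V a b * u b) \<le> (\<Sum>a<n * m. (cmod (u a))\<^sup>2)" for u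
 proof -
  let ?u = "%i j. u (i * m + j)"
  have "(\<Sum>a<n * m. \<Sum>b<n * m. cnj (u a) * V a b * u b) =
   (\<Sum>i<n. \<Sum>j<m. \<Sum>i'<n. \<Sum>j'<m. (cnj (?u i j) * U i i' * ?u i' j') * of_bool (j = j'))"
   unfolding sum_div_mod2[symmetric] by (intro sum.cong refl) (simp add: V_def)
  also have "\<dots> = (\<Sum>j<m. \<Sum>i<n. \<Sum>i'<n. cnj (?u i j) * U i i' * ?u i' j)" by (rule diag)
  finally have "cmod (\<Sum>a<n * m. \<Sum>b<n * m. cnj (u a) * V a b * u b) = cmod (\<Sum>j<m. \<Sum>i<n. \<Sum>i'<n. cnj (?u i j) * U i i' * ?u i' j)" by simp
  also have "\<dots> \<le> (\<Sum>j<m. \<Sum>i<n. (cmod (?u i j))\<^sup>2)" by (rule sum_norm_le) (rule U)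
  also have "\<dots> = (\<Sum>i<n. \<Sum>j<m. (cmod (?u i j))\<^sup>2)" by (rule sum.swap)
  also have "\<dots> = (\<Sum>a<n * m. (cmod (u a))\<^sup>2)" unfolding sum_div_mod[symmetric] by simp
  finally show ?thesis .
 qed
 moreover have "(\<Sum>a<n * m. \<Sum>b<n * m. (kron A1 B1 - kron A2 B2) $$ (b, a) * V a b) = (\<Sum>a<n. \<Sum>b<n. (A1 - A2) $$ (b, a) * U a b)"
 proof -
  have "(\<Sum>a<n * m. \<Sum>b<n * m. (kron A1 B1 - kron A2 B2) $$ (b, a) * V a b) =
   (\<Sum>i<n. \<Sum>j<m. \<Sum>i'<n. \<Sum>j'<m. ((A1 $$ (i', i) * B1 $$ (j', j) - A2 $$ (i', i) * B2 $$ (j', j)) * U i i') * of_bool (j = j'))"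
   unfolding sum_div_mod2[symmetric] by (intro sum.cong refl) (use kron_diff_entry[OF ca] in \<open>simp add: V_def mult.assoc\<close>)
  also have "\<dots> = (\<Sum>j<m. \<Sum>i<n. \<Sum>i'<n. (A1 $$ (i', i) * B1 $$ (j, j) - A2 $$ (i', i) * B2 $$ (j, j)) * U i i')" by (rule diag)
  also have "\<dots> = (\<Sum>i<n. \<Sum>j<m. \<Sum>i'<n. (A1 $$ (i', i) * B1 $$ (j, j) - A2 $$ (i', i) * B2 $$ (j, j)) * U i i')" by (rule sum.swap)
  also have "\<dots> = (\<Sum>i<n. \<Sum>i'<n. \<Sum>j<m. (A1 $$ (i', i) * B1 $$ (j, j) - A2 $$ (i', i) * B2 $$ (j, j)) * U i i')" by (intro sum.cong refl sum.swap)
  also have "\<dots> = (\<Sum>i<n. \<Sum>i'<n. (A1 $$ (i', i) * (\<Sum>j<m. B1 $$ (j, j)) - A2 $$ (i', i) * (\<Sum>j<m. B2 $$ (j, j))) * U i i')"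
   by (simp add: sum_distrib_left sum_distrib_right sum_subtractf left_diff_distrib)
  also have "\<dots> = (\<Sum>a<n. \<Sum>b<n. (A1 - A2) $$ (b, a) * U a b)" unfolding tr by (intro sum.cong refl) (use ca in simp)
  finally show ?thesis .
 qed
 ultimately show "\<exists>V. (\<forall>u. cmod (\<Sum>a<n * m. \<Sum>b<n * m. cnj (u a) * V a b * u b) \<le> (\<Sum>a<n * m. (cmod (u a))\<^sup>2)) \<and>
    cmod (\<Sum>a<n * m. \<Sum>b<n * m. (kron A1 B1 - kron A2 B2) $$ (b, a) * V a b) = cmod (\<Sum>a<n. \<Sum>b<n. (A1 - A2) $$ (b, a) * U a b)"
  by (intro exI[of _ V]) simp
qed

text \<open>The mirror image, with the identity on the first factor. A common first factor
  \<open>A\<close> of unit trace is enough for its use.\<close>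

lemma trace_norm_kron_right:
 assumes h: "herm n A" "herm m B1" "herm m B2" and tr: "(\<Sum>j<n. A $$ (j, j)) = 1"
 shows "trace_norm (B1 - B2) \<le> trace_norm (kron A B1 - kron A B2)"
proof (rule trace_norm_le[OF herm_diff[OF h(2,3)] herm_diff[OF herm_kron[OF h(1,2)] herm_kron[OF h(1,3)]]])
 fix U :: "nat => nat => complex"
 assume U: "\<And>u. cmod (\<Sum>a<m. \<Sum>b<m. cnj (u a) * U a b * u b) \<le> (\<Sum>a<m. (cmod (u a))\<^sup>2)"
 have ca: "A \<in> carrier_mat n n" "B1 \<in> carrier_mat m m" "B2 \<in> carrier_mat m m" using h unfolding herm_def by blast+
 define V where "V a b = of_bool (a div m = b div m) * U (a mod m) (b mod m)" for a b
 have diag: "(\<Sum>i<n. \<Sum>j<m. \<Sum>i'<n. \<Sum>j'<m. of_bool (i = i') * F i j i' j') = (\<Sum>i<n. \<Sum>j<m. \<Sum>j'<m. F i j i j')" for F :: "nat => nat => nat => nat => complex"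
 proof -
  have "(\<Sum>i'<n. \<Sum>j'<m. of_bool (i = i') * F i j i' j') = (\<Sum>j'<m. F i j i j')" if "i < n" for i j
  proof -
   have "(\<Sum>i'<n. \<Sum>j'<m. of_bool (i = i') * F i j i' j') = (\<Sum>i'<n. if i' = i then \<Sum>j'<m. F i j i' j' else 0)" by (intro sum.cong) auto
   then show ?thesis using that by simp
  qed
  then show ?thesis by simp
 qed
 have "cmod (\<Sum>a<n * m. \<Sum>b<n * m. cnj (u a) * V a b * u b) \<le> (\<Sum>a<n * m. (cmod (u a))\<^sup>2)" for u
 proof -
  let ?u = "%i j. u (i * m + j)"
  have "(\<Sum>a<n * m. \<Sum>b<n * m. cnj (u a) * V a b * u b) =
   (\<Sum>i<n. \<Sum>j<m. \<Sum>i'<n. \<Sum>j'<m. of_bool (i = i') * (cnj (?u i j) * U j j' * ?u i' j'))"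
   unfolding sum_div_mod2[symmetric] by (intro sum.cong refl) (simp add: V_def)
  also have "\<dots> = (\<Sum>i<n. \<Sum>j<m. \<Sum>j'<m. cnj (?u i j) * U j j' * ?u i j')" by (rule diag)
  finally have "cmod (\<Sum>a<n * m. \<Sum>b<n * m. cnj (u a) * V a b * u b) = cmod (\<Sum>i<n. \<Sum>j<m. \<Sum>j'<m. cnj (?u i j) * U j j' * ?u i j')" by simp
  also have "\<dots> \<le> (\<Sum>i<n. \<Sum>j<m. (cmod (?u i j))\<^sup>2)" by (rule sum_norm_le) (rule U)
  also have "\<dots> = (\<Sum>a<n * m. (cmod (u a))\<^sup>2)" unfolding sum_div_mod[symmetric] by simp
  finally show ?thesis .
 qed
 moreover have "(\<Sum>a<n * m. \<Sum>b<n * m. (kron A B1 - kron A B2) $$ (b, a) * V a b) = (\<Sum>a<m. \<Sum>b<m. (B1 - B2) $$ (b, a) * U a b)"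
 proof -
  have "(\<Sum>a<n * m. \<Sum>b<n * m. (kron A B1 - kron A B2) $$ (b, a) * V a b) =
   (\<Sum>i<n. \<Sum>j<m. \<Sum>i'<n. \<Sum>j'<m. of_bool (i = i') * (A $$ (i', i) * ((B1 $$ (j', j) - B2 $$ (j', j)) * U j j')))"
   unfolding sum_div_mod2[symmetric] by (intro sum.cong refl) (simp add: V_def kron_diff_entry[OF ca(1,1,2,3)] left_diff_distrib right_diff_distrib mult_ac)
  also have "\<dots> = (\<Sum>i<n. \<Sum>j<m. \<Sum>j'<m. A $$ (i, i) * ((B1 $$ (j', j) - B2 $$ (j', j)) * U j j'))" by (rule diag)
  also have "\<dots> = (\<Sum>i<n. A $$ (i, i)) * (\<Sum>j<m. \<Sum>j'<m. (B1 $$ (j', j) - B2 $$ (j', j)) * U j j')"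
   by (simp add: sum_distrib_right flip: sum_distrib_left)
  also have "\<dots> = (\<Sum>a<m. \<Sum>b<m. (B1 - B2) $$ (b, a) * U a b)" unfolding tr mult_1 by (intro sum.cong refl) (use ca in simp)
  finally show ?thesis .
 qed
 ultimately show "\<exists>V. (\<forall>u. cmod (\<Sum>a<n * m. \<Sum>b<n * m. cnj (u a) * V a b * u b) \<le> (\<Sum>a<n * m. (cmod (u a))\<^sup>2)) \<and>
    cmod (\<Sum>a<n * m. \<Sum>b<n * m. (kron A B1 - kron A B2) $$ (b, a) * V a b) = cmod (\<Sum>a<m. \<Sum>b<m. (B1 - B2) $$ (b, a) * U a b)"
  by (intro exI[of _ V]) simp
qed

lemma qstate_density:
 assumes g: "wf_circuit g"
 shows "herm (2 ^ length (outs g)) (qstate g b)" "(\<Sum>j<2 ^ length (outs g). qstate g b $$ (j, j)) = 1"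
proof -
 let ?gs = "xp b 0 @ gates g" and ?ws = "outs g" and ?N = "2 ^ length (outs g) :: nat"
 have mg: "map (map_gate id) (gates g) = gates g" by (simp add: gate.map_id0)
 have q: "red ?gs ?ws = qstate g b" using red_copy[OF g inj_on_id, of b] by (simp add: mg)
 have hh: "qstate g b $$ (y, x) = cnj (qstate g b $$ (x, y))" if "x < ?N" "y < ?N" for x y
  unfolding q[symmetric] red_def using that by (simp add: mult.commute)
 then show "herm ?N (qstate g b)" unfolding herm_def using red_carrier(1)[of ?gs ?ws] unfolding q by blast
 have "\<forall>h\<in>set ?gs. wfg h" using wfg_gates[OF g] by (auto simp: xp_def wfg_def)
 then have "(\<Sum>a<?N. Re (qstate g b $$ (a, a))) = 1"
  using ex_red[of ?ws ?gs "%_. 1"] ex_const[of ?gs 1] g unfolding q by (simp add: wf_circuit_def)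
 moreover have "qstate g b $$ (a, a) = complex_of_real (Re (qstate g b $$ (a, a)))" if "a < ?N" for a
 proof -
  have "Im (qstate g b $$ (a, a)) = - Im (qstate g b $$ (a, a))" using arg_cong[OF hh[OF that that], of Im] unfolding cnj.simps .
  then show ?thesis by (simp add: complex_eq_iff)
 qed
 then have "(\<Sum>j<?N. qstate g b $$ (j, j)) = complex_of_real (\<Sum>a<?N. Re (qstate g b $$ (a, a)))"
  unfolding of_real_sum by (intro sum.cong) auto
 ultimately show "(\<Sum>j<?N. qstate g b $$ (j, j)) = 1" by simp
qed

text \<open>Some component differs, and discarding the other one leaves the two basic states, in one
  order or the other.\<close>

lemma TD_pair:
 assumes g: "wf_circuit g" and ne: "(x1, x2) ~= (y1, y2)"
 shows "TD (qstate g False) (qstate g True) \<le> TD (kron (qstate g x2) (qstate g x1)) (kron (qstate g y2) (qstate g y1))"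
proof -
 let ?q = "qstate g"
 note h = qstate_density[OF g]
 have s: "trace_norm (?q False - ?q True) \<le> trace_norm (?q x - ?q y)" if "x ~= y" for x y
  using that trace_norm_minus[OF h(1) h(1), of False True] by (cases x; cases y) auto
 have "trace_norm (?q False - ?q True) \<le> trace_norm (kron (?q x2) (?q x1) - kron (?q y2) (?q y1))"
 proof (cases "x2 = y2")
  case False
  then show ?thesis using s[OF False] trace_norm_kron_left[OF h(1) h(1) h(1) h(1) h(2) h(2), of x2 y2 x1 y1] by linarith
 next
  case True
  then have "x1 ~= y1" using ne by simp
  then show ?thesis using s[of x1 y1] trace_norm_kron_right[OF h(1) h(1) h(1) h(2), of x1 y1 x2] unfolding True by linarith
 qed
 then show ?thesis unfolding TD_def by simp
qed


section \<open>Hybrid argument and hardness on average\<close>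

definition uu :: "qalg => qalg => (nat => nat) => bool list => nat => bool list => real" where
 "uu G A t S n x = uval (A n (t n * (2 * length (outs (G n 1))))) (t n * (2 * length (outs (G n 1)))) S
   (klist (map (qstate (G n 1)) (concat (replicate (t n) x))))"

lemma length_grid: "length (grid T xb p q xa) = T * T"
proof -
 have "length (concat (map (%a. map (X a) [0..<T]) [0..<N])) = N * T" for X :: "nat => nat => bool list \<times> bool list" and N by (induction N) simp_all
 from this[of "%a z. (concat (replicate a xb) @ p, q @ concat (replicate z xa))" T] show ?thesis unfolding grid_def .
qed

text \<open>The choice of \<open>rr\<close> puts \<open>2 ^ r\<close> between
  \<open>4 * T\<^sup>2\<close> and \<open>16 * T\<^sup>2\<close>. Hence \<open>T * T\<close> slots
  lose at most a factor 1/2 by Bernoulli's inequality, while the activation probability is at least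
  \<open>1 / (16 * T\<^sup>2)\<close>. The constant is 256 = 16 * 4 * 2 * 2, where 4 stems from the
  squared jump and one 2 from \<open>Fv_diff\<close>.\<close>

lemma gap_bound:
 fixes T r :: nat and \<Delta> u v :: real
 assumes T: "T > 0" and r: "r = rr T" and uv: "1 / (2 * real T) \<le> \<bar>u - v\<bar>"
  and D: "(1 / 2 ^ r) * (u - v)\<^sup>2 / 2 * (1 - 2 * (1 / 2 ^ r)) ^ (T * T) \<le> \<Delta>"
 shows "1 / (256 * real T ^ 4) \<le> \<Delta>"
proof -
 let ?b = "2 ^ blen T :: real" and ?T = "real T"
 have b: "?T < ?b" "?b \<le> 2 * ?T"
 proof -
  have "real T < real (2 ^ blen T)" unfolding of_nat_less_iff using blen_bounds by blast
  then show "?T < ?b" by simp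
  have "real (2 ^ blen T) \<le> real (2 * T)" unfolding of_nat_le_iff using blen_bounds T by blast
  then show "?b \<le> 2 * ?T" by simp
 qed
 have R: "(2 :: real) ^ r = 4 * ?b\<^sup>2" unfolding r rr_def by (simp add: power_add power_mult power2_eq_square flip: power_mult_distrib)
 have "?T\<^sup>2 \<le> ?b\<^sup>2" by (rule power_mono) (use b in simp_all)
 moreover have "?b\<^sup>2 \<le> (2 * ?T)\<^sup>2" by (rule power_mono[OF b(2)]) simp
 moreover have "(2 * ?T)\<^sup>2 = 4 * ?T\<^sup>2" by (simp add: power_mult_distrib)
 ultimately have RT: "4 * ?T\<^sup>2 \<le> 2 ^ r" "2 ^ r \<le> 16 * ?T\<^sup>2" unfolding R by linarith+
 have Tp: "?T\<^sup>2 > 0" using T by simp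
 have p1: "1 / (16 * ?T\<^sup>2) \<le> 1 / 2 ^ r" using RT Tp by (intro divide_left_mono) simp_all
 have p2: "1 / 2 ^ r \<le> 1 / (4 * ?T\<^sup>2)" using RT Tp by (intro divide_left_mono) simp_all
 have T1: "1 \<le> ?T\<^sup>2" using T by (simp add: one_le_power)
 have "1 / (4 * ?T\<^sup>2) \<le> 1 / 4" by (rule divide_left_mono) (use T1 Tp in simp_all)
 then have "- 1 \<le> - (2 * (1 / 2 ^ r) :: real)" using p2 by linarith
 from Bernoulli_inequality[OF this, of "T * T"] have "1 - ?T\<^sup>2 * (2 * (1 / 2 ^ r)) \<le> (1 - 2 * (1 / 2 ^ r)) ^ (T * T)"
  by (simp add: power2_eq_square)
 moreover have "?T\<^sup>2 * (2 * (1 / 2 ^ r)) \<le> ?T\<^sup>2 * (2 * (1 / (4 * ?T\<^sup>2)))" by (intro mult_left_mono p2) simp_all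
 moreover have "?T\<^sup>2 * (2 * (1 / (4 * ?T\<^sup>2))) = 1 / 2" using Tp by simp
 ultimately have be: "1 / 2 \<le> (1 - 2 * (1 / 2 ^ r) :: real) ^ (T * T)" by linarith
 have "(1 / (2 * ?T))\<^sup>2 \<le> \<bar>u - v\<bar>\<^sup>2" by (rule power_mono[OF uv]) simp
 then have sq: "1 / (4 * ?T\<^sup>2) \<le> (u - v)\<^sup>2" by (simp add: power_divide power_mult_distrib)
 have "1 / (16 * ?T\<^sup>2) * (1 / (4 * ?T\<^sup>2)) / 2 * (1 / 2) \<le> (1 / 2 ^ r) * (u - v)\<^sup>2 / 2 * (1 - 2 * (1 / 2 ^ r)) ^ (T * T)"
  by (intro mult_mono divide_right_mono p1 sq be) simp_all
 moreover have "1 / (16 * ?T\<^sup>2) * (1 / (4 * ?T\<^sup>2)) / 2 * (1 / 2) = 1 / (256 * ?T ^ 4)"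
  using T by (simp add: field_simps power2_eq_square power4_eq_xxxx)
 ultimately show ?thesis using D by linarith
qed

text \<open>The two inputs differ in the bit after \<open>p\<close>. Exchanging the copies one at a
  time, a difference above 1/2 over \<open>t n\<close> copies forces a jump above
  \<open>1 / (2 * t n)\<close> at some position. The slot of this position is in the grid because
  \<open>t n \<le> T\<close>, and it alone makes the advantage too large.\<close>

lemma hybrid_bound:
 assumes E: "EFI_pair G" and A: "QPT A" and t: "polynomial t" and pq: "length p + length q = 1"
 shows "\<forall>\<^sub>F n in sequentially. \<bar>uu G A t [S0, S1] n (p @ False # q) - uu G A t [S0, S1] n (p @ True # q)\<bar> \<le> 1 / 2"
proof -
 have G: "QPT G" and ci: "comp_indistinguishable G" using E by (auto simp: EFI_pair_def)
 obtain c where c: "\<forall>n>0. t n \<le> c * n ^ c" using t unfolding polynomial_def by blast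
 let ?xa = "p @ False # q" and ?xb = "p @ True # q"
 have len: "length ?xa = 2" "length ?xb = 2" "length p \<le> 1" "length q \<le> 1" using pq by auto
 obtain D where D: "QPT D" "\<forall>n k. \<exists>gs e' o3. D n k = Circuit gs [k] \<and>
  slots (G n 1) (A n) k (rr (c * n ^ c)) [S0, S1] (grid (c * n ^ c) ?xb p q ?xa) (2 * k + 2) (2 * k + 3) gs e' o3"
  using ex_distinguisher[OF G A len, of c S0 S1] by blast
 \<comment> \<open>The advantage would be at least \<open>1 / (512 * T ^ 4)\<close>, where 512 is
   twice 256 because the acceptance probability is half of one minus the value. With
   \<open>T = c * n ^ c\<close> the denominator is \<open>K * n ^ (4 * c)\<close>, at most
   \<open>n ^ (K + 4 * c)\<close> for \<open>n \<ge> 2\<close> by \<open>K < 2 ^ K\<close>.\<close>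
 define K where "K = 512 * c ^ 4"
 have "\<forall>\<^sub>F n in sequentially. \<bar>prob_output D n (out_len G n 1) (efi_state G n False) [True]
   - prob_output D n (out_len G n 1) (efi_state G n True) [True]\<bar> < 1 / real n ^ (K + 4 * c)"
  using ci D(1) unfolding comp_indistinguishable_def negligible_def by blast
 with eventually_ge_at_top[of 2] show ?thesis
 proof eventually_elim
  fix n :: nat
  assume n: "2 \<le> n" and neg: "\<bar>prob_output D n (out_len G n 1) (efi_state G n False) [True]
   - prob_output D n (out_len G n 1) (efi_state G n True) [True]\<bar> < 1 / real n ^ (K + 4 * c)"
  define g where "g = G n 1"
  define m where "m = length (outs g)"
  define T where "T = c * n ^ c"
  define tt where "tt = t n"
  let ?S = "[S0, S1]"
  have tT: "tt \<le> T" using c n by (simp add: tt_def T_def)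
  have wg: "wf_circuit g" and wA: "\<And>j. wf_circuit (A n j)" using G A by (auto simp: QPT_def g_def)
  \<comment> \<open>Hybrid \<open>a\<close>: the first \<open>a\<close> copies belong to
    \<open>?xb\<close>, the remaining ones to \<open>?xa\<close>.\<close>
  define H where "H a = uval (A n (tt * (2 * m))) (tt * (2 * m)) ?S
   (klist (map (qstate g) (concat (replicate a ?xb) @ concat (replicate (tt - a) ?xa))))" for a
  have H0: "uu G A t ?S n ?xa = H 0" "uu G A t ?S n ?xb = H tt" unfolding uu_def H_def g_def m_def tt_def by simp_all
  have tel: "(\<Sum>a<tt. H a - H (Suc a)) = H 0 - H tt" by (rule sum_lessThan_telescope')
  show "\<bar>uu G A t ?S n ?xa - uu G A t ?S n ?xb\<bar> \<le> 1 / 2"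
  proof (rule ccontr)
   assume "\<not> ?thesis"
   then have big: "1 / 2 < \<bar>\<Sum>a<tt. H a - H (Suc a)\<bar>" unfolding H0 tel by simp
   have "\<exists>a<tt. 1 / (2 * real tt) < \<bar>H a - H (Suc a)\<bar>"
   proof (rule ccontr)
    assume "\<not> ?thesis"
    then have "\<bar>\<Sum>a<tt. H a - H (Suc a)\<bar> \<le> (\<Sum>a<tt. 1 / (2 * real tt))"
     by (intro order_trans[OF sum_abs] sum_mono) auto
    also have "\<dots> \<le> 1 / 2" by simp
    finally show False using big by simp
   qed
   then obtain a where a: "a < tt" "1 / (2 * real tt) < \<bar>H a - H (Suc a)\<bar>" by blast
   define pre where "pre = concat (replicate a ?xb) @ p"
   \<comment> \<open>Between the hybrids \<open>a\<close> and \<open>Suc a\<close> one copy pair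
     changes, and in it only the component after \<open>p\<close>. The component is the challenge;
     \<open>p\<close> and \<open>q\<close> supply the other one.\<close>
   define post where "post = q @ concat (replicate (tt - a - 1) ?xa)"
   have T0: "0 < T" using a(1) tT by simp
   have mem: "(pre, post) \<in> set (grid T ?xb p q ?xa)"
    unfolding grid_def pre_def post_def
    by (simp, rule bexI[of _ a], rule image_eqI[of _ _ "tt - Suc a"]) (use a(1) tT in simp_all)
   have "length pre + 1 + length post = a * 2 + (length p + length q) + 1 + (tt - a - 1) * 2"
    unfolding pre_def post_def using len by (simp only: length_append length_concat_replicate)
   then have lpp: "length pre + 1 + length post = tt * 2" using pq a(1) by simp
   have mK: "m * (length pre + 1 + length post) = tt * (2 * m)" unfolding lpp by simp
   obtain z where z: "tt - a = Suc z" "tt - a - 1 = z" "tt - Suc a = z" using a(1) by (metis Suc_diff_Suc diff_Suc_1 diff_diff_left plus_1_eq_Suc add.commute)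
   have rep: "concat (replicate (Suc a) ?xb) = concat (replicate a ?xb) @ ?xb" by (induction a) simp_all
   have l: "pre @ False # post = concat (replicate a ?xb) @ concat (replicate (tt - a) ?xa)"
    "pre @ True # post = concat (replicate (Suc a) ?xb) @ concat (replicate (tt - Suc a) ?xa)"
    unfolding pre_def post_def z rep by simp_all
   have V: "slotval g (A n (m * (length pre + 1 + length post))) ?S pre post False = H a"
    "slotval g (A n (m * (length pre + 1 + length post))) ?S pre post True = H (Suc a)"
    unfolding slotval_def m_def[symmetric] mK l H_def by (rule refl)+
   let ?k = "length (outs g)"
   obtain gs e' o3 where s: "D n ?k = Circuit gs [?k]" "slots g (A n) ?k (rr T) ?S (grid T ?xb p q ?xa) (2 * ?k + 2) (2 * ?k + 3) gs e' o3"
    using D(2) unfolding g_def T_def by blast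
   let ?vals = "slotvals g (A n) ?S (grid T ?xb p q ?xa)" and ?p = "1 / 2 ^ rr T :: real"
   have P: "prob_output D n (out_len G n 1) (efi_state G n b) [True] = (1 - Fv ?p ?vals b) / 2" for b
   proof -
    have "prob_output D n (out_len G n 1) (efi_state G n b) [True] = Re (run_circuit ?k (Circuit gs [?k]) (qstate g b) $$ (1, 1))"
     using s(1) by (simp add: prob_output_def out_len_def run_def efi_state_def qstate_def g_def index_of_def)
    also have "\<dots> = (1 - Fv ?p ?vals b) / 2" by (rule prob_slots[OF wg refl wA s(2)]) simp_all
    finally show ?thesis .
   qed
   have b1: "\<forall>(u, v)\<in>set ?vals. \<bar>u\<bar> \<le> 1 \<and> \<bar>v\<bar> \<le> 1"
    unfolding slotvals_def Let_def using slotval_abs_le[OF wg wA] by auto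
   have uv: "(H a, H (Suc a)) \<in> set ?vals"
    unfolding slotvals_def Let_def set_map m_def[symmetric] by (rule image_eqI[OF _ mem]) (simp only: prod.case V)
   have "2 \<le> rr T" by (simp add: rr_def)
   then have "(2 :: real) ^ 2 \<le> 2 ^ rr T" by (rule power_increasing) simp
   then have "?p \<le> 1 / 2" by (simp add: field_simps)
   then have "?p * (H a - H (Suc a))\<^sup>2 / 2 * (1 - 2 * ?p) ^ length ?vals \<le> Fv ?p ?vals False - Fv ?p ?vals True"
    using Fv_diff[OF _ _ b1, of ?p] uv by auto
   moreover have "length ?vals = T * T" by (simp add: slotvals_def length_grid)
   moreover have "1 / (2 * real T) \<le> \<bar>H a - H (Suc a)\<bar>"
   proof -
    have "1 / (2 * real T) \<le> 1 / (2 * real tt)" using tT a(1) by (intro divide_left_mono) simp_all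
    then show ?thesis using a(2) by linarith
   qed
   ultimately have \<Delta>: "1 / (256 * real T ^ 4) \<le> Fv ?p ?vals False - Fv ?p ?vals True"
    using gap_bound[OF T0 refl] by metis
   have "1 / (256 * real T ^ 4) / 2 \<le> (Fv ?p ?vals False - Fv ?p ?vals True) / 2" using \<Delta> by simp
   also have "\<dots> \<le> \<bar>(1 - Fv ?p ?vals False) / 2 - (1 - Fv ?p ?vals True) / 2\<bar>" by (simp add: abs_if field_simps)
   also have "\<dots> < 1 / real n ^ (K + 4 * c)" using neg unfolding P .
   finally have "1 / (512 * real T ^ 4) < 1 / real n ^ (K + 4 * c)" by simp
   moreover have "512 * real T ^ 4 \<le> real n ^ (K + 4 * c)"
   proof -
    have "512 * T ^ 4 = K * n ^ (4 * c)" by (simp add: T_def K_def power_mult_distrib power_mult mult.commute flip: power_mult)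
    also have "\<dots> \<le> 2 ^ K * n ^ (4 * c)" by (intro mult_le_mono1 less_imp_le less_exp)
    also have "\<dots> \<le> n ^ K * n ^ (4 * c)" by (intro mult_le_mono1 power_mono n) simp
    finally have "512 * T ^ 4 \<le> n ^ (K + 4 * c)" by (simp add: power_add)
    then have "real (512 * T ^ 4) \<le> real (n ^ (K + 4 * c))" by (simp only: of_nat_le_iff)
    then show ?thesis by simp
   qed
   moreover have "0 < 512 * real T ^ 4" using T0 by simp
   ultimately show False using divide_left_mono[of "512 * real T ^ 4" "real n ^ (K + 4 * c)" 1] n by simp
  qed
 qed
qed

lemma output_probabilities:
 assumes "wf_circuit g" "wf_circuit c" "k = length (outs g) * length bs"
 defines "outp \<equiv> %a. Re (run_circuit k c (klist (map (qstate g) bs)) $$ (a, a))"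
 shows "(\<Sum>a<2 ^ length (outs c). outp a) = 1" "i < 2 ^ length (outs c) ==> 0 \<le> outp i"
proof -
 obtain gs ws where gs: "\<forall>h\<in>set gs. wfg h"
  and F: "\<forall>F. (\<Sum>a<2 ^ length (outs c). F a * outp a) = ex gs (%s. F (rd ws s))"
  using output_distribution[OF assms(1-3)] unfolding outp_def by blast
 show s: "(\<Sum>a<2 ^ length (outs c). outp a) = 1" using spec[OF F, of "%_. 1"] ex_const[OF gs, of 1] by simp
 show "0 \<le> outp i" if i: "i < 2 ^ length (outs c)"
 proof -
  \<comment> \<open>Entry \<open>i\<close> is nonnegative because the indicator of all other
    outcomes has expectation at most 1.\<close>
  have "\<bar>ex gs (%s. (%a. if a = i then 0 else 1) (rd ws s))\<bar> \<le> 1" by (rule ex_abs_le[OF gs]) simp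
  then have "(\<Sum>a<2 ^ length (outs c). (if a = i then 0 else 1) * outp a) \<le> 1" using spec[OF F, of "%a. if a = i then 0 else 1"] by simp
  moreover have "(\<Sum>a<2 ^ length (outs c). (if a = i then 0 else 1) * outp a) = (\<Sum>a<2 ^ length (outs c). outp a - (if a = i then outp i else 0))"
   by (intro sum.cong) auto
  ultimately show ?thesis using s i by (simp add: sum_subtractf)
 qed
qed

lemma uval_two:
 assumes "length (outs c) = 2"
 shows "uval c k [s0, s1] \<rho> = Re (run_circuit k c \<rho> $$ (0, 0)) + (if s0 then -1 else 1) * Re (run_circuit k c \<rho> $$ (1, 1))
  + (if s1 then -1 else 1) * Re (run_circuit k c \<rho> $$ (2, 2)) + (if s0 = s1 then 1 else -1) * Re (run_circuit k c \<rho> $$ (3, 3))"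
proof -
 have u: "[0..<2] = [0, 1 :: nat]" by (simp add: upt_rec)
 have l: "{..<2 ^ 2 :: nat} = {0, 1, 2, 3}" by auto
 have b: "bit (1 :: nat) 0 = True" "bit (Suc 0) 0 = True" "bit (1 :: nat) 1 = False" "bit (2 :: nat) 1 = True" "bit (3 :: nat) 1 = True" by (simp_all add: bit_iff_odd)
 show ?thesis unfolding uval_def assms u l by (simp add: chi_def sg_def bit_values b del: bit_numeral_rec)
qed

lemma lists_of_two: "{x :: bool list. length x = 2} = {[False, False], [True, False], [False, True], [True, True]}"
 by (auto simp: length_Suc_conv numeral_2_eq_2)

theorem theorem5p3:
 assumes "\<exists>G. EFI_pair G"
 shows "\<exists>C len. QPT C \<and> polynomial len \<and> hard_on_average C len"
proof -
 obtain G where E: "EFI_pair G" using assms by blast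
 then have G: "QPT G" and sf: "statistically_far G" by (auto simp: EFI_pair_def)
 obtain p where p: "polynomial p" "\<forall>n. p n > 0"
  "\<forall>\<^sub>F n in sequentially. TD (efi_state G n False) (efi_state G n True) \<ge> 1 / real (p n)" using sf unfolding statistically_far_def by blast
 obtain C where C: "QPT C" "\<forall>n k. \<exists>B'. fits (G n 1) 2 B' \<and> C n k = pairc (G n 1) 2 B'" using ex_pair_algorithm[OF G] by blast
 have wg: "wf_circuit (G n 1)" for n using G by (simp add: QPT_def)
 have out: "output_state C n [x1, x2] = kron (qstate (G n 1) x2) (qstate (G n 1) x1)" for n x1 x2
 proof -
  obtain B' where "fits (G n 1) 2 B'" "C n 2 = pairc (G n 1) 2 B'" using C(2) by blast
  then show ?thesis using pairc_facts(2)[OF wg, of n 2 B' x1 x2] by (simp add: output_state_def run_def numeral_2_eq_2)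
 qed
 have ol: "out_len C n 2 = 2 * length (outs (G n 1))" for n
 proof -
  obtain B' where "C n 2 = pairc (G n 1) 2 B'" using C(2) by blast
  then show ?thesis by (simp add: out_len_def pairc_def)
 qed
 define S where "S = (%n :: nat. pmf_of_set {x :: bool list. length x = 2})"
 have fin: "finite {x :: bool list. length x = 2}" "{x :: bool list. length x = 2} ~= {}" "card {x :: bool list. length x = 2} = 4"
  unfolding lists_of_two by simp_all
 have poly2: "polynomial (%_. 2)"
 proof -
  have "2 \<le> 2 * n ^ 2" if "n > 0" for n :: nat using that by simp
  then show ?thesis unfolding polynomial_def by blast
 qed
 have polye: "polynomial (%n. 2 * p n)"
 proof -
  obtain c where c: "\<forall>n>0. p n \<le> c * n ^ c" using p(1) unfolding polynomial_def by blast
  have "2 * p n \<le> (2 * c) * n ^ (2 * c)" if "n > 0" for n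
  proof -
   have "n ^ c \<le> n ^ (2 * c)" by (rule power_increasing) (use that in simp_all)
   then have "c * n ^ c \<le> c * n ^ (2 * c)" by (rule mult_le_mono2)
   then have "p n \<le> c * n ^ (2 * c)" using c that le_trans by blast
   then show ?thesis by simp
  qed
  then show ?thesis unfolding polynomial_def by blast
 qed
 have samp: "efficiently_sampleable S" unfolding efficiently_sampleable_def
 proof (intro exI[of _ "%n k. Circuit [Had 0, Had 1] [0, 1]"] conjI QPT_coins allI)
  fix n :: nat and x :: "bool list"
  show "pmf (S n) x = prob_output (%n k. Circuit [Had 0, Had 1] [0, 1]) n 0 (basis_state []) x"
  proof (cases "length x = 2")
   case True
   then have "pmf (S n) x = 1 / 4" unfolding S_def using fin by (subst pmf_of_set) simp_all
   then show ?thesis using coin_distribution[OF True] True by (simp add: prob_output_def out_len_def run_def)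
  next
   case False
   then have "pmf (S n) x = 0" unfolding S_def using fin by (subst pmf_of_set) simp_all
   then show ?thesis using False by (simp add: prob_output_def out_len_def)
  qed
 qed
 have main: "\<forall>\<^sub>F n in sequentially. learning_prob C (%_. 2) S (%n. 2 * p n) t A n \<le> 1 / 2"
  if t: "polynomial t" and A: "QPT A" and oA: "\<forall>n. out_len A n (t n * out_len C n 2) = 2" for t A
 proof -
  note hb = hybrid_bound[OF E A t]
  \<comment> \<open>The parity of one output bit is tested against a flip of the same input bit, for
    both values of the other one. The parity of both bits is tested against a flip of the first
    input bit.\<close>
  have e1: "\<forall>\<^sub>F n in sequentially. \<bar>uu G A t [True, False] n [False, False] - uu G A t [True, False] n [True, False]\<bar> \<le> 1 / 2"
   using hb[of "[]" "[False]" True False] by simp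
  have e2: "\<forall>\<^sub>F n in sequentially. \<bar>uu G A t [True, False] n [False, True] - uu G A t [True, False] n [True, True]\<bar> \<le> 1 / 2"
   using hb[of "[]" "[True]" True False] by simp
  have e3: "\<forall>\<^sub>F n in sequentially. \<bar>uu G A t [False, True] n [False, False] - uu G A t [False, True] n [False, True]\<bar> \<le> 1 / 2"
   using hb[of "[False]" "[]" False True] by simp
  have e4: "\<forall>\<^sub>F n in sequentially. \<bar>uu G A t [False, True] n [True, False] - uu G A t [False, True] n [True, True]\<bar> \<le> 1 / 2"
   using hb[of "[True]" "[]" False True] by simp
  have e5: "\<forall>\<^sub>F n in sequentially. \<bar>uu G A t [True, True] n [False, False] - uu G A t [True, True] n [True, False]\<bar> \<le> 1 / 2"
   using hb[of "[]" "[False]" True True] by simp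
  have e6: "\<forall>\<^sub>F n in sequentially. \<bar>uu G A t [True, True] n [False, True] - uu G A t [True, True] n [True, True]\<bar> \<le> 1 / 2"
   using hb[of "[]" "[True]" True True] by simp
  from e1 e2 e3 e4 e5 e6 p(3) show ?thesis
  proof eventually_elim
   fix n
   let ?g = "G n 1" and ?K = "t n * (2 * length (outs (G n 1)))"
   assume u: "\<bar>uu G A t [True, False] n [False, False] - uu G A t [True, False] n [True, False]\<bar> \<le> 1 / 2"
    "\<bar>uu G A t [True, False] n [False, True] - uu G A t [True, False] n [True, True]\<bar> \<le> 1 / 2"
    "\<bar>uu G A t [False, True] n [False, False] - uu G A t [False, True] n [False, True]\<bar> \<le> 1 / 2"
    "\<bar>uu G A t [False, True] n [True, False] - uu G A t [False, True] n [True, True]\<bar> \<le> 1 / 2"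
    "\<bar>uu G A t [True, True] n [False, False] - uu G A t [True, True] n [True, False]\<bar> \<le> 1 / 2"
    "\<bar>uu G A t [True, True] n [False, True] - uu G A t [True, True] n [True, True]\<bar> \<le> 1 / 2"
    and far: "1 / real (p n) \<le> TD (efi_state G n False) (efi_state G n True)"
   define outp where "outp x a = Re (run_circuit ?K (A n ?K) (klist (map (qstate ?g) (concat (replicate (t n) x)))) $$ (a, a))" for x and a :: nat
   have wA: "wf_circuit (A n ?K)" using A by (simp add: QPT_def)
   have oA': "length (outs (A n ?K)) = 2" using oA ol by (simp add: out_len_def)
   have outp: "(\<Sum>a<2 ^ 2. outp x a) = 1" "a < 2 ^ 2 ==> 0 \<le> outp x a" if "length x = 2" for x a
   proof -
    have "?K = length (outs ?g) * length (concat (replicate (t n) x))" using that by (simp add: length_concat_replicate)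
    from output_probabilities[OF wg wA this] show "(\<Sum>a<2 ^ 2. outp x a) = 1" "a < 2 ^ 2 ==> 0 \<le> outp x a" unfolding outp_def oA' by blast+
   qed
   have U: "uu G A t [s0, s1] n x = outp x 0 + (if s0 then -1 else 1) * outp x 1 + (if s1 then -1 else 1) * outp x 2 + (if s0 = s1 then 1 else -1) * outp x 3" for s0 s1 x
    unfolding uu_def outp_def by (rule uval_two[OF oA'])
   have l4: "{..<2 ^ 2 :: nat} = {0, 1, 2, 3}" by auto
   have R1: "outp x 0 + outp x 1 + outp x 2 + outp x 3 = 1" if "length x = 2" for x using outp(1)[OF that] unfolding l4 by (simp add: add.assoc)
   define f where "f x = (\<Sum>y | length y = 2 \<and> TD (output_state C n x) (output_state C n y) \<le> 1 / real (2 * p n).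
     prob_output A n (t n * out_len C n 2) (kron_power (output_state C n x) (t n)) y)" for x
   have f: "f x \<le> outp x (index_of x)" if x: "length x = 2" for x
   proof -
    obtain x1 x2 where x12: "x = [x1, x2]" using x by (auto simp: length_Suc_conv numeral_2_eq_2)
    have "klist (map (qstate ?g) x) = output_state C n x" unfolding x12 out by (simp add: kron_one)
    then have kp: "kron_power (output_state C n x) (t n) = klist (map (qstate ?g) (concat (replicate (t n) x)))"
     unfolding map_concat map_replicate klist_power by simp
    have pr: "prob_output A n (t n * out_len C n 2) (kron_power (output_state C n x) (t n)) y = outp x (index_of y)" if "length y = 2" for y
     using that oA unfolding kp by (simp add: prob_output_def outp_def run_def ol)
    \<comment> \<open>Distinct inputs give states at distance at least \<open>1 / p n\<close>,
      strictly more than the accuracy \<open>1 / (2 * p n)\<close>, so the only accepted answer is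
      the input itself.\<close>
    have sub: "{y. length y = 2 \<and> TD (output_state C n x) (output_state C n y) \<le> 1 / real (2 * p n)} \<subseteq> {x}"
    proof
     fix y assume "y \<in> {y. length y = 2 \<and> TD (output_state C n x) (output_state C n y) \<le> 1 / real (2 * p n)}"
     then have y: "length y = 2" "TD (output_state C n x) (output_state C n y) \<le> 1 / real (2 * p n)" by auto
     obtain y1 y2 where y12: "y = [y1, y2]" using y(1) by (auto simp: length_Suc_conv numeral_2_eq_2)
     show "y \<in> {x}"
     proof (rule ccontr)
      assume "y \<notin> {x}"
      then have "(x1, x2) ~= (y1, y2)" unfolding x12 y12 by auto
      from TD_pair[OF wg this, of n] have "1 / real (p n) \<le> TD (output_state C n x) (output_state C n y)"
       using far unfolding x12 y12 out by (simp add: efi_state_def qstate_def run_def)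
      moreover have "1 / real (2 * p n) < 1 / real (p n)" using p(2) by (simp add: field_simps)
      ultimately show False using y(2) by linarith
     qed
    qed
    have i: "index_of y < 2 ^ 2" if "length y = 2" for y using index_of_less[of y] that by simp
    have "f x = (\<Sum>y | length y = 2 \<and> TD (output_state C n x) (output_state C n y) \<le> 1 / real (2 * p n). outp x (index_of y))"
     unfolding f_def by (intro sum.cong refl) (use pr in blast)
    also have "\<dots> \<le> (\<Sum>y\<in>{x}. outp x (index_of y))" by (rule sum_mono2[OF _ sub]) (use outp(2)[OF x i] x in auto)
    finally show ?thesis by simp
   qed
   have ix: "index_of [False, False] = 0" "index_of [True, False] = 1" "index_of [False, True] = 2" "index_of [True, True] = 3"
    by (simp_all add: index_of_def)
   have "learning_prob C (%_. 2) S (%n. 2 * p n) t A n = (\<Sum>x | length x = 2. f x) / 4"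
    unfolding learning_prob_def S_def f_def using fin by (subst integral_pmf_of_set) simp_all
   also have "\<dots> = (f [False, False] + f [True, False] + f [False, True] + f [True, True]) / 4"
    unfolding lists_of_two by (simp add: add.assoc)
   finally have lp: "learning_prob C (%_. 2) S (%n. 2 * p n) t A n = (f [False, False] + f [True, False] + f [False, True] + f [True, True]) / 4" .
   have ff: "f [False, False] \<le> outp [False, False] 0" "f [True, False] \<le> outp [True, False] 1" "f [False, True] \<le> outp [False, True] 2" "f [True, True] \<le> outp [True, True] 3"
    using f[of "[False, False]"] f[of "[True, False]"] f[of "[False, True]"] f[of "[True, True]"] unfolding ix by simp_all
   have n4: "outp [x1, x2] 0 + outp [x1, x2] 1 + outp [x1, x2] 2 + outp [x1, x2] 3 = 1" for x1 x2 by (rule R1) simp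
   \<comment> \<open>The last inequality is used in the opposite direction. With total probability
     one for each input, the six inequalities add up to \<open>4 * s - 4 \<le> 3\<close>, where
     \<open>s\<close> is the sum of the four probabilities of a correct answer; so \<open>s\<close>
     is at most 7/4, below the required 2.\<close>
   note w = u(1-5)[THEN abs_le_D1, unfolded U if_True if_False simp_thms] u(6)[THEN abs_le_D2, unfolded U if_True if_False simp_thms]
   have "f [False, False] + f [True, False] + f [False, True] + f [True, True] \<le> 2"
    using w ff n4[of False False] n4[of True False] n4[of False True] n4[of True True] by linarith
   then show "learning_prob C (%_. 2) S (%n. 2 * p n) t A n \<le> 1 / 2" unfolding lp by simp
  qed
 qed
 have sub: "\<forall>n. set_pmf (S n) \<subseteq> {x. length x = 2}" unfolding S_def using fin by simp
 have pos: "\<forall>n. 0 < 2 * p n" using p(2) by simp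
 have "hard_on_average C (%_. 2)" unfolding hard_on_average_def
  by (rule exI[of _ S], rule exI[of _ "%n. 2 * p n"], rule exI[of _ "%_. 2"], intro conjI samp sub polye pos poly2) (use main in simp_all)
 then show ?thesis using C(1) poly2 by blast
qed

end
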